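(* Let $(M,\mathcal{V})$ be an abstract, smooth, finitely nondegenerate CR structure, and let $X$ be a locally integrable infinitesimal CR diffeomorphism of $M$ with distributional coefficients which extends microlocally to a wedge with edge $M$. Then $X$ is smooth.
   Context: An abstract CR manifold $(M,\mathcal{V})$ is a smooth real manifold $M$ with a smooth complex subbundle $\mathcal{V}\subset\mathbb{C}TM$ that is formally integrable ($[\Gamma(M,\mathcal{V}),\Gamma(M,\mathcal{V})]\subset\Gamma(M,\mathcal{V})$) and satisfies $\mathcal{V}\cap\overline{\mathcal{V}}=\{0\}$. No embeddability into $\mathbb{C}^N$ is assumed. Write $\dim_{\mathbb{R}}M=2n+d$, where $n=\dim_{\mathbb{C}}\mathcal{V}_p$, and $N=n+d$. $\Gamma(\cdot,\cdot)$ denotes smooth sections; sections of $\mathcal{V}$ are CR vector fields. $\mathcal{E}(M)$ is the ring of smooth complex-valued functions on $M$. $T'M=\mathcal{V}^\perp\subset\mathbb{C}T^*M$ (complex rank $N$) is the holomorphic cotangent bundle; its sections are holomorphic forms. $T^0M\subset T'M$ is the real subbundle of real covectors annihilating $\mathcal{V}+\overline{\mathcal{V}}$; its sections are characteristic forms. For a CR vector field $L$ and a holomorphic form $\alpha$, the Lie derivative $\mathcal{L}_L\alpha=d\alpha(L,\cdot)$ is again a holomorphic form. Distributional sections: $\mathcal{D}'(M,(T'M)^* )$ is the space of distributions on $M$ with values in $(T'M)^*$ (the dual of the space of compactly supported smooth sections of $T'M$ tensored with the density bundle). If $\omega^1,\dots,\omega^N$ is a local basis of $T'M$ on an open set $U$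 with dual basis $\omega_1,\dots,\omega_N$ of $(T'M)^*$, then $X\in\mathcal{D}'(M,(T'M)^* )$ is given on $U$ by $X=\sum_j c_j\omega_j$ with scalar distributions $c_j\in\mathcal{D}'(U)$. $X$ is locally integrable if in every such local representation the $c_j$ are locally integrable functions. For a holomorphic form $\omega=\sum_j f_j\omega^j$ on $U$ ($f_j$ smooth) one sets $\omega(X)=X(\omega)=\sum_j f_jc_j\in\mathcal{D}'(U)$; this defines $\omega(X)\in\mathcal{D}'(M)$ globally. $X\in\mathcal{D}'(M,(T'M)^* )$ is an infinitesimal CR diffeomorphism with distributional coefficients if $\tau(X)=\overline{\tau(X)}$ for all $\tau\in\Gamma(M,T^0M)$ and $L(\alpha(X))=(\mathcal{L}_L\alpha)(X)$ for all $L\in\Gamma(M,\mathcal{V})$ and all $\alpha\in\Gamma(M,T'M)$. $X$ extends microlocally to a wedge with edge $M$ if there is a set $\Gamma\subset T^0M$ such that for each $p\in M$ the fiber $\Gamma_p\subset T^0_pM\setminus\{0\}$ is a closed, convex cone, and $\mathrm{WF}(\omega(X))\subset\Gamma$ for every holomorphic form $\omega\in\Gamma(M,T'M)$, where $\mathrm{WF}$ is the ($C^\infty$) wavefront set. For $k\ge 0$, $E_k\subset\Gamma(M,T'M)$ is the $\mathcal{E}(M)$-module spanned by all $\mathcal{L}_{K_1}\cdots\mathcal{L}_{K_j}\theta$ with $0\le j\le k$, $K_q\in\Gamma(M,\mathcal{V})$, $\theta\in\Gamma(M,T^0M)$; $E=\bigcup_kE_k$. $\mathcal{S}=\bigwedge^N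 E\subset\mathcal{E}(M)$ is the ideal generated by all determinants $\det\big(V^i(\mathfrak{Y}_j)\big)_{i,j=1}^N$ with $V^i\in E$ and $\mathfrak{Y}_j\in\Gamma(M,(T'M)^* )$. $M$ is finitely nondegenerate if $\mathcal{S}=\mathcal{E}(M)$. *)

theory Defs
  imports "HOL-Analysis.Analysis"
begin

section \<open>Smooth manifolds\<close>

text \<open>\<open>C\<^sup>k\<close> functions on an open subset of a finite dimensional space.\<close>

primrec Ck_on :: "nat \<Rightarrow> 'e::real_normed_vector set \<Rightarrow> ('e \<Rightarrow> 'b::real_normed_vector) \<Rightarrow> bool" where
  "Ck_on 0 S f \<longleftrightarrow> continuous_on S f"
| "Ck_on (Suc k) S f \<longleftrightarrow> (\<forall>x\<in>S. f differentiable (at x)) \<and>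
     (\<forall>v. Ck_on k S (\<lambda>x. frechet_derivative f (at x) v))"

definition smooth_on :: "'e::real_normed_vector set \<Rightarrow> ('e \<Rightarrow> 'b::real_normed_vector) \<Rightarrow> bool" where
  "smooth_on S f \<longleftrightarrow> (\<forall>k. Ck_on k S f)"

text \<open>The manifold is the whole type \<open>'a\<close>; its dimension is \<open>CARD('m)\<close>. A chart consists of its domain
  and the coordinate map. An atlas need not be maximal.\<close>

type_synonym ('a, 'm) chart = "'a set \<times> ('a \<Rightarrow> real^'m)"

abbreviation cdom :: "('a, 'm) chart \<Rightarrow> 'a set" where "cdom \<equiv> fst"
abbreviation cmap :: "('a, 'm) chart \<Rightarrow> 'a \<Rightarrow> real^'m" where "cmap \<equiv> snd"

definition cinv :: "('a, 'm) chart \<Rightarrow> real^'m \<Rightarrow> 'a" where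
  "cinv c = inv_into (cdom c) (cmap c)"

definition smooth_atlas ::
    "('a::{t2_space, second_countable_topology}, 'm::finite) chart set \<Rightarrow> bool" where
  "smooth_atlas A \<longleftrightarrow>
     (\<Union>c\<in>A. cdom c) = UNIV \<and>
     (\<forall>c\<in>A. open (cdom c) \<and> open (cmap c ` cdom c) \<and>
        homeomorphism (cdom c) (cmap c ` cdom c) (cmap c) (cinv c)) \<and>
     (\<forall>c\<in>A. \<forall>c'\<in>A. smooth_on (cmap c ` (cdom c \<inter> cdom c')) (cmap c' \<circ> cinv c))"

definition smooth_fun_on ::
    "('a::topological_space, 'm::finite) chart set \<Rightarrow> 'a set \<Rightarrow> ('a \<Rightarrow> complex) \<Rightarrow> bool" where
  "smooth_fun_on A U f \<longleftrightarrow> (\<forall>c\<in>A. smooth_on (cmap c ` (U \<inter> cdom c)) (f \<circ> cinv c))"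

definition smooth_funs ::
    "('a::topological_space, 'm::finite) chart set \<Rightarrow> ('a \<Rightarrow> complex) set" where
  "smooth_funs A = {f. smooth_fun_on A UNIV f}"


section \<open>Complex tangent vectors and covectors\<close>

text \<open>Elements of the complexified tangent space at \<open>p\<close> are the complex derivations at \<open>p\<close> of the
  algebra of smooth complex functions. They are set to 0 on non-smooth functions (and covectors to 0
  off the tangent space), so that equality of HOL functions is equality of (co)vectors.\<close>

type_synonym 'a tvec = "('a \<Rightarrow> complex) \<Rightarrow> complex"
type_synonym 'a covec = "'a tvec \<Rightarrow> complex"

definition ctangent ::
    "('a::topological_space, 'm::finite) chart set \<Rightarrow> 'a \<Rightarrow> 'a tvec set" where
  "ctangent A p = {v.
     (\<forall>f\<in>smooth_funs A. \<forall>g\<in>smooth_funs A. v (\<lambda>x. f x + g x) = v f + v g) \<and>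
     (\<forall>f\<in>smooth_funs A. \<forall>a. v (\<lambda>x. a * f x) = a * v f) \<and>
     (\<forall>f\<in>smooth_funs A. \<forall>g\<in>smooth_funs A. v (\<lambda>x. f x * g x) = v f * g p + f p * v g) \<and>
     (\<forall>f. f \<notin> smooth_funs A \<longrightarrow> v f = 0)}"

definition conj_vec :: "'a tvec \<Rightarrow> 'a tvec" where
  "conj_vec v = (\<lambda>f. cnj (v (\<lambda>x. cnj (f x))))"

definition ccotangent ::
    "('a::topological_space, 'm::finite) chart set \<Rightarrow> 'a \<Rightarrow> 'a covec set" where
  "ccotangent A p = {\<xi>.
     (\<forall>v\<in>ctangent A p. \<forall>w\<in>ctangent A p. \<xi> (\<lambda>f. v f + w f) = \<xi> v + \<xi> w) \<and>
     (\<forall>v\<in>ctangent A p. \<forall>a. \<xi> (\<lambda>f. a * v f) = a * \<xi> v) \<and>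
     (\<forall>v. v \<notin> ctangent A p \<longrightarrow> \<xi> v = 0)}"

definition real_cotangent ::
    "('a::topological_space, 'm::finite) chart set \<Rightarrow> 'a \<Rightarrow> 'a covec set" where
  "real_cotangent A p = {\<xi>\<in>ccotangent A p. \<forall>v\<in>ctangent A p. conj_vec v = v \<longrightarrow> \<xi> v \<in> \<real>}"

definition coord_vec ::
    "('a::topological_space, 'm::finite) chart set \<Rightarrow> ('a, 'm) chart \<Rightarrow> 'm \<Rightarrow> 'a \<Rightarrow> 'a tvec" where
  "coord_vec A c i p = (\<lambda>f. if f \<in> smooth_funs A
     then frechet_derivative (f \<circ> cinv c) (at (cmap c p)) (axis i 1) else 0)"

definition vec_coords ::
    "('a::topological_space, 'm::finite) chart set \<Rightarrow> ('a, 'm) chart \<Rightarrow> 'a \<Rightarrow> 'a tvec \<Rightarrow> complex^'m" where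
  "vec_coords A c p v = (THE a. v = (\<lambda>f. \<Sum>i\<in>UNIV. a $ i * coord_vec A c i p f))"

definition covec_coords ::
    "('a::topological_space, 'm::finite) chart set \<Rightarrow> ('a, 'm) chart \<Rightarrow> 'a \<Rightarrow> 'a covec \<Rightarrow> real^'m" where
  "covec_coords A c p \<xi> = (\<chi> i. Re (\<xi> (coord_vec A c i p)))"

definition vector_fields ::
    "('a::topological_space, 'm::finite) chart set \<Rightarrow> 'a set \<Rightarrow> ('a \<Rightarrow> 'a tvec) set" where
  "vector_fields A U = {Y. (\<forall>p\<in>U. Y p \<in> ctangent A p) \<and>
     (\<forall>f\<in>smooth_funs A. smooth_fun_on A U (\<lambda>p. Y p f))}"

definition bracket :: "('a \<Rightarrow> 'a tvec) \<Rightarrow> ('a \<Rightarrow> 'a tvec) \<Rightarrow> 'a \<Rightarrow> 'a tvec" where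
  "bracket Y Z p = (\<lambda>f. Y p (\<lambda>q. Z q f) - Z p (\<lambda>q. Y q f))"

definition one_forms ::
    "('a::topological_space, 'm::finite) chart set \<Rightarrow> 'a set \<Rightarrow> ('a \<Rightarrow> 'a covec) set" where
  "one_forms A U = {\<alpha>. (\<forall>p\<in>U. \<alpha> p \<in> ccotangent A p) \<and>
     (\<forall>Y\<in>vector_fields A UNIV. smooth_fun_on A U (\<lambda>p. \<alpha> p (Y p)))}"

text \<open>The exterior derivative of a 1-form at \<open>p\<close>, computed from arbitrary extensions of the two
  tangent vectors to global vector fields; the value does not depend on the extensions.\<close>

definition ext_deriv ::
    "('a::topological_space, 'm::finite) chart set \<Rightarrow> ('a \<Rightarrow> 'a covec) \<Rightarrow> 'a \<Rightarrow> 'a tvec \<Rightarrow> 'a tvec \<Rightarrow> complex" where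
  "ext_deriv A \<alpha> p u v =
     (let Y = (SOME Y. Y \<in> vector_fields A UNIV \<and> Y p = u);
          Z = (SOME Z. Z \<in> vector_fields A UNIV \<and> Z p = v)
      in Y p (\<lambda>q. \<alpha> q (Z q)) - Z p (\<lambda>q. \<alpha> q (Y q)) - \<alpha> p (bracket Y Z p))"


section \<open>CR structures\<close>

definition complex_basis :: "nat \<Rightarrow> (nat \<Rightarrow> 'x \<Rightarrow> complex) \<Rightarrow> ('x \<Rightarrow> complex) set \<Rightarrow> bool" where
  "complex_basis k b S \<longleftrightarrow>
     S = range (\<lambda>a. (\<lambda>x. \<Sum>j<k. a j * b j x)) \<and>
     (\<forall>a. (\<forall>x. (\<Sum>j<k. a j * b j x) = 0) \<longrightarrow> (\<forall>j<k. a j = 0))"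

definition smooth_subbundle ::
    "('a::topological_space, 'm::finite) chart set \<Rightarrow> ('a \<Rightarrow> 'a tvec set) \<Rightarrow> nat \<Rightarrow> bool" where
  "smooth_subbundle A V n \<longleftrightarrow>
     (\<forall>p. \<exists>U Ls. open U \<and> p \<in> U \<and> (\<forall>j<n. Ls j \<in> vector_fields A U) \<and>
        (\<forall>q\<in>U. complex_basis n (\<lambda>j. Ls j q) (V q)))"

definition CR_fields ::
    "('a::topological_space, 'm::finite) chart set \<Rightarrow> ('a \<Rightarrow> 'a tvec set) \<Rightarrow> ('a \<Rightarrow> 'a tvec) set" where
  "CR_fields A V = {L\<in>vector_fields A UNIV. \<forall>p. L p \<in> V p}"

definition CR_structure ::
    "('a::{t2_space, second_countable_topology}, 'm::finite) chart set \<Rightarrow> ('a \<Rightarrow> 'a tvec set) \<Rightarrow> nat \<Rightarrow> bool" where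
  "CR_structure A V n \<longleftrightarrow>
     smooth_atlas A \<and> smooth_subbundle A V n \<and>
     (\<forall>L\<in>CR_fields A V. \<forall>K\<in>CR_fields A V. bracket L K \<in> CR_fields A V) \<and>
     (\<forall>p. V p \<inter> conj_vec ` V p = {\<lambda>_. 0})"

text \<open>The fibres of \<open>T'M\<close> and \<open>T\<^sup>0M\<close>.\<close>

definition hol_cotangent ::
    "('a::topological_space, 'm::finite) chart set \<Rightarrow> ('a \<Rightarrow> 'a tvec set) \<Rightarrow> 'a \<Rightarrow> 'a covec set" where
  "hol_cotangent A V p = {\<xi>\<in>ccotangent A p. \<forall>v\<in>V p. \<xi> v = 0}"

definition char_cotangent ::
    "('a::topological_space, 'm::finite) chart set \<Rightarrow> ('a \<Rightarrow> 'a tvec set) \<Rightarrow> 'a \<Rightarrow> 'a covec set" where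
  "char_cotangent A V p = {\<xi>\<in>real_cotangent A p. \<forall>v \<in> V p \<union> conj_vec ` V p. \<xi> v = 0}"

definition hol_forms ::
    "('a::topological_space, 'm::finite) chart set \<Rightarrow> ('a \<Rightarrow> 'a tvec set) \<Rightarrow> 'a set \<Rightarrow> ('a \<Rightarrow> 'a covec) set" where
  "hol_forms A V U = {\<alpha>\<in>one_forms A U. \<forall>p\<in>U. \<alpha> p \<in> hol_cotangent A V p}"

definition char_forms ::
    "('a::topological_space, 'm::finite) chart set \<Rightarrow> ('a \<Rightarrow> 'a tvec set) \<Rightarrow> ('a \<Rightarrow> 'a covec) set" where
  "char_forms A V = {\<tau>\<in>one_forms A UNIV. \<forall>p. \<tau> p \<in> char_cotangent A V p}"

definition lie_form ::
    "('a::topological_space, 'm::finite) chart set \<Rightarrow> ('a \<Rightarrow> 'a tvec) \<Rightarrow> ('a \<Rightarrow> 'a covec) \<Rightarrow> 'a \<Rightarrow> 'a covec" where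
  "lie_form A L \<alpha> p = (\<lambda>v. if v \<in> ctangent A p then ext_deriv A \<alpha> p (L p) v else 0)"

definition hol_dual ::
    "('a::topological_space, 'm::finite) chart set \<Rightarrow> ('a \<Rightarrow> 'a tvec set) \<Rightarrow> 'a \<Rightarrow> ('a covec \<Rightarrow> complex) set" where
  "hol_dual A V p = {s.
     (\<forall>\<xi>\<in>hol_cotangent A V p. \<forall>\<eta>\<in>hol_cotangent A V p. s (\<lambda>v. \<xi> v + \<eta> v) = s \<xi> + s \<eta>) \<and>
     (\<forall>\<xi>\<in>hol_cotangent A V p. \<forall>a. s (\<lambda>v. a * \<xi> v) = a * s \<xi>) \<and>
     (\<forall>\<xi>. \<xi> \<notin> hol_cotangent A V p \<longrightarrow> s \<xi> = 0)}"

definition dual_sections ::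
    "('a::topological_space, 'm::finite) chart set \<Rightarrow> ('a \<Rightarrow> 'a tvec set) \<Rightarrow> ('a \<Rightarrow> 'a covec \<Rightarrow> complex) set" where
  "dual_sections A V = {s. (\<forall>p. s p \<in> hol_dual A V p) \<and>
     (\<forall>\<alpha>\<in>hol_forms A V UNIV. smooth_fun_on A UNIV (\<lambda>p. s p (\<alpha> p)))}"


section \<open>Finite nondegeneracy\<close>

definition E_generators ::
    "('a::topological_space, 'm::finite) chart set \<Rightarrow> ('a \<Rightarrow> 'a tvec set) \<Rightarrow> nat \<Rightarrow> ('a \<Rightarrow> 'a covec) set" where
  "E_generators A V k = {foldr (lie_form A) Ks \<theta> | Ks \<theta>.
     length Ks \<le> k \<and> set Ks \<subseteq> CR_fields A V \<and> \<theta> \<in> char_forms A V}"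

definition E_module ::
    "('a::topological_space, 'm::finite) chart set \<Rightarrow> ('a \<Rightarrow> 'a tvec set) \<Rightarrow> nat \<Rightarrow> ('a \<Rightarrow> 'a covec) set" where
  "E_module A V k = {(\<lambda>p v. \<Sum>l<r. g l p * \<beta> l p v) | (r::nat) g \<beta>.
     \<forall>l<r. g l \<in> smooth_funs A \<and> \<beta> l \<in> E_generators A V k}"

text \<open>The Leibniz formula, because \<open>det\<close> requires the size of the matrix to be a type.\<close>

definition leibniz_det :: "nat \<Rightarrow> (nat \<Rightarrow> nat \<Rightarrow> complex) \<Rightarrow> complex" where
  "leibniz_det N a = (\<Sum>\<pi> | \<pi> permutes {..<N}. of_int (sign \<pi>) * (\<Prod>i<N. a i (\<pi> i)))"

definition det_ideal ::
    "('a::topological_space, 'm::finite) chart set \<Rightarrow> ('a \<Rightarrow> 'a tvec set) \<Rightarrow> nat \<Rightarrow> ('a \<Rightarrow> complex) set" where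
  "det_ideal A V N = {(\<lambda>p. \<Sum>l<r. g l p * leibniz_det N (\<lambda>i j. Y l j p (W l i p))) | (r::nat) g W Y.
     \<forall>l<r. g l \<in> smooth_funs A \<and>
       (\<forall>i<N. W l i \<in> (\<Union>k. E_module A V k)) \<and> (\<forall>j<N. Y l j \<in> dual_sections A V)}"

definition finitely_nondegenerate ::
    "('a::topological_space, 'm::finite) chart set \<Rightarrow> ('a \<Rightarrow> 'a tvec set) \<Rightarrow> nat \<Rightarrow> bool" where
  "finitely_nondegenerate A V N \<longleftrightarrow> det_ideal A V N = smooth_funs A"


section \<open>Densities and distributions\<close>

text \<open>A density is given by its coefficients \<open>\<mu> c\<close> with respect to the Lebesgue measure in each chart
  \<open>c\<close>, regarded as functions on the manifold. They are related by the absolute value of the Jacobian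
  determinant. Coefficients are 0 where they have no meaning.\<close>

type_synonym ('a, 'm) dens = "('a, 'm) chart \<Rightarrow> 'a \<Rightarrow> complex"
type_synonym ('a, 'm) form_dens = "('a, 'm) chart \<Rightarrow> 'a \<Rightarrow> 'a covec"

definition jacobian :: "('a, 'm::finite) chart \<Rightarrow> ('a, 'm) chart \<Rightarrow> 'a \<Rightarrow> real" where
  "jacobian c c' p = \<bar>det (matrix (frechet_derivative (cmap c \<circ> cinv c') (at (cmap c' p))))\<bar>"

definition test_dens ::
    "('a::topological_space, 'm::finite) chart set \<Rightarrow> 'a set \<Rightarrow> ('a, 'm) dens set" where
  "test_dens A U = {\<mu>.
     (\<forall>c p. c \<notin> A \<or> p \<notin> cdom c \<longrightarrow> \<mu> c p = 0) \<and>
     (\<forall>c\<in>A. smooth_fun_on A (cdom c) (\<mu> c)) \<and>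
     (\<forall>c\<in>A. \<forall>c'\<in>A. \<forall>p \<in> cdom c \<inter> cdom c'. \<mu> c' p = of_real (jacobian c c' p) * \<mu> c p) \<and>
     (\<exists>K. compact K \<and> K \<subseteq> U \<and> (\<forall>c p. p \<notin> K \<longrightarrow> \<mu> c p = 0))}"

text \<open>Compactly supported smooth sections of \<open>T'M\<close> tensored with the density bundle.\<close>

definition test_form_dens ::
    "('a::topological_space, 'm::finite) chart set \<Rightarrow> ('a \<Rightarrow> 'a tvec set) \<Rightarrow> 'a set \<Rightarrow> ('a, 'm) form_dens set" where
  "test_form_dens A V U = {m.
     (\<forall>c p. c \<notin> A \<or> p \<notin> cdom c \<longrightarrow> m c p = (\<lambda>_. 0)) \<and>
     (\<forall>c\<in>A. m c \<in> hol_forms A V (cdom c)) \<and>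
     (\<forall>c\<in>A. \<forall>c'\<in>A. \<forall>p \<in> cdom c \<inter> cdom c'.
        m c' p = (\<lambda>v. of_real (jacobian c c' p) * m c p v)) \<and>
     (\<exists>K. compact K \<and> K \<subseteq> U \<and> (\<forall>c p. p \<notin> K \<longrightarrow> m c p = (\<lambda>_. 0)))}"

definition tensor_dens :: "('a \<Rightarrow> 'a covec) \<Rightarrow> ('a, 'm) dens \<Rightarrow> ('a, 'm) form_dens" where
  "tensor_dens \<alpha> \<mu> = (\<lambda>c p v. \<mu> c p * \<alpha> p v)"

fun iter_deriv :: "'e::real_normed_vector list \<Rightarrow> ('e \<Rightarrow> complex) \<Rightarrow> 'e \<Rightarrow> complex" where
  "iter_deriv [] f = f"
| "iter_deriv (v # vs) f = (\<lambda>x. frechet_derivative (iter_deriv vs f) (at x) v)"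

text \<open>Null sequences in the LF-topology on test sections.\<close>

definition test_null ::
    "('a::topological_space, 'm::finite) chart set \<Rightarrow> (nat \<Rightarrow> ('a, 'm) form_dens) \<Rightarrow> bool" where
  "test_null A ms \<longleftrightarrow>
     (\<exists>K. compact K \<and> (\<forall>j c p. p \<notin> K \<longrightarrow> ms j c p = (\<lambda>_. 0))) \<and>
     (\<forall>c\<in>A. \<forall>C i vs. compact C \<and> C \<subseteq> cmap c ` cdom c \<longrightarrow>
        uniform_limit C
          (\<lambda>j. iter_deriv vs (\<lambda>x. ms j c (cinv c x) (coord_vec A c i (cinv c x))))
          (\<lambda>_. 0) sequentially)"

text \<open>\<open>\<D>'(M, (T'M)\<^sup>*)\<close>: for linear functionals on an LF-space, continuity is sequential continuity.\<close>

definition distr_sections ::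
    "('a::topological_space, 'm::finite) chart set \<Rightarrow> ('a \<Rightarrow> 'a tvec set) \<Rightarrow> (('a, 'm) form_dens \<Rightarrow> complex) set" where
  "distr_sections A V = {X.
     (\<forall>m\<in>test_form_dens A V UNIV. \<forall>m'\<in>test_form_dens A V UNIV.
        X (\<lambda>c p v. m c p v + m' c p v) = X m + X m') \<and>
     (\<forall>m\<in>test_form_dens A V UNIV. \<forall>a. X (\<lambda>c p v. a * m c p v) = a * X m) \<and>
     (\<forall>ms. (\<forall>j. ms j \<in> test_form_dens A V UNIV) \<and> test_null A ms \<longrightarrow> (\<lambda>j. X (ms j)) \<longlonglongrightarrow> 0)}"

text \<open>The scalar distribution \<open>\<omega>(X)\<close>. If \<open>\<omega>\<close> is a holomorphic form on an open set \<open>U\<close> only, it is a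
  distribution on \<open>U\<close>, to be applied to elements of \<open>test_dens A U\<close>.\<close>

definition apply_form ::
    "('a \<Rightarrow> 'a covec) \<Rightarrow> (('a, 'm) form_dens \<Rightarrow> complex) \<Rightarrow> ('a, 'm) dens \<Rightarrow> complex" where
  "apply_form \<omega> X = (\<lambda>\<mu>. X (tensor_dens \<omega> \<mu>))"

definition conj_distr :: "(('a, 'm) dens \<Rightarrow> complex) \<Rightarrow> ('a, 'm) dens \<Rightarrow> complex" where
  "conj_distr u = (\<lambda>\<mu>. cnj (u (\<lambda>c p. cnj (\<mu> c p))))"

text \<open>If \<open>L = \<Sum> a\<^sub>i \<partial>\<^sub>i\<close> in a chart, the Lie derivative of a density has the coefficient
  \<open>\<Sum> \<partial>\<^sub>i (a\<^sub>i \<mu>)\<close> there; minus this operator is the transpose of \<open>L\<close>.\<close>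

definition lie_dens ::
    "('a::topological_space, 'm::finite) chart set \<Rightarrow> ('a \<Rightarrow> 'a tvec) \<Rightarrow> ('a, 'm) dens \<Rightarrow> ('a, 'm) dens" where
  "lie_dens A L \<mu> = (\<lambda>c p. if c \<in> A \<and> p \<in> cdom c
     then \<Sum>i\<in>UNIV. frechet_derivative ((\<lambda>q. vec_coords A c q (L q) $ i * \<mu> c q) \<circ> cinv c)
            (at (cmap c p)) (axis i 1)
     else 0)"

definition field_distr ::
    "('a::topological_space, 'm::finite) chart set \<Rightarrow> ('a \<Rightarrow> 'a tvec) \<Rightarrow> (('a, 'm) dens \<Rightarrow> complex) \<Rightarrow> ('a, 'm) dens \<Rightarrow> complex" where
  "field_distr A L u = (\<lambda>\<mu>. - u (lie_dens A L \<mu>))"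

definition infinitesimal_CR_diffeo ::
    "('a::topological_space, 'm::finite) chart set \<Rightarrow> ('a \<Rightarrow> 'a tvec set) \<Rightarrow> (('a, 'm) form_dens \<Rightarrow> complex) \<Rightarrow> bool" where
  "infinitesimal_CR_diffeo A V X \<longleftrightarrow> X \<in> distr_sections A V \<and>
     (\<forall>\<tau>\<in>char_forms A V. \<forall>\<mu>\<in>test_dens A UNIV.
        apply_form \<tau> X \<mu> = conj_distr (apply_form \<tau> X) \<mu>) \<and>
     (\<forall>L\<in>CR_fields A V. \<forall>\<alpha>\<in>hol_forms A V UNIV. \<forall>\<mu>\<in>test_dens A UNIV.
        field_distr A L (apply_form \<alpha> X) \<mu> = apply_form (lie_form A L \<alpha>) X \<mu>)"


section \<open>Regularity of distributions\<close>

definition loc_integrable_distr_on ::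
    "('a::topological_space, 'm::finite) chart set \<Rightarrow> 'a set \<Rightarrow> (('a, 'm) dens \<Rightarrow> complex) \<Rightarrow> bool" where
  "loc_integrable_distr_on A U u \<longleftrightarrow> (\<exists>h::'a \<Rightarrow> complex.
     (\<forall>c\<in>A. \<forall>K. compact K \<and> K \<subseteq> cmap c ` (U \<inter> cdom c) \<longrightarrow>
        set_integrable lebesgue K (h \<circ> cinv c)) \<and>
     (\<forall>c\<in>A. \<forall>\<mu>\<in>test_dens A (U \<inter> cdom c).
        u \<mu> = (LINT x : cmap c ` (U \<inter> cdom c) | lebesgue. h (cinv c x) * \<mu> c (cinv c x))))"

text \<open>The coefficient distributions of \<open>X\<close> with respect to the basis dual to \<open>\<omega>\<close> are the \<open>\<omega>\<^sup>j(X)\<close>.\<close>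

definition loc_integrable_section ::
    "('a::topological_space, 'm::finite) chart set \<Rightarrow> ('a \<Rightarrow> 'a tvec set) \<Rightarrow> nat \<Rightarrow> (('a, 'm) form_dens \<Rightarrow> complex) \<Rightarrow> bool" where
  "loc_integrable_section A V N X \<longleftrightarrow>
     (\<forall>U \<omega>. open U \<and> (\<forall>j<N. \<omega> j \<in> hol_forms A V U) \<and>
        (\<forall>p\<in>U. complex_basis N (\<lambda>j. \<omega> j p) (hol_cotangent A V p)) \<longrightarrow>
        (\<forall>j<N. loc_integrable_distr_on A U (apply_form (\<omega> j) X)))"

definition smooth_distr_section ::
    "('a::topological_space, 'm::finite) chart set \<Rightarrow> ('a \<Rightarrow> 'a tvec set) \<Rightarrow> (('a, 'm) form_dens \<Rightarrow> complex) \<Rightarrow> bool" where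
  "smooth_distr_section A V X \<longleftrightarrow>
     (\<exists>s\<in>dual_sections A V. \<forall>c\<in>A. \<forall>m\<in>test_form_dens A V (cdom c).
        X m = (LINT x : cmap c ` cdom c | lebesgue. s (cinv c x) (m c (cinv c x))))"


section \<open>Wavefront sets\<close>

text \<open>The wavefront set of a distribution \<open>v\<close> on an open subset \<open>S\<close> of Euclidean space: a direction is
  excluded if the Fourier transform of some localization \<open>\<rho> v\<close> decays rapidly in an open cone around
  it.\<close>

definition wavefront_euclidean ::
    "(real^'m::finite) set \<Rightarrow> ((real^'m \<Rightarrow> complex) \<Rightarrow> complex) \<Rightarrow> ((real^'m) \<times> (real^'m)) set" where
  "wavefront_euclidean S v = {(x, \<xi>). x \<in> S \<and> \<xi> \<noteq> 0 \<and>
     \<not> (\<exists>\<rho>::real^'m \<Rightarrow> complex. smooth_on UNIV \<rho> \<and>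
          (\<exists>K. compact K \<and> K \<subseteq> S \<and> (\<forall>y. y \<notin> K \<longrightarrow> \<rho> y = 0)) \<and> \<rho> x \<noteq> 0 \<and>
          (\<exists>C. open C \<and> \<xi> \<in> C \<and> (\<forall>\<eta>\<in>C. \<forall>t>0. t *\<^sub>R \<eta> \<in> C) \<and>
             (\<forall>k::nat. \<exists>B. \<forall>\<eta>\<in>C.
                (1 + norm \<eta>) ^ k * cmod (v (\<lambda>y. \<rho> y * exp (- (\<i> * of_real (\<eta> \<bullet> y))))) \<le> B)))}"

text \<open>The density whose coefficient in the chart \<open>c\<close> is the test function \<open>g\<close>.\<close>

definition chart_dens ::
    "('a::topological_space, 'm::finite) chart set \<Rightarrow> ('a, 'm) chart \<Rightarrow> (real^'m \<Rightarrow> complex) \<Rightarrow> ('a, 'm) dens" where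
  "chart_dens A c g = (\<lambda>c' p. if c' \<in> A \<and> p \<in> cdom c \<inter> cdom c'
     then of_real (jacobian c c' p) * g (cmap c p) else 0)"

definition wavefront ::
    "('a::topological_space, 'm::finite) chart set \<Rightarrow> (('a, 'm) dens \<Rightarrow> complex) \<Rightarrow> ('a \<times> 'a covec) set" where
  "wavefront A u = {(p, \<xi>). \<xi> \<in> real_cotangent A p \<and>
     (\<exists>c\<in>A. p \<in> cdom c \<and>
        (cmap c p, covec_coords A c p \<xi>)
          \<in> wavefront_euclidean (cmap c ` cdom c) (\<lambda>g. u (chart_dens A c g)))}"

text \<open>The fibre of \<open>\<Gamma>\<close> is closed relative to \<open>T\<^sup>0\<^sub>pM\<close> without the origin. The topology used is that of
  pointwise convergence of covectors, which is the usual one on the finite dimensional space \<open>T\<^sup>0\<^sub>pM\<close>.\<close>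

definition extends_to_wedge ::
    "('a::topological_space, 'm::finite) chart set \<Rightarrow> ('a \<Rightarrow> 'a tvec set) \<Rightarrow> (('a, 'm) form_dens \<Rightarrow> complex) \<Rightarrow> bool" where
  "extends_to_wedge A V X \<longleftrightarrow>
     (\<exists>\<Gamma> :: 'a \<Rightarrow> 'a covec set.
        (\<forall>p. \<Gamma> p \<subseteq> char_cotangent A V p - {\<lambda>_. 0} \<and>
             closedin (top_of_set (char_cotangent A V p - {\<lambda>_. 0})) (\<Gamma> p) \<and>
             (\<forall>\<xi>\<in>\<Gamma> p. \<forall>t>0. (\<lambda>v. of_real t * \<xi> v) \<in> \<Gamma> p) \<and>
             (\<forall>\<xi>\<in>\<Gamma> p. \<forall>\<eta>\<in>\<Gamma> p. \<forall>t\<in>{0..1::real}.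
                (\<lambda>v. of_real (1 - t) * \<xi> v + of_real t * \<eta> v) \<in> \<Gamma> p)) \<and>
        (\<forall>\<omega>\<in>hol_forms A V UNIV. wavefront A (apply_form \<omega> X) \<subseteq> (SIGMA p:UNIV. \<Gamma> p)))"

end

theory Submission
  imports Defs
begin

text \<open>Let \<open>\<theta>\<close> be a characteristic form. The distribution \<open>\<theta>(X)\<close> is real, so its wavefront set is symmetric
  under \<open>\<xi> \<mapsto> - \<xi>\<close>. Over each point it lies in a convex cone that does not contain \<open>0\<close>, and such a cone
  contains no two opposite covectors, because their midpoint is \<open>0\<close>. Hence the wavefront set is empty and
  \<open>\<theta>(X)\<close> is smooth (\<open>char_form_wavefront_empty\<close>, \<open>represents_of_wavefront_empty\<close>). For a CR field \<open>K\<close> the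
  value of \<open>X\<close> on the Lie derivative of \<open>\<alpha>\<close> along \<open>K\<close> is \<open>K(\<alpha>(X))\<close>, which is smooth if \<open>\<alpha>(X)\<close> is; so \<open>\<omega>(X)\<close> is
  smooth for every \<open>\<omega>\<close> in the module \<open>E\<close> (\<open>E_module_smooth_value\<close>). Finite nondegeneracy writes \<open>1\<close> as a
  combination of determinants of \<open>N\<close> elements of \<open>E\<close> paired with \<open>N\<close> sections of the dual bundle. Where such
  a determinant does not vanish, the \<open>N\<close> elements are a basis of the holomorphic cotangent space, and by
  Cramer's rule (\<open>cofactor_expansion\<close>) every holomorphic form is a combination of them whose coefficients
  are smooth after multiplication by the determinant. Averaging these expansions with the conjugates of
  the determinants as weights leaves a denominator without zeros. So \<open>X\<close> is a smooth section
  (\<open>smooth_distr_section_of_nondegenerate\<close>).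

  The analytic ingredient is that a distribution is a smooth function near a point over which its
  wavefront set is empty (\<open>locally_smooth_of_wavefront\<close>). A test function supported in the ball of radius \<open>R\<close>
  is expanded in \<open>2R\<close>-periodic plane waves (\<open>fourier_inversion\<close>), and a distribution may be applied
  termwise to the expansion because it grows at most polynomially on modulated cutoff functions.
  Multiplication of the cutoff by a smooth function therefore convolves the localized transform with
  rapidly decreasing weights and preserves rapid decay in a smaller cone (\<open>rapid_decay_smooth_mult\<close>). As the
  unit sphere is compact, the product of finitely many cutoffs gives rapid decay in all directions, and
  the series with these coefficients is the smooth function.

  On the manifold these statements are applied in charts. The smooth functions found in different
  charts agree, and the Lie derivative of a density does not depend on the chart; both follow from the
  change of variables formula and the fundamental lemma of the calculus of variations. The Lie
  derivative of a holomorphic form is again holomorphic because the CR fields are closed under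
  brackets and the exterior derivative is tensorial (\<open>d_form_vanishing_field\<close>).\<close>


section \<open>Calculus of smooth functions\<close>

lemma Ck_on_cong:
  assumes "open S" "\<And>x. x \<in> S \<Longrightarrow> f x = g x"
  shows "Ck_on k S f \<longleftrightarrow> Ck_on k S g"
  using assms(2)
proof (induction k arbitrary: f g)
  case 0
  then show ?case by (simp cong: continuous_on_cong)
next
  case (Suc k)
  have d: "(f has_derivative D) (at x) \<longleftrightarrow> (g has_derivative D) (at x)" if "x \<in> S" for x D
    using has_derivative_transform_within_open[OF _ assms(1) that] Suc.prems by metis
  then have "frechet_derivative f (at x) = frechet_derivative g (at x)" if "x \<in> S" for x
    using that by (simp add: frechet_derivative_def)
  then have "Ck_on k S (\<lambda>x. frechet_derivative f (at x) v) = Ck_on k S (\<lambda>x. frechet_derivative g (at x) v)" for v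
    by (intro Suc.IH) simp
  with d show ?case by (auto simp: differentiable_def)
qed

lemma frechet_derivative_cong_open:
  assumes "open S" "x \<in> S" "\<And>x. x \<in> S \<Longrightarrow> f x = g x"
  shows "frechet_derivative f (at x) = frechet_derivative g (at x)"
proof -
  have "(f has_derivative D) (at x) \<longleftrightarrow> (g has_derivative D) (at x)" for D
    using has_derivative_transform_within_open[OF _ assms(1,2)] assms(3) by metis
  then show ?thesis by (simp add: frechet_derivative_def)
qed

lemma Ck_on_subset: "Ck_on k S f \<Longrightarrow> T \<subseteq> S \<Longrightarrow> Ck_on k T f"
  by (induction k arbitrary: f) (auto intro: continuous_on_subset)

text \<open>The definition refers to the chosen derivative \<open>frechet_derivative\<close>; any derivative on an open set may be
  used in its place.\<close>

lemma Ck_on_SucI: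
  assumes "open S" "\<And>x. x \<in> S \<Longrightarrow> (f has_derivative f' x) (at x)"
    and "\<And>v. Ck_on k S (\<lambda>x. f' x v)"
  shows "Ck_on (Suc k) S f"
proof -
  have "frechet_derivative f (at x) = f' x" if "x \<in> S" for x
    using assms(2)[OF that] by (metis frechet_derivative_at)
  then have "Ck_on k S (\<lambda>x. frechet_derivative f (at x) v)" for v
    using assms(3)[of v] by (subst Ck_on_cong[OF assms(1)]) auto
  then show ?thesis using assms(2) by (auto simp: differentiable_def)
qed

lemma Ck_on_local:
  assumes "\<And>x. x \<in> S \<Longrightarrow> \<exists>U. open U \<and> x \<in> U \<and> Ck_on k (S \<inter> U) f"
  shows "Ck_on k S f"
  using assms
proof (induction k arbitrary: f)
  case 0
  have "continuous (at x within S) f" if x: "x \<in> S" for x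
  proof -
    obtain U where U: "open U" "x \<in> U" "continuous_on (S \<inter> U) f" using 0[OF x] by auto
    then have "continuous (at x within (S \<inter> U)) f" using x
      by (simp add: continuous_on_eq_continuous_within)
    moreover have "at x within (S \<inter> U) = at x within S"
      using U(1,2) by (intro at_within_nhd[of x U]) auto
    ultimately show ?thesis by (simp add: continuous_within)
  qed
  then show ?case by (simp add: continuous_on_eq_continuous_within)
next
  case (Suc k)
  show ?case
    unfolding Ck_on.simps
  proof (intro conjI ballI allI)
    fix x assume "x \<in> S"
    then show "f differentiable (at x)" using Suc.prems[of x] by auto
  next
    fix v show "Ck_on k S (\<lambda>x. frechet_derivative f (at x) v)"
    proof (rule Suc.IH)
      fix x assume "x \<in> S"
      from Suc.prems[OF this]
      show "\<exists>U. open U \<and> x \<in> U \<and> Ck_on k (S \<inter> U) (\<lambda>x. frechet_derivative f (at x) v)" by auto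
    qed
  qed
qed

lemma smooth_on_frechet:
  "smooth_on S f \<Longrightarrow> smooth_on S (\<lambda>x. frechet_derivative f (at x) v)"
  unfolding smooth_on_def using Ck_on.simps(2) by blast

lemma smooth_on_differentiable: "smooth_on S f \<Longrightarrow> x \<in> S \<Longrightarrow> f differentiable (at x)"
  unfolding smooth_on_def using Ck_on.simps(2) by blast

lemma smooth_on_has_derivative:
  "smooth_on S f \<Longrightarrow> x \<in> S \<Longrightarrow> (f has_derivative frechet_derivative f (at x)) (at x)"
  using smooth_on_differentiable frechet_derivative_works by blast

lemma smooth_on_continuous: "smooth_on S f \<Longrightarrow> continuous_on S f"
  unfolding smooth_on_def using Ck_on.simps(1) by blast

lemma smooth_on_cong:
  "open S \<Longrightarrow> (\<And>x. x \<in> S \<Longrightarrow> f x = g x) \<Longrightarrow> smooth_on S f \<longleftrightarrow> smooth_on S g"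
  unfolding smooth_on_def using Ck_on_cong by blast

lemma smooth_on_subset: "smooth_on S f \<Longrightarrow> T \<subseteq> S \<Longrightarrow> smooth_on T f"
  unfolding smooth_on_def using Ck_on_subset by blast

lemma smooth_on_local:
  "(\<And>x. x \<in> S \<Longrightarrow> \<exists>U. open U \<and> x \<in> U \<and> smooth_on (S \<inter> U) f) \<Longrightarrow> smooth_on S f"
  unfolding smooth_on_def by (intro allI Ck_on_local) blast

text \<open>By induction on the order: membership in the family is inherited by directional derivatives, so all
  members are differentiable arbitrarily often. Smoothness of explicit functions is reduced to the choice
  of a family closed under differentiation.\<close>

lemma smooth_on_family:
  assumes "open S" and "f \<in> F"
    and "\<And>f. f \<in> F \<Longrightarrow> \<exists>f'. (\<forall>x\<in>S. (f has_derivative f' x) (at x)) \<and> (\<forall>v. (\<lambda>x. f' x v) \<in> F)"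
  shows "smooth_on S f"
proof -
  have "Ck_on k S f" if "f \<in> F" for k f
    using that
  proof (induction k arbitrary: f)
    case 0
    with assms(3)[OF this] show ?case
      by (auto intro!: continuous_at_imp_continuous_on intro: has_derivative_continuous)
  next
    case (Suc k)
    from assms(3)[OF this(2)] obtain f'
      where "\<And>x. x \<in> S \<Longrightarrow> (f has_derivative f' x) (at x)" "\<And>v. (\<lambda>x. f' x v) \<in> F" by blast
    then show ?case
      by (intro Ck_on_SucI[OF assms(1)] Suc.IH)
  qed
  with assms(2) show ?thesis by (simp add: smooth_on_def)
qed

lemma smooth_on_const: "open S \<Longrightarrow> smooth_on S (\<lambda>x. c)"
  by (rule smooth_on_family[where F = "range (\<lambda>c x. c)"]) (auto intro!: exI[of _ "\<lambda>_ _. 0"])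

lemma smooth_on_bounded_linear:
  assumes "open S" "bounded_linear f" shows "smooth_on S f"
  unfolding smooth_on_def
proof
  fix k show "Ck_on k S f"
  proof (cases k)
    case 0
    with assms show ?thesis by (simp add: linear_continuous_on)
  next
    case (Suc j)
    have "Ck_on (Suc j) S f"
      using smooth_on_const[OF assms(1)] bounded_linear_imp_has_derivative[OF assms(2)]
      by (intro Ck_on_SucI[OF assms(1)]) (auto simp: smooth_on_def)
    then show ?thesis by (simp add: Suc)
  qed
qed

lemma smooth_on_id: "open S \<Longrightarrow> smooth_on S (\<lambda>x. x)"
  by (rule smooth_on_bounded_linear) (auto simp: bounded_linear_ident)

lemma Ck_on_add:
  assumes "open S" shows "Ck_on k S f \<Longrightarrow> Ck_on k S g \<Longrightarrow> Ck_on k S (\<lambda>x. f x + g x)"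
proof (induction k arbitrary: f g)
  case 0
  then show ?case by (auto intro: continuous_on_add)
next
  case (Suc k)
  then have "Ck_on k S (\<lambda>x. frechet_derivative f (at x) v + frechet_derivative g (at x) v)" for v
    by auto
  moreover have "((\<lambda>x. f x + g x) has_derivative (\<lambda>v. frechet_derivative f (at x) v + frechet_derivative g (at x) v)) (at x)"
    if "x \<in> S" for x
    using Suc.prems that by (intro has_derivative_add) (auto simp: frechet_derivative_works)
  ultimately show ?case
    by (intro Ck_on_SucI[OF assms])
qed

lemma smooth_on_add:
  "open S \<Longrightarrow> smooth_on S f \<Longrightarrow> smooth_on S g \<Longrightarrow> smooth_on S (\<lambda>x. f x + g x)"
  by (simp add: smooth_on_def Ck_on_add)

lemma smooth_on_sum:
  assumes "open S" "\<And>i. i \<in> I \<Longrightarrow> smooth_on S (f i)" shows "smooth_on S (\<lambda>x. \<Sum>i\<in>I. f i x)"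
  using assms(2)
  by (induction I rule: infinite_finite_induct) (auto simp: smooth_on_const smooth_on_add assms(1))

lemma (in bounded_bilinear) smooth_on:
  fixes f :: "'d::real_normed_vector \<Rightarrow> 'a"
  assumes S: "open S" and "smooth_on S f" "smooth_on S g" shows "smooth_on S (\<lambda>x. prod (f x) (g x))"
proof -
  have "\<forall>f g. smooth_on S f \<longrightarrow> smooth_on S g \<longrightarrow> Ck_on k S (\<lambda>x. prod (f x) (g x))" for k
  proof (induction k)
    case 0
    then show ?case by (simp add: continuous_on smooth_on_continuous)
  next
    case (Suc k)
    show ?case
    proof (intro allI impI)
      fix f :: "'d \<Rightarrow> 'a" and g :: "'d \<Rightarrow> 'b" assume fg: "smooth_on S f" "smooth_on S g"
      show "Ck_on (Suc k) S (\<lambda>x. prod (f x) (g x))"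
      proof (rule Ck_on_SucI[OF S])
        show "((\<lambda>x. prod (f x) (g x)) has_derivative
           (\<lambda>v. prod (f x) (frechet_derivative g (at x) v) + prod (frechet_derivative f (at x) v) (g x))) (at x)"
          if "x \<in> S" for x
          using that fg by (intro FDERIV smooth_on_has_derivative)
        have "smooth_on S (\<lambda>x. frechet_derivative f (at x) v)" "smooth_on S (\<lambda>x. frechet_derivative g (at x) v)" for v
          using fg by (auto intro: smooth_on_frechet)
        then have *: "Ck_on k S (\<lambda>x. prod (f x) (frechet_derivative g (at x) v))"
          "Ck_on k S (\<lambda>x. prod (frechet_derivative f (at x) v) (g x))" for v
          using Suc.IH fg by auto
        show "Ck_on k S (\<lambda>x. prod (f x) (frechet_derivative g (at x) v) + prod (frechet_derivative f (at x) v) (g x))" for v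
          using * by (rule Ck_on_add[OF S])
      qed
    qed
  qed
  then show ?thesis using assms by (simp add: smooth_on_def)
qed

lemmas smooth_on_mult = bounded_bilinear.smooth_on[OF bounded_bilinear_mult]
lemmas smooth_on_scaleR = bounded_bilinear.smooth_on[OF bounded_bilinear_scaleR]
lemmas smooth_on_inner = bounded_bilinear.smooth_on[OF bounded_bilinear_inner]

lemma smooth_on_compose:
  fixes f :: "'a::real_normed_vector \<Rightarrow> 'b::euclidean_space" and g :: "'b \<Rightarrow> 'c::real_normed_vector"
  assumes S: "open S" and T: "open T" and f: "smooth_on S f" and g: "smooth_on T g" and fST: "f ` S \<subseteq> T"
  shows "smooth_on S (\<lambda>x. g (f x))"
proof -
  \<comment> \<open>the factor \<open>a\<close> absorbs the derivatives of \<open>f\<close> that the chain rule produces\<close>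
  have "Ck_on k S (\<lambda>x. a x *\<^sub>R g (f x))" if "smooth_on T g" "smooth_on S a" for k and g :: "'b \<Rightarrow> 'c" and a :: "'a \<Rightarrow> real"
    using that
  proof (induction k arbitrary: g a)
    case 0
    then have "continuous_on S (\<lambda>x. g (f x))"
      using f fST by (intro continuous_on_compose2[of T g S f] smooth_on_continuous)
    with 0 show ?case by (simp add: continuous_on_scaleR smooth_on_continuous)
  next
    case (Suc k)
    let ?f' = "\<lambda>x. frechet_derivative f (at x)" and ?g' = "\<lambda>x. frechet_derivative g (at x)"
      and ?a' = "\<lambda>x. frechet_derivative a (at x)"
    have sum: "finite B \<Longrightarrow> (\<And>b. b \<in> B \<Longrightarrow> Ck_on k S (F b)) \<Longrightarrow> Ck_on k S (\<lambda>x. \<Sum>b\<in>B. F b x)"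
      for F :: "'b \<Rightarrow> 'a \<Rightarrow> 'c" and B
      by (induction B rule: finite_induct)
         (use smooth_on_const[OF S] in \<open>auto simp: smooth_on_def intro!: Ck_on_add[OF S]\<close>)
    show ?case
    proof (rule Ck_on_SucI[OF S])
      fix x assume x: "x \<in> S"
      have "((\<lambda>x. g (f x)) has_derivative (\<lambda>v. ?g' (f x) (?f' x v))) (at x)"
        using smooth_on_has_derivative[OF f x] smooth_on_has_derivative[OF Suc.prems(1), of "f x"] x fST
        by (intro has_derivative_compose[of f _ x UNIV g]) auto
      moreover have "?g' (f x) (?f' x v) = (\<Sum>b\<in>Basis. (?f' x v \<bullet> b) *\<^sub>R ?g' (f x) b)" for v
      proof -
        have "bounded_linear (?g' (f x))" using smooth_on_has_derivative[OF Suc.prems(1), of "f x"] x fST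
          by (auto dest: has_derivative_bounded_linear)
        then have "linear (?g' (f x))" by (rule bounded_linear.linear)
        have "?g' (f x) (\<Sum>b\<in>Basis. (?f' x v \<bullet> b) *\<^sub>R b) = (\<Sum>b\<in>Basis. (?f' x v \<bullet> b) *\<^sub>R ?g' (f x) b)"
          by (simp add: linear_sum[OF \<open>linear _\<close>] linear_cmul[OF \<open>linear _\<close>] del: euclidean_representation)
        then show ?thesis by (simp only: euclidean_representation)
      qed
      ultimately have "((\<lambda>x. g (f x)) has_derivative (\<lambda>v. \<Sum>b\<in>Basis. (?f' x v \<bullet> b) *\<^sub>R ?g' (f x) b)) (at x)"
        by simp
      from has_derivative_scaleR[OF smooth_on_has_derivative[OF Suc.prems(2) x] this]
      have "((\<lambda>x. a x *\<^sub>R g (f x)) has_derivative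
        (\<lambda>v. a x *\<^sub>R (\<Sum>b\<in>Basis. (?f' x v \<bullet> b) *\<^sub>R ?g' (f x) b) + ?a' x v *\<^sub>R g (f x))) (at x)" .
      then show "((\<lambda>x. a x *\<^sub>R g (f x)) has_derivative
        (\<lambda>v. (\<Sum>b\<in>Basis. (a x * (?f' x v \<bullet> b)) *\<^sub>R ?g' (f x) b) + ?a' x v *\<^sub>R g (f x))) (at x)"
        by (simp add: scaleR_sum_right)
    next
      fix v
      have "Ck_on k S (\<lambda>x. (a x * (?f' x v \<bullet> b)) *\<^sub>R ?g' (f x) b)" for b
        using Suc.prems f S by (intro Suc.IH smooth_on_frechet smooth_on_mult smooth_on_inner smooth_on_const)
      moreover have "Ck_on k S (\<lambda>x. ?a' x v *\<^sub>R g (f x))"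
        using Suc.prems by (intro Suc.IH smooth_on_frechet)
      ultimately show "Ck_on k S (\<lambda>x. (\<Sum>b\<in>Basis. (a x * (?f' x v \<bullet> b)) *\<^sub>R ?g' (f x) b) + ?a' x v *\<^sub>R g (f x))"
        by (intro Ck_on_add[OF S] sum[OF finite_Basis, where F = "\<lambda>b x. (a x * (?f' x v \<bullet> b)) *\<^sub>R ?g' (f x) b"])
    qed
  qed
  from this[OF g smooth_on_const[OF S], of _ 1] show ?thesis by (simp add: smooth_on_def)
qed

lemma smooth_on_minus: "open S \<Longrightarrow> smooth_on S f \<Longrightarrow> smooth_on S (\<lambda>x. - f x)"
  using smooth_on_scaleR[OF _ smooth_on_const[of S "-1::real"], of f] by simp

lemma smooth_on_diff: "open S \<Longrightarrow> smooth_on S f \<Longrightarrow> smooth_on S g \<Longrightarrow> smooth_on S (\<lambda>x. f x - g x)"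
  using smooth_on_add[OF _ _ smooth_on_minus, of S f g] by simp

lemma smooth_on_prod:
  fixes f :: "'i \<Rightarrow> 'a::real_normed_vector \<Rightarrow> 'b::{real_normed_algebra, comm_ring_1}"
  assumes "open S" "\<And>i. i \<in> I \<Longrightarrow> smooth_on S (f i)" shows "smooth_on S (\<lambda>x. \<Prod>i\<in>I. f i x)"
  using assms(2)
  by (induction I rule: infinite_finite_induct) (auto simp: smooth_on_const smooth_on_mult assms(1))

lemma smooth_on_bounded_linear_compose:
  fixes f :: "'a::real_normed_vector \<Rightarrow> 'b::euclidean_space"
  assumes "open S" "bounded_linear g" "smooth_on S f" shows "smooth_on S (\<lambda>x. g (f x))"
  using smooth_on_compose[OF assms(1) open_UNIV assms(3) smooth_on_bounded_linear[OF open_UNIV assms(2)]] by simp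

lemma smooth_on_cnj: "open S \<Longrightarrow> smooth_on S f \<Longrightarrow> smooth_on S (\<lambda>x. cnj (f x))"
  by (rule smooth_on_bounded_linear_compose[OF _ bounded_linear_cnj])

lemma smooth_on_of_real: "open S \<Longrightarrow> smooth_on S f \<Longrightarrow> smooth_on S (\<lambda>x. complex_of_real (f x))"
  by (rule smooth_on_bounded_linear_compose[OF _ bounded_linear_of_real])

text \<open>The family of the functions \<open>c / x\<^sup>n\<close> is closed under differentiation.\<close>

lemma smooth_on_inverse_id: "smooth_on (- {0}) (inverse :: 'a::real_normed_field \<Rightarrow> 'a)"
proof (rule smooth_on_family[where F = "range (\<lambda>(c, n) x. c * inverse x ^ n)"])
  show "inverse \<in> range (\<lambda>(c, n) x. c * inverse (x::'a) ^ n)"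
    by (rule range_eqI[of _ _ "(1, 1)"]) auto
  fix f assume "f \<in> range (\<lambda>(c, n) x. c * inverse (x::'a) ^ n)"
  then obtain c n where f: "f = (\<lambda>x. c * inverse (x::'a) ^ n)" by auto
  have "(f has_derivative (\<lambda>v. (- (c * of_nat n * v)) * inverse x ^ (n + 1))) (at x)" if "x \<noteq> 0" for x
  proof -
    have "(f has_field_derivative c * (of_nat n * (- (inverse x ^ Suc (Suc 0)) * inverse x ^ (n - Suc 0)))) (at x)"
      unfolding f by (rule DERIV_cmult[OF DERIV_power[OF DERIV_inverse[OF that]]])
    moreover have "c * (of_nat n * (- (inverse x ^ Suc (Suc 0)) * inverse x ^ (n - Suc 0))) = - (c * of_nat n) * inverse x ^ (n + 1)"
      by (cases n) (simp_all add: mult.assoc)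
    ultimately have "(f has_field_derivative - (c * of_nat n) * inverse x ^ (n + 1)) (at x)" by (simp only:)
    then show ?thesis
      unfolding has_field_derivative_def
      by (rule back_subst[of "\<lambda>D. (f has_derivative D) (at x)"]) (auto simp: mult_ac)
  qed
  then show "\<exists>f'. (\<forall>x\<in>-{0}. (f has_derivative f' x) (at x)) \<and> (\<forall>v. (\<lambda>x. f' x v) \<in> range (\<lambda>(c, n) x. c * inverse x ^ n))"
  proof (intro exI[of _ "\<lambda>x v. (- (c * of_nat n * v)) * inverse x ^ (n + 1)"] conjI allI)
    show "(\<lambda>x. - (c * of_nat n * v) * inverse x ^ (n + 1)) \<in> range (\<lambda>(c, n) x. c * inverse x ^ n)" for v
      by (rule range_eqI[of _ _ "(- (c * of_nat n * v), n + 1)"]) simp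
  qed auto
qed auto

lemma smooth_on_inverse:
  fixes f :: "'a::real_normed_vector \<Rightarrow> 'b::{real_normed_field, euclidean_space}"
  assumes "open S" "smooth_on S f" "\<And>x. x \<in> S \<Longrightarrow> f x \<noteq> 0" shows "smooth_on S (\<lambda>x. inverse (f x))"
  using assms by (intro smooth_on_compose[OF assms(1) _ assms(2) smooth_on_inverse_id]) auto

lemma smooth_on_exp:
  fixes f :: "'a::real_normed_vector \<Rightarrow> 'b::{real_normed_field, euclidean_space, banach}"
  assumes "open S" "smooth_on S f" shows "smooth_on S (\<lambda>x. exp (f x))"
proof -
  have "smooth_on UNIV (exp :: 'b \<Rightarrow> 'b)"
  proof (rule smooth_on_family[where F = "range (\<lambda>c x. c * exp x)"])
    fix f assume "f \<in> range (\<lambda>c x. c * exp (x::'b))"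
    then obtain c where f: "f = (\<lambda>x. c * exp (x::'b))" by auto
    have "(f has_derivative (\<lambda>v. (c * v) * exp x)) (at x)" for x
      unfolding f by (auto intro!: derivative_eq_intros)
    then show "\<exists>f'. (\<forall>x\<in>UNIV. (f has_derivative f' x) (at x)) \<and> (\<forall>v. (\<lambda>x. f' x v) \<in> range (\<lambda>c x. c * exp x))"
      by (intro exI[of _ "\<lambda>x v. (c * v) * exp x"]) auto
  qed (auto intro!: range_eqI[of _ _ 1])
  from smooth_on_compose[OF assms(1) _ assms(2) this] show ?thesis by simp
qed


section \<open>Bump functions\<close>

text \<open>All derivatives of \<open>exp (- 1 / t)\<close> have the form \<open>p (1 / t) * exp (- 1 / t)\<close> with a polynomial \<open>p\<close>,
  and these functions vanish at the origin.\<close>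

definition flat_fun :: "real poly \<Rightarrow> real \<Rightarrow> real" where
  "flat_fun p t = (if t > 0 then poly p (inverse t) * exp (- inverse t) else 0)"

lemma flat_fun_at_0: "(flat_fun p \<longlongrightarrow> 0) (at 0)"
proof -
  have pow: "((\<lambda>x::real. x ^ k * exp (- x)) \<longlongrightarrow> 0) at_top" for k
    using tendsto_power_div_exp_0[of k] by (simp add: exp_minus divide_inverse)
  have "((\<lambda>x::real. poly p x * exp (- x)) \<longlongrightarrow> 0) at_top"
  proof -
    have "((\<lambda>x::real. \<Sum>i\<le>degree p. coeff p i * (x ^ i * exp (- x))) \<longlongrightarrow> (\<Sum>i\<le>degree p. coeff p i * 0)) at_top"
      by (intro tendsto_sum tendsto_mult pow tendsto_const)
    then show ?thesis by (simp add: poly_altdef sum_distrib_right mult.assoc)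
  qed
  from filterlim_compose[OF this filterlim_inverse_at_top_right]
  have "((\<lambda>t. poly p (inverse t) * exp (- inverse t)) \<longlongrightarrow> 0) (at_right 0)" .
  then have "(flat_fun p \<longlongrightarrow> 0) (at_right 0)"
    by (rule Lim_transform_eventually) (auto simp: flat_fun_def eventually_at_filter)
  moreover have "((\<lambda>t. 0) \<longlongrightarrow> (0::real)) (at_left 0)" by simp
  then have "(flat_fun p \<longlongrightarrow> 0) (at_left 0)"
    by (rule Lim_transform_eventually) (auto simp: flat_fun_def eventually_at_filter)
  ultimately show ?thesis by (simp add: filterlim_split_at)
qed

lemma flat_fun_DERIV:
  "(flat_fun p has_field_derivative flat_fun ((p - pderiv p) * monom 1 2) t) (at t)"
proof (cases t "0::real" rule: linorder_cases)
  case less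
  have "((\<lambda>_. 0) has_field_derivative 0) (at t)" by simp
  then have "(flat_fun p has_field_derivative 0) (at t)"
    by (rule has_field_derivative_transform_within_open[of _ _ _ "{..<0}"]) (use less in \<open>auto simp: flat_fun_def\<close>)
  then show ?thesis using less by (simp add: flat_fun_def)
next
  case equal
  have "((\<lambda>h. (flat_fun p (0 + h) - flat_fun p 0) / h) \<longlongrightarrow> 0) (at 0)"
  proof (rule Lim_transform_eventually[OF flat_fun_at_0[of "p * monom 1 1"]])
    show "\<forall>\<^sub>F h in at 0. flat_fun (p * monom 1 1) h = (flat_fun p (0 + h) - flat_fun p 0) / h"
      by (auto simp: flat_fun_def eventually_at_filter poly_monom field_simps)
  qed
  then have "(flat_fun p has_field_derivative 0) (at 0)" by (simp add: DERIV_def)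
  then show ?thesis using equal by (simp add: flat_fun_def)
next
  case greater
  have "((\<lambda>t. poly p (inverse t) * exp (- inverse t)) has_field_derivative
     poly ((p - pderiv p) * monom 1 2) (inverse t) * exp (- inverse t)) (at t)"
    using greater
    by (auto intro!: derivative_eq_intros DERIV_chain2[OF poly_DERIV] simp: poly_monom field_simps power2_eq_square)
  then have "(flat_fun p has_field_derivative poly ((p - pderiv p) * monom 1 2) (inverse t) * exp (- inverse t)) (at t)"
    by (rule has_field_derivative_transform_within_open[of _ _ _ "{0<..}"]) (use greater in \<open>auto simp: flat_fun_def\<close>)
  then show ?thesis using greater by (simp add: flat_fun_def)
qed

lemma smooth_on_flat_fun: "smooth_on UNIV (flat_fun p)"
proof (rule smooth_on_family[where F = "range flat_fun"])
  fix f assume "f \<in> range flat_fun"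
  then obtain p where f: "f = flat_fun p" by auto
  have "(f has_derivative (\<lambda>v. flat_fun (smult v ((p - pderiv p) * monom 1 2)) t)) (at t)" for t
    using flat_fun_DERIV[of p t] unfolding f has_field_derivative_def
    by (rule back_subst[of "\<lambda>D. (flat_fun p has_derivative D) (at t)"]) (auto simp: flat_fun_def)
  then show "\<exists>f'. (\<forall>x\<in>UNIV. (f has_derivative f' x) (at x)) \<and> (\<forall>v. (\<lambda>x. f' x v) \<in> range flat_fun)"
    by (intro exI[of _ "\<lambda>t v. flat_fun (smult v ((p - pderiv p) * monom 1 2)) t"]) auto
qed auto

text \<open>The denominator has no zero, since \<open>t\<close> or \<open>1 - t\<close> is positive.\<close>

definition smooth_step :: "real \<Rightarrow> real" where
  "smooth_step t = flat_fun 1 t * inverse (flat_fun 1 t + flat_fun 1 (1 - t))"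

lemma smooth_step_bounds: "0 \<le> smooth_step t" "smooth_step t \<le> 1"
  and smooth_step_0: "t \<le> 0 \<Longrightarrow> smooth_step t = 0"
  and smooth_step_1: "t \<ge> 1 \<Longrightarrow> smooth_step t = 1"
  by (auto simp: smooth_step_def flat_fun_def field_simps add_pos_pos)

lemma smooth_on_smooth_step: "smooth_on UNIV smooth_step"
proof -
  have "smooth_on UNIV (\<lambda>t. flat_fun 1 (1 - t))"
    using smooth_on_compose[OF open_UNIV open_UNIV smooth_on_diff[OF open_UNIV smooth_on_const[OF open_UNIV] smooth_on_id[OF open_UNIV]]
        smooth_on_flat_fun, of 1 1] by simp
  moreover have "flat_fun 1 t + flat_fun 1 (1 - t) \<noteq> 0" for t
    using add_pos_pos[of "exp (- inverse t)" "exp (- inverse (1 - t))"] by (auto simp: flat_fun_def)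
  ultimately show ?thesis
    unfolding smooth_step_def[abs_def]
    by (intro smooth_on_mult smooth_on_inverse smooth_on_add smooth_on_flat_fun open_UNIV) auto
qed

lemma smooth_bump_ball:
  fixes x0 :: "'a::euclidean_space" and r :: real
  assumes "r > 0"
  obtains \<phi> :: "'a \<Rightarrow> real" where "smooth_on UNIV \<phi>" "\<And>x. 0 \<le> \<phi> x" "\<And>x. \<phi> x \<le> 1"
    "\<And>x. x \<in> cball x0 r \<Longrightarrow> \<phi> x = 1" "\<And>x. x \<notin> cball x0 (2 * r) \<Longrightarrow> \<phi> x = 0"
proof
  let ?\<phi> = "\<lambda>x. smooth_step (2 - ((x - x0) \<bullet> (x - x0)) * inverse (r^2))"
  have "smooth_on UNIV (\<lambda>x. 2 - ((x - x0) \<bullet> (x - x0)) * inverse (r^2))"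
    by (intro smooth_on_diff smooth_on_mult smooth_on_inner smooth_on_const smooth_on_id open_UNIV)
  from smooth_on_compose[OF _ _ this smooth_on_smooth_step] show "smooth_on UNIV ?\<phi>" by simp
  show "0 \<le> ?\<phi> x" "?\<phi> x \<le> 1" for x by (auto simp: smooth_step_bounds)
  show "?\<phi> x = 1" if "x \<in> cball x0 r" for x
  proof (rule smooth_step_1)
    have "(norm (x - x0))\<^sup>2 \<le> r\<^sup>2" using that by (intro power_mono) (auto simp: dist_norm norm_minus_commute)
    then show "1 \<le> 2 - ((x - x0) \<bullet> (x - x0)) * inverse (r^2)"
      using assms by (simp add: power2_norm_eq_inner field_simps)
  qed
  show "?\<phi> x = 0" if "x \<notin> cball x0 (2 * r)" for x
  proof (rule smooth_step_0)
    have "(2 * r)\<^sup>2 \<le> (norm (x - x0))\<^sup>2" using that assms by (intro power_mono) (auto simp: dist_norm norm_minus_commute)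
    then have "2 * r\<^sup>2 \<le> (x - x0) \<bullet> (x - x0)" using assms by (simp add: power2_norm_eq_inner power_mult_distrib) (smt (verit) zero_le_power2)
    then show "2 - ((x - x0) \<bullet> (x - x0)) * inverse (r^2) \<le> 0"
      using assms by (simp add: field_simps)
  qed
qed

text \<open>Cover \<open>K\<close> by finitely many balls for which the concentric balls of twice the radius lie in \<open>S\<close>, and take one
  minus the product of the functions \<open>1 - \<beta>\<close>, where the \<open>\<beta>\<close> are bump functions of these balls.\<close>

lemma smooth_bump:
  fixes K S :: "'a::euclidean_space set"
  assumes "compact K" "open S" "K \<subseteq> S"
  obtains \<phi> :: "'a \<Rightarrow> real" and U L where "smooth_on UNIV \<phi>" "\<And>x. 0 \<le> \<phi> x" "\<And>x. \<phi> x \<le> 1"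
    "open U" "K \<subseteq> U" "\<And>x. x \<in> U \<Longrightarrow> \<phi> x = 1" "compact L" "L \<subseteq> S" "\<And>x. x \<notin> L \<Longrightarrow> \<phi> x = 0"
proof -
  have "\<exists>r>0. cball x (2 * r) \<subseteq> S" if "x \<in> K" for x
  proof -
    have "x \<in> S" using assms(3) that by auto
    then obtain e where "e > 0" "cball x e \<subseteq> S" using assms(2) open_contains_cball[of S] by auto
    then show ?thesis by (intro exI[of _ "e / 2"]) auto
  qed
  then have "\<forall>x\<in>K. \<exists>r. r > 0 \<and> cball x (2 * r) \<subseteq> S" by blast
  from bchoice[OF this] obtain r where r: "\<And>x. x \<in> K \<Longrightarrow> r x > 0 \<and> cball x (2 * r x) \<subseteq> S" by blast
  have "\<exists>\<phi>::'a \<Rightarrow> real. smooth_on UNIV \<phi> \<and> (\<forall>y. 0 \<le> \<phi> y) \<and> (\<forall>y. \<phi> y \<le> 1) \<and>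
    (\<forall>y\<in>cball x (r x). \<phi> y = 1) \<and> (\<forall>y. y \<notin> cball x (2 * r x) \<longrightarrow> \<phi> y = 0)" if "x \<in> K" for x
    by (rule smooth_bump_ball[of "r x" x]) (use r[OF that] in blast)+
  then have "\<forall>x\<in>K. \<exists>\<phi>::'a \<Rightarrow> real. smooth_on UNIV \<phi> \<and> (\<forall>y. 0 \<le> \<phi> y) \<and> (\<forall>y. \<phi> y \<le> 1) \<and>
    (\<forall>y\<in>cball x (r x). \<phi> y = 1) \<and> (\<forall>y. y \<notin> cball x (2 * r x) \<longrightarrow> \<phi> y = 0)" by blast
  from bchoice[OF this] obtain \<beta> :: "'a \<Rightarrow> 'a \<Rightarrow> real" where \<beta>: "\<And>x. x \<in> K \<Longrightarrow> smooth_on UNIV (\<beta> x)" "\<And>x y. x \<in> K \<Longrightarrow> 0 \<le> \<beta> x y"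
    "\<And>x y. x \<in> K \<Longrightarrow> \<beta> x y \<le> 1" "\<And>x y. x \<in> K \<Longrightarrow> y \<in> cball x (r x) \<Longrightarrow> \<beta> x y = 1"
    "\<And>x y. x \<in> K \<Longrightarrow> y \<notin> cball x (2 * r x) \<Longrightarrow> \<beta> x y = 0" by blast
  obtain D where D: "D \<subseteq> K" "finite D" "K \<subseteq> (\<Union>x\<in>D. ball x (r x))"
  proof (rule compactE_image[OF assms(1), of K "\<lambda>x. ball x (r x)"])
    show "K \<subseteq> (\<Union>x\<in>K. ball x (r x))" using r by force
  qed auto
  let ?\<phi> = "\<lambda>y. 1 - (\<Prod>x\<in>D. 1 - \<beta> x y)"
  show ?thesis
  proof (rule that[of ?\<phi> "\<Union>x\<in>D. ball x (r x)" "\<Union>x\<in>D. cball x (2 * r x)"])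
    show "smooth_on UNIV ?\<phi>" using D(1) \<beta>(1) by (intro smooth_on_diff smooth_on_prod smooth_on_const open_UNIV) auto
    show "0 \<le> ?\<phi> y" for y using D(1) \<beta>(2,3) by (auto intro!: prod_le_1)
    show "?\<phi> y \<le> 1" for y using D(1) \<beta>(2,3) by (auto intro!: prod_nonneg)
    show "?\<phi> y = 1" if "y \<in> (\<Union>x\<in>D. ball x (r x))" for y
    proof -
      from that obtain x where "x \<in> D" "y \<in> ball x (r x)" by auto
      then have "\<exists>x\<in>D. 1 - \<beta> x y = 0" using D(1) \<beta>(4)[of x y] by (intro bexI[of _ x]) auto
      then show ?thesis using D(2) by (simp add: prod_zero)
    qed
    show "?\<phi> y = 0" if "y \<notin> (\<Union>x\<in>D. cball x (2 * r x))" for y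
    proof -
      have "\<beta> x y = 0" if "x \<in> D" for x using \<open>y \<notin> _\<close> that D(1) \<beta>(5)[of x y] by auto
      then show ?thesis by simp
    qed
    show "compact (\<Union>x\<in>D. cball x (2 * r x))" using D(2) by (intro compact_UN) auto
    show "(\<Union>x\<in>D. cball x (2 * r x)) \<subseteq> S" using D(1) r by blast
  qed (use D in auto)
qed


section \<open>Hadamard's lemma\<close>

text \<open>Differentiation under the integral sign. The power of \<open>t\<close> takes up the factor \<open>t\<close> that each derivative
  produces.\<close>

lemma smooth_on_segment_average:
  fixes F :: "'a::euclidean_space \<Rightarrow> 'b::banach"
  assumes S: "open S" "convex S" "p \<in> S" and F: "smooth_on S F"
  shows "smooth_on S (\<lambda>x. integral {0..1} (\<lambda>t::real. t ^ k *\<^sub>R F (p + t *\<^sub>R (x - p))))"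
proof -
  let ?I = "\<lambda>(F :: 'a \<Rightarrow> 'b) k x. integral {0..1} (\<lambda>t::real. t ^ k *\<^sub>R F (p + t *\<^sub>R (x - p)))"
  let ?\<F> = "{?I F k | F k. smooth_on S F}"
  have seg: "p + t *\<^sub>R (x - p) \<in> S" if "x \<in> S" "t \<in> {0..1}" for x t
    using convexD[OF S(2) S(3) that(1), of "1 - t" t] that(2) by (simp add: algebra_simps)
  show ?thesis
  proof (rule smooth_on_family[where F = ?\<F>])
    fix f assume "f \<in> ?\<F>"
    then obtain F k where f: "f = ?I F k" and F: "smooth_on S F" by blast
    have der: "(f has_derivative (\<lambda>v. ?I (\<lambda>y. frechet_derivative F (at y) v) (Suc k) x)) (at x)" if x: "x \<in> S" for x
    proof -
      let ?D = "\<lambda>x t v. t ^ Suc k *\<^sub>R frechet_derivative F (at (p + t *\<^sub>R (x - p))) v"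
      have D: "((\<lambda>x. t ^ k *\<^sub>R F (p + t *\<^sub>R (x - p))) has_derivative ?D x t) (at x)" if "x \<in> S" "t \<in> {0..1}" for x t
      proof -
        have F': "(F has_derivative frechet_derivative F (at (p + t *\<^sub>R (x - p)))) (at (p + t *\<^sub>R (x - p)))"
          using smooth_on_has_derivative[OF F seg[OF that]] .
        have "((\<lambda>x. p + t *\<^sub>R (x - p)) has_derivative (\<lambda>v. t *\<^sub>R v)) (at x)"
          by (auto intro!: derivative_eq_intros)
        from has_derivative_compose[OF this F']
        have "((\<lambda>x. t ^ k *\<^sub>R F (p + t *\<^sub>R (x - p))) has_derivative
          (\<lambda>v. t ^ k *\<^sub>R frechet_derivative F (at (p + t *\<^sub>R (x - p))) (t *\<^sub>R v))) (at x)"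
          by (intro has_derivative_scaleR_right)
        then show ?thesis
          by (simp add: linear_cmul[OF has_derivative_linear[OF F']] mult.commute)
      qed
      have app: "blinfun_apply (Blinfun (?D x t)) = ?D x t" if "x \<in> S" "t \<in> {0..1}" for x t
        using D[OF that] by (intro bounded_linear_Blinfun_apply) (rule has_derivative_bounded_linear)
      have segc: "continuous_on (S \<times> {0..1}) (\<lambda>(x, t). G (p + t *\<^sub>R (x - p)))" if "continuous_on S G" for G :: "'a \<Rightarrow> 'b"
        unfolding case_prod_beta
        by (rule continuous_on_compose2[OF that]) (auto intro!: continuous_intros seg)
      have cont: "continuous_on (S \<times> {0..1}) (\<lambda>(x, t). ?D x t v)" for v
      proof -
        have "continuous_on (S \<times> {0..1}) (\<lambda>(x, t). frechet_derivative F (at (p + t *\<^sub>R (x - p))) v)"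
          using segc[OF smooth_on_continuous[OF smooth_on_frechet[OF F]]] .
        then show ?thesis unfolding case_prod_beta by (auto intro!: continuous_intros)
      qed
      have contI: "continuous_on {0..1} (\<lambda>t. G x t)" if "continuous_on (S \<times> {0..1}) (\<lambda>(x, t). G x t)" "x \<in> S" for x and G :: "'a \<Rightarrow> real \<Rightarrow> 'c::topological_space"
        using continuous_on_compose2[OF that(1) continuous_on_Pair[OF continuous_on_const continuous_on_id], of x "{0..1}"] that(2)
        by auto
      have contB: "continuous_on (S \<times> {0..1}) (\<lambda>(x, t). Blinfun (?D x t))"
      proof (rule continuous_on_blinfun_componentwise)
        fix i :: 'a
        show "continuous_on (S \<times> {0..1}) (\<lambda>x. blinfun_apply (case x of (x, t) \<Rightarrow> Blinfun (?D x t)) i)"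
          using cont[of i] by (rule continuous_on_eq) (auto simp: app simp del: power_Suc)
      qed
      have "((\<lambda>x. integral (cbox 0 1) (\<lambda>t::real. t ^ k *\<^sub>R F (p + t *\<^sub>R (x - p)))) has_derivative
          integral (cbox 0 1) (\<lambda>t. Blinfun (?D x t))) (at x within S)"
      proof (rule leibniz_rule[OF _ _ _ x S(2)])
        show "((\<lambda>x. t ^ k *\<^sub>R F (p + t *\<^sub>R (x - p))) has_derivative blinfun_apply (Blinfun (?D x t))) (at x within S)"
          if "x \<in> S" "t \<in> cbox 0 1" for x t
          using D[of x t] that app[of x t] by (auto intro: has_derivative_at_withinI)
        have c: "continuous_on (S \<times> {0..1}) (\<lambda>(x, t). t ^ k *\<^sub>R F (p + t *\<^sub>R (x - p)))"
          using segc[OF smooth_on_continuous[OF F]] unfolding case_prod_beta by (auto intro!: continuous_intros)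
        show "(\<lambda>t. t ^ k *\<^sub>R F (p + t *\<^sub>R (x - p))) integrable_on cbox 0 1" if "x \<in> S" for x
          using contI[OF c that] by (auto intro: integrable_continuous_real)
        show "continuous_on (S \<times> cbox 0 1) (\<lambda>(x, t). Blinfun (?D x t))" using contB by simp
      qed
      moreover have *: "blinfun_apply (integral (cbox 0 1) (\<lambda>t. Blinfun (?D x t))) v = integral {0..1} (\<lambda>t. ?D x t v)" for v
      proof -
        have "(\<lambda>t. Blinfun (?D x t)) integrable_on cbox 0 1"
          using contI[OF contB x] by (auto intro: integrable_continuous_real)
        from integral_linear[OF this blinfun.bounded_linear_left[of v]]
        have "blinfun_apply (integral (cbox 0 1) (\<lambda>t. Blinfun (?D x t))) v
          = integral (cbox 0 1) (\<lambda>t. blinfun_apply (Blinfun (?D x t)) v)" by (simp add: o_def)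
        also have "\<dots> = integral {0..1} (\<lambda>t. ?D x t v)" unfolding interval_cbox[symmetric] using app[OF x] by (intro integral_cong) (simp only:)
        finally show ?thesis .
      qed
      from ext[OF *] have "blinfun_apply (integral (cbox 0 1) (\<lambda>t. Blinfun (?D x t))) = (\<lambda>v. integral {0..1} (\<lambda>t. ?D x t v))" .
      ultimately show ?thesis
        unfolding at_within_open[OF x S(1)] f by (simp only: box_real)
    qed
    show "\<exists>f'. (\<forall>x\<in>S. (f has_derivative f' x) (at x)) \<and> (\<forall>v. (\<lambda>x. f' x v) \<in> ?\<F>)"
    proof (intro exI[of _ "\<lambda>x v. ?I (\<lambda>y. frechet_derivative F (at y) v) (Suc k) x"] conjI ballI allI)
      show "(\<lambda>x. ?I (\<lambda>y. frechet_derivative F (at y) v) (Suc k) x) \<in> ?\<F>" for v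
        using smooth_on_frechet[OF F, of v] by (intro CollectI exI[of _ "\<lambda>y. frechet_derivative F (at y) v"] exI[of _ "Suc k"]) (rule conjI[OF refl])
    qed (rule der)
  qed (use S F in blast)+
qed

text \<open>The difference \<open>f x - f p\<close> is the integral of the derivative of \<open>f\<close> along the segment from \<open>p\<close> to \<open>x\<close>, and the
  coefficients are the averages of the partial derivatives over the segment.\<close>

lemma hadamard_lemma:
  fixes f :: "'a::euclidean_space \<Rightarrow> 'b::banach"
  assumes S: "open S" "convex S" "p \<in> S" and f: "smooth_on S f"
  obtains g where "\<And>b. smooth_on S (g b)"
    "\<And>x. x \<in> S \<Longrightarrow> f x = f p + (\<Sum>b\<in>Basis. ((x - p) \<bullet> b) *\<^sub>R g b x)"
proof
  let ?g = "\<lambda>b x. integral {0..1} (\<lambda>t::real. t ^ 0 *\<^sub>R frechet_derivative f (at (p + t *\<^sub>R (x - p))) b)"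
  show "smooth_on S (?g b)" for b
    by (rule smooth_on_segment_average[OF S]) (rule smooth_on_frechet[OF f])
  fix x assume x: "x \<in> S"
  let ?\<gamma> = "\<lambda>t. p + t *\<^sub>R (x - p)"
  let ?D = "\<lambda>t. frechet_derivative f (at (?\<gamma> t))"
  have seg: "?\<gamma> t \<in> S" if "t \<in> {0..1}" for t
    using convexD[OF S(2) S(3) x, of "1 - t" t] that by (simp add: algebra_simps)
  have f': "(f has_derivative ?D t) (at (?\<gamma> t))" if "t \<in> {0..1}" for t
    using smooth_on_has_derivative[OF f seg[OF that]] .
  have "((\<lambda>t. f (?\<gamma> t)) has_vector_derivative ?D t (x - p)) (at t within {0..1})" if t: "t \<in> {0..1}" for t
  proof -
    have "(?\<gamma> has_derivative (\<lambda>s. s *\<^sub>R (x - p))) (at t within {0..1})"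
      by (auto intro!: derivative_eq_intros)
    from has_derivative_compose[OF this f'[OF t]] show ?thesis
      by (simp add: has_vector_derivative_def linear_cmul[OF has_derivative_linear[OF f'[OF t]]])
  qed
  from fundamental_theorem_of_calculus[where a = 0 and b = 1, OF _ this]
  have "((\<lambda>t. ?D t (x - p)) has_integral f x - f p) {0..1}" by simp
  then have "f x - f p = integral {0..1} (\<lambda>t. ?D t (x - p))" by (simp add: integral_unique)
  also have "\<dots> = integral {0..1} (\<lambda>t. \<Sum>b\<in>Basis. ((x - p) \<bullet> b) *\<^sub>R ?D t b)"
  proof (rule integral_cong)
    fix t :: real assume t: "t \<in> {0..1}"
    have "?D t (\<Sum>b\<in>Basis. ((x - p) \<bullet> b) *\<^sub>R b) = (\<Sum>b\<in>Basis. ((x - p) \<bullet> b) *\<^sub>R ?D t b)"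
      using has_derivative_linear[OF f'[OF t]]
      by (simp add: linear_sum linear_cmul del: euclidean_representation)
    then show "?D t (x - p) = (\<Sum>b\<in>Basis. ((x - p) \<bullet> b) *\<^sub>R ?D t b)" by (simp only: euclidean_representation)
  qed
  also have "\<dots> = (\<Sum>b\<in>Basis. ((x - p) \<bullet> b) *\<^sub>R integral {0..1} (\<lambda>t. ?D t b))"
  proof -
    have "(\<lambda>t. ?D t b) integrable_on {0..1}" for b
    proof (rule integrable_continuous_real)
      show "continuous_on {0..1} (\<lambda>t. ?D t b)"
        by (rule continuous_on_compose2[OF smooth_on_continuous[OF smooth_on_frechet[OF f]]]) (auto intro!: continuous_intros seg)
    qed
    then show ?thesis by (subst integral_sum) (auto intro: integrable_cmul)
  qed
  finally show "f x = f p + (\<Sum>b\<in>Basis. ((x - p) \<bullet> b) *\<^sub>R ?g b x)" by (simp add: algebra_simps)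
qed


section \<open>Test functions and distributions on Euclidean space\<close>

text \<open>\<open>iter_deriv\<close> takes the last element of the list as the first derivative. Inductions on the number of
  derivatives therefore remove it and replace \<open>f\<close> by its derivative.\<close>

lemma iter_deriv_snoc:
  "iter_deriv (vs @ [v]) f = iter_deriv vs (\<lambda>x. frechet_derivative f (at x) v)"
  by (induction vs) simp_all

lemma smooth_on_iter_deriv: "smooth_on S f \<Longrightarrow> smooth_on S (iter_deriv vs f)"
  by (induction vs) (simp_all add: smooth_on_frechet)

lemma iter_deriv_cong:
  assumes "open S" "\<And>x. x \<in> S \<Longrightarrow> f x = g x" "x \<in> S"
  shows "iter_deriv vs f x = iter_deriv vs g x"
proof -
  have "\<forall>x\<in>S. iter_deriv vs f x = iter_deriv vs g x"
  proof (induction vs)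
    case (Cons v vs)
    then have "frechet_derivative (iter_deriv vs f) (at x) = frechet_derivative (iter_deriv vs g) (at x)" if "x \<in> S" for x
      using that by (intro frechet_derivative_cong_open[OF assms(1)]) auto
    then show ?case by simp
  qed (use assms in simp)
  then show ?thesis using assms(3) by blast
qed

lemma frechet_derivative_eqI: "(f has_derivative f') (at x) \<Longrightarrow> frechet_derivative f (at x) = f'"
  by (metis frechet_derivative_at)

lemma frechet_derivative_add_smooth:
  assumes "smooth_on S f" "smooth_on S g" "x \<in> S"
  shows "frechet_derivative (\<lambda>x. f x + g x) (at x) = (\<lambda>v. frechet_derivative f (at x) v + frechet_derivative g (at x) v)"
  by (intro frechet_derivative_eqI has_derivative_add smooth_on_has_derivative[OF assms(1,3)] smooth_on_has_derivative[OF assms(2,3)])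

lemma frechet_derivative_mult_smooth:
  fixes f g :: "'a::real_normed_vector \<Rightarrow> 'b::real_normed_algebra"
  assumes "smooth_on S f" "smooth_on S g" "x \<in> S"
  shows "frechet_derivative (\<lambda>x. f x * g x) (at x) = (\<lambda>v. f x * frechet_derivative g (at x) v + frechet_derivative f (at x) v * g x)"
  by (intro frechet_derivative_eqI has_derivative_mult smooth_on_has_derivative[OF assms(1,3)] smooth_on_has_derivative[OF assms(2,3)])

lemma frechet_derivative_cmult_smooth:
  fixes f :: "'a::real_normed_vector \<Rightarrow> 'b::real_normed_algebra"
  assumes "smooth_on S f" "x \<in> S"
  shows "frechet_derivative (\<lambda>x. c * f x) (at x) = (\<lambda>v. c * frechet_derivative f (at x) v)"
  by (intro frechet_derivative_eqI has_derivative_mult_right smooth_on_has_derivative[OF assms])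

lemma linear_frechet_derivative_smooth: "smooth_on S f \<Longrightarrow> x \<in> S \<Longrightarrow> linear (frechet_derivative f (at x))"
  using has_derivative_linear smooth_on_has_derivative by blast

lemma frechet_derivative_basis_sum:
  fixes f :: "'a::euclidean_space \<Rightarrow> 'b::real_normed_vector"
  assumes "smooth_on S f" "x \<in> S"
  shows "frechet_derivative f (at x) v = (\<Sum>b\<in>Basis. (v \<bullet> b) *\<^sub>R frechet_derivative f (at x) b)"
proof -
  have "frechet_derivative f (at x) (\<Sum>b\<in>Basis. (v \<bullet> b) *\<^sub>R b) = (\<Sum>b\<in>Basis. (v \<bullet> b) *\<^sub>R frechet_derivative f (at x) b)"
    using linear_frechet_derivative_smooth[OF assms] by (simp add: linear_sum linear_cmul del: euclidean_representation)
  then show ?thesis by (simp only: euclidean_representation)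
qed

lemma frechet_derivative_compose_smooth:
  fixes g :: "'b::euclidean_space \<Rightarrow> 'c::real_normed_vector"
  assumes "smooth_on S f" "smooth_on T g" "x \<in> S" "f x \<in> T"
  shows "frechet_derivative (\<lambda>x. g (f x)) (at x) v
    = (\<Sum>b\<in>Basis. (frechet_derivative f (at x) v \<bullet> b) *\<^sub>R frechet_derivative g (at (f x)) b)"
proof -
  have "((\<lambda>x. g (f x)) has_derivative (\<lambda>v. frechet_derivative g (at (f x)) (frechet_derivative f (at x) v))) (at x)"
    using smooth_on_has_derivative[OF assms(1,3)] smooth_on_has_derivative[OF assms(2,4)]
    by (intro has_derivative_compose[of f _ x UNIV g]) auto
  then show ?thesis
    by (simp add: frechet_derivative_eqI frechet_derivative_basis_sum[OF assms(2,4), symmetric])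
qed

lemma iter_deriv_add:
  assumes "open S" "smooth_on S f" "smooth_on S g" "x \<in> S"
  shows "iter_deriv vs (\<lambda>x. f x + g x) x = iter_deriv vs f x + iter_deriv vs g x"
  using assms(4)
proof (induction vs arbitrary: x)
  case (Cons v vs)
  have "frechet_derivative (iter_deriv vs (\<lambda>x. f x + g x)) (at x)
    = frechet_derivative (\<lambda>x. iter_deriv vs f x + iter_deriv vs g x) (at x)"
    using Cons by (intro frechet_derivative_cong_open[OF assms(1)]) auto
  then show ?case
    using frechet_derivative_add_smooth[OF smooth_on_iter_deriv[OF assms(2)] smooth_on_iter_deriv[OF assms(3)] Cons.prems]
    by simp
qed simp

lemma iter_deriv_zero [simp]: "iter_deriv vs (\<lambda>_. 0) x = 0"
proof -
  have "iter_deriv vs (\<lambda>_::'a. 0) = (\<lambda>_. 0)" by (induction vs) (simp_all add: frechet_derivative_const)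
  then show ?thesis by simp
qed

lemma iter_deriv_sum:
  assumes "open S" "finite I" "\<And>i. i \<in> I \<Longrightarrow> smooth_on S (f i)" "x \<in> S"
  shows "iter_deriv vs (\<lambda>x. \<Sum>i\<in>I. f i x) x = (\<Sum>i\<in>I. iter_deriv vs (f i) x)"
  using assms(2,3)
proof (induction I rule: finite_induct)
  case (insert i I)
  then show ?case
    using iter_deriv_add[OF assms(1) _ smooth_on_sum[OF assms(1), of I f] assms(4)] by simp
qed simp

lemma iter_deriv_cmult:
  assumes "open S" "smooth_on S f" "x \<in> S"
  shows "iter_deriv vs (\<lambda>x. c * f x) x = c * iter_deriv vs f x"
  using assms(3)
proof (induction vs arbitrary: x)
  case (Cons v vs)
  have "frechet_derivative (iter_deriv vs (\<lambda>x. c * f x)) (at x)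
    = frechet_derivative (\<lambda>x. c * iter_deriv vs f x) (at x)"
    using Cons by (intro frechet_derivative_cong_open[OF assms(1)]) auto
  then show ?case
    using frechet_derivative_cmult_smooth[OF smooth_on_iter_deriv[OF assms(2)] Cons.prems] by simp
qed simp

definition test_funs :: "'e::euclidean_space set \<Rightarrow> ('e \<Rightarrow> complex) set" where
  "test_funs S = {g. smooth_on UNIV g \<and> (\<exists>K. compact K \<and> K \<subseteq> S \<and> (\<forall>x. x \<notin> K \<longrightarrow> g x = 0))}"

lemma test_funs_smooth: "g \<in> test_funs S \<Longrightarrow> smooth_on UNIV g"
  by (simp add: test_funs_def)

lemma test_funs_mono: "g \<in> test_funs S \<Longrightarrow> S \<subseteq> T \<Longrightarrow> g \<in> test_funs T"
  unfolding test_funs_def by blast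

lemma test_funs_outside: "g \<in> test_funs S \<Longrightarrow> x \<notin> S \<Longrightarrow> g x = 0"
  unfolding test_funs_def by blast

lemma test_funsE:
  assumes "g \<in> test_funs S"
  obtains K where "compact K" "K \<subseteq> S" "\<And>x. x \<notin> K \<Longrightarrow> g x = 0"
  using assms unfolding test_funs_def by blast

lemma test_funsI:
  assumes "open S" "smooth_on S g" "compact K" "K \<subseteq> S" "\<And>x. x \<notin> K \<Longrightarrow> g x = 0"
  shows "g \<in> test_funs S"
proof -
  have "smooth_on UNIV g"
  proof (rule smooth_on_local)
    fix x
    show "\<exists>U. open U \<and> x \<in> U \<and> smooth_on (UNIV \<inter> U) g"
    proof (cases "x \<in> S")
      case False
      have "open (- K)" using assms(3) by (simp add: compact_imp_closed open_Compl)
      then have "smooth_on (- K) g" using smooth_on_cong[of "- K" g "\<lambda>_. 0"] smooth_on_const[of "- K" 0] assms(5) by auto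
      with False assms(4) \<open>open (- K)\<close> show ?thesis by (intro exI[of _ "- K"]) auto
    qed (use assms in auto)
  qed
  with assms show ?thesis unfolding test_funs_def by blast
qed

lemma test_funs_zero [simp]: "(\<lambda>_. 0) \<in> test_funs S"
  unfolding test_funs_def by (auto intro: smooth_on_const exI[of _ "{}"])

lemma test_funs_add: assumes "f \<in> test_funs S" "g \<in> test_funs S" shows "(\<lambda>x. f x + g x) \<in> test_funs S"
proof -
  from assms obtain K L where "compact K" "K \<subseteq> S" "\<forall>x. x \<notin> K \<longrightarrow> f x = 0" "compact L" "L \<subseteq> S" "\<forall>x. x \<notin> L \<longrightarrow> g x = 0"
    unfolding test_funs_def by blast
  then have "compact (K \<union> L) \<and> K \<union> L \<subseteq> S \<and> (\<forall>x. x \<notin> K \<union> L \<longrightarrow> f x + g x = 0)" by auto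
  then show ?thesis using assms unfolding test_funs_def by (blast intro: smooth_on_add)
qed

lemma test_funs_mult:
  assumes "open S" "f \<in> test_funs S" "smooth_on S g"
  shows "(\<lambda>x. f x * g x) \<in> test_funs S"
proof -
  from assms(2) obtain K where K: "compact K" "K \<subseteq> S" "\<And>x. x \<notin> K \<Longrightarrow> f x = 0" by (rule test_funsE) blast
  from assms show ?thesis
    by (intro test_funsI[OF assms(1) _ K(1,2)] smooth_on_mult) (auto simp: K(3) intro: smooth_on_subset test_funs_smooth)
qed

lemma test_funs_mult_UNIV:
  assumes "f \<in> test_funs S" "smooth_on UNIV g"
  shows "(\<lambda>x. f x * g x) \<in> test_funs S" "(\<lambda>x. g x * f x) \<in> test_funs S"
proof -
  from assms(1) obtain K where K: "compact K" "K \<subseteq> S" "\<And>x. x \<notin> K \<Longrightarrow> f x = 0" by (rule test_funsE) blast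
  then have "\<forall>x. x \<notin> K \<longrightarrow> f x * g x = 0" by simp
  with K(1,2) show "(\<lambda>x. f x * g x) \<in> test_funs S"
    using smooth_on_mult[OF open_UNIV test_funs_smooth[OF assms(1)] assms(2)] unfolding test_funs_def by blast
  then show "(\<lambda>x. g x * f x) \<in> test_funs S" by (simp add: mult.commute)
qed

lemma test_funs_cmult: "f \<in> test_funs S \<Longrightarrow> (\<lambda>x. c * f x) \<in> test_funs S"
  by (rule test_funs_mult_UNIV(2)) (auto intro: smooth_on_const)

lemma test_funs_sum: "(\<And>i. i \<in> I \<Longrightarrow> f i \<in> test_funs S) \<Longrightarrow> (\<lambda>x. \<Sum>i\<in>I. f i x) \<in> test_funs S"
  by (induction I rule: infinite_finite_induct) (auto simp: test_funs_add)

lemma test_funs_cnj: assumes "f \<in> test_funs S" shows "(\<lambda>x. cnj (f x)) \<in> test_funs S"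
proof -
  from assms obtain K where K: "compact K" "K \<subseteq> S" "\<And>x. x \<notin> K \<Longrightarrow> f x = 0" by (rule test_funsE) blast
  then show ?thesis
    using smooth_on_cnj[OF open_UNIV test_funs_smooth[OF assms]] unfolding test_funs_def by force
qed

lemma test_funs_frechet: assumes "f \<in> test_funs S" shows "(\<lambda>x. frechet_derivative f (at x) v) \<in> test_funs S"
proof -
  from assms obtain K where K: "compact K" "K \<subseteq> S" "\<And>x. x \<notin> K \<Longrightarrow> f x = 0" by (rule test_funsE) blast
  have "frechet_derivative f (at x) v = 0" if "x \<notin> K" for x
  proof -
    have "open (- K)" using K(1) by (simp add: compact_imp_closed open_Compl)
    then have "frechet_derivative f (at x) = frechet_derivative (\<lambda>_. 0) (at x)"
      using that K(3) by (intro frechet_derivative_cong_open[of "- K"]) auto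
    then show ?thesis by (simp add: frechet_derivative_const)
  qed
  with K show ?thesis
    using smooth_on_frechet[OF test_funs_smooth[OF assms]] unfolding test_funs_def by blast
qed

lemma test_funs_bounded: assumes "f \<in> test_funs S" obtains B where "B \<ge> 0" "\<And>x. cmod (f x) \<le> B"
proof -
  from assms obtain K where K: "compact K" "K \<subseteq> S" "\<And>x. x \<notin> K \<Longrightarrow> f x = 0" by (rule test_funsE) blast
  have "continuous_on K f" using smooth_on_continuous[OF test_funs_smooth[OF assms]] continuous_on_subset by blast
  then have "bounded (f ` K)" using K(1) compact_continuous_image compact_imp_bounded by blast
  then obtain B where B: "\<And>x. x \<in> K \<Longrightarrow> cmod (f x) \<le> B" unfolding bounded_iff by blast
  show ?thesis
  proof (rule that[of "max B 0"])
    show "cmod (f x) \<le> max B 0" for x using B K(3) by (cases "x \<in> K") (auto simp: le_max_iff_disj)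
  qed simp
qed

lemma test_funs_integrable: assumes "f \<in> test_funs S" shows "integrable lborel f"
proof -
  from assms obtain K where K: "compact K" "K \<subseteq> S" "\<And>x. x \<notin> K \<Longrightarrow> f x = 0" by (rule test_funsE) blast
  have "continuous_on K f" using smooth_on_continuous[OF test_funs_smooth[OF assms]] continuous_on_subset by blast
  from borel_integrable_compact[OF K(1) this]
  have "integrable lborel (\<lambda>x. indicator K x *\<^sub>R f x)" .
  moreover have "(\<lambda>x. indicator K x *\<^sub>R f x) = f" using K(3) by (auto simp: indicator_def)
  ultimately show ?thesis by simp
qed

lemma test_bump:
  fixes K S :: "'a::euclidean_space set"
  assumes "compact K" "open S" "K \<subseteq> S"
  obtains \<phi> U where "\<phi> \<in> test_funs S" "\<And>x. \<phi> x = of_real (Re (\<phi> x))" "\<And>x. 0 \<le> Re (\<phi> x)" "open U" "K \<subseteq> U" "\<And>x. x \<in> U \<Longrightarrow> \<phi> x = 1"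
proof -
  obtain \<phi> :: "'a \<Rightarrow> real" and U L where "smooth_on UNIV \<phi>" "\<And>x. 0 \<le> \<phi> x" "\<And>x. \<phi> x \<le> 1"
    "open U" "K \<subseteq> U" "\<And>x. x \<in> U \<Longrightarrow> \<phi> x = 1" "compact L" "L \<subseteq> S" "\<And>x. x \<notin> L \<Longrightarrow> \<phi> x = 0"
    using smooth_bump[OF assms] by metis
  then show ?thesis
    by (intro that[of "\<lambda>x. of_real (\<phi> x)" U]) (auto simp: test_funs_def intro!: smooth_on_of_real exI[of _ L])
qed

lemma uniform_limit_sum:
  fixes f :: "'i \<Rightarrow> 'j \<Rightarrow> 'a \<Rightarrow> 'b::real_normed_vector"
  assumes "\<And>i. i \<in> I \<Longrightarrow> uniform_limit X (f i) (l i) F"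
  shows "uniform_limit X (\<lambda>j x. \<Sum>i\<in>I. f i j x) (\<lambda>x. \<Sum>i\<in>I. l i x) F"
  using assms
  by (induction I rule: infinite_finite_induct) (auto intro: uniform_limit_add uniform_limit_const)

definition Cinf_null :: "'e::real_normed_vector set \<Rightarrow> (nat \<Rightarrow> 'e \<Rightarrow> complex) \<Rightarrow> bool" where
  "Cinf_null C f \<longleftrightarrow> (\<forall>vs. uniform_limit C (\<lambda>j. iter_deriv vs (f j)) (\<lambda>_. 0) sequentially)"

text \<open>Stability of null sequences under changes of variables and multiplication, by induction on
  the number of derivatives: the innermost derivative is distributed by the chain rule.\<close>

lemma Cinf_null_mult_compose:
  fixes F :: "'e::euclidean_space \<Rightarrow> 'f::euclidean_space"
  assumes W: "open W" and T: "open T" and F: "smooth_on W F" "F ` W \<subseteq> T"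
    and C: "compact C" "C \<subseteq> W" and g: "\<And>j. smooth_on T (g j)" "Cinf_null (F ` C) g"
    and a: "smooth_on W a"
  shows "Cinf_null C (\<lambda>j x. a x * g j (F x))"
proof -
  have "uniform_limit C (\<lambda>j. iter_deriv vs (\<lambda>x. a x * g j (F x))) (\<lambda>_. 0) sequentially" for vs
    using g a
  proof (induction vs arbitrary: a g rule: rev_induct)
    case Nil
    have "continuous_on C a" using smooth_on_continuous[OF Nil(3)] C continuous_on_subset by blast
    then have "bounded (a ` C)" using C(1) compact_continuous_image compact_imp_bounded by blast
    then obtain A where A: "\<And>x. x \<in> C \<Longrightarrow> cmod (a x) \<le> A" unfolding bounded_iff by blast
    from Nil(2) have lim: "uniform_limit (F ` C) (\<lambda>j. iter_deriv [] (g j)) (\<lambda>_. 0) sequentially"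
      unfolding Cinf_null_def by blast
    show ?case
    proof (rule uniform_limitI)
      fix e :: real assume e: "e > 0"
      have A0: "max A 1 > 0" by simp
      from uniform_limitD[OF lim divide_pos_pos[OF e A0]]
      show "\<forall>\<^sub>F j in sequentially. \<forall>x\<in>C. dist (iter_deriv [] (\<lambda>x. a x * g j (F x)) x) 0 < e"
      proof (rule eventually_mono, intro ballI)
        fix j x assume j: "\<forall>x\<in>F ` C. dist (iter_deriv [] (g j) x) 0 < e / max A 1" and x: "x \<in> C"
        then have "cmod (g j (F x)) < e / max A 1" by auto
        moreover have "cmod (a x) \<le> max A 1" using A[OF x] by simp
        ultimately have "cmod (a x) * cmod (g j (F x)) < max A 1 * (e / max A 1)"
          by (smt (verit) A0 mult_left_mono mult_right_mono mult_strict_left_mono norm_ge_zero)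
        then show "dist (iter_deriv [] (\<lambda>x. a x * g j (F x)) x) 0 < e" using A0 by (simp add: norm_mult)
      qed
    qed
  next
    case (snoc v vs)
    let ?a' = "\<lambda>x. frechet_derivative a (at x) v" and ?F' = "\<lambda>x. frechet_derivative F (at x) v"
    let ?g' = "\<lambda>b j y. frechet_derivative (g j) (at y) b"
    let ?c = "\<lambda>b x. of_real (?F' x \<bullet> b) * a x"
    have gF: "smooth_on W (\<lambda>x. g j (F x))" for j by (rule smooth_on_compose[OF W T F(1) snoc.prems(1) F(2)])
    have g'F: "smooth_on W (\<lambda>x. ?g' b j (F x))" for j b
      by (rule smooth_on_compose[OF W T F(1) smooth_on_frechet[OF snoc.prems(1)] F(2)])
    have sc: "smooth_on W (?c b)" for b
      by (intro smooth_on_mult smooth_on_of_real smooth_on_inner smooth_on_const smooth_on_frechet W F snoc.prems)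
    have der: "frechet_derivative (\<lambda>x. a x * g j (F x)) (at x) v
      = ?a' x * g j (F x) + (\<Sum>b\<in>Basis. ?c b x * ?g' b j (F x))" if "x \<in> W" for x j
      using frechet_derivative_mult_smooth[OF snoc.prems(3) gF that, of j]
        frechet_derivative_compose_smooth[OF F(1) snoc.prems(1) that, of j v] F(2) that
      by (auto simp: sum_distrib_left scaleR_conv_of_real mult_ac image_subset_iff)
    have eq: "iter_deriv (vs @ [v]) (\<lambda>x. a x * g j (F x)) x
      = iter_deriv vs (\<lambda>x. ?a' x * g j (F x)) x + (\<Sum>b\<in>Basis. iter_deriv vs (\<lambda>x. ?c b x * ?g' b j (F x)) x)"
      if "x \<in> C" for x j
    proof -
      have x: "x \<in> W" using that C by blast
      have "iter_deriv (vs @ [v]) (\<lambda>x. a x * g j (F x)) x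
        = iter_deriv vs (\<lambda>x. ?a' x * g j (F x) + (\<Sum>b\<in>Basis. ?c b x * ?g' b j (F x))) x"
        unfolding iter_deriv_snoc by (rule iter_deriv_cong[OF W _ x]) (rule der)
      also have "\<dots> = iter_deriv vs (\<lambda>x. ?a' x * g j (F x)) x + iter_deriv vs (\<lambda>x. \<Sum>b\<in>Basis. ?c b x * ?g' b j (F x)) x"
        by (intro iter_deriv_add[OF W _ _ x] smooth_on_mult smooth_on_sum W gF g'F sc smooth_on_frechet snoc.prems(3))
      also have "iter_deriv vs (\<lambda>x. \<Sum>b\<in>Basis. ?c b x * ?g' b j (F x)) x = (\<Sum>b\<in>Basis. iter_deriv vs (\<lambda>x. ?c b x * ?g' b j (F x)) x)"
        by (intro iter_deriv_sum[OF W _ _ x] smooth_on_mult W g'F sc finite_Basis)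
      finally show ?thesis .
    qed
    have "Cinf_null (F ` C) (?g' b)" for b
      unfolding Cinf_null_def
    proof
      fix us
      show "uniform_limit (F ` C) (\<lambda>j. iter_deriv us (?g' b j)) (\<lambda>_. 0) sequentially"
        using snoc.prems(2) unfolding Cinf_null_def by (subst iter_deriv_snoc[symmetric]) blast
    qed
    then have "uniform_limit C (\<lambda>j. iter_deriv vs (\<lambda>x. ?c b x * ?g' b j (F x))) (\<lambda>_. 0) sequentially" for b
      using snoc.prems(1) by (intro snoc.IH smooth_on_frechet sc)
    moreover have "uniform_limit C (\<lambda>j. iter_deriv vs (\<lambda>x. ?a' x * g j (F x))) (\<lambda>_. 0) sequentially"
      using snoc.prems by (intro snoc.IH smooth_on_frechet)
    ultimately have "uniform_limit C (\<lambda>j x. iter_deriv vs (\<lambda>x. ?a' x * g j (F x)) x + (\<Sum>b\<in>Basis. iter_deriv vs (\<lambda>x. ?c b x * ?g' b j (F x)) x))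
        (\<lambda>x. 0 + (\<Sum>b\<in>(Basis :: 'f set). 0)) sequentially"
      by (intro uniform_limit_add uniform_limit_sum)
    then show ?case
      by (rule uniform_limit_cong'[THEN iffD1, rotated 2]) (use eq in auto)
  qed
  then show ?thesis unfolding Cinf_null_def by blast
qed

definition distribution_on :: "'e::euclidean_space set \<Rightarrow> (('e \<Rightarrow> complex) \<Rightarrow> complex) \<Rightarrow> bool" where
  "distribution_on S v \<longleftrightarrow>
     (\<forall>f\<in>test_funs S. \<forall>g\<in>test_funs S. v (\<lambda>x. f x + g x) = v f + v g) \<and>
     (\<forall>f\<in>test_funs S. \<forall>c. v (\<lambda>x. c * f x) = c * v f) \<and>
     (\<forall>f K. (\<forall>j. f j \<in> test_funs S) \<and> compact K \<and> K \<subseteq> S \<and> (\<forall>j x. x \<notin> K \<longrightarrow> f j x = 0) \<and> Cinf_null UNIV f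
        \<longrightarrow> (\<lambda>j. v (f j)) \<longlonglongrightarrow> 0)"

lemma distribution_on_add: "distribution_on S v \<Longrightarrow> f \<in> test_funs S \<Longrightarrow> g \<in> test_funs S \<Longrightarrow> v (\<lambda>x. f x + g x) = v f + v g"
  and distribution_on_cmult: "distribution_on S v \<Longrightarrow> f \<in> test_funs S \<Longrightarrow> v (\<lambda>x. c * f x) = c * v f"
  and distribution_on_null: "distribution_on S v \<Longrightarrow> (\<And>j. fs j \<in> test_funs S) \<Longrightarrow> compact K \<Longrightarrow> K \<subseteq> S \<Longrightarrow> (\<And>j x. x \<notin> K \<Longrightarrow> fs j x = 0)
     \<Longrightarrow> Cinf_null UNIV fs \<Longrightarrow> (\<lambda>j. v (fs j)) \<longlonglongrightarrow> 0"
  unfolding distribution_on_def by blast+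

lemma distribution_on_zero: "distribution_on S v \<Longrightarrow> v (\<lambda>_. 0) = 0"
  using distribution_on_cmult[of S v "\<lambda>_. 0" 0] by simp

lemma distribution_on_sum:
  assumes "distribution_on S v" "\<And>i. i \<in> I \<Longrightarrow> f i \<in> test_funs S"
  shows "v (\<lambda>x. \<Sum>i\<in>I. f i x) = (\<Sum>i\<in>I. v (f i))"
  using assms(2)
  by (induction I rule: infinite_finite_induct)
     (auto simp: distribution_on_zero[OF assms(1)] distribution_on_add[OF assms(1)] test_funs_sum)

lemma distribution_on_diff:
  assumes "distribution_on S v" "f \<in> test_funs S" "g \<in> test_funs S"
  shows "v (\<lambda>x. f x - g x) = v f - v g"
  using distribution_on_add[OF assms(1,2) test_funs_cmult[OF assms(3), of "-1"]] distribution_on_cmult[OF assms(1,3), of "-1"]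
  by simp

lemma distribution_on_integral: "distribution_on UNIV (\<lambda>f. integral\<^sup>L lborel f)"
  unfolding distribution_on_def
proof (intro conjI allI ballI impI)
  fix f :: "nat \<Rightarrow> 'a \<Rightarrow> complex" and K :: "'a set"
  assume "(\<forall>j. f j \<in> test_funs UNIV) \<and> compact K \<and> K \<subseteq> UNIV \<and> (\<forall>j x. x \<notin> K \<longrightarrow> f j x = 0) \<and> Cinf_null UNIV f"
  then have f: "\<And>j. f j \<in> test_funs UNIV" and K: "compact K" "\<And>j x. x \<notin> K \<Longrightarrow> f j x = 0" and "Cinf_null UNIV f" by auto
  then have "uniform_limit UNIV (\<lambda>j. iter_deriv [] (f j)) (\<lambda>_. 0) sequentially" unfolding Cinf_null_def by blast
  then have lim: "uniform_limit UNIV f (\<lambda>_. 0) sequentially" by simp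
  have fin: "emeasure lborel K < \<infinity>" using K(1) emeasure_bounded_finite[OF compact_imp_bounded] by simp
  have Kb: "K \<in> sets lborel" using K(1) by (simp add: borel_compact)
  show "(\<lambda>j. integral\<^sup>L lborel (f j)) \<longlonglongrightarrow> 0"
  proof (rule LIMSEQ_I)
    fix r :: real assume r: "r > 0"
    define e where "e = r / (measure lborel K + 1)"
    have e: "e > 0" using r by (simp add: e_def add_nonneg_pos)
    from uniform_limitD[OF lim e] obtain n where n: "\<And>j x. j \<ge> n \<Longrightarrow> cmod (f j x) < e"
      by (auto simp: eventually_sequentially)
    have "cmod (integral\<^sup>L lborel (f j)) < r" if "j \<ge> n" for j
    proof -
      have "cmod (integral\<^sup>L lborel (f j)) \<le> (LINT x|lborel. cmod (f j x))" by (rule integral_norm_bound)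
      also have "\<dots> \<le> (LINT x|lborel. e * indicator K x)"
      proof (rule integral_mono)
        show "integrable lborel (\<lambda>x. cmod (f j x))" using test_funs_integrable[OF f] by simp
        show "integrable lborel (\<lambda>x. e * indicator K x)" using fin Kb by simp
        show "cmod (f j x) \<le> e * indicator K x" for x
          using n[OF that, of x] K(2)[of x j] by (auto simp: indicator_def)
      qed
      also have "\<dots> = e * measure lborel K" by simp
      also have "\<dots> < r"
      proof -
        have "r * measure lborel K < r * (measure lborel K + 1)" using r by simp
        then show ?thesis
          by (simp add: e_def pos_divide_less_eq add_nonneg_pos)
      qed
      finally show ?thesis .
    qed
    then show "\<exists>n0. \<forall>n\<ge>n0. norm (integral\<^sup>L lborel (f n) - 0) < r" by auto
  qed
qed (auto simp: test_funs_integrable)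


section \<open>Integration by parts\<close>

lemma integral_translate:
  fixes f :: "'a::euclidean_space \<Rightarrow> complex"
  assumes "f \<in> test_funs UNIV"
  shows "(LINT x|lborel. f (x + a)) = (LINT x|lborel. f x)"
proof -
  have [measurable]: "f \<in> borel_measurable lborel" using test_funs_integrable[OF assms] by (rule borel_measurable_integrable)
  have "(LINT x|lborel. f x) = (LINT x|distr lborel borel ((+) a). f x)" by (simp add: lborel_distr_plus)
  also have "\<dots> = (LINT x|lborel. f (a + x))" by (subst integral_distr) auto
  finally show ?thesis by (simp add: add.commute)
qed

text \<open>The integral of the difference quotient in a direction vanishes by translation invariance.\<close>

lemma integral_derivative_eq_0:
  fixes f :: "'a::euclidean_space \<Rightarrow> complex"
  assumes f: "f \<in> test_funs UNIV"
  shows "(LINT x|lborel. frechet_derivative f (at x) v) = 0"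
proof -
  let ?f' = "\<lambda>x. frechet_derivative f (at x) v"
  from f obtain K where K: "compact K" "\<And>x. x \<notin> K \<Longrightarrow> f x = 0" by (rule test_funsE) blast
  obtain B where B: "B \<ge> 0" "\<And>x. cmod (?f' x) \<le> B" using test_funs_bounded[OF test_funs_frechet[OF f, of v]] by blast
  let ?K = "(\<lambda>(x, s). x - s *\<^sub>R v) ` (K \<times> {0..1::real})"
  let ?t = "\<lambda>n. inverse (real (Suc n))"
  let ?q = "\<lambda>n x. (f (x + ?t n *\<^sub>R v) - f x) /\<^sub>R ?t n"
  have cK: "compact ?K"
    unfolding case_prod_beta by (intro compact_continuous_image compact_Times K(1) continuous_intros) auto
  have t01: "?t n \<in> {0..1}" "?t n > 0" for n by (auto simp: field_simps)
  have line: "((\<lambda>t. f (x + t *\<^sub>R v)) has_vector_derivative ?f' (x + t *\<^sub>R v)) (at t)" for x t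
  proof -
    have "((\<lambda>t. x + t *\<^sub>R v) has_derivative (\<lambda>s. s *\<^sub>R v)) (at t)" by (auto intro!: derivative_eq_intros)
    from has_derivative_compose[OF this smooth_on_has_derivative[OF test_funs_smooth[OF f] UNIV_I]]
    show ?thesis
      using linear_frechet_derivative_smooth[OF test_funs_smooth[OF f] UNIV_I]
      by (simp add: has_vector_derivative_def linear_cmul)
  qed
  have mvt: "cmod (f (x + t *\<^sub>R v) - f x) \<le> B * t" if "t \<in> {0..1}" for x t
  proof -
    have "cmod (f (x + t *\<^sub>R v) - f (x + 0 *\<^sub>R v)) \<le> B * norm (t - 0)"
    proof (rule differentiable_bound[of "{0..1}" "\<lambda>t. f (x + t *\<^sub>R v)" "\<lambda>t s. s *\<^sub>R ?f' (x + t *\<^sub>R v)"])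
      show "((\<lambda>t. f (x + t *\<^sub>R v)) has_derivative (\<lambda>s. s *\<^sub>R ?f' (x + t *\<^sub>R v))) (at t within {0..1})" for t
        using line[of x t] unfolding has_vector_derivative_def by (rule has_derivative_at_withinI)
      show "onorm (\<lambda>s. s *\<^sub>R ?f' (x + t *\<^sub>R v)) \<le> B" for t
        using B by (intro onorm_bound) (auto simp: mult.commute[of B] intro!: mult_left_mono)
    qed (use that in auto)
    then show ?thesis using that by simp
  qed
  have fi: "(\<lambda>x. f (x + a)) \<in> borel_measurable lborel" for a
  proof -
    have "continuous_on UNIV f" using smooth_on_continuous[OF test_funs_smooth[OF f]] .
    then have "continuous_on UNIV (\<lambda>x. f (x + a))" by (rule continuous_on_compose2) (auto intro!: continuous_intros)
    then show ?thesis by (simp add: borel_measurable_continuous_onI)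
  qed
  have "(\<lambda>n. LINT x|lborel. ?q n x) \<longlonglongrightarrow> (LINT x|lborel. ?f' x)"
  proof (rule integral_dominated_convergence[where w = "\<lambda>x. B * indicator (K \<union> ?K) x"])
    show "?f' \<in> borel_measurable lborel" using test_funs_integrable[OF test_funs_frechet[OF f]] by (rule borel_measurable_integrable)
    show "?q n \<in> borel_measurable lborel" for n
      using fi[of "?t n *\<^sub>R v"] fi[of 0] by (intro borel_measurable_scaleR borel_measurable_diff borel_measurable_const) auto
    have "compact (K \<union> ?K)" using K cK by auto
    then show "integrable lborel (\<lambda>x. B * indicator (K \<union> ?K) x)"
      using emeasure_compact_finite[OF \<open>compact (K \<union> ?K)\<close>] borel_compact[OF \<open>compact (K \<union> ?K)\<close>]
      by (intro integrable_mult_right integrable_real_indicator) simp_all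
    show "AE x in lborel. norm (?q n x) \<le> B * indicator (K \<union> ?K) x" for n
    proof (rule AE_I2)
      fix x
      show "norm (?q n x) \<le> B * indicator (K \<union> ?K) x"
      proof (cases "x \<in> K \<union> ?K")
        case True
        have "norm (?q n x) = cmod (f (x + ?t n *\<^sub>R v) - f x) / ?t n" using t01(2)[of n] by (simp add: divide_inverse mult.commute)
        also have "\<dots> \<le> B" using mvt[OF t01(1)[of n], of x] t01(2)[of n] by (simp add: pos_divide_le_eq)
        finally show ?thesis using True by simp
      next
        case False
        have "x + ?t n *\<^sub>R v \<notin> K"
        proof
          assume "x + ?t n *\<^sub>R v \<in> K"
          then have "(\<lambda>(x, s). x - s *\<^sub>R v) (x + ?t n *\<^sub>R v, ?t n) \<in> ?K" using t01(1)[of n] by (intro imageI) auto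
          then show False using False by simp
        qed
        then show ?thesis using False K(2) by simp
      qed
    qed
    show "AE x in lborel. (\<lambda>n. ?q n x) \<longlonglongrightarrow> ?f' x"
    proof (rule AE_I2)
      fix x
      have "((\<lambda>t. f (x + t *\<^sub>R v)) has_vector_derivative ?f' x) (at 0)" using line[of x 0] by simp
      then have "((\<lambda>t. (f (x + t *\<^sub>R v) - f x) /\<^sub>R t) \<longlongrightarrow> ?f' x) (at 0)"
      proof -
        have "((\<lambda>t. f (x + t *\<^sub>R v)) has_derivative (\<lambda>t. t *\<^sub>R ?f' x)) (at 0)"
          using line[of x 0] by (simp add: has_vector_derivative_def)
        then have "((\<lambda>t. norm (f (x + t *\<^sub>R v) - f x - t *\<^sub>R ?f' x) / norm t) \<longlongrightarrow> 0) (at 0)"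
          by (simp add: has_derivative_at)
        then have "((\<lambda>t. norm ((f (x + t *\<^sub>R v) - f x) /\<^sub>R t - ?f' x)) \<longlongrightarrow> 0) (at 0)"
        proof (rule Lim_transform_eventually)
          have "norm (f (x + t *\<^sub>R v) - f x - t *\<^sub>R ?f' x) / norm t = norm ((f (x + t *\<^sub>R v) - f x) /\<^sub>R t - ?f' x)" if "t \<noteq> 0" for t
          proof -
            have "(f (x + t *\<^sub>R v) - f x) /\<^sub>R t - ?f' x = (f (x + t *\<^sub>R v) - f x - t *\<^sub>R ?f' x) /\<^sub>R t"
              using that by (simp add: scaleR_diff_right)
            then show ?thesis by (simp add: divide_inverse mult.commute)
          qed
          then show "\<forall>\<^sub>F t in at 0. norm (f (x + t *\<^sub>R v) - f x - t *\<^sub>R ?f' x) / norm t = norm ((f (x + t *\<^sub>R v) - f x) /\<^sub>R t - ?f' x)"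
            by (simp add: eventually_at_filter)
        qed
        then show ?thesis using LIM_zero_cancel tendsto_norm_zero_iff by blast
      qed
      moreover have "filterlim ?t (at 0) sequentially"
        by (intro filterlim_atI LIMSEQ_inverse_real_of_nat) (auto intro!: always_eventually)
      ultimately show "(\<lambda>n. ?q n x) \<longlonglongrightarrow> ?f' x" by (rule filterlim_compose)
    qed
  qed
  moreover have "(LINT x|lborel. ?q n x) = 0" for n
  proof -
    have i1: "integrable lborel (\<lambda>x. f (x + a))" for a
    proof -
      have "integrable (distr lborel borel ((+) a)) f" using test_funs_integrable[OF f] by (simp add: lborel_distr_plus)
      then have "integrable lborel (\<lambda>x. f (a + x))"
        using smooth_on_continuous[OF test_funs_smooth[OF f]]
        by (subst (asm) integrable_distr_eq) (auto simp: borel_measurable_continuous_onI)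
      then show ?thesis by (simp add: add.commute)
    qed
    show ?thesis using integral_translate[OF f, of "?t n *\<^sub>R v"] i1[of "?t n *\<^sub>R v"] i1[of 0] by simp
  qed
  ultimately have "(\<lambda>n::nat. 0) \<longlonglongrightarrow> (LINT x|lborel. ?f' x)" by (simp only:)
  then show ?thesis by (simp add: LIMSEQ_const_iff)
qed

lemma integration_by_parts:
  fixes f g :: "'a::euclidean_space \<Rightarrow> complex"
  assumes S: "open S" and f: "f \<in> test_funs S" and g: "smooth_on S g"
  shows "(LINT x|lborel. frechet_derivative f (at x) v * g x) = - (LINT x|lborel. f x * frechet_derivative g (at x) v)"
proof -
  have fg: "(\<lambda>x. f x * g x) \<in> test_funs S" by (rule test_funs_mult[OF S f g])
  have "frechet_derivative (\<lambda>x. f x * g x) (at x) v = frechet_derivative f (at x) v * g x + f x * frechet_derivative g (at x) v" for x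
  proof (cases "x \<in> S")
    case True
    then show ?thesis
      using frechet_derivative_mult_smooth[OF smooth_on_subset[OF test_funs_smooth[OF f] subset_UNIV] g True] by (simp add: add.commute)
  next
    case False
    then show ?thesis
      using test_funs_outside[OF test_funs_frechet[OF f, of v] False] test_funs_outside[OF test_funs_frechet[OF fg, of v] False]
        test_funs_outside[OF f False] by simp
  qed
  moreover have "(LINT x|lborel. frechet_derivative (\<lambda>x. f x * g x) (at x) v) = 0"
    by (rule integral_derivative_eq_0[OF test_funs_mono[OF fg subset_UNIV]])
  moreover have "integrable lborel (\<lambda>x. frechet_derivative f (at x) v * g x)"
    by (rule test_funs_integrable[OF test_funs_mult[OF S test_funs_frechet[OF f] g]])
  moreover have "integrable lborel (\<lambda>x. f x * frechet_derivative g (at x) v)"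
    by (rule test_funs_integrable[OF test_funs_mult[OF S f smooth_on_frechet[OF g]]])
  ultimately show ?thesis by (simp add: add_eq_0_iff)
qed

text \<open>The set where \<open>f\<close> is positive is open and of measure zero.\<close>

lemma integral_eq_0_continuous_nonneg:
  fixes f :: "'a::euclidean_space \<Rightarrow> real"
  assumes "integrable lborel f" "continuous_on UNIV f" "\<And>x. f x \<ge> 0" "(LINT x|lborel. f x) = 0"
  shows "f x = 0"
proof (rule ccontr)
  assume "f x \<noteq> 0"
  have "AE x in lborel. f x = 0"
    using integral_nonneg_eq_0_iff_AE[OF assms(1)] assms(3,4) by auto
  then have *: "emeasure lborel {x. f x \<noteq> 0} = 0"
    using assms(1) by (subst (asm) AE_iff_measurable[OF _ refl]) auto
  have "open {x. f x \<noteq> 0}" using assms(2) by (intro open_Collect_neq continuous_on_const)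
  with \<open>f x \<noteq> 0\<close> obtain e where e: "e > 0" "ball x e \<subseteq> {x. f x \<noteq> 0}" by (auto simp: open_contains_ball)
  have "emeasure lborel (ball x e) \<le> emeasure lborel {x. f x \<noteq> 0}"
    using e(2) \<open>open {x. f x \<noteq> 0}\<close> by (intro emeasure_mono) auto
  then show False using * content_ball_pos[OF e(1), of x] by (simp add: measure_def)
qed

text \<open>The fundamental lemma of the calculus of variations: a bump function times the conjugate of \<open>h\<close> is a
  test function, so the integral of the bump function times \<open>\<bar>h\<bar>\<^sup>2\<close> is \<open>0\<close>.\<close>

lemma fundamental_lemma:
  assumes S: "open S" and h: "smooth_on S h" and eq: "\<And>f. f \<in> test_funs S \<Longrightarrow> (LINT x|lborel. f x * h x) = 0" and x: "x \<in> S"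
  shows "h x = 0"
proof -
  obtain \<phi> U where \<phi>: "\<phi> \<in> test_funs S" "\<And>x. \<phi> x = of_real (Re (\<phi> x))" "\<And>x. 0 \<le> Re (\<phi> x)" "open U" "{x} \<subseteq> U" "\<And>x. x \<in> U \<Longrightarrow> \<phi> x = 1"
    using test_bump[of "{x}" S] S x by auto
  let ?f = "\<lambda>x. \<phi> x * cnj (h x)" and ?g = "\<lambda>x. Re (\<phi> x) * (cmod (h x))\<^sup>2"
  have f: "?f \<in> test_funs S" by (rule test_funs_mult[OF S \<phi>(1) smooth_on_cnj[OF S h]])
  have fh: "(\<lambda>x. ?f x * h x) \<in> test_funs S" by (rule test_funs_mult[OF S f h])
  have g: "?f x * h x = of_real (?g x)" for x
    by (subst \<phi>(2)) (simp add: complex_norm_square[symmetric] mult_ac del: of_real_power)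
  have g': "?g = (\<lambda>x. Re (?f x * h x))" unfolding g by simp
  have "?g x = 0"
  proof (rule integral_eq_0_continuous_nonneg[of ?g])
    show "integrable lborel ?g" unfolding g' by (intro integrable_Re test_funs_integrable[OF fh])
    show "continuous_on UNIV ?g" unfolding g' by (intro continuous_intros smooth_on_continuous test_funs_smooth[OF fh])
    show "?g x \<ge> 0" for x using \<phi>(3) by simp
    have "(LINT x|lborel. ?g x) = Re (LINT x|lborel. ?f x * h x)"
      unfolding g' using test_funs_integrable[OF fh] by (rule integral_Re)
    then show "(LINT x|lborel. ?g x) = 0" using eq[OF f] by simp
  qed
  then show ?thesis using \<phi>(5,6) by simp
qed


section \<open>Plane waves and Fourier coefficients\<close>

definition wave :: "'e::euclidean_space \<Rightarrow> 'e \<Rightarrow> complex" where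
  "wave \<kappa> x = exp (\<i> * of_real (\<kappa> \<bullet> x))"

lemma norm_wave [simp]: "cmod (wave \<kappa> x) = 1"
  by (simp add: wave_def)

lemma wave_0 [simp]: "wave 0 x = 1" "wave \<kappa> 0 = 1"
  by (simp_all add: wave_def)

lemma wave_add: "wave (\<kappa> + \<mu>) x = wave \<kappa> x * wave \<mu> x" "wave \<kappa> (x + y) = wave \<kappa> x * wave \<kappa> y"
  by (simp_all add: wave_def exp_add[symmetric] algebra_simps)

lemma wave_minus: "wave (- \<kappa>) x = cnj (wave \<kappa> x)"
  by (simp add: wave_def exp_cnj)

lemma smooth_on_wave: "open S \<Longrightarrow> smooth_on S (wave \<kappa>)"
  unfolding wave_def[abs_def]
  by (intro smooth_on_exp smooth_on_mult smooth_on_of_real smooth_on_inner smooth_on_const smooth_on_id)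

lemma wave_has_derivative: "(wave \<kappa> has_derivative (\<lambda>v. \<i> * of_real (\<kappa> \<bullet> v) * wave \<kappa> x)) (at x)"
proof -
  have 1: "((\<lambda>x. \<i> * of_real (\<kappa> \<bullet> x)) has_derivative (\<lambda>v. \<i> * of_real (\<kappa> \<bullet> v))) (at x)"
    by (intro bounded_linear_imp_has_derivative bounded_linear_const_mult bounded_linear_of_real[THEN bounded_linear_compose] bounded_linear_inner_right)
  have "(exp has_derivative (*) (exp (\<i> * of_real (\<kappa> \<bullet> x)))) (at (\<i> * of_real (\<kappa> \<bullet> x)))"
    using DERIV_exp[of "\<i> * of_real (\<kappa> \<bullet> x)"] by (simp add: has_field_derivative_def)
  from has_derivative_compose[OF 1 this] show ?thesis unfolding wave_def[abs_def] by (simp add: mult.commute)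
qed

lemma frechet_derivative_wave: "frechet_derivative (wave \<kappa>) (at x) v = \<i> * of_real (\<kappa> \<bullet> v) * wave \<kappa> x"
  by (simp add: frechet_derivative_eqI[OF wave_has_derivative])

lemma test_funs_wave: "\<rho> \<in> test_funs S \<Longrightarrow> (\<lambda>x. \<rho> x * wave \<kappa> x) \<in> test_funs S"
  by (intro test_funs_mult_UNIV smooth_on_wave open_UNIV)

definition fourier :: "('e::euclidean_space \<Rightarrow> complex) \<Rightarrow> 'e \<Rightarrow> complex" where
  "fourier f \<kappa> = (LINT x|lborel. f x * wave (- \<kappa>) x)"

lemma fourier_integrable: "f \<in> test_funs S \<Longrightarrow> integrable lborel (\<lambda>x. f x * wave \<kappa> x)"
  by (rule test_funs_integrable[OF test_funs_wave])

lemma fourier_add: "f \<in> test_funs S \<Longrightarrow> g \<in> test_funs S \<Longrightarrow> fourier (\<lambda>x. f x + g x) \<kappa> = fourier f \<kappa> + fourier g \<kappa>"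
  unfolding fourier_def by (simp add: distrib_right fourier_integrable)

lemma fourier_cmult: "fourier (\<lambda>x. c * f x) \<kappa> = c * fourier f \<kappa>"
  unfolding fourier_def by (simp add: mult.assoc)

lemma fourier_sum: "(\<And>i. i \<in> I \<Longrightarrow> f i \<in> test_funs S) \<Longrightarrow> fourier (\<lambda>x. \<Sum>i\<in>I. f i x) \<kappa> = (\<Sum>i\<in>I. fourier (f i) \<kappa>)"
  unfolding fourier_def sum_distrib_right
  by (rule Bochner_Integration.integral_sum) (rule fourier_integrable)

lemma fourier_wave: "fourier (\<lambda>x. wave \<mu> x * f x) \<kappa> = fourier f (\<kappa> - \<mu>)"
  unfolding fourier_def using wave_add(1)[of "\<mu>" "- \<kappa>"] by (simp add: algebra_simps)

lemma fourier_frechet: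
  assumes "f \<in> test_funs UNIV"
  shows "fourier (\<lambda>x. frechet_derivative f (at x) v) \<kappa> = \<i> * of_real (\<kappa> \<bullet> v) * fourier f \<kappa>"
proof -
  have "fourier (\<lambda>x. frechet_derivative f (at x) v) \<kappa> = - (LINT x|lborel. f x * frechet_derivative (wave (- \<kappa>)) (at x) v)"
    unfolding fourier_def by (rule integration_by_parts[OF open_UNIV assms smooth_on_wave[OF open_UNIV]])
  also have "\<dots> = - (LINT x|lborel. (- (\<i> * of_real (\<kappa> \<bullet> v))) * (f x * wave (- \<kappa>) x))"
    by (simp add: frechet_derivative_wave mult_ac)
  finally show ?thesis by (simp add: fourier_def)
qed

lemma norm_le_1_sum_Basis: "1 + norm x \<le> 1 + (\<Sum>b\<in>Basis. \<bar>x \<bullet> b\<bar>)"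
  by (simp add: norm_le_l1)

text \<open>Each derivative of \<open>f\<close> contributes a factor that is linear in the frequency.\<close>

lemma fourier_decay:
  assumes "f \<in> test_funs UNIV"
  shows "\<exists>B. \<forall>\<kappa>. cmod (fourier f \<kappa>) * (1 + norm \<kappa>) ^ p \<le> B"
  using assms
proof (induction p arbitrary: f)
  case 0
  have "cmod (fourier f \<kappa>) \<le> (LINT x|lborel. cmod (f x))" for \<kappa>
    unfolding fourier_def
    by (rule order_trans[OF integral_norm_bound]) (simp add: norm_mult)
  then show ?case by auto
next
  case (Suc p)
  let ?f' = "\<lambda>b x. frechet_derivative f (at x) b"
  have "\<exists>B. \<forall>\<kappa>. cmod (fourier (?f' b) \<kappa>) * (1 + norm \<kappa>) ^ p \<le> B" for b
    by (rule Suc.IH) (rule test_funs_frechet[OF Suc.prems])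
  then obtain B where B: "\<And>b \<kappa>. cmod (fourier (?f' b) \<kappa>) * (1 + norm \<kappa>) ^ p \<le> B b" by metis
  obtain B0 where B0: "\<And>\<kappa>. cmod (fourier f \<kappa>) * (1 + norm \<kappa>) ^ p \<le> B0" using Suc by blast
  have "cmod (fourier f \<kappa>) * (1 + norm \<kappa>) ^ Suc p \<le> B0 + (\<Sum>b\<in>Basis. B b)" for \<kappa>
  proof -
    have "cmod (fourier f \<kappa>) * (1 + norm \<kappa>) ^ Suc p = cmod (fourier f \<kappa>) * (1 + norm \<kappa>) ^ p * (1 + norm \<kappa>)" by simp
    also have "\<dots> \<le> cmod (fourier f \<kappa>) * (1 + norm \<kappa>) ^ p * (1 + (\<Sum>b\<in>Basis. \<bar>\<kappa> \<bullet> b\<bar>))"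
      by (intro mult_left_mono norm_le_1_sum_Basis) auto
    also have "\<dots> = cmod (fourier f \<kappa>) * (1 + norm \<kappa>) ^ p + (\<Sum>b\<in>Basis. cmod (fourier (?f' b) \<kappa>) * (1 + norm \<kappa>) ^ p)"
      by (simp add: fourier_frechet[OF Suc.prems] norm_mult algebra_simps sum_distrib_left sum_distrib_right)
    also have "\<dots> \<le> B0 + (\<Sum>b\<in>Basis. B b)" by (intro add_mono B0 sum_mono B)
    finally show ?thesis .
  qed
  then show ?case by blast
qed

text \<open>Each derivative falls on the wave, contributing at most the norm of the frequency, or on \<open>\<rho>\<close>.\<close>

lemma iter_deriv_wave_bound:
  assumes "\<rho> \<in> test_funs UNIV"
  shows "\<exists>B. \<forall>\<eta> x. cmod (iter_deriv vs (\<lambda>x. \<rho> x * wave \<eta> x) x) \<le> B * (1 + norm \<eta>) ^ length vs"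
  using assms
proof (induction vs arbitrary: \<rho> rule: rev_induct)
  case Nil
  then obtain B where "\<And>x. cmod (\<rho> x) \<le> B" by (rule test_funs_bounded) blast
  then show ?case by (intro exI[of _ B]) (simp add: norm_mult)
next
  case (snoc v vs)
  let ?\<rho>' = "\<lambda>x. frechet_derivative \<rho> (at x) v"
  obtain B1 where B1: "\<And>\<eta> x. cmod (iter_deriv vs (\<lambda>x. ?\<rho>' x * wave \<eta> x) x) \<le> B1 * (1 + norm \<eta>) ^ length vs"
    using snoc.IH[OF test_funs_frechet[OF snoc.prems]] by blast
  obtain B2 where B2: "\<And>\<eta> x. cmod (iter_deriv vs (\<lambda>x. \<rho> x * wave \<eta> x) x) \<le> B2 * (1 + norm \<eta>) ^ length vs"
    using snoc.IH[OF snoc.prems] by blast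
  have B0: "0 \<le> B1" "0 \<le> B2" using order_trans[OF norm_ge_zero B1[of 0 0]] order_trans[OF norm_ge_zero B2[of 0 0]] by auto
  have "cmod (iter_deriv (vs @ [v]) (\<lambda>x. \<rho> x * wave \<eta> x) x) \<le> (B1 + norm v * B2) * (1 + norm \<eta>) ^ length (vs @ [v])" for \<eta> x
  proof -
    let ?c = "\<i> * of_real (\<eta> \<bullet> v)"
    have "(\<lambda>x. frechet_derivative (\<lambda>x. \<rho> x * wave \<eta> x) (at x) v) = (\<lambda>x. ?\<rho>' x * wave \<eta> x + ?c * (\<rho> x * wave \<eta> x))"
      by (simp add: frechet_derivative_mult_smooth[OF test_funs_smooth[OF snoc.prems] smooth_on_wave[OF open_UNIV]] frechet_derivative_wave mult_ac add.commute)
    then have "iter_deriv (vs @ [v]) (\<lambda>x. \<rho> x * wave \<eta> x) x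
      = iter_deriv vs (\<lambda>x. ?\<rho>' x * wave \<eta> x + ?c * (\<rho> x * wave \<eta> x)) x"
      by (simp add: iter_deriv_snoc)
    also have "\<dots> = iter_deriv vs (\<lambda>x. ?\<rho>' x * wave \<eta> x) x + iter_deriv vs (\<lambda>x. ?c * (\<rho> x * wave \<eta> x)) x"
      by (intro iter_deriv_add[OF open_UNIV _ _ UNIV_I] smooth_on_mult smooth_on_const smooth_on_wave open_UNIV
          smooth_on_frechet test_funs_smooth[OF snoc.prems])
    also have "iter_deriv vs (\<lambda>x. ?c * (\<rho> x * wave \<eta> x)) x = ?c * iter_deriv vs (\<lambda>x. \<rho> x * wave \<eta> x) x"
      by (intro iter_deriv_cmult[OF open_UNIV _ UNIV_I] test_funs_smooth[OF test_funs_wave[OF snoc.prems]])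
    finally have "cmod (iter_deriv (vs @ [v]) (\<lambda>x. \<rho> x * wave \<eta> x) x)
      \<le> cmod (iter_deriv vs (\<lambda>x. ?\<rho>' x * wave \<eta> x) x) + \<bar>\<eta> \<bullet> v\<bar> * cmod (iter_deriv vs (\<lambda>x. \<rho> x * wave \<eta> x) x)"
      using norm_triangle_ineq[of "iter_deriv vs (\<lambda>x. ?\<rho>' x * wave \<eta> x) x" "?c * iter_deriv vs (\<lambda>x. \<rho> x * wave \<eta> x) x"] by (simp add: norm_mult)
    also have "\<dots> \<le> B1 * (1 + norm \<eta>) ^ length vs + norm \<eta> * norm v * (B2 * (1 + norm \<eta>) ^ length vs)"
      by (intro add_mono B1 mult_mono B2 Cauchy_Schwarz_ineq2) auto
    also have "\<dots> \<le> B1 * (1 + norm \<eta>) ^ length vs * (1 + norm \<eta>) + (1 + norm \<eta>) * norm v * (B2 * (1 + norm \<eta>) ^ length vs)"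
    proof (intro add_mono)
      show "B1 * (1 + norm \<eta>) ^ length vs \<le> B1 * (1 + norm \<eta>) ^ length vs * (1 + norm \<eta>)"
        using mult_left_mono[of 1 "1 + norm \<eta>" "B1 * (1 + norm \<eta>) ^ length vs"] B0 by simp
      show "norm \<eta> * norm v * (B2 * (1 + norm \<eta>) ^ length vs) \<le> (1 + norm \<eta>) * norm v * (B2 * (1 + norm \<eta>) ^ length vs)"
        using B0 by (intro mult_right_mono) auto
    qed
    also have "\<dots> = (B1 + norm v * B2) * (1 + norm \<eta>) ^ length (vs @ [v])"
      by (simp add: algebra_simps)
    finally show ?thesis .
  qed
  then show ?case by blast
qed

text \<open>Otherwise there are frequencies \<open>\<eta> j\<close> for which the value exceeds \<open>(j + 1) * (1 + norm (\<eta> j)) ^ (j + 1)\<close>.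
  Divided by these bounds, the modulated functions tend to zero with all derivatives, while the values
  of \<open>v\<close> on them exceed \<open>1\<close>.\<close>

lemma distribution_wave_growth:
  assumes v: "distribution_on S v" and \<rho>: "\<rho> \<in> test_funs S"
  shows "\<exists>M B. \<forall>\<eta>. cmod (v (\<lambda>x. \<rho> x * wave \<eta> x)) \<le> B * (1 + norm \<eta>) ^ M"
proof (rule ccontr)
  assume "\<not> ?thesis"
  then have "\<exists>\<eta>. cmod (v (\<lambda>x. \<rho> x * wave \<eta> x)) > real (Suc j) * (1 + norm \<eta>) ^ Suc j" for j
    by (metis not_le)
  then obtain \<eta> where \<eta>: "\<And>j. cmod (v (\<lambda>x. \<rho> x * wave (\<eta> j) x)) > real (Suc j) * (1 + norm (\<eta> j)) ^ Suc j" by metis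
  let ?w = "\<lambda>j. real (Suc j) * (1 + norm (\<eta> j)) ^ Suc j"
  have w: "?w j > 0" for j by (intro mult_pos_pos zero_less_power) (auto simp: add_pos_nonneg)
  let ?g = "\<lambda>j x. of_real (inverse (?w j)) * (\<rho> x * wave (\<eta> j) x)"
  from \<rho> obtain K where K: "compact K" "K \<subseteq> S" "\<And>x. x \<notin> K \<Longrightarrow> \<rho> x = 0" by (rule test_funsE) blast
  have \<rho>U: "\<rho> \<in> test_funs UNIV" by (rule test_funs_mono[OF \<rho> subset_UNIV])
  have "Cinf_null UNIV ?g"
    unfolding Cinf_null_def
  proof
    fix vs :: "'a list"
    obtain B where B: "\<And>\<eta> x. cmod (iter_deriv vs (\<lambda>x. \<rho> x * wave \<eta> x) x) \<le> B * (1 + norm \<eta>) ^ length vs"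
      using iter_deriv_wave_bound[OF \<rho>U] by blast
    have B0: "0 \<le> B" using order_trans[OF norm_ge_zero B[of 0 0]] by auto
    have bound: "cmod (iter_deriv vs (?g j) x) \<le> B * inverse (real (Suc j))" if "j \<ge> length vs" for j x
    proof -
      have "cmod (iter_deriv vs (?g j) x) = inverse (?w j) * cmod (iter_deriv vs (\<lambda>x. \<rho> x * wave (\<eta> j) x) x)"
        unfolding iter_deriv_cmult[OF open_UNIV test_funs_smooth[OF test_funs_wave[OF \<rho>]] UNIV_I]
        by (simp only: norm_mult norm_of_real abs_of_pos[OF positive_imp_inverse_positive[OF w[of j]]])
      also have "\<dots> \<le> inverse (?w j) * (B * (1 + norm (\<eta> j)) ^ length vs)"
        using w[of j] by (intro mult_left_mono B) (auto simp del: of_nat_Suc power_Suc)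
      also have "\<dots> \<le> inverse (?w j) * (B * (1 + norm (\<eta> j)) ^ Suc j)"
        using w[of j] B0 that by (intro mult_left_mono power_increasing) (auto simp del: of_nat_Suc power_Suc)
      also have "\<dots> = B * inverse (real (Suc j))"
      proof -
        have "(1 + norm (\<eta> j)) ^ Suc j \<noteq> 0" by (smt (verit) norm_ge_zero power_not_zero)
        then show ?thesis by (simp add: field_simps del: of_nat_Suc power_Suc)
      qed
      finally show ?thesis .
    qed
    have lim0: "(\<lambda>j. B * inverse (real (Suc j))) \<longlonglongrightarrow> 0"
      using tendsto_mult_right_zero[OF LIMSEQ_inverse_real_of_nat] .
    show "uniform_limit UNIV (\<lambda>j. iter_deriv vs (?g j)) (\<lambda>_. 0) sequentially"
    proof (rule uniform_limitI)
      fix e :: real assume "e > 0"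
      with lim0 have "\<forall>\<^sub>F j in sequentially. B * inverse (real (Suc j)) < e" by (rule order_tendstoD)
      moreover have "\<forall>\<^sub>F j in sequentially. j \<ge> length vs" by (rule eventually_ge_at_top)
      ultimately show "\<forall>\<^sub>F j in sequentially. \<forall>x\<in>UNIV. dist (iter_deriv vs (?g j) x) 0 < e"
        by eventually_elim (use bound in \<open>auto intro: le_less_trans\<close>)
    qed
  qed
  moreover have "?g j \<in> test_funs S" for j by (intro test_funs_cmult test_funs_wave \<rho>)
  moreover have "?g j x = 0" if "x \<notin> K" for j x using K(3)[OF that] by simp
  ultimately have "(\<lambda>j. v (?g j)) \<longlonglongrightarrow> 0" by (intro distribution_on_null[OF v _ K(1,2)])
  then have "\<forall>\<^sub>F j in sequentially. cmod (v (?g j)) < 1" by (auto dest: tendstoD[of _ _ _ 1])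
  then obtain j where j: "cmod (v (?g j)) < 1" by (auto simp: eventually_sequentially)
  have "v (?g j) = of_real (inverse (?w j)) * v (\<lambda>x. \<rho> x * wave (\<eta> j) x)"
    by (rule distribution_on_cmult[OF v test_funs_wave[OF \<rho>]])
  then have "cmod (v (?g j)) = inverse (?w j) * cmod (v (\<lambda>x. \<rho> x * wave (\<eta> j) x))"
    using w[of j] by (simp only: norm_mult norm_of_real abs_of_pos positive_imp_inverse_positive)
  also have "\<dots> > inverse (?w j) * ?w j"
    by (rule mult_strict_left_mono[OF \<eta>[of j] positive_imp_inverse_positive[OF w[of j]]])
  finally have "inverse (?w j) * ?w j < cmod (v (?g j))" .
  moreover have "inverse (?w j) * ?w j = 1" using w[of j] by (intro left_inverse) (metis less_irrefl)
  ultimately show False using j by linarith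
qed


section \<open>Trigonometric series\<close>

text \<open>Frequencies of \<open>2R\<close>-periodic waves.\<close>

definition lattice_freq :: "real \<Rightarrow> ('m::finite \<Rightarrow> int) \<Rightarrow> real^'m" where
  "lattice_freq R k = (\<chi> i. pi / R * of_int (k i))"

text \<open>The subtracted term makes the bound inductive: it dominates the tail of the series by telescoping.\<close>

lemma sum_inverse_1_plus_square_le: "(\<Sum>j\<in>{- int n..int n}. 1 / (1 + (of_int j)\<^sup>2 :: real)) \<le> 5 - 4 / (real n + 1)"
proof (induction n)
  case (Suc n)
  have "{- int (Suc n)..int (Suc n)} = insert (- int (Suc n)) (insert (int (Suc n)) {- int n..int n})" by auto
  then have "(\<Sum>j\<in>{- int (Suc n)..int (Suc n)}. 1 / (1 + (of_int j)\<^sup>2 :: real))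
     = 2 / (1 + (real n + 1)\<^sup>2) + (\<Sum>j\<in>{- int n..int n}. 1 / (1 + (of_int j)\<^sup>2))"
    by (simp add: algebra_simps power2_eq_square)
  also have "\<dots> \<le> 2 / (1 + (real n + 1)\<^sup>2) + (5 - 4 / (real n + 1))" using Suc by simp
  also have "\<dots> \<le> 5 - 4 / (real (Suc n) + 1)"
  proof -
    define a where "a = real n + 1"
    have a: "a \<ge> 1" by (simp add: a_def)
    have "2 / (1 + a\<^sup>2) \<le> 4 / (a * (a + 1))"
    proof -
      have "2 * (a * (a + 1)) \<le> 4 * (1 + a\<^sup>2)" using zero_le_power2[of "a - 1"] a by (simp add: power2_eq_square algebra_simps)
      then show ?thesis using a by (simp add: frac_le_eq divide_le_eq pos_le_divide_eq add_pos_nonneg field_simps)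
    qed
    also have "4 / (a * (a + 1)) = 4 / a - 4 / (a + 1)" using a by (simp add: field_simps)
    finally show ?thesis by (simp add: a_def add.commute)
  qed
  finally show ?case .
qed simp

lemma finite_int_box: "finite {k :: 'm::finite \<Rightarrow> int. \<forall>i. \<bar>k i\<bar> \<le> int n}"
proof -
  have "{k :: 'm \<Rightarrow> int. \<forall>i. \<bar>k i\<bar> \<le> int n} = PiE UNIV (\<lambda>_. {- int n..int n})"
    by (auto simp: PiE_def Pi_def extensional_def abs_le_iff) (smt (verit))+
  then show ?thesis by (simp add: finite_PiE)
qed

lemma filterlim_int_boxes:
  "filterlim (\<lambda>n. {k :: 'm::finite \<Rightarrow> int. \<forall>i. \<bar>k i\<bar> \<le> int n}) (finite_subsets_at_top UNIV) sequentially"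
proof -
  let ?B = "\<lambda>n. {k :: 'm \<Rightarrow> int. \<forall>i. \<bar>k i\<bar> \<le> int n}"
  have fin: "finite (?B n)" for n by (rule finite_int_box)
  show ?thesis
    unfolding filterlim_finite_subsets_at_top
  proof (intro allI impI)
    fix X :: "('m \<Rightarrow> int) set" assume "finite X \<and> X \<subseteq> UNIV"
    then have X: "finite X" by simp
    let ?N = "Max (insert 0 ((\<lambda>(k, i). nat \<bar>k i\<bar>) ` (X \<times> UNIV)))"
    have fX: "finite (insert 0 ((\<lambda>(k, i). nat \<bar>k i\<bar>) ` (X \<times> (UNIV :: 'm set))))" using X by simp
    have N: "\<bar>k i\<bar> \<le> int ?N" if "k \<in> X" for k i
    proof -
      have "(\<lambda>(k, i). nat \<bar>k i\<bar>) (k, i) \<le> ?N" using that by (intro Max_ge[OF fX] insertI2 imageI) auto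
      then show ?thesis by simp
    qed
    show "\<forall>\<^sub>F n in sequentially. finite (?B n) \<and> X \<subseteq> ?B n \<and> ?B n \<subseteq> UNIV"
      using eventually_ge_at_top[of ?N]
    proof eventually_elim
      case (elim n)
      then show ?case using fin N by (force intro: order_trans)
    qed
  qed
qed

text \<open>On a box the sum over the lattice is a product of one-dimensional sums.\<close>

lemma summable_int_product: "(\<lambda>k :: 'm::finite \<Rightarrow> int. \<Prod>i\<in>UNIV. 1 / (1 + (of_int (k i))\<^sup>2 :: real)) summable_on UNIV"
proof (rule nonneg_bounded_partial_sums_imp_summable_on[where C = "5 ^ CARD('m)"])
  show "\<forall>\<^sub>F X in finite_subsets_at_top (UNIV :: ('m \<Rightarrow> int) set). (\<Sum>k\<in>X. \<Prod>i\<in>UNIV. 1 / (1 + (of_int (k i))\<^sup>2 :: real)) \<le> 5 ^ CARD('m)"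
  proof (intro eventually_finite_subsets_at_top_weakI)
    fix X :: "('m \<Rightarrow> int) set" assume X: "finite X" "X \<subseteq> UNIV"
    have "\<forall>\<^sub>F n in sequentially. X \<subseteq> {k :: 'm::finite \<Rightarrow> int. \<forall>i. \<bar>k i\<bar> \<le> int n}"
    proof -
      have "\<forall>\<^sub>F n in sequentially. finite {k :: 'm \<Rightarrow> int. \<forall>i. \<bar>k i\<bar> \<le> int n} \<and> X \<subseteq> {k. \<forall>i. \<bar>k i\<bar> \<le> int n} \<and> {k :: 'm \<Rightarrow> int. \<forall>i. \<bar>k i\<bar> \<le> int n} \<subseteq> UNIV"
        using filterlim_int_boxes X unfolding filterlim_finite_subsets_at_top by blast
      then show ?thesis by (rule eventually_mono) blast
    qed
    then obtain n where n: "X \<subseteq> {k :: 'm::finite \<Rightarrow> int. \<forall>i. \<bar>k i\<bar> \<le> int n}" by (auto simp: eventually_sequentially)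
    have "(\<Sum>k\<in>X. \<Prod>i\<in>UNIV. 1 / (1 + (of_int (k i))\<^sup>2 :: real)) \<le> (\<Sum>k\<in>{k :: 'm \<Rightarrow> int. \<forall>i. \<bar>k i\<bar> \<le> int n}. \<Prod>i\<in>UNIV. 1 / (1 + (of_int (k i))\<^sup>2 :: real))"
      by (intro sum_mono2 n finite_int_box prod_nonneg) (auto intro!: divide_nonneg_nonneg)
    also have "{k :: 'm \<Rightarrow> int. \<forall>i. \<bar>k i\<bar> \<le> int n} = PiE UNIV (\<lambda>_. {- int n..int n})"
      by (auto simp: PiE_def Pi_def extensional_def abs_le_iff) (smt (verit))+
    also have "(\<Sum>k\<in>PiE UNIV (\<lambda>_::'m. {- int n..int n}). \<Prod>i\<in>UNIV. 1 / (1 + (of_int (k i))\<^sup>2 :: real))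
       = (\<Prod>i\<in>(UNIV :: 'm set). \<Sum>j\<in>{- int n..int n}. 1 / (1 + (of_int j)\<^sup>2 :: real))"
      by (subst prod_sum_PiE) auto
    also have "\<dots> \<le> (\<Prod>i\<in>(UNIV :: 'm set). 5)"
    proof (intro prod_mono conjI)
      show "(\<Sum>j\<in>{- int n..int n}. 1 / (1 + (of_int j)\<^sup>2 :: real)) \<le> 5"
        using sum_inverse_1_plus_square_le[of n] by (smt (verit) divide_nonneg_nonneg of_nat_0_le_iff)
    qed (auto intro!: sum_nonneg divide_nonneg_nonneg)
    finally show "(\<Sum>k\<in>X. \<Prod>i\<in>UNIV. 1 / (1 + (of_int (k i))\<^sup>2 :: real)) \<le> 5 ^ CARD('m)" by simp
  qed
qed (auto intro!: prod_nonneg divide_nonneg_nonneg)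

text \<open>Coefficients that are summable against every power of the frequency: the Fourier coefficients of
  smooth periodic functions.\<close>

definition rapid_coeffs :: "real \<Rightarrow> (('m::finite \<Rightarrow> int) \<Rightarrow> complex) \<Rightarrow> bool" where
  "rapid_coeffs R a \<longleftrightarrow> (\<forall>p. (\<lambda>k. cmod (a k) * (1 + norm (lattice_freq R k)) ^ p) summable_on UNIV)"

lemma rapid_coeffsI:
  fixes a :: "('m::finite \<Rightarrow> int) \<Rightarrow> complex"
  assumes R: "R > 0" and a: "\<And>p. \<exists>B. \<forall>k. cmod (a k) * (1 + norm (lattice_freq R k)) ^ p \<le> B"
  shows "rapid_coeffs R a"
  unfolding rapid_coeffs_def
proof
  fix p
  let ?M = "CARD('m)" and ?w = "\<lambda>k. 1 + norm (lattice_freq R k :: real^'m)" and ?c = "1 + (R / pi)\<^sup>2"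
  let ?P = "\<lambda>k :: 'm \<Rightarrow> int. \<Prod>i\<in>UNIV. 1 / (1 + (of_int (k i))\<^sup>2 :: real)"
  obtain B where B: "\<And>k. cmod (a k) * ?w k ^ (p + 2 * ?M) \<le> B" using a by blast
  have P: "1 \<le> ?c ^ ?M * ?w k ^ (2 * ?M) * ?P k" for k
  proof -
    have "1 + (of_int (k i))\<^sup>2 \<le> ?c * (?w k)\<^sup>2" for i
    proof -
      have "\<bar>lattice_freq R k $ i\<bar> \<le> norm (lattice_freq R k)" by (rule component_le_norm_cart)
      then have "(lattice_freq R k $ i)\<^sup>2 \<le> (norm (lattice_freq R k))\<^sup>2"
        by (simp add: abs_le_square_iff[symmetric])
      also have "\<dots> \<le> (?w k)\<^sup>2" by (intro power_mono) auto
      finally have 1: "(pi / R * of_int (k i))\<^sup>2 \<le> (?w k)\<^sup>2" by (simp add: lattice_freq_def)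
      have "(of_int (k i))\<^sup>2 = (R / pi)\<^sup>2 * (pi / R * of_int (k i))\<^sup>2" using R by (simp add: power_mult_distrib power_divide)
      also have "\<dots> \<le> (R / pi)\<^sup>2 * (?w k)\<^sup>2" using 1 by (intro mult_left_mono) auto
      finally have "(of_int (k i))\<^sup>2 \<le> (R / pi)\<^sup>2 * (?w k)\<^sup>2" .
      moreover have "1 \<le> (?w k)\<^sup>2" by (simp add: one_le_power)
      ultimately show ?thesis unfolding distrib_right by linarith
    qed
    then have "(\<Prod>i\<in>UNIV. 1 + (of_int (k i))\<^sup>2) \<le> (\<Prod>i\<in>(UNIV :: 'm set). ?c * (?w k)\<^sup>2)"
      by (intro prod_mono) auto
    also have "\<dots> = ?c ^ ?M * ?w k ^ (2 * ?M)" by (simp add: power_mult_distrib power_mult)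
    finally have "(\<Prod>i\<in>UNIV. 1 + (of_int (k i))\<^sup>2) * ?P k \<le> ?c ^ ?M * ?w k ^ (2 * ?M) * ?P k"
      by (intro mult_right_mono prod_nonneg) (auto intro!: divide_nonneg_nonneg)
    moreover have "(\<Prod>i\<in>UNIV. 1 + (of_int (k i))\<^sup>2) * ?P k = 1"
      unfolding prod.distrib[symmetric]
    proof (rule prod.neutral, intro ballI)
      fix i
      have "1 + (real_of_int (k i))\<^sup>2 \<noteq> 0" by (smt (verit) zero_le_power2)
      then show "(1 + (real_of_int (k i))\<^sup>2) * (1 / (1 + (real_of_int (k i))\<^sup>2)) = 1" by simp
    qed
    ultimately show ?thesis by simp
  qed
  have le: "cmod (a k) * ?w k ^ p \<le> B * ?c ^ ?M * ?P k" for k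
  proof -
    have "cmod (a k) * ?w k ^ p * 1 \<le> cmod (a k) * ?w k ^ p * (?c ^ ?M * ?w k ^ (2 * ?M) * ?P k)"
      by (intro mult_left_mono P) auto
    also have "\<dots> = (cmod (a k) * ?w k ^ (p + 2 * ?M)) * (?c ^ ?M * ?P k)" by (simp add: power_add mult_ac)
    also have "\<dots> \<le> B * (?c ^ ?M * ?P k)"
      by (intro mult_right_mono B mult_nonneg_nonneg prod_nonneg) (auto intro!: divide_nonneg_nonneg)
    finally show ?thesis by (simp add: mult_ac)
  qed
  have "(\<lambda>k. B * ?c ^ ?M * ?P k) summable_on UNIV"
    by (intro summable_on_cmult_right summable_int_product)
  then show "(\<lambda>k. cmod (a k) * ?w k ^ p) summable_on UNIV"
    by (rule summable_on_comparison_test) (rule le, simp)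
qed

lemma rapid_coeffs_abs_summable: "rapid_coeffs R a \<Longrightarrow> (\<lambda>k. cmod (a k)) summable_on UNIV"
  unfolding rapid_coeffs_def by (drule spec[of _ 0]) simp

lemma rapid_coeffs_bounded_mult:
  assumes a: "rapid_coeffs R a" and b: "\<And>k. cmod (b k) \<le> B * (1 + norm (lattice_freq R k)) ^ M"
  shows "rapid_coeffs R (\<lambda>k. b k * a k)"
  unfolding rapid_coeffs_def
proof
  fix p
  let ?w = "\<lambda>k. 1 + norm (lattice_freq R k)"
  have sb: "(\<lambda>k. B * (cmod (a k) * ?w k ^ (p + M))) summable_on UNIV"
    using a unfolding rapid_coeffs_def by (intro summable_on_cmult_right) blast
  have le: "cmod (b k * a k) * ?w k ^ p \<le> B * (cmod (a k) * ?w k ^ (p + M))" for k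
  proof -
    have "cmod (b k * a k) * ?w k ^ p \<le> (B * ?w k ^ M) * (cmod (a k) * ?w k ^ p)"
      unfolding norm_mult mult.assoc[of "cmod (b k)"] by (intro mult_right_mono b) auto
    then show ?thesis by (simp add: power_add mult_ac)
  qed
  show "(\<lambda>k. cmod (b k * a k) * ?w k ^ p) summable_on UNIV"
    by (rule summable_on_comparison_test[OF sb]) (rule le, simp)
qed

lemma rapid_coeffs_deriv: "rapid_coeffs R a \<Longrightarrow> rapid_coeffs R (\<lambda>k. \<i> * of_real (lattice_freq R k \<bullet> v) * a k)"
proof (rule rapid_coeffs_bounded_mult[where M = 1 and B = "norm v"])
  fix k :: "'a \<Rightarrow> int"
  have "\<bar>lattice_freq R k \<bullet> v\<bar> \<le> norm (lattice_freq R k) * norm v" by (rule Cauchy_Schwarz_ineq2)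
  also have "\<dots> \<le> norm v * (1 + norm (lattice_freq R k)) ^ 1" by (simp add: algebra_simps)
  finally show "cmod (\<i> * of_real (lattice_freq R k \<bullet> v)) \<le> norm v * (1 + norm (lattice_freq R k)) ^ 1" by (simp add: norm_mult)
qed auto

lemma has_sum_diff:
  fixes f g :: "'a \<Rightarrow> 'b::topological_ab_group_add"
  shows "(f has_sum a) A \<Longrightarrow> (g has_sum b) A \<Longrightarrow> ((\<lambda>x. f x - g x) has_sum a - b) A"
  using has_sum_add[of f A a "\<lambda>x. - g x" "- b"] by (simp add: has_sum_uminus)

definition wave_series :: "real \<Rightarrow> (('m::finite \<Rightarrow> int) \<Rightarrow> complex) \<Rightarrow> real^'m \<Rightarrow> complex" where
  "wave_series R a x = (\<Sum>\<^sub>\<infinity>k. a k * wave (lattice_freq R k) x)"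

lemma wave_series_abs_summable: "rapid_coeffs R a \<Longrightarrow> (\<lambda>k. cmod (a k * wave (lattice_freq R k) x)) summable_on UNIV"
  by (simp add: norm_mult rapid_coeffs_abs_summable)

lemma wave_series_summable: "rapid_coeffs R a \<Longrightarrow> (\<lambda>k. a k * wave (lattice_freq R k) x) summable_on UNIV"
  using abs_summable_summable[OF wave_series_abs_summable] .

lemma wave_series_norm_le: "rapid_coeffs R a \<Longrightarrow> cmod (wave_series R a x) \<le> (\<Sum>\<^sub>\<infinity>k. cmod (a k))"
  unfolding wave_series_def using norm_infsum_bound[OF wave_series_abs_summable[of R a x]] by (simp add: norm_mult)

text \<open>Termwise differentiation, with the quadratic remainder estimate \<open>\<bar>exp (i t) - 1 - i t\<bar> \<le> t\<^sup>2\<close> for each wave.\<close>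

lemma wave_series_has_derivative:
  assumes a: "rapid_coeffs R a"
  shows "(wave_series R a has_derivative (\<lambda>v. wave_series R (\<lambda>k. \<i> * of_real (lattice_freq R k \<bullet> v) * a k) x)) (at x)"
proof -
  let ?\<kappa> = "lattice_freq R"
  let ?D = "\<lambda>v. wave_series R (\<lambda>k. \<i> * of_real (?\<kappa> k \<bullet> v) * a k) x"
  let ?C = "\<Sum>\<^sub>\<infinity>k. cmod (a k) * (1 + norm (?\<kappa> k)) ^ 2"
  have sD: "(\<lambda>k. \<i> * of_real (?\<kappa> k \<bullet> v) * a k * wave (?\<kappa> k) x) summable_on UNIV" for v
    by (rule wave_series_summable[OF rapid_coeffs_deriv[OF a]])
  have bl: "bounded_linear ?D"
  proof (rule bounded_linear_intro[where K = "\<Sum>\<^sub>\<infinity>k. cmod (a k) * (1 + norm (?\<kappa> k)) ^ 1"])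
    fix u v :: "real^'a" and r :: real
    show "?D (u + v) = ?D u + ?D v"
      unfolding wave_series_def by (subst infsum_add[symmetric, OF sD sD]) (simp add: inner_add_right algebra_simps)
    have "?D (r *\<^sub>R u) = (\<Sum>\<^sub>\<infinity>k. of_real r * (\<i> * of_real (?\<kappa> k \<bullet> u) * a k * wave (?\<kappa> k) x))"
      unfolding wave_series_def by (simp add: mult_ac)
    then show "?D (r *\<^sub>R u) = r *\<^sub>R ?D u"
      unfolding wave_series_def by (simp add: infsum_cmult_right[OF sD] scaleR_conv_of_real)
    have s1: "(\<lambda>k. cmod (a k) * (1 + norm (?\<kappa> k)) ^ 1) summable_on UNIV" using a unfolding rapid_coeffs_def by blast
    have "cmod (?D u) \<le> (\<Sum>\<^sub>\<infinity>k. cmod (\<i> * of_real (?\<kappa> k \<bullet> u) * a k))"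
      by (rule wave_series_norm_le[OF rapid_coeffs_deriv[OF a]])
    also have "\<dots> \<le> (\<Sum>\<^sub>\<infinity>k. norm u * (cmod (a k) * (1 + norm (?\<kappa> k)) ^ 1))"
    proof (rule infsum_mono[OF rapid_coeffs_abs_summable[OF rapid_coeffs_deriv[OF a]] summable_on_cmult_right[OF s1]])
      fix k :: "'a \<Rightarrow> int"
      have "\<bar>?\<kappa> k \<bullet> u\<bar> * cmod (a k) \<le> norm (?\<kappa> k) * norm u * cmod (a k)"
        by (intro mult_right_mono Cauchy_Schwarz_ineq2) auto
      also have "\<dots> \<le> norm u * (cmod (a k) * (1 + norm (?\<kappa> k)) ^ 1)" by (simp add: algebra_simps)
      finally show "cmod (\<i> * of_real (?\<kappa> k \<bullet> u) * a k) \<le> norm u * (cmod (a k) * (1 + norm (?\<kappa> k)) ^ 1)"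
        by (simp add: norm_mult)
    qed
    also have "\<dots> = norm u * (\<Sum>\<^sub>\<infinity>k. cmod (a k) * (1 + norm (?\<kappa> k)) ^ 1)" by (rule infsum_cmult_right[OF s1])
    finally show "cmod (?D u) \<le> norm u * (\<Sum>\<^sub>\<infinity>k. cmod (a k) * (1 + norm (?\<kappa> k)) ^ 1)" .
  qed
  have rem: "cmod (wave_series R a (x + h) - wave_series R a x - ?D h) \<le> ?C * (norm h)\<^sup>2" for h
  proof -
    let ?e = "\<lambda>k. wave (?\<kappa> k) h - 1 - \<i> * of_real (?\<kappa> k \<bullet> h)"
    have s2: "(\<lambda>k. cmod (a k) * (1 + norm (?\<kappa> k)) ^ 2) summable_on UNIV" using a unfolding rapid_coeffs_def by blast
    have eq: "wave_series R a (x + h) - wave_series R a x - ?D h = (\<Sum>\<^sub>\<infinity>k. a k * wave (?\<kappa> k) x * ?e k)"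
    proof -
      have W: "((\<lambda>k. a k * wave (?\<kappa> k) y) has_sum wave_series R a y) UNIV" for y
        unfolding wave_series_def by (rule has_sum_infsum[OF wave_series_summable[OF a]])
      have D: "((\<lambda>k. \<i> * of_real (?\<kappa> k \<bullet> h) * a k * wave (?\<kappa> k) x) has_sum ?D h) UNIV"
        unfolding wave_series_def by (rule has_sum_infsum[OF sD])
      from has_sum_diff[OF has_sum_diff[OF W W] D]
      have "((\<lambda>k. a k * wave (?\<kappa> k) (x + h) - a k * wave (?\<kappa> k) x - \<i> * of_real (?\<kappa> k \<bullet> h) * a k * wave (?\<kappa> k) x)
        has_sum wave_series R a (x + h) - wave_series R a x - ?D h) UNIV" .
      then have "((\<lambda>k. a k * wave (?\<kappa> k) x * ?e k) has_sum wave_series R a (x + h) - wave_series R a x - ?D h) UNIV"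
        by (simp add: wave_add algebra_simps)
      then show ?thesis by (rule infsumI[symmetric])
    qed
    have le: "cmod (a k * wave (?\<kappa> k) x * ?e k) \<le> (norm h)\<^sup>2 * (cmod (a k) * (1 + norm (?\<kappa> k)) ^ 2)" for k
    proof -
      have "cmod (?e k) \<le> \<bar>?\<kappa> k \<bullet> h\<bar>\<^sup>2"
        using Taylor_exp[of "\<i> * of_real (?\<kappa> k \<bullet> h)" 1] by (simp add: wave_def norm_mult numeral_2_eq_2 algebra_simps)
      also have "\<dots> \<le> ((1 + norm (?\<kappa> k)) * norm h)\<^sup>2"
      proof (intro power_mono)
        have "\<bar>?\<kappa> k \<bullet> h\<bar> \<le> norm (?\<kappa> k) * norm h" by (rule Cauchy_Schwarz_ineq2)
        also have "\<dots> \<le> (1 + norm (?\<kappa> k)) * norm h" by (intro mult_right_mono) auto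
        finally show "\<bar>?\<kappa> k \<bullet> h\<bar> \<le> (1 + norm (?\<kappa> k)) * norm h" .
      qed auto
      finally have "cmod (a k) * cmod (?e k) \<le> cmod (a k) * ((1 + norm (?\<kappa> k)) * norm h)\<^sup>2" by (intro mult_left_mono) auto
      then show ?thesis by (simp add: norm_mult power_mult_distrib mult_ac)
    qed
    have sb: "(\<lambda>k. (norm h)\<^sup>2 * (cmod (a k) * (1 + norm (?\<kappa> k)) ^ 2)) summable_on UNIV" by (rule summable_on_cmult_right[OF s2])
    have se: "(\<lambda>k. cmod (a k * wave (?\<kappa> k) x * ?e k)) summable_on UNIV"
      by (rule summable_on_comparison_test[OF sb]) (use le in auto)
    have "cmod (\<Sum>\<^sub>\<infinity>k. a k * wave (?\<kappa> k) x * ?e k) \<le> (\<Sum>\<^sub>\<infinity>k. cmod (a k * wave (?\<kappa> k) x * ?e k))" by (rule norm_infsum_bound[OF se])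
    also have "\<dots> \<le> (\<Sum>\<^sub>\<infinity>k. (norm h)\<^sup>2 * (cmod (a k) * (1 + norm (?\<kappa> k)) ^ 2))" by (rule infsum_mono[OF se sb le])
    also have "\<dots> = (norm h)\<^sup>2 * ?C" by (rule infsum_cmult_right[OF s2])
    finally show ?thesis unfolding eq by (simp only: mult.commute)
  qed
  have "((\<lambda>h. norm (wave_series R a (x + h) - wave_series R a x - ?D h) / norm h) \<longlongrightarrow> 0) (at 0)"
  proof (rule Lim_null_comparison[where g = "\<lambda>h. ?C * norm h"])
    show "\<forall>\<^sub>F h in at 0. norm (norm (wave_series R a (x + h) - wave_series R a x - ?D h) / norm h) \<le> ?C * norm h"
      using rem by (auto simp: eventually_at_filter divide_le_eq power2_eq_square mult.assoc)
    show "((\<lambda>h. ?C * norm h) \<longlongrightarrow> 0) (at (0 :: real^'a))"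
      by (rule tendsto_mult_right_zero) (rule tendsto_norm_zero[OF tendsto_ident_at])
  qed
  with bl show ?thesis by (simp add: has_derivative_at)
qed

lemma frechet_derivative_wave_series:
  "rapid_coeffs R a \<Longrightarrow> frechet_derivative (wave_series R a) (at x) v = wave_series R (\<lambda>k. \<i> * of_real (lattice_freq R k \<bullet> v) * a k) x"
  by (simp add: frechet_derivative_eqI[OF wave_series_has_derivative])

lemma smooth_on_wave_series:
  assumes "rapid_coeffs R a" shows "smooth_on UNIV (wave_series R a)"
proof (rule smooth_on_family[where F = "wave_series R ` Collect (rapid_coeffs R)"])
  fix f :: "real^'a \<Rightarrow> complex" assume "f \<in> wave_series R ` Collect (rapid_coeffs R)"
  then obtain a where f: "f = wave_series R a" and a: "rapid_coeffs R a" by blast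
  have "\<forall>x\<in>UNIV. (f has_derivative (\<lambda>v. wave_series R (\<lambda>k. \<i> * of_real (lattice_freq R k \<bullet> v) * a k) x)) (at x)"
    using wave_series_has_derivative[OF a] f by simp
  moreover have "(\<lambda>x. wave_series R (\<lambda>k. \<i> * of_real (lattice_freq R k \<bullet> v) * a k) x) \<in> wave_series R ` Collect (rapid_coeffs R)" for v
    using rapid_coeffs_deriv[OF a, of v] by (intro image_eqI[of _ _ "\<lambda>k. \<i> * of_real (lattice_freq R k \<bullet> v) * a k"]) auto
  ultimately show "\<exists>f'. (\<forall>x\<in>UNIV. (f has_derivative f' x) (at x)) \<and> (\<forall>v. (\<lambda>x. f' x v) \<in> wave_series R ` Collect (rapid_coeffs R))"
    by (intro exI[of _ "\<lambda>x v. wave_series R (\<lambda>k. \<i> * of_real (lattice_freq R k \<bullet> v) * a k) x"]) blast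
qed (use assms in auto)

lemma rapid_coeffs_restrict: "rapid_coeffs R a \<Longrightarrow> rapid_coeffs R (\<lambda>k. if k \<in> X then 0 else a k)"
  using rapid_coeffs_bounded_mult[of R a "\<lambda>k. if k \<in> X then 0 else 1" 1 0]
  by (simp add: if_distrib[of "\<lambda>c. c * _"] cong: if_cong)

text \<open>Differentiation replaces the coefficients by others that are again rapidly decreasing, so it suffices
  to bound the tail by the tail of the sum of absolute values.\<close>

lemma wave_series_tail_null:
  fixes a :: "('m::finite \<Rightarrow> int) \<Rightarrow> complex"
  assumes "rapid_coeffs R a"
  shows "Cinf_null C (\<lambda>n. wave_series R (\<lambda>k. if k \<in> {k. \<forall>i. \<bar>k i\<bar> \<le> int n} then 0 else a k))"
proof -
  let ?B = "\<lambda>n. {k :: 'm \<Rightarrow> int. \<forall>i. \<bar>k i\<bar> \<le> int n}"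
  let ?a = "\<lambda>(a :: ('m \<Rightarrow> int) \<Rightarrow> complex) n k. if k \<in> ?B n then 0 else a k"
  have "uniform_limit C (\<lambda>n. iter_deriv vs (wave_series R (?a a n))) (\<lambda>_. 0) sequentially" for vs
    using assms
  proof (induction vs arbitrary: a rule: rev_induct)
    case Nil
    let ?S = "\<Sum>\<^sub>\<infinity>k. cmod (a k)"
    have s: "(\<lambda>k. cmod (a k)) summable_on UNIV" by (rule rapid_coeffs_abs_summable[OF Nil])
    have lim: "(\<lambda>n. \<Sum>k\<in>?B n. cmod (a k)) \<longlonglongrightarrow> ?S"
      using filterlim_compose[OF infsum_tendsto[OF s] filterlim_int_boxes] .
    have tail: "(\<Sum>\<^sub>\<infinity>k. cmod (?a a n k)) = ?S - (\<Sum>k\<in>?B n. cmod (a k))" for n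
    proof -
      have "((\<lambda>k. cmod (a k)) has_sum ?S - (\<Sum>k\<in>?B n. cmod (a k))) (UNIV - ?B n)"
        using s by (intro has_sum_Diff has_sum_infsum has_sum_finite finite_int_box) auto
      then have "((\<lambda>k. cmod (?a a n k)) has_sum ?S - (\<Sum>k\<in>?B n. cmod (a k))) UNIV"
        by (rule has_sum_cong_neutral[THEN iffD1, rotated -1]) auto
      then show ?thesis by (rule infsumI)
    qed
    show ?case
    proof (rule uniform_limitI)
      fix e :: real assume "e > 0"
      with lim have "\<forall>\<^sub>F n in sequentially. dist (\<Sum>k\<in>?B n. cmod (a k)) ?S < e" by (rule tendstoD)
      then show "\<forall>\<^sub>F n in sequentially. \<forall>x\<in>C. dist (iter_deriv [] (wave_series R (?a a n)) x) 0 < e"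
      proof eventually_elim
        case (elim n)
        have "cmod (wave_series R (?a a n) x) \<le> ?S - (\<Sum>k\<in>?B n. cmod (a k))" for x
          using wave_series_norm_le[OF rapid_coeffs_restrict[OF Nil, of "?B n"], of x] tail[of n] by simp
        moreover have "?S - (\<Sum>k\<in>?B n. cmod (a k)) < e" using elim by (simp add: dist_real_def)
        ultimately show ?case by (auto intro: le_less_trans)
      qed
    qed
  next
    case (snoc v vs)
    let ?a' = "\<lambda>k. \<i> * of_real (lattice_freq R k \<bullet> v) * a k"
    have "(\<lambda>x. frechet_derivative (wave_series R (?a a n)) (at x) v) = wave_series R (?a ?a' n)" for n
      unfolding frechet_derivative_wave_series[OF rapid_coeffs_restrict[OF snoc.prems]]
      by (simp add: if_distrib[of "(*) _"] cong: if_cong)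
    then show ?case using snoc.IH[OF rapid_coeffs_deriv[OF snoc.prems, of v]] by (simp add: iter_deriv_snoc)
  qed
  then show ?thesis unfolding Cinf_null_def by blast
qed

text \<open>The partial sums over boxes converge with all derivatives, so continuity of \<open>v\<close> allows termwise
  application. Absolute convergence turns this limit into an unordered sum.\<close>

lemma distribution_wave_series:
  fixes a :: "('m::finite \<Rightarrow> int) \<Rightarrow> complex"
  assumes v: "distribution_on S v" and \<rho>: "\<rho> \<in> test_funs S" and a: "rapid_coeffs R a"
  shows "((\<lambda>k. a k * v (\<lambda>x. \<rho> x * wave (lattice_freq R k) x)) has_sum v (\<lambda>x. \<rho> x * wave_series R a x)) UNIV"
    and "rapid_coeffs R (\<lambda>k. v (\<lambda>x. \<rho> x * wave (lattice_freq R k) x) * a k)"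
proof -
  let ?B = "\<lambda>n. {k :: 'm \<Rightarrow> int. \<forall>i. \<bar>k i\<bar> \<le> int n}" and ?\<kappa> = "lattice_freq R"
  let ?a = "\<lambda>n k. if k \<in> ?B n then 0 else a k" and ?u = "\<lambda>k. v (\<lambda>x. \<rho> x * wave (?\<kappa> k) x)"
  obtain M B where "\<And>\<eta>. cmod (v (\<lambda>x. \<rho> x * wave \<eta> x)) \<le> B * (1 + norm \<eta>) ^ M"
    using distribution_wave_growth[OF v \<rho>] by blast
  then show ru: "rapid_coeffs R (\<lambda>k. ?u k * a k)" by (intro rapid_coeffs_bounded_mult[OF a])
  then have s: "(\<lambda>k. a k * ?u k) summable_on UNIV"
    using abs_summable_summable[OF rapid_coeffs_abs_summable[OF ru]] by (simp add: mult.commute)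
  from \<rho> obtain K where K: "compact K" "K \<subseteq> S" "\<And>x. x \<notin> K \<Longrightarrow> \<rho> x = 0" by (rule test_funsE) blast
  let ?g = "\<lambda>n x. \<rho> x * wave_series R (?a n) x"
  have g: "?g n \<in> test_funs S" for n
    by (intro test_funs_mult_UNIV(1)[OF \<rho>] smooth_on_wave_series rapid_coeffs_restrict a)
  have "Cinf_null UNIV ?g"
  proof -
    have "Cinf_null K ?g"
      using Cinf_null_mult_compose[OF open_UNIV open_UNIV smooth_on_id[OF open_UNIV] _ K(1) _ smooth_on_wave_series[OF rapid_coeffs_restrict[OF a]] _ test_funs_smooth[OF \<rho>], of ?B]
        wave_series_tail_null[OF a] by simp
    moreover have "iter_deriv vs (?g n) x = 0" if "x \<notin> K" for vs n x
    proof -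
      have "iter_deriv vs (?g n) x = iter_deriv vs (\<lambda>_. 0) x"
        using that K by (intro iter_deriv_cong[of "- K"]) (auto simp: compact_imp_closed open_Compl)
      then show ?thesis by simp
    qed
    ultimately show ?thesis
      unfolding Cinf_null_def uniform_limit_iff by (smt (verit) dist_self eventually_mono UNIV_I)
  qed
  then have lim: "(\<lambda>n. v (?g n)) \<longlonglongrightarrow> 0"
    by (intro distribution_on_null[OF v g K(1,2)]) (auto simp: K(3))
  have vg: "v (?g n) = v (\<lambda>x. \<rho> x * wave_series R a x) - (\<Sum>k\<in>?B n. a k * ?u k)" for n
  proof -
    have "wave_series R (?a n) x = wave_series R a x - (\<Sum>k\<in>?B n. a k * wave (?\<kappa> k) x)" for x
    proof -
      have "((\<lambda>k. a k * wave (?\<kappa> k) x) has_sum wave_series R a x - (\<Sum>k\<in>?B n. a k * wave (?\<kappa> k) x)) (UNIV - ?B n)"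
        unfolding wave_series_def
        using wave_series_summable[OF a, of x] by (intro has_sum_Diff has_sum_infsum has_sum_finite finite_int_box) auto
      then have "((\<lambda>k. ?a n k * wave (?\<kappa> k) x) has_sum wave_series R a x - (\<Sum>k\<in>?B n. a k * wave (?\<kappa> k) x)) UNIV"
        by (rule has_sum_cong_neutral[THEN iffD1, rotated -1]) auto
      then show ?thesis unfolding wave_series_def by (rule infsumI)
    qed
    then have "?g n = (\<lambda>x. \<rho> x * wave_series R a x - (\<Sum>k\<in>?B n. a k * (\<rho> x * wave (?\<kappa> k) x)))"
      by (simp only: right_diff_distrib sum_distrib_left mult.left_commute)
    then have "v (?g n) = v (\<lambda>x. \<rho> x * wave_series R a x - (\<Sum>k\<in>?B n. a k * (\<rho> x * wave (?\<kappa> k) x)))" by simp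
    also have "\<dots> = v (\<lambda>x. \<rho> x * wave_series R a x) - v (\<lambda>x. \<Sum>k\<in>?B n. a k * (\<rho> x * wave (?\<kappa> k) x))"
      by (intro distribution_on_diff[OF v] test_funs_mult_UNIV(1)[OF \<rho>] smooth_on_wave_series a test_funs_sum test_funs_cmult test_funs_wave \<rho>)
    also have "v (\<lambda>x. \<Sum>k\<in>?B n. a k * (\<rho> x * wave (?\<kappa> k) x)) = (\<Sum>k\<in>?B n. v (\<lambda>x. a k * (\<rho> x * wave (?\<kappa> k) x)))"
      by (intro distribution_on_sum[OF v] test_funs_cmult test_funs_wave \<rho>)
    also have "\<dots> = (\<Sum>k\<in>?B n. a k * ?u k)"
      by (intro sum.cong refl distribution_on_cmult[OF v] test_funs_wave \<rho>)
    finally show ?thesis .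
  qed
  have "(\<lambda>n. \<Sum>k\<in>?B n. a k * ?u k) \<longlonglongrightarrow> (\<Sum>\<^sub>\<infinity>k. a k * ?u k)"
    using filterlim_compose[OF infsum_tendsto[OF s] filterlim_int_boxes] .
  then have "(\<lambda>n. v (?g n)) \<longlonglongrightarrow> v (\<lambda>x. \<rho> x * wave_series R a x) - (\<Sum>\<^sub>\<infinity>k. a k * ?u k)"
    unfolding vg by (intro tendsto_diff tendsto_const)
  from LIMSEQ_unique[OF this lim] have "v (\<lambda>x. \<rho> x * wave_series R a x) = (\<Sum>\<^sub>\<infinity>k. a k * ?u k)" by simp
  then show "((\<lambda>k. a k * ?u k) has_sum v (\<lambda>x. \<rho> x * wave_series R a x)) UNIV"
    using has_sum_infsum[OF s] by simp
qed


section \<open>Expansion of test functions in plane waves\<close>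

lemma sum_Basis_cart: "(\<Sum>b\<in>(Basis :: (real^'m::finite) set). f b) = (\<Sum>i\<in>UNIV. f (axis i 1))"
proof -
  have B: "(Basis :: (real^'m) set) = (\<lambda>i. axis i 1) ` UNIV" by (auto simp: Basis_vec_def)
  have "inj (\<lambda>i::'m. axis i (1::real))" by (auto simp: inj_on_def axis_eq_axis)
  then show ?thesis unfolding B by (subst sum.reindex) auto
qed

text \<open>The zeros of the left side are the multiples of \<open>2R\<close>, and its zero at the origin is simple.\<close>

lemma exp_minus_1_factor:
  assumes R: "R > 0"
  obtains w :: "real \<Rightarrow> complex" where "smooth_on UNIV w" "\<And>t. exp (\<i> * of_real (pi / R * t)) - 1 = of_real t * w t"
    "\<And>t. \<bar>t\<bar> < 2 * R \<Longrightarrow> w t \<noteq> 0"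
proof -
  let ?E = "\<lambda>t::real. exp (\<i> * of_real (pi / R * t))"
  have E: "smooth_on UNIV ?E"
    by (intro smooth_on_exp smooth_on_mult smooth_on_of_real smooth_on_const smooth_on_id open_UNIV)
  obtain g where g: "\<And>b. smooth_on UNIV (g b)" "\<And>t. ?E t = ?E 0 + (\<Sum>b\<in>Basis. ((t - 0) \<bullet> b) *\<^sub>R g b t)"
    using hadamard_lemma[OF open_UNIV convex_UNIV UNIV_I E, of 0] by (metis UNIV_I)
  let ?w = "g 1"
  have w: "?E t - 1 = of_real t * ?w t" for t using g(2)[of t] by (simp add: scaleR_conv_of_real)
  have "?w t \<noteq> 0" if t: "\<bar>t\<bar> < 2 * R" for t
  proof (cases "t = 0")
    case False
    have "?E t \<noteq> 1"
    proof
      assume "?E t = 1"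
      then obtain n :: int where "pi / R * t = of_int (2 * n) * pi" by (auto simp: exp_eq_1)
      then have n: "t = 2 * R * of_int n" using R by (simp add: field_simps)
      with False have "n \<noteq> 0" by auto
      then have "1 \<le> \<bar>real_of_int n\<bar>" by linarith
      then have "2 * R * 1 \<le> 2 * R * \<bar>real_of_int n\<bar>" using R by (intro mult_left_mono) auto
      then show False using n t R by (simp add: abs_mult)
    qed
    then show ?thesis using w[of t] by auto
  next
    case True
    have "((\<lambda>t. (?E t - 1) / of_real t) \<longlongrightarrow> \<i> * of_real (pi / R)) (at 0)"
    proof -
      have d: "((\<lambda>z. exp (\<i> * of_real (pi / R) * z)) has_field_derivative \<i> * of_real (pi / R)) (at (0::complex))"
        using R by (auto intro!: derivative_eq_intros)
      then have "((\<lambda>z. (exp (\<i> * of_real (pi / R) * z) - 1) / z) \<longlongrightarrow> \<i> * of_real (pi / R)) (at 0)"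
        by (simp add: DERIV_def)
      moreover have "filterlim complex_of_real (at 0) (at 0)"
        by (intro filterlim_atI tendsto_of_real[of "\<lambda>x. x" 0, simplified] tendsto_ident_at) (auto simp: eventually_at_filter)
      ultimately have "((\<lambda>t. (exp (\<i> * of_real (pi / R) * of_real t) - 1) / of_real t) \<longlongrightarrow> \<i> * of_real (pi / R)) (at 0)"
        by (rule filterlim_compose)
      then show ?thesis by (simp add: mult_ac)
    qed
    then have "(?w \<longlongrightarrow> \<i> * of_real (pi / R)) (at 0)"
    proof (rule Lim_transform_eventually)
      have "(?E t - 1) / of_real t = ?w t" if "t \<noteq> 0" for t unfolding w using that by simp
      then show "\<forall>\<^sub>F t in at 0. (?E t - 1) / of_real t = ?w t" unfolding eventually_at_filter by (intro always_eventually) blast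
    qed
    moreover have "(?w \<longlongrightarrow> ?w 0) (at 0)"
      using smooth_on_continuous[OF g(1)] by (simp add: continuous_on_eq_continuous_at isCont_def)
    ultimately have "?w 0 = \<i> * of_real (pi / R)" by (intro tendsto_unique[OF trivial_limit_at]) auto
    then show ?thesis using True R by simp
  qed
  with g(1) w show ?thesis by (intro that[of ?w]) auto
qed

lemma has_sum_finite_sum:
  fixes f :: "'i \<Rightarrow> 'a \<Rightarrow> 'b::{topological_comm_monoid_add}"
  assumes "\<And>i. i \<in> I \<Longrightarrow> (f i has_sum s i) A"
  shows "((\<lambda>x. \<Sum>i\<in>I. f i x) has_sum (\<Sum>i\<in>I. s i)) A"
  using assms by (induction I rule: infinite_finite_induct) (auto intro: has_sum_0 has_sum_add)

definition unit_index :: "'m \<Rightarrow> 'm::finite \<Rightarrow> int" where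
  "unit_index i j = (if j = i then 1 else 0)"

lemma wave_unit_index: "wave (lattice_freq R (unit_index i)) x = exp (\<i> * of_real (pi / R * x $ i))"
proof -
  have "lattice_freq R (unit_index i) = (pi / R) *\<^sub>R axis i 1"
    by (simp add: lattice_freq_def unit_index_def vec_eq_iff axis_def)
  then show ?thesis by (simp add: wave_def inner_axis' )
qed

text \<open>Hadamard's lemma divides \<open>\<phi>\<close> by the coordinates. These differ from the functions \<open>e\<^sub>i - 1\<close>, where \<open>e\<^sub>i\<close> are
  the basic \<open>2R\<close>-periodic waves, by factors that are invertible in the ball of radius \<open>2R\<close>. So a test
  function vanishing at the origin lies in the ideal generated by the \<open>e\<^sub>i - 1\<close>.\<close>

lemma test_fun_division:
  fixes \<phi> :: "real^'m::finite \<Rightarrow> complex"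
  assumes R: "R > 0" and \<phi>: "\<phi> \<in> test_funs (ball 0 (2 * R))" and 0: "\<phi> 0 = 0"
  obtains \<psi> where "\<And>i. \<psi> i \<in> test_funs (ball 0 (2 * R))"
    "\<And>x. \<phi> x = (\<Sum>i\<in>UNIV. (wave (lattice_freq R (unit_index i)) x - 1) * \<psi> i x)"
proof -
  let ?B = "ball (0::real^'m) (2 * R)"
  obtain w :: "real \<Rightarrow> complex" where w: "smooth_on UNIV w" "\<And>t. exp (\<i> * of_real (pi / R * t)) - 1 = of_real t * w t"
    "\<And>t. \<bar>t\<bar> < 2 * R \<Longrightarrow> w t \<noteq> 0" using exp_minus_1_factor[OF R] by blast
  have "0 \<in> ?B" using R by simp
  then obtain g where g: "\<And>b. smooth_on ?B (g b)" "\<And>x. x \<in> ?B \<Longrightarrow> \<phi> x = \<phi> 0 + (\<Sum>b\<in>Basis. ((x - 0) \<bullet> b) *\<^sub>R g b x)"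
    using hadamard_lemma[OF open_ball convex_ball _ smooth_on_subset[OF test_funs_smooth[OF \<phi>] subset_UNIV]] by blast
  from \<phi> obtain K where K: "compact K" "K \<subseteq> ?B" "\<And>x. x \<notin> K \<Longrightarrow> \<phi> x = 0" by (rule test_funsE) blast
  obtain \<beta> U where \<beta>: "\<beta> \<in> test_funs ?B" "K \<subseteq> U" "\<And>x. x \<in> U \<Longrightarrow> \<beta> x = 1"
    using test_bump[OF K(1) open_ball K(2)] by metis
  let ?\<psi> = "\<lambda>i x. \<beta> x * (g (axis i 1) x * inverse (w (x $ i)))"
  have wi: "w (x $ i) \<noteq> 0" if "x \<in> ?B" for x i
    using w(3)[of "x $ i"] component_le_norm_cart[of x i] that by simp
  have coord: "smooth_on ?B (\<lambda>x. x $ i)" for i :: 'm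
    by (rule smooth_on_bounded_linear[OF open_ball bounded_linear_vec_nth])
  show ?thesis
  proof (rule that[of ?\<psi>])
    show "?\<psi> i \<in> test_funs ?B" for i
      using wi by (intro test_funs_mult[OF open_ball \<beta>(1)] smooth_on_mult g smooth_on_inverse open_ball
          smooth_on_compose[OF open_ball open_UNIV coord w(1)]) auto
    fix x
    show "\<phi> x = (\<Sum>i\<in>UNIV. (wave (lattice_freq R (unit_index i)) x - 1) * ?\<psi> i x)"
    proof (cases "x \<in> ?B")
      case True
      have "(wave (lattice_freq R (unit_index i)) x - 1) * ?\<psi> i x = \<beta> x * (x $ i *\<^sub>R g (axis i 1) x)" for i
        using wi[OF True, of i] unfolding wave_unit_index w(2) by (simp add: scaleR_conv_of_real)
      then have "(\<Sum>i\<in>UNIV. (wave (lattice_freq R (unit_index i)) x - 1) * ?\<psi> i x) = \<beta> x * \<phi> x"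
        using g(2)[OF True] 0 by (simp add: sum_Basis_cart sum_distrib_left inner_axis)
      then show ?thesis using K(3)[of x] \<beta>(2,3) by (cases "x \<in> K") auto
    next
      case False
      then show ?thesis using test_funs_outside[OF \<phi> False] test_funs_outside[OF \<beta>(1) False] by simp
    qed
  qed
qed

lemma fourier_coeffs_rapid: "R > 0 \<Longrightarrow> f \<in> test_funs UNIV \<Longrightarrow> rapid_coeffs R (\<lambda>k. fourier f (lattice_freq R k))"
  using fourier_decay[of f] by (intro rapid_coeffsI) blast+

lemma lattice_freq_diff: "lattice_freq R k - lattice_freq R l = lattice_freq R (\<lambda>i. k i - l i)"
  by (simp add: lattice_freq_def vec_eq_iff right_diff_distrib)

lemma lattice_freq_minus: "- lattice_freq R k = lattice_freq R (\<lambda>i. - k i)"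
  by (simp add: lattice_freq_def vec_eq_iff)

text \<open>The sum of all Fourier coefficients is a linear functional that is invariant under multiplication by
  \<open>e\<^sub>i\<close>, because that only shifts the frequencies. It vanishes on the ideal generated by the \<open>e\<^sub>i - 1\<close>, which
  contains the test functions vanishing at the origin; so it is a multiple of evaluation at the origin.\<close>

lemma sum_fourier_coeffs:
  fixes \<phi> \<beta> :: "real^'m::finite \<Rightarrow> complex"
  assumes R: "R > 0" and \<phi>: "\<phi> \<in> test_funs (ball 0 (2 * R))" and \<beta>: "\<beta> \<in> test_funs (ball 0 (2 * R))" "\<beta> 0 = 1"
  shows "(\<Sum>\<^sub>\<infinity>k. fourier \<phi> (lattice_freq R k)) = \<phi> 0 * (\<Sum>\<^sub>\<infinity>k. fourier \<beta> (lattice_freq R k))"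
proof -
  let ?T = "\<lambda>\<phi>. \<Sum>\<^sub>\<infinity>k. fourier \<phi> (lattice_freq R k :: real^'m)"
  have summ: "(\<lambda>k. fourier f (lattice_freq R k)) summable_on UNIV" if "f \<in> test_funs (ball 0 (2 * R))" for f :: "real^'m \<Rightarrow> complex"
    using abs_summable_summable[OF rapid_coeffs_abs_summable[OF fourier_coeffs_rapid[OF R test_funs_mono[OF that subset_UNIV]]]] .
  have shift: "?T (\<lambda>x. wave (lattice_freq R (unit_index i)) x * \<psi> x) = ?T \<psi>" for \<psi> i
  proof -
    have "?T (\<lambda>x. wave (lattice_freq R (unit_index i)) x * \<psi> x) = (\<Sum>\<^sub>\<infinity>k. fourier \<psi> (lattice_freq R (\<lambda>j. k j - unit_index i j)))"
      by (simp add: fourier_wave lattice_freq_diff)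
    also have "\<dots> = ?T \<psi>"
      by (rule infsum_reindex_bij_witness[where i = "\<lambda>k j. k j + unit_index i j" and j = "\<lambda>k j. k j - unit_index i j"]) auto
    finally show ?thesis .
  qed
  have zero: "?T f = 0" if f: "f \<in> test_funs (ball 0 (2 * R))" "f 0 = 0" for f :: "real^'m \<Rightarrow> complex"
  proof -
    obtain \<psi> where \<psi>: "\<And>i. \<psi> i \<in> test_funs (ball 0 (2 * R))"
      "\<And>x. f x = (\<Sum>i\<in>UNIV. (wave (lattice_freq R (unit_index i)) x - 1) * \<psi> i x)"
      using test_fun_division[OF R f] by blast
    let ?e = "\<lambda>i x. wave (lattice_freq R (unit_index i)) x * \<psi> i x"
    have e: "?e i \<in> test_funs (ball 0 (2 * R))" for i by (rule test_funs_mult_UNIV(2)[OF \<psi>(1) smooth_on_wave[OF open_UNIV]])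
    have "f = (\<lambda>x. \<Sum>i\<in>UNIV. ?e i x + (- 1) * \<psi> i x)" using \<psi>(2) by (intro ext) (simp add: algebra_simps)
    then have "fourier f \<kappa> = (\<Sum>i\<in>UNIV. fourier (?e i) \<kappa> - fourier (\<psi> i) \<kappa>)" for \<kappa>
    proof -
      have "fourier (\<lambda>x. \<Sum>i\<in>UNIV. ?e i x + (- 1) * \<psi> i x) \<kappa> = (\<Sum>i\<in>UNIV. fourier (\<lambda>x. ?e i x + (- 1) * \<psi> i x) \<kappa>)"
        by (rule fourier_sum[where S = "ball 0 (2 * R)"]) (intro test_funs_add test_funs_cmult e \<psi>)
      also have "\<dots> = (\<Sum>i\<in>UNIV. fourier (?e i) \<kappa> - fourier (\<psi> i) \<kappa>)"
        using fourier_add[OF e test_funs_cmult[OF \<psi>(1), of "-1"]] by (simp add: fourier_cmult[of "-1", simplified])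
      finally show ?thesis using \<open>f = _\<close> by simp
    qed
    then have "?T f = (\<Sum>\<^sub>\<infinity>k. \<Sum>i\<in>UNIV. fourier (?e i) (lattice_freq R k) - fourier (\<psi> i) (lattice_freq R k))" by simp
    also have "\<dots> = 0"
    proof -
      have "((\<lambda>k. \<Sum>i\<in>UNIV. fourier (?e i) (lattice_freq R k) - fourier (\<psi> i) (lattice_freq R k)) has_sum (\<Sum>i\<in>UNIV. ?T (?e i) - ?T (\<psi> i))) UNIV"
        by (intro has_sum_finite_sum has_sum_diff has_sum_infsum summ e \<psi>(1)) 
      then show ?thesis by (simp add: shift infsumI)
    qed
    finally show ?thesis .
  qed
  have f: "(\<lambda>x. \<phi> x + (- \<phi> 0) * \<beta> x) \<in> test_funs (ball 0 (2 * R))" by (intro test_funs_add test_funs_cmult \<phi> \<beta>)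
  then have "?T (\<lambda>x. \<phi> x + (- \<phi> 0) * \<beta> x) = 0" using \<beta>(2) by (intro zero) auto
  moreover have "((\<lambda>k. fourier (\<lambda>x. \<phi> x + (- \<phi> 0) * \<beta> x) (lattice_freq R k)) has_sum ?T \<phi> + (- \<phi> 0) * ?T \<beta>) UNIV"
    unfolding fourier_add[OF \<phi> test_funs_cmult[OF \<beta>(1)]] fourier_cmult
    by (intro has_sum_add has_sum_cmult_right has_sum_infsum summ \<phi> \<beta>)
  ultimately show ?thesis by (simp add: infsumI)
qed

lemma fourier_translate:
  assumes "\<phi> \<in> test_funs UNIV"
  shows "fourier (\<lambda>y. \<phi> (y + x)) \<kappa> = fourier \<phi> \<kappa> * wave \<kappa> x"
proof -
  have "fourier (\<lambda>y. \<phi> (y + x)) \<kappa> = (LINT y|lborel. (\<phi> (y + x) * wave (- \<kappa>) (y + x)) * wave \<kappa> x)"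
    unfolding fourier_def
  proof (rule Bochner_Integration.integral_cong[OF refl])
    fix y
    have "wave (- \<kappa>) (y + x) * wave \<kappa> x = wave (- \<kappa>) y * (wave (- \<kappa>) x * wave \<kappa> x)" by (simp add: wave_add)
    also have "wave (- \<kappa>) x * wave \<kappa> x = 1" using wave_add(1)[of "- \<kappa>" \<kappa> x] by simp
    finally show "\<phi> (y + x) * wave (- \<kappa>) y = \<phi> (y + x) * wave (- \<kappa>) (y + x) * wave \<kappa> x" by (simp add: mult.assoc)
  qed
  also have "\<dots> = (LINT y|lborel. (\<phi> (y + x) * wave (- \<kappa>) (y + x))) * wave \<kappa> x" by simp
  also have "(LINT y|lborel. (\<phi> (y + x) * wave (- \<kappa>) (y + x))) = fourier \<phi> \<kappa>"
    unfolding fourier_def by (rule integral_translate[OF test_funs_wave[OF assms]])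
  finally show ?thesis .
qed

text \<open>At the origin this is \<open>sum_fourier_coeffs\<close>, and translation carries it to other points; the translated
  function is supported in the ball of radius \<open>2R\<close>, which is why the period is \<open>2R\<close>. The constant \<open>C\<close> relating
  the series to the function is nonzero: otherwise Parseval's identity for a bump function would give
  vanishing Fourier coefficients, in particular a vanishing integral.\<close>

lemma fourier_inversion:
  assumes R: "R > 0"
  obtains \<gamma> where "\<And>(\<phi> :: real^'m::finite \<Rightarrow> complex) x. \<phi> \<in> test_funs (ball 0 R) \<Longrightarrow> x \<in> ball 0 R \<Longrightarrow>
    \<phi> x = wave_series R (\<lambda>k. \<gamma> * fourier \<phi> (lattice_freq R k)) x"
proof -
  let ?B = "ball (0::real^'m) R" and ?B2 = "ball (0::real^'m) (2 * R)"
  have R2: "?B \<subseteq> ?B2" using R by auto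
  obtain \<beta> U where \<beta>: "\<beta> \<in> test_funs ?B" "\<And>x. \<beta> x = of_real (Re (\<beta> x))" "\<And>x. 0 \<le> Re (\<beta> x)" "{0} \<subseteq> U" "\<And>x. x \<in> U \<Longrightarrow> \<beta> x = 1"
    using test_bump[of "{0}" ?B] R by (metis centre_in_ball compact_sing empty_subsetI insert_subset open_ball)
  then have \<beta>0: "\<beta> 0 = 1" by auto
  have \<beta>2: "\<beta> \<in> test_funs ?B2" and \<beta>U: "\<beta> \<in> test_funs UNIV" by (rule test_funs_mono[OF \<beta>(1)], use R2 in auto)+
  define C where "C = (\<Sum>\<^sub>\<infinity>k. fourier \<beta> (lattice_freq R k))"
  let ?s = "\<lambda>\<phi>. wave_series R (\<lambda>k. fourier \<phi> (lattice_freq R k :: real^'m))"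
  have inv: "?s \<phi> x = \<phi> x * C" if \<phi>: "\<phi> \<in> test_funs ?B" and x: "x \<in> ?B" for \<phi> :: "real^'m \<Rightarrow> complex" and x
  proof -
    from \<phi> obtain K where K: "compact K" "K \<subseteq> ?B" "\<And>x. x \<notin> K \<Longrightarrow> \<phi> x = 0" by (rule test_funsE) blast
    have "(\<lambda>y. \<phi> (y + x)) \<in> test_funs ?B2"
    proof (rule test_funsI[OF open_ball, where K = "(\<lambda>y. y - x) ` K"])
      have "smooth_on ?B2 (\<lambda>y. y + x)" by (intro smooth_on_add smooth_on_id smooth_on_const open_ball)
      from smooth_on_compose[OF open_ball open_UNIV this test_funs_smooth[OF \<phi>]] show "smooth_on ?B2 (\<lambda>y. \<phi> (y + x))" by simp
      show "compact ((\<lambda>y. y - x) ` K)" by (intro compact_continuous_image K(1) continuous_intros)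
      show "(\<lambda>y. y - x) ` K \<subseteq> ?B2"
      proof clarsimp
        fix y assume "y \<in> K"
        then have "norm y < R" using K(2) by auto
        then show "norm (y - x) < 2 * R" using x norm_triangle_ineq4[of y x] by simp
      qed
      show "\<phi> (y + x) = 0" if "y \<notin> (\<lambda>y. y - x) ` K" for y
      proof (rule K(3))
        show "y + x \<notin> K" using that image_iff[of y "\<lambda>y. y - x" K] by force
      qed
    qed
    from sum_fourier_coeffs[OF R this \<beta>2 \<beta>0] show ?thesis
      unfolding wave_series_def C_def fourier_translate[OF test_funs_mono[OF \<phi> subset_UNIV]] by simp
  qed
  have "C \<noteq> 0"
  proof
    assume C: "C = 0"
    let ?b = "\<lambda>k. fourier \<beta> (lattice_freq R k :: real^'m)"
    have rb: "rapid_coeffs R ?b" by (rule fourier_coeffs_rapid[OF R \<beta>U])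
    have prod0: "(\<lambda>x. \<beta> x * ?s \<beta> x) = (\<lambda>x. 0)"
    proof
      fix x show "\<beta> x * ?s \<beta> x = 0"
        using inv[OF \<beta>(1), of x] C test_funs_outside[OF \<beta>(1), of x] by (cases "x \<in> ?B") auto
    qed
    have "((\<lambda>k. ?b k * (LINT x|lborel. \<beta> x * wave (lattice_freq R k) x)) has_sum (LINT x|lborel. \<beta> x * ?s \<beta> x)) UNIV"
      by (rule distribution_wave_series(1)[OF distribution_on_integral \<beta>U rb])
    moreover have "(LINT x|lborel. \<beta> x * wave (lattice_freq R k) x) = cnj (?b k)" for k
    proof -
      have r: "cnj (\<beta> x) = \<beta> x" for x by (subst (1 2) \<beta>(2)) simp
      have "cnj (?b k) = (LINT x|lborel. cnj (\<beta> x * wave (- lattice_freq R k) x))" by (simp only: fourier_def Bochner_Integration.integral_cnj)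
      also have "\<dots> = (LINT x|lborel. \<beta> x * wave (lattice_freq R k) x)"
        by (intro Bochner_Integration.integral_cong refl) (simp add: r wave_minus)
      finally show ?thesis by simp
    qed
    ultimately have "((\<lambda>k. ?b k * cnj (?b k)) has_sum 0) UNIV" by (simp add: prod0)
    then have "((\<lambda>k. of_real ((cmod (?b k))\<^sup>2) :: complex) has_sum of_real 0) UNIV" by (simp only: complex_norm_square of_real_0)
    then have hs: "((\<lambda>k. (cmod (?b k))\<^sup>2) has_sum 0) UNIV" by (simp only: has_sum_of_real_iff)
    have "?b (\<lambda>_. 0) = 0"
    proof -
      have "((\<lambda>k. (cmod (?b k))\<^sup>2) has_sum (cmod (?b (\<lambda>_. 0)))\<^sup>2) {\<lambda>_. 0}" using has_sum_finite[of "{\<lambda>_. 0}" "\<lambda>k. (cmod (?b k))\<^sup>2"] by simp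
      from has_sum_mono_neutral[OF this hs] have "(cmod (?b (\<lambda>_. 0)))\<^sup>2 \<le> 0" by simp
      then show ?thesis by simp
    qed
    moreover have "lattice_freq R (\<lambda>_. 0) = (0 :: real^'m)" by (simp add: lattice_freq_def vec_eq_iff)
    ultimately have "(LINT x|lborel. \<beta> x) = 0" by (simp add: fourier_def)
    then have "(LINT x|lborel. Re (\<beta> x)) = 0"
      using test_funs_integrable[OF \<beta>(1)] by (simp add: integral_Re)
    then have "Re (\<beta> 0) = 0"
      using \<beta>(3) by (intro integral_eq_0_continuous_nonneg[of "\<lambda>x. Re (\<beta> x)"] integrable_Re test_funs_integrable[OF \<beta>(1)]
        continuous_intros smooth_on_continuous test_funs_smooth[OF \<beta>(1)])
    then show False using \<beta>0 by simp
  qed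
  show ?thesis
  proof (rule that[of "inverse C"])
    fix \<phi> :: "real^'m \<Rightarrow> complex" and x assume \<phi>: "\<phi> \<in> test_funs ?B" and x: "x \<in> ?B"
    have "wave_series R (\<lambda>k. inverse C * fourier \<phi> (lattice_freq R k)) x = inverse C * ?s \<phi> x"
      unfolding wave_series_def mult.assoc
      by (intro infsum_cmult_right wave_series_summable fourier_coeffs_rapid[OF R] test_funs_mono[OF \<phi> subset_UNIV])
    then show "\<phi> x = wave_series R (\<lambda>k. inverse C * fourier \<phi> (lattice_freq R k)) x" using inv[OF \<phi> x] \<open>C \<noteq> 0\<close> by simp
  qed
qed

lemma rapid_coeffs_cmult: "rapid_coeffs R a \<Longrightarrow> rapid_coeffs R (\<lambda>k. c * a k)"
  by (rule rapid_coeffs_bounded_mult[where B = "cmod c" and M = 0]) auto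


section \<open>Wavefront sets and smoothness on Euclidean space\<close>

definition rapid_decay_on :: "'e::real_normed_vector set \<Rightarrow> ('e \<Rightarrow> complex) \<Rightarrow> bool" where
  "rapid_decay_on C u \<longleftrightarrow> (\<forall>k::nat. \<exists>B. \<forall>\<eta>\<in>C. (1 + norm \<eta>) ^ k * cmod (u \<eta>) \<le> B)"

lemma compact_in_ball:
  fixes K :: "'e::euclidean_space set"
  assumes "compact K" obtains R where "R > 0" "K \<subseteq> ball 0 R"
proof -
  obtain B where "\<And>x. x \<in> K \<Longrightarrow> norm x \<le> B" using compact_imp_bounded[OF assms] unfolding bounded_iff by blast
  then have "norm x < max B 0 + 1" if "x \<in> K" for x using that by (smt (verit) max.cobounded1)
  then show ?thesis by (intro that[of "max B 0 + 1"]) auto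
qed

text \<open>Multiplication by a smooth function averages the localized Fourier transform over frequency shifts
  \<open>\<kappa>\<close> with rapidly decreasing weights. Shifts that are small compared with \<open>\<eta>\<close> stay in the larger cone,
  and for large ones the polynomial growth is compensated by the weights.\<close>

lemma rapid_decay_smooth_mult:
  fixes v :: "(real^'m::finite \<Rightarrow> complex) \<Rightarrow> complex"
  assumes v: "distribution_on S v" and \<rho>: "\<rho> \<in> test_funs S" and \<phi>: "smooth_on UNIV \<phi>"
    and decay: "rapid_decay_on C (\<lambda>\<eta>. v (\<lambda>x. \<rho> x * wave (- \<eta>) x))"
    and \<delta>: "0 < \<delta>" "\<delta> \<le> 1 / 2" and CC': "\<And>\<eta> \<kappa>. \<eta> \<in> C' \<Longrightarrow> norm \<kappa> < \<delta> * norm \<eta> \<Longrightarrow> \<eta> - \<kappa> \<in> C"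
  shows "rapid_decay_on C' (\<lambda>\<eta>. v (\<lambda>x. \<rho> x * \<phi> x * wave (- \<eta>) x))"
  unfolding rapid_decay_on_def
proof
  fix p :: nat
  let ?u = "\<lambda>\<eta>. v (\<lambda>x. \<rho> x * wave (- \<eta>) x)"
  obtain M B0 where B0: "\<And>\<eta>. cmod (v (\<lambda>x. \<rho> x * wave \<eta> x)) \<le> B0 * (1 + norm \<eta>) ^ M"
    using distribution_wave_growth[OF v \<rho>] by blast
  have B00: "0 \<le> B0" using order_trans[OF norm_ge_zero B0[of 0]] by simp
  obtain Bp where Bp: "\<And>\<eta>. \<eta> \<in> C \<Longrightarrow> (1 + norm \<eta>) ^ p * cmod (?u \<eta>) \<le> Bp"
    using decay unfolding rapid_decay_on_def by blast
  let ?Bp = "max Bp 0"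
  \<comment> \<open>the first summand bounds the contribution of the small shifts, the second that of the large ones\<close>
  define D where "D = 2 ^ p * ?Bp + (1 / \<delta>) ^ p * B0 * (1 / \<delta>) ^ M"
  have d1: "1 \<le> 1 / \<delta>" using \<delta> by simp
  have est: "(1 + norm \<eta>) ^ p * cmod (?u (\<eta> - \<kappa>)) \<le> D * (1 + norm \<kappa>) ^ (p + 2 * M)" if \<eta>: "\<eta> \<in> C'" for \<eta> \<kappa>
  proof (cases "norm \<kappa> < \<delta> * norm \<eta>")
    case True
    have "norm \<eta> \<le> norm (\<eta> - \<kappa>) + norm \<kappa>" using norm_triangle_ineq[of "\<eta> - \<kappa>" \<kappa>] by simp
    moreover have "norm \<kappa> \<le> norm \<eta> / 2" using True mult_right_mono[OF \<delta>(2), of "norm \<eta>"] by simp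
    ultimately have "1 + norm \<eta> \<le> 2 * (1 + norm (\<eta> - \<kappa>))" by simp
    then have "(1 + norm \<eta>) ^ p \<le> (2 * (1 + norm (\<eta> - \<kappa>))) ^ p" by (intro power_mono) auto
    then have "(1 + norm \<eta>) ^ p * cmod (?u (\<eta> - \<kappa>)) \<le> (2 * (1 + norm (\<eta> - \<kappa>))) ^ p * cmod (?u (\<eta> - \<kappa>))"
      by (intro mult_right_mono) auto
    also have "\<dots> = 2 ^ p * ((1 + norm (\<eta> - \<kappa>)) ^ p * cmod (?u (\<eta> - \<kappa>)))" by (simp only: power_mult_distrib mult.assoc)
    also have "\<dots> \<le> 2 ^ p * ?Bp" using Bp[OF CC'[OF \<eta> True]] by (intro mult_left_mono) auto
    also have "\<dots> \<le> D" using B00 \<delta> by (simp add: D_def)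
    also have "\<dots> \<le> D * (1 + norm \<kappa>) ^ (p + 2 * M)"
    proof -
      have "D \<ge> 0" using B00 \<delta> by (simp add: D_def)
      moreover have "1 \<le> (1 + norm \<kappa>) ^ (p + 2 * M)" by (rule one_le_power) simp
      ultimately show ?thesis using mult_left_mono[of 1 "(1 + norm \<kappa>) ^ (p + 2 * M)" D] by simp
    qed
    finally show ?thesis .
  next
    case False
    then have "norm \<eta> \<le> 1 / \<delta> * norm \<kappa>" using \<delta> by (simp add: field_simps)
    then have 1: "1 + norm \<eta> \<le> 1 / \<delta> * (1 + norm \<kappa>)" using d1 by (simp add: distrib_left)
    have "1 + norm (\<eta> - \<kappa>) \<le> (1 + norm \<eta>) * (1 + norm \<kappa>)"
      using norm_triangle_ineq4[of \<eta> \<kappa>] mult_nonneg_nonneg[OF norm_ge_zero[of \<eta>] norm_ge_zero[of \<kappa>]]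
      by (simp only: distrib_left distrib_right mult_1 mult_1_right)
    also have "\<dots> \<le> 1 / \<delta> * (1 + norm \<kappa>) * (1 + norm \<kappa>)" using 1 by (intro mult_right_mono) auto
    finally have 2: "1 + norm (- (\<eta> - \<kappa>)) \<le> 1 / \<delta> * (1 + norm \<kappa>) ^ 2" by (simp add: power2_eq_square norm_minus_commute)
    have "(1 + norm \<eta>) ^ p * cmod (?u (\<eta> - \<kappa>)) \<le> (1 / \<delta> * (1 + norm \<kappa>)) ^ p * (B0 * (1 / \<delta> * (1 + norm \<kappa>) ^ 2) ^ M)"
    proof (intro mult_mono power_mono 1)
      have "cmod (?u (\<eta> - \<kappa>)) \<le> B0 * (1 + norm (- (\<eta> - \<kappa>))) ^ M" by (rule B0)
      also have "\<dots> \<le> B0 * (1 / \<delta> * (1 + norm \<kappa>) ^ 2) ^ M" by (intro mult_left_mono power_mono 2 B00) auto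
      finally show "cmod (?u (\<eta> - \<kappa>)) \<le> B0 * (1 / \<delta> * (1 + norm \<kappa>) ^ 2) ^ M" .
    qed (use \<delta> in auto)
    also have "\<dots> = ((1 / \<delta>) ^ p * B0 * (1 / \<delta>) ^ M) * (1 + norm \<kappa>) ^ (p + 2 * M)"
      by (simp only: power_mult_distrib power_add power_mult[symmetric] mult_ac)
    also have "\<dots> \<le> D * (1 + norm \<kappa>) ^ (p + 2 * M)" by (intro mult_right_mono) (auto simp: D_def)
    finally show ?thesis .
  qed
  from \<rho> obtain K where K: "compact K" "K \<subseteq> S" "\<And>x. x \<notin> K \<Longrightarrow> \<rho> x = 0" by (rule test_funsE) blast
  obtain R where R: "R > 0" "K \<subseteq> ball 0 R" using compact_in_ball[OF K(1)] by blast
  obtain \<beta> U where \<beta>: "\<beta> \<in> test_funs (ball 0 R)" "K \<subseteq> U" "\<And>x. x \<in> U \<Longrightarrow> \<beta> x = 1"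
    using test_bump[OF K(1) open_ball R(2)] by metis
  have \<beta>\<phi>: "(\<lambda>x. \<beta> x * \<phi> x) \<in> test_funs (ball 0 R)" by (rule test_funs_mult_UNIV(1)[OF \<beta>(1) \<phi>])
  obtain \<gamma> where \<gamma>: "\<And>(\<phi> :: real^'m \<Rightarrow> complex) x. \<phi> \<in> test_funs (ball 0 R) \<Longrightarrow> x \<in> ball 0 R \<Longrightarrow>
    \<phi> x = wave_series R (\<lambda>k. \<gamma> * fourier \<phi> (lattice_freq R k)) x" using fourier_inversion[OF R(1)] by blast
  define a where "a k = \<gamma> * fourier (\<lambda>x. \<beta> x * \<phi> x) (lattice_freq R k)" for k
  have a: "rapid_coeffs R a"
    unfolding a_def by (intro rapid_coeffs_cmult fourier_coeffs_rapid R test_funs_mono[OF \<beta>\<phi> subset_UNIV])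
  have eq: "\<rho> x * \<phi> x * wave (- \<eta>) x = \<rho> x * wave (- \<eta>) x * wave_series R a x" for x \<eta>
  proof (cases "x \<in> K")
    case True
    then have "x \<in> ball 0 R" "\<beta> x = 1" using R \<beta> by auto
    then show ?thesis using \<gamma>[OF \<beta>\<phi>, of x] unfolding a_def by simp
  qed (simp add: K(3))
  let ?w = "\<lambda>k. (1 + norm (lattice_freq R k :: real^'m)) ^ (p + 2 * M)"
  have sw: "(\<lambda>k. cmod (a k) * ?w k) summable_on UNIV" using a unfolding rapid_coeffs_def by blast
  have "(1 + norm \<eta>) ^ p * cmod (v (\<lambda>x. \<rho> x * \<phi> x * wave (- \<eta>) x)) \<le> D * (\<Sum>\<^sub>\<infinity>k. cmod (a k) * ?w k)" if \<eta>: "\<eta> \<in> C'" for \<eta>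
  proof -
    let ?\<rho> = "\<lambda>x. \<rho> x * wave (- \<eta>) x"
    have \<rho>': "?\<rho> \<in> test_funs S" by (rule test_funs_wave[OF \<rho>])
    have u: "v (\<lambda>x. ?\<rho> x * wave (lattice_freq R k) x) = ?u (\<eta> - lattice_freq R k)" for k
      by (simp add: wave_add(1)[symmetric] mult.assoc)
    note ds = distribution_wave_series[OF v \<rho>' a, unfolded u]
    have sa: "(\<lambda>k. cmod (a k * ?u (\<eta> - lattice_freq R k))) summable_on UNIV"
      using rapid_coeffs_abs_summable[OF ds(2)] by (simp add: mult.commute)
    have sb: "(\<lambda>k. (1 + norm \<eta>) ^ p * cmod (a k * ?u (\<eta> - lattice_freq R k))) summable_on UNIV"
      by (rule summable_on_cmult_right[OF sa])
    have sc: "(\<lambda>k. D * (cmod (a k) * ?w k)) summable_on UNIV" by (rule summable_on_cmult_right[OF sw])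
    have "v (\<lambda>x. \<rho> x * \<phi> x * wave (- \<eta>) x) = (\<Sum>\<^sub>\<infinity>k. a k * ?u (\<eta> - lattice_freq R k))"
      unfolding eq by (rule infsumI[OF ds(1), symmetric])
    then have "cmod (v (\<lambda>x. \<rho> x * \<phi> x * wave (- \<eta>) x)) \<le> (\<Sum>\<^sub>\<infinity>k. cmod (a k * ?u (\<eta> - lattice_freq R k)))"
      using norm_infsum_bound[OF sa] by simp
    then have "(1 + norm \<eta>) ^ p * cmod (v (\<lambda>x. \<rho> x * \<phi> x * wave (- \<eta>) x)) \<le> (1 + norm \<eta>) ^ p * (\<Sum>\<^sub>\<infinity>k. cmod (a k * ?u (\<eta> - lattice_freq R k)))"
      by (intro mult_left_mono) auto
    also have "\<dots> = (\<Sum>\<^sub>\<infinity>k. (1 + norm \<eta>) ^ p * cmod (a k * ?u (\<eta> - lattice_freq R k)))"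
      by (rule infsum_cmult_right[OF sa, symmetric])
    also have "\<dots> \<le> (\<Sum>\<^sub>\<infinity>k. D * (cmod (a k) * ?w k))"
    proof (rule infsum_mono[OF sb sc])
      fix k
      have "(1 + norm \<eta>) ^ p * cmod (a k * ?u (\<eta> - lattice_freq R k)) = cmod (a k) * ((1 + norm \<eta>) ^ p * cmod (?u (\<eta> - lattice_freq R k)))"
        by (simp add: norm_mult mult_ac)
      also have "\<dots> \<le> cmod (a k) * (D * ?w k)" by (intro mult_left_mono est \<eta>) auto
      finally show "(1 + norm \<eta>) ^ p * cmod (a k * ?u (\<eta> - lattice_freq R k)) \<le> D * (cmod (a k) * ?w k)" by (simp add: mult_ac)
    qed
    also have "\<dots> = D * (\<Sum>\<^sub>\<infinity>k. cmod (a k) * ?w k)" by (rule infsum_cmult_right[OF sw])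
    finally show ?thesis .
  qed
  then show "\<exists>B. \<forall>\<eta>\<in>C'. (1 + norm \<eta>) ^ p * cmod (v (\<lambda>x. \<rho> x * \<phi> x * wave (- \<eta>) x)) \<le> B" by blast
qed

lemma wavefront_euclideanD:
  assumes "(x, \<xi>) \<notin> wavefront_euclidean S v" "x \<in> S" "\<xi> \<noteq> 0"
  obtains \<rho> C where "\<rho> \<in> test_funs S" "\<rho> x \<noteq> 0" "open C" "\<xi> \<in> C" "\<And>\<eta> t. \<eta> \<in> C \<Longrightarrow> t > 0 \<Longrightarrow> t *\<^sub>R \<eta> \<in> C"
    "rapid_decay_on C (\<lambda>\<eta>. v (\<lambda>x. \<rho> x * wave (- \<eta>) x))"
proof -
  from assms obtain \<rho> K C where \<rho>: "smooth_on UNIV \<rho>" "compact K" "K \<subseteq> S" "\<forall>y. y \<notin> K \<longrightarrow> \<rho> y = 0" "\<rho> x \<noteq> 0"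
    "open C" "\<xi> \<in> C" "\<forall>\<eta>\<in>C. \<forall>t>0. t *\<^sub>R \<eta> \<in> C"
    "\<forall>k::nat. \<exists>B. \<forall>\<eta>\<in>C. (1 + norm \<eta>) ^ k * cmod (v (\<lambda>y. \<rho> y * exp (- (\<i> * of_real (\<eta> \<bullet> y))))) \<le> B"
    unfolding wavefront_euclidean_def by blast
  show ?thesis
  proof (rule that[of \<rho> C])
    show "\<rho> \<in> test_funs S" using \<rho>(1-4) unfolding test_funs_def by blast
    show "rapid_decay_on C (\<lambda>\<eta>. v (\<lambda>x. \<rho> x * wave (- \<eta>) x))"
      using \<rho>(9) unfolding rapid_decay_on_def wave_def by (simp add: inner_minus_left)
  qed (use \<rho> in auto)
qed

text \<open>Over each direction there is a cutoff function that works near it. By compactness of the sphere finitely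
  many of them suffice, and their product works for all directions: relative to each factor the rest of
  the product is a smooth multiplier, at the price of halving the radius of the cone.\<close>

lemma rapid_decay_all_directions:
  fixes v :: "(real^'m::finite \<Rightarrow> complex) \<Rightarrow> complex"
  assumes v: "distribution_on S v" and x: "x \<in> S" and wf: "\<And>\<xi>. (x, \<xi>) \<notin> wavefront_euclidean S v"
  obtains \<rho> where "\<rho> \<in> test_funs S" "\<rho> x \<noteq> 0" "rapid_decay_on UNIV (\<lambda>\<eta>. v (\<lambda>y. \<rho> y * wave (- \<eta>) y))"
proof -
  let ?S = "sphere (0::real^'m) 1"
  have "\<exists>\<rho> r. \<rho> \<in> test_funs S \<and> \<rho> x \<noteq> 0 \<and> r > 0 \<and> r \<le> 1 \<and>
    rapid_decay_on {t *\<^sub>R w | t w. t > 0 \<and> w \<in> ball \<xi> r} (\<lambda>\<eta>. v (\<lambda>x. \<rho> x * wave (- \<eta>) x))" if "\<xi> \<in> ?S" for \<xi>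
  proof -
    have "\<xi> \<noteq> 0" using that by auto
    from wavefront_euclideanD[OF wf x this] obtain \<rho> C where \<rho>: "\<rho> \<in> test_funs S" "\<rho> x \<noteq> 0" "open C" "\<xi> \<in> C" "\<And>\<eta> t. \<eta> \<in> C \<Longrightarrow> t > 0 \<Longrightarrow> t *\<^sub>R \<eta> \<in> C"
      "rapid_decay_on C (\<lambda>\<eta>. v (\<lambda>x. \<rho> x * wave (- \<eta>) x))" by blast
    then obtain r where r: "r > 0" "ball \<xi> r \<subseteq> C" using open_contains_ball by blast
    have "{t *\<^sub>R w | t w. t > 0 \<and> w \<in> ball \<xi> (min r 1)} \<subseteq> C" using r \<rho>(5) by auto
    with \<rho>(6) have "rapid_decay_on {t *\<^sub>R w | t w. t > 0 \<and> w \<in> ball \<xi> (min r 1)} (\<lambda>\<eta>. v (\<lambda>x. \<rho> x * wave (- \<eta>) x))"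
      unfolding rapid_decay_on_def by blast
    with \<rho>(1,2) r(1) show ?thesis by (intro exI[of _ \<rho>] exI[of _ "min r 1"]) auto
  qed
  then have "\<forall>\<xi>\<in>?S. \<exists>\<rho> r. \<rho> \<in> test_funs S \<and> \<rho> x \<noteq> 0 \<and> r > 0 \<and> r \<le> 1 \<and>
    rapid_decay_on {t *\<^sub>R w | t w. t > 0 \<and> w \<in> ball \<xi> r} (\<lambda>\<eta>. v (\<lambda>x. \<rho> x * wave (- \<eta>) x))" by blast
  from bchoice[OF this] obtain \<rho> where "\<forall>\<xi>\<in>?S. \<exists>r. \<rho> \<xi> \<in> test_funs S \<and> \<rho> \<xi> x \<noteq> 0 \<and> r > 0 \<and> r \<le> 1 \<and>
    rapid_decay_on {t *\<^sub>R w | t w. t > 0 \<and> w \<in> ball \<xi> r} (\<lambda>\<eta>. v (\<lambda>x. \<rho> \<xi> x * wave (- \<eta>) x))" by blast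
  from bchoice[OF this] obtain r where \<rho>: "\<And>\<xi>. \<xi> \<in> ?S \<Longrightarrow> \<rho> \<xi> \<in> test_funs S" "\<And>\<xi>. \<xi> \<in> ?S \<Longrightarrow> \<rho> \<xi> x \<noteq> 0"
    and r: "\<And>\<xi>. \<xi> \<in> ?S \<Longrightarrow> r \<xi> > 0" "\<And>\<xi>. \<xi> \<in> ?S \<Longrightarrow> r \<xi> \<le> 1"
    and dec: "\<And>\<xi>. \<xi> \<in> ?S \<Longrightarrow> rapid_decay_on {t *\<^sub>R w | t w. t > 0 \<and> w \<in> ball \<xi> (r \<xi>)} (\<lambda>\<eta>. v (\<lambda>x. \<rho> \<xi> x * wave (- \<eta>) x))"
    by blast
  obtain F where F: "F \<subseteq> ?S" "finite F" "?S \<subseteq> (\<Union>\<xi>\<in>F. ball \<xi> (r \<xi> / 2))"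
  proof (rule compactE_image[OF compact_sphere[of 0 1], of ?S "\<lambda>\<xi>. ball \<xi> (r \<xi> / 2)"])
    show "?S \<subseteq> (\<Union>\<xi>\<in>?S. ball \<xi> (r \<xi> / 2))" using r by force
  qed auto
  \<comment> \<open>the product of the cutoff functions is supported in \<open>S\<close> because it is not empty\<close>
  have "axis undefined 1 \<in> ?S" by (simp add: norm_axis_1)
  with F(3) obtain \<xi>0 where \<xi>0: "\<xi>0 \<in> F" by blast
  let ?\<rho> = "\<lambda>x. \<Prod>\<xi>\<in>F. \<rho> \<xi> x"
  have sm: "smooth_on UNIV (\<lambda>x. \<Prod>\<xi>\<in>F - {\<xi>}. \<rho> \<xi> x)" for \<xi>
    using F(1) by (intro smooth_on_prod open_UNIV test_funs_smooth[OF \<rho>(1)]) blast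
  have split: "?\<rho> y = \<rho> \<xi> y * (\<Prod>\<xi>\<in>F - {\<xi>}. \<rho> \<xi> y)" if "\<xi> \<in> F" for \<xi> y
    using that F(2) by (simp add: prod.remove)
  show ?thesis
  proof (rule that[of ?\<rho>])
    show "?\<rho> \<in> test_funs S"
      unfolding split[OF \<xi>0] using \<xi>0 F(1) by (intro test_funs_mult_UNIV(1) \<rho>(1) sm) auto
    show "?\<rho> x \<noteq> 0" using F \<rho>(2) by (auto simp: prod_zero_iff)
    let ?C' = "\<lambda>\<xi>. {t *\<^sub>R w | t w. t > 0 \<and> w \<in> ?S \<and> w \<in> ball \<xi> (r \<xi> / 2)}"
    have dec': "rapid_decay_on (?C' \<xi>) (\<lambda>\<eta>. v (\<lambda>y. ?\<rho> y * wave (- \<eta>) y))" if \<xi>: "\<xi> \<in> F" for \<xi>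
      unfolding split[OF \<xi>]
    proof (rule rapid_decay_smooth_mult[OF v \<rho>(1) sm dec, where \<delta> = "r \<xi> / 2"])
      show "\<xi> \<in> ?S" "\<xi> \<in> ?S" "0 < r \<xi> / 2" "r \<xi> / 2 \<le> 1 / 2" using \<xi> F(1) r[of \<xi>] by auto
      fix \<eta> \<kappa> :: "real^'m" assume "\<eta> \<in> ?C' \<xi>" and \<kappa>: "norm \<kappa> < r \<xi> / 2 * norm \<eta>"
      then obtain t w where tw: "\<eta> = t *\<^sub>R w" "t > 0" "w \<in> ?S" "w \<in> ball \<xi> (r \<xi> / 2)" by blast
      have "norm ((1 / t) *\<^sub>R \<kappa>) < r \<xi> / 2" using \<kappa> tw by (simp add: field_simps)
      moreover have "dist \<xi> (w - (1 / t) *\<^sub>R \<kappa>) \<le> dist \<xi> w + norm ((1 / t) *\<^sub>R \<kappa>)"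
        using norm_triangle_ineq[of "\<xi> - w" "(1 / t) *\<^sub>R \<kappa>"] by (simp add: dist_norm algebra_simps)
      ultimately have "w - (1 / t) *\<^sub>R \<kappa> \<in> ball \<xi> (r \<xi>)" using tw(4) unfolding mem_ball by linarith
      moreover have "\<eta> - \<kappa> = t *\<^sub>R (w - (1 / t) *\<^sub>R \<kappa>)" using tw by (simp add: scaleR_diff_right)
      ultimately show "\<eta> - \<kappa> \<in> {t *\<^sub>R w | t w. t > 0 \<and> w \<in> ball \<xi> (r \<xi>)}" using tw(2) by blast
    qed
    show "rapid_decay_on UNIV (\<lambda>\<eta>. v (\<lambda>y. ?\<rho> y * wave (- \<eta>) y))"
      unfolding rapid_decay_on_def
    proof
      fix k :: nat
      let ?f = "\<lambda>\<eta>. (1 + norm \<eta>) ^ k * cmod (v (\<lambda>y. ?\<rho> y * wave (- \<eta>) y))"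
      have "\<forall>\<xi>\<in>F. \<exists>B. \<forall>\<eta>\<in>?C' \<xi>. ?f \<eta> \<le> B" using dec' unfolding rapid_decay_on_def by blast
      from bchoice[OF this] obtain B where B: "\<And>\<xi> \<eta>. \<xi> \<in> F \<Longrightarrow> \<eta> \<in> ?C' \<xi> \<Longrightarrow> ?f \<eta> \<le> B \<xi>" by blast
      have "?f \<eta> \<le> (\<Sum>\<xi>\<in>F. max 0 (B \<xi>)) + ?f 0" for \<eta>
      proof (cases "\<eta> = 0")
        case False
        have unit: "(1 / norm \<eta>) *\<^sub>R \<eta> \<in> ?S" using False by simp
        with F(3) obtain \<xi> where \<xi>: "\<xi> \<in> F" "(1 / norm \<eta>) *\<^sub>R \<eta> \<in> ball \<xi> (r \<xi> / 2)" by blast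
        have "\<eta> = norm \<eta> *\<^sub>R ((1 / norm \<eta>) *\<^sub>R \<eta>)" "norm \<eta> > 0" using False by auto
        then have "\<eta> \<in> ?C' \<xi>" using \<xi>(2) unit by blast
        then have "?f \<eta> \<le> max 0 (B \<xi>)" using B[OF \<xi>(1)] by (simp add: le_max_iff_disj)
        also have "\<dots> \<le> (\<Sum>\<xi>\<in>F. max 0 (B \<xi>))" using F(2) \<xi>(1) by (intro member_le_sum) auto
        finally show ?thesis by (simp add: add_increasing2)
      qed (auto intro!: sum_nonneg)
      then show "\<exists>B. \<forall>\<eta>\<in>UNIV. ?f \<eta> \<le> B" by blast
    qed
  qed
qed

text \<open>Applied termwise to the expansion of a test function \<open>g\<close> in waves, \<open>v\<close> becomes a pairing of the Fourier
  coefficients of \<open>g\<close> with those of \<open>\<rho> v\<close>, taken at opposite frequencies. The series with the latter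
  coefficients is the smooth function.\<close>

lemma distribution_smooth_of_rapid_decay:
  fixes v :: "(real^'m::finite \<Rightarrow> complex) \<Rightarrow> complex"
  assumes v: "distribution_on S v" and \<rho>: "\<rho> \<in> test_funs S"
    and decay: "rapid_decay_on UNIV (\<lambda>\<eta>. v (\<lambda>y. \<rho> y * wave (- \<eta>) y))" and R: "R > 0" "\<And>x. x \<notin> ball 0 R \<Longrightarrow> \<rho> x = 0"
  obtains h where "smooth_on UNIV h" "\<And>g. g \<in> test_funs (ball 0 R) \<Longrightarrow> v (\<lambda>x. \<rho> x * g x) = (LINT x|lborel. g x * h x)"
proof -
  obtain \<gamma> where \<gamma>: "\<And>(\<phi> :: real^'m \<Rightarrow> complex) x. \<phi> \<in> test_funs (ball 0 R) \<Longrightarrow> x \<in> ball 0 R \<Longrightarrow>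
    \<phi> x = wave_series R (\<lambda>k. \<gamma> * fourier \<phi> (lattice_freq R k)) x" using fourier_inversion[OF R(1)] by blast
  let ?u = "\<lambda>\<eta>. v (\<lambda>y. \<rho> y * wave \<eta> y)"
  define a where "a k = \<gamma> * ?u (- lattice_freq R k)" for k
  have a: "rapid_coeffs R a"
    unfolding a_def
  proof (intro rapid_coeffs_cmult rapid_coeffsI[OF R(1)])
    fix p show "\<exists>B. \<forall>k. cmod (?u (- lattice_freq R k)) * (1 + norm (lattice_freq R k :: real^'m)) ^ p \<le> B"
    proof -
      obtain B where "\<And>\<eta>. (1 + norm \<eta>) ^ p * cmod (?u (- \<eta>)) \<le> B" using decay unfolding rapid_decay_on_def by blast
      then show ?thesis by (subst mult.commute) blast
    qed
  qed
  show ?thesis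
  proof (rule that[of "wave_series R a"])
    show "smooth_on UNIV (wave_series R a)" by (rule smooth_on_wave_series[OF a])
    fix g :: "real^'m \<Rightarrow> complex" assume g: "g \<in> test_funs (ball 0 R)"
    then have gU: "g \<in> test_funs UNIV" by (rule test_funs_mono) simp
    let ?c = "\<lambda>k. \<gamma> * fourier g (lattice_freq R k)"
    have c: "rapid_coeffs R ?c" by (intro rapid_coeffs_cmult fourier_coeffs_rapid R gU)
    have "\<rho> x * g x = \<rho> x * wave_series R ?c x" for x
      using \<gamma>[OF g, of x] R(2)[of x] by (cases "x \<in> ball 0 R") auto
    then have "(\<lambda>x. \<rho> x * g x) = (\<lambda>x. \<rho> x * wave_series R ?c x)" by (intro ext)
    then have "v (\<lambda>x. \<rho> x * g x) = (\<Sum>\<^sub>\<infinity>k. ?c k * ?u (lattice_freq R k))"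
      using distribution_wave_series(1)[OF v \<rho> c] by (simp add: infsumI)
    also have "\<dots> = (\<Sum>\<^sub>\<infinity>k. a k * (LINT x|lborel. g x * wave (lattice_freq R k) x))"
    proof (rule infsum_reindex_bij_witness[where i = "\<lambda>k i. - k i" and j = "\<lambda>k i. - k i"])
      fix k :: "'m \<Rightarrow> int"
      show "a (\<lambda>i. - k i) * (LINT x|lborel. g x * wave (lattice_freq R (\<lambda>i. - k i)) x) = ?c k * ?u (lattice_freq R k)"
        unfolding a_def lattice_freq_minus[symmetric] by (simp add: fourier_def)
    qed auto
    also have "\<dots> = (LINT x|lborel. g x * wave_series R a x)"
      by (rule infsumI[OF distribution_wave_series(1)[OF distribution_on_integral gU a]])
    finally show "v (\<lambda>x. \<rho> x * g x) = (LINT x|lborel. g x * wave_series R a x)" .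
  qed
qed

text \<open>Near \<open>x\<close> the cutoff \<open>\<rho>\<close> can be divided out again.\<close>

lemma locally_smooth_of_wavefront:
  fixes v :: "(real^'m::finite \<Rightarrow> complex) \<Rightarrow> complex"
  assumes S: "open S" and v: "distribution_on S v" and x: "x \<in> S" and wf: "\<And>\<xi>. (x, \<xi>) \<notin> wavefront_euclidean S v"
  shows "\<exists>N h. open N \<and> x \<in> N \<and> N \<subseteq> S \<and> smooth_on N h \<and> (\<forall>f\<in>test_funs N. v f = (LINT y|lborel. f y * h y))"
proof -
  obtain \<rho> where \<rho>: "\<rho> \<in> test_funs S" "\<rho> x \<noteq> 0" "rapid_decay_on UNIV (\<lambda>\<eta>. v (\<lambda>y. \<rho> y * wave (- \<eta>) y))"
    using rapid_decay_all_directions[OF v x wf] by blast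
  from \<rho>(1) obtain K where K: "compact K" "K \<subseteq> S" "\<And>x. x \<notin> K \<Longrightarrow> \<rho> x = 0" by (rule test_funsE) blast
  obtain R where R: "R > 0" "K \<subseteq> ball 0 R" using compact_in_ball[OF K(1)] by blast
  obtain h where h: "smooth_on UNIV h" "\<And>g. g \<in> test_funs (ball 0 R) \<Longrightarrow> v (\<lambda>x. \<rho> x * g x) = (LINT x|lborel. g x * h x)"
    by (rule distribution_smooth_of_rapid_decay[OF v \<rho>(1,3) R(1)]) (use K(3) R(2) in blast)+
  let ?N = "{y. \<rho> y \<noteq> 0}"
  have N: "open ?N" by (intro open_Collect_neq continuous_on_const smooth_on_continuous test_funs_smooth[OF \<rho>(1)])
  have NK: "?N \<subseteq> K" using K(3) by blast
  have inv: "smooth_on ?N (\<lambda>y. inverse (\<rho> y))"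
    by (intro smooth_on_inverse N smooth_on_subset[OF test_funs_smooth[OF \<rho>(1)]]) auto
  have "v f = (LINT y|lborel. f y * (inverse (\<rho> y) * h y))" if f: "f \<in> test_funs ?N" for f
  proof -
    have g: "(\<lambda>y. f y * inverse (\<rho> y)) \<in> test_funs ?N" by (rule test_funs_mult[OF N f inv])
    then have "(\<lambda>y. f y * inverse (\<rho> y)) \<in> test_funs (ball 0 R)" using NK R(2) by (intro test_funs_mono[OF g]) auto
    from h(2)[OF this] have "v (\<lambda>y. \<rho> y * (f y * inverse (\<rho> y))) = (LINT y|lborel. f y * (inverse (\<rho> y) * h y))"
      by (simp add: mult.assoc)
    moreover have "\<rho> y * (f y * inverse (\<rho> y)) = f y" for y
      using test_funs_outside[OF f, of y] by (cases "\<rho> y = 0") auto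
    ultimately show ?thesis by simp
  qed
  moreover have "smooth_on ?N (\<lambda>y. inverse (\<rho> y) * h y)"
    by (intro smooth_on_mult N inv smooth_on_subset[OF h(1)]) auto
  ultimately show ?thesis using N NK K(2) \<rho>(2) by (intro exI[of _ ?N] exI[of _ "\<lambda>y. inverse (\<rho> y) * h y"]) auto
qed

text \<open>Densities of a distribution on different open sets agree on the overlap by the fundamental lemma,
  and a partition of unity reduces a test function to ones with small support.\<close>

lemma distribution_smooth_glue:
  fixes v :: "('e::euclidean_space \<Rightarrow> complex) \<Rightarrow> complex"
  assumes S: "open S" and v: "distribution_on S v"
    and loc: "\<And>x. x \<in> S \<Longrightarrow> \<exists>N h. open N \<and> x \<in> N \<and> N \<subseteq> S \<and> smooth_on N h \<and> (\<forall>f\<in>test_funs N. v f = (LINT y|lborel. f y * h y))"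
  obtains h where "smooth_on S h" "\<And>f. f \<in> test_funs S \<Longrightarrow> v f = (LINT y|lborel. f y * h y)"
proof -
  have "\<forall>x\<in>S. \<exists>N h. open N \<and> x \<in> N \<and> N \<subseteq> S \<and> smooth_on N h \<and> (\<forall>f\<in>test_funs N. v f = (LINT y|lborel. f y * h y))"
    using loc by blast
  from bchoice[OF this] obtain N where "\<forall>x\<in>S. \<exists>h. open (N x) \<and> x \<in> N x \<and> N x \<subseteq> S \<and> smooth_on (N x) h \<and> (\<forall>f\<in>test_funs (N x). v f = (LINT y|lborel. f y * h y))"
    by blast
  from bchoice[OF this] obtain H where N: "\<And>x. x \<in> S \<Longrightarrow> open (N x)" "\<And>x. x \<in> S \<Longrightarrow> x \<in> N x" "\<And>x. x \<in> S \<Longrightarrow> N x \<subseteq> S"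
    and H: "\<And>x. x \<in> S \<Longrightarrow> smooth_on (N x) (H x)" "\<And>x f. x \<in> S \<Longrightarrow> f \<in> test_funs (N x) \<Longrightarrow> v f = (LINT y|lborel. f y * H x y)"
    by blast
  define h where "h x = H x x" for x
  have agree: "h y = H x y" if x: "x \<in> S" and y: "y \<in> N x" for x y
  proof -
    have yS: "y \<in> S" using N(3)[OF x] y by blast
    let ?O = "N x \<inter> N y"
    have O: "open ?O" using N(1) x yS by auto
    have sm: "smooth_on ?O (\<lambda>z. H y z - H x z)"
      by (intro smooth_on_diff O smooth_on_subset[OF H(1)[OF x]] smooth_on_subset[OF H(1)[OF yS]]) auto
    have "H y y - H x y = 0"
    proof (rule fundamental_lemma[OF O sm])
      fix f assume f: "f \<in> test_funs ?O"
      have fx: "f \<in> test_funs (N x)" "f \<in> test_funs (N y)" using f by (auto intro: test_funs_mono)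
      have "integrable lborel (\<lambda>z. f z * H y z)" "integrable lborel (\<lambda>z. f z * H x z)"
        using test_funs_integrable[OF test_funs_mult[OF N(1)[OF yS] fx(2) H(1)[OF yS]]]
          test_funs_integrable[OF test_funs_mult[OF N(1)[OF x] fx(1) H(1)[OF x]]] by auto
      then show "(LINT z|lborel. f z * (H y z - H x z)) = 0"
        using H(2)[OF x fx(1)] H(2)[OF yS fx(2)] by (simp add: right_diff_distrib)
    qed (use y N(2)[OF yS] in auto)
    then show ?thesis by (simp add: h_def)
  qed
  have sh: "smooth_on S h"
  proof (rule smooth_on_local)
    fix x assume x: "x \<in> S"
    have "smooth_on (N x) h" using H(1)[OF x] agree[OF x] by (subst smooth_on_cong[OF N(1)[OF x]]) auto
    then show "\<exists>U. open U \<and> x \<in> U \<and> smooth_on (S \<inter> U) h"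
      using N[OF x] by (intro exI[of _ "N x"]) (auto intro: smooth_on_subset)
  qed
  show ?thesis
  proof (rule that[OF sh])
    fix f assume f: "f \<in> test_funs S"
    let ?w = "\<lambda>f. v f - (LINT y|lborel. f y * h y)"
    have int: "integrable lborel (\<lambda>y. g y * h y)" if "g \<in> test_funs S" for g
      by (rule test_funs_integrable[OF test_funs_mult[OF S that sh]])
    have w0: "?w g = 0" if x: "x \<in> S" and g: "g \<in> test_funs (N x)" for x g
    proof -
      have "g y * h y = g y * H x y" for y
        using agree[OF x, of y] test_funs_outside[OF g, of y] by (cases "y \<in> N x") auto
      then have "(\<lambda>y. g y * h y) = (\<lambda>y. g y * H x y)" by (intro ext)
      then show ?thesis using H(2)[OF x g] by simp
    qed
    obtain K where K: "compact K" "K \<subseteq> S" "\<And>x. x \<notin> K \<Longrightarrow> f x = 0" using f by (rule test_funsE) blast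
    have "\<forall>x\<in>K. \<exists>\<beta> U. \<beta> \<in> test_funs (N x) \<and> open U \<and> x \<in> U \<and> (\<forall>y\<in>U. \<beta> y = 1)"
    proof
      fix x assume "x \<in> K"
      then have "x \<in> S" using K(2) by blast
      obtain \<beta> U where "\<beta> \<in> test_funs (N x)" "open U" "{x} \<subseteq> U" "\<And>y. y \<in> U \<Longrightarrow> \<beta> y = 1"
        using test_bump[of "{x}" "N x"] N(1,2)[OF \<open>x \<in> S\<close>] by (metis compact_sing empty_subsetI insert_subset)
      then show "\<exists>\<beta> U. \<beta> \<in> test_funs (N x) \<and> open U \<and> x \<in> U \<and> (\<forall>y\<in>U. \<beta> y = 1)" by blast
    qed
    from bchoice[OF this] obtain \<beta> where "\<forall>x\<in>K. \<exists>U. \<beta> x \<in> test_funs (N x) \<and> open U \<and> x \<in> U \<and> (\<forall>y\<in>U. \<beta> x y = 1)" by blast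
    from bchoice[OF this] obtain U where \<beta>: "\<And>x. x \<in> K \<Longrightarrow> \<beta> x \<in> test_funs (N x)" "\<And>x. x \<in> K \<Longrightarrow> open (U x)" "\<And>x. x \<in> K \<Longrightarrow> x \<in> U x"
      "\<And>x y. x \<in> K \<Longrightarrow> y \<in> U x \<Longrightarrow> \<beta> x y = 1" by blast
    obtain D where D: "D \<subseteq> K" "finite D" "K \<subseteq> (\<Union>x\<in>D. U x)"
      by (rule compactE_image[OF K(1), of K U]) (use \<beta> in auto)
    have w_red: "f' \<in> test_funs S \<Longrightarrow> (\<lambda>y. f' y * (\<Prod>x\<in>D. 1 - \<beta> x y)) \<in> test_funs S \<and> ?w (\<lambda>y. f' y * (\<Prod>x\<in>D. 1 - \<beta> x y)) = ?w f'"
      if "finite D" "D \<subseteq> K" for D f'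
      using that
    proof (induction D arbitrary: f' rule: finite_induct)
      case (insert x D)
      have x: "x \<in> K" "x \<in> S" using insert.prems K(2) by auto
      have s\<beta>: "smooth_on UNIV (\<beta> x)" using test_funs_smooth[OF \<beta>(1)[OF x(1)]] .
      let ?g = "\<lambda>y. f' y * (1 - \<beta> x y)" and ?r = "\<lambda>y. f' y * \<beta> x y"
      have g: "?g \<in> test_funs S"
        by (intro test_funs_mult_UNIV(1)[OF insert.prems(1)] smooth_on_diff smooth_on_const open_UNIV s\<beta>)
      have r: "?r \<in> test_funs (N x)" by (rule test_funs_mult_UNIV(2)[OF \<beta>(1)[OF x(1)] test_funs_smooth[OF insert.prems(1)]])
      have rS: "?r \<in> test_funs S" by (rule test_funs_mono[OF r N(3)[OF x(2)]])
      have f': "f' = (\<lambda>y. ?g y + ?r y)" by (auto simp: algebra_simps)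
      have "?w (\<lambda>y. ?g y + ?r y) = ?w ?g + ?w ?r"
        using distribution_on_add[OF v g rS] int[OF g] int[OF rS] by (simp add: distrib_right)
      moreover have "?w f' = ?w (\<lambda>y. ?g y + ?r y)" by (rule arg_cong[OF f'])
      ultimately have "?w f' = ?w ?g" using w0[OF x(2) r] by simp
      have eq: "?g y * (\<Prod>x\<in>D. 1 - \<beta> x y) = f' y * (\<Prod>x\<in>insert x D. 1 - \<beta> x y)" for y
        using insert.hyps by (simp add: mult.assoc)
      have "(\<lambda>y. ?g y * (\<Prod>x\<in>D. 1 - \<beta> x y)) \<in> test_funs S \<and> ?w (\<lambda>y. ?g y * (\<Prod>x\<in>D. 1 - \<beta> x y)) = ?w ?g"
        using insert.prems(2) by (intro insert.IH[OF g]) simp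
      then show ?case unfolding eq \<open>?w f' = ?w ?g\<close> .
    qed simp
    have "f y * (\<Prod>x\<in>D. 1 - \<beta> x y) = 0" for y
    proof -
      show "f y * (\<Prod>x\<in>D. 1 - \<beta> x y) = 0"
      proof (cases "y \<in> K")
        case True
        then obtain x where "x \<in> D" "y \<in> U x" using D(3) by blast
        then have "\<exists>x\<in>D. 1 - \<beta> x y = 0" using D(1) \<beta>(4)[of x y] by (intro bexI[of _ x]) auto
        then show ?thesis using D(2) by (simp add: prod_zero)
      qed (simp add: K(3))
    qed
    then have "?w (\<lambda>y. f y * (\<Prod>x\<in>D. 1 - \<beta> x y)) = 0" by (simp only: distribution_on_zero[OF v]) simp
    then show "v f = (LINT y|lborel. f y * h y)" using w_red[OF D(2,1) f] by simp
  qed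
qed


section \<open>Smooth functions on the manifold\<close>

lemma test_bump_point:
  fixes x :: "'a::euclidean_space"
  assumes "open S" "x \<in> S"
  obtains \<beta> V where "\<beta> \<in> test_funs S" "open V" "{x} \<subseteq> V" "\<And>y. y \<in> V \<Longrightarrow> \<beta> y = 1"
  using test_bump[of "{x}" S] assms by (metis compact_sing empty_subsetI insert_subset)

locale smooth_manifold =
  fixes A :: "('a::{t2_space, second_countable_topology}, 'm::finite) chart set"
  assumes atlas: "smooth_atlas A"
begin

lemma chart_cover: obtains c where "c \<in> A" "p \<in> cdom c"
  using atlas unfolding smooth_atlas_def by blast

lemma open_cdom: "c \<in> A \<Longrightarrow> open (cdom c)"
  and open_cimg: "c \<in> A \<Longrightarrow> open (cmap c ` cdom c)"
  and chart_homeo: "c \<in> A \<Longrightarrow> homeomorphism (cdom c) (cmap c ` cdom c) (cmap c) (cinv c)"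
  using atlas unfolding smooth_atlas_def by blast+

lemma cinv_cmap [simp]: "c \<in> A \<Longrightarrow> p \<in> cdom c \<Longrightarrow> cinv c (cmap c p) = p"
  using chart_homeo unfolding homeomorphism_def by blast

lemma cmap_cinv: "c \<in> A \<Longrightarrow> x \<in> cmap c ` cdom c \<Longrightarrow> cmap c (cinv c x) = x"
  using chart_homeo unfolding homeomorphism_def by blast

lemma cinv_in: "c \<in> A \<Longrightarrow> x \<in> cmap c ` cdom c \<Longrightarrow> cinv c x \<in> cdom c"
  by force

lemma continuous_cmap: "c \<in> A \<Longrightarrow> continuous_on (cdom c) (cmap c)"
  and continuous_cinv: "c \<in> A \<Longrightarrow> continuous_on (cmap c ` cdom c) (cinv c)"
  using chart_homeo unfolding homeomorphism_def by blast+

lemma image_cmap: "c \<in> A \<Longrightarrow> cmap c ` (U \<inter> cdom c) = {x \<in> cmap c ` cdom c. cinv c x \<in> U}"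
  by force

lemma open_cmap_image: 
  assumes "c \<in> A" "open U" shows "open (cmap c ` (U \<inter> cdom c))"
proof -
  have "cmap c ` (U \<inter> cdom c) = cmap c ` cdom c \<inter> cinv c -` U" using image_cmap[OF assms(1)] by auto
  then show ?thesis using continuous_open_preimage[OF continuous_cinv[OF assms(1)] open_cimg[OF assms(1)] assms(2)] by simp
qed

lemma open_cinv_image:
  assumes "c \<in> A" "open S" shows "open {p \<in> cdom c. cmap c p \<in> S}"
  using continuous_open_preimage[OF continuous_cmap[OF assms(1)] open_cdom[OF assms(1)] assms(2)]
  unfolding vimage_def Int_def by simp

lemma compact_cinv_image:
  assumes "c \<in> A" "compact K" "K \<subseteq> cmap c ` cdom c" shows "compact (cinv c ` K)" "cinv c ` K \<subseteq> cdom c"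
  using compact_continuous_image[OF continuous_on_subset[OF continuous_cinv[OF assms(1)] assms(3)] assms(2)] assms cinv_in by auto

lemma compact_cmap_image:
  assumes "c \<in> A" "compact L" "L \<subseteq> cdom c" shows "compact (cmap c ` L)"
  using compact_continuous_image[OF continuous_on_subset[OF continuous_cmap[OF assms(1)] assms(3)] assms(2)] .

lemma smooth_transition: "c \<in> A \<Longrightarrow> c' \<in> A \<Longrightarrow> smooth_on (cmap c ` (cdom c \<inter> cdom c')) (\<lambda>x. cmap c' (cinv c x))"
  using atlas unfolding smooth_atlas_def comp_def by blast

lemma smooth_fun_on_iff: "smooth_fun_on A U f \<longleftrightarrow> (\<forall>c\<in>A. smooth_on (cmap c ` (U \<inter> cdom c)) (\<lambda>x. f (cinv c x)))"
  by (simp add: smooth_fun_on_def comp_def)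

lemma smooth_fun_onD: "smooth_fun_on A U f \<Longrightarrow> c \<in> A \<Longrightarrow> smooth_on (cmap c ` (U \<inter> cdom c)) (\<lambda>x. f (cinv c x))"
  by (simp add: smooth_fun_on_iff)

lemma smooth_funsD: "f \<in> smooth_funs A \<Longrightarrow> c \<in> A \<Longrightarrow> smooth_on (cmap c ` cdom c) (\<lambda>x. f (cinv c x))"
  using smooth_fun_onD[of UNIV] by (simp add: smooth_funs_def)

lemma smooth_funs_on: "f \<in> smooth_funs A \<Longrightarrow> smooth_fun_on A U f"
  unfolding smooth_funs_def smooth_fun_on_iff by (auto intro: smooth_on_subset)

lemma smooth_fun_on_subset: "smooth_fun_on A U f \<Longrightarrow> V \<subseteq> U \<Longrightarrow> smooth_fun_on A V f"
  unfolding smooth_fun_on_iff by (meson Int_mono image_mono order_refl smooth_on_subset)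

lemma smooth_fun_on_cong:
  assumes "open U" "\<And>p. p \<in> U \<Longrightarrow> f p = g p" shows "smooth_fun_on A U f \<longleftrightarrow> smooth_fun_on A U g"
proof -
  have "smooth_on (cmap c ` (U \<inter> cdom c)) (\<lambda>x. f (cinv c x)) \<longleftrightarrow> smooth_on (cmap c ` (U \<inter> cdom c)) (\<lambda>x. g (cinv c x))" if "c \<in> A" for c
    using that assms by (intro smooth_on_cong open_cmap_image) (auto simp: image_cmap)
  then show ?thesis unfolding smooth_fun_on_iff by blast
qed

lemma smooth_fun_on_const: "open U \<Longrightarrow> smooth_fun_on A U (\<lambda>_. a)"
  and smooth_fun_on_add: "open U \<Longrightarrow> smooth_fun_on A U f \<Longrightarrow> smooth_fun_on A U g \<Longrightarrow> smooth_fun_on A U (\<lambda>p. f p + g p)"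
  and smooth_fun_on_diff: "open U \<Longrightarrow> smooth_fun_on A U f \<Longrightarrow> smooth_fun_on A U g \<Longrightarrow> smooth_fun_on A U (\<lambda>p. f p - g p)"
  and smooth_fun_on_mult: "open U \<Longrightarrow> smooth_fun_on A U f \<Longrightarrow> smooth_fun_on A U g \<Longrightarrow> smooth_fun_on A U (\<lambda>p. f p * g p)"
  and smooth_fun_on_cnj: "open U \<Longrightarrow> smooth_fun_on A U f \<Longrightarrow> smooth_fun_on A U (\<lambda>p. cnj (f p))"
  unfolding smooth_fun_on_iff
  by (simp_all add: open_cmap_image smooth_on_const smooth_on_add smooth_on_diff smooth_on_mult smooth_on_cnj)

lemma smooth_fun_on_sum: "open U \<Longrightarrow> (\<And>i. i \<in> I \<Longrightarrow> smooth_fun_on A U (f i)) \<Longrightarrow> smooth_fun_on A U (\<lambda>p. \<Sum>i\<in>I. f i p)"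
  unfolding smooth_fun_on_iff by (simp add: open_cmap_image smooth_on_sum)

lemma smooth_fun_on_prod: "open U \<Longrightarrow> (\<And>i. i \<in> I \<Longrightarrow> smooth_fun_on A U (f i)) \<Longrightarrow> smooth_fun_on A U (\<lambda>p. \<Prod>i\<in>I. f i p)"
  unfolding smooth_fun_on_iff by (simp add: open_cmap_image smooth_on_prod)

lemma smooth_fun_on_inverse: "open U \<Longrightarrow> smooth_fun_on A U f \<Longrightarrow> (\<And>p. p \<in> U \<Longrightarrow> f p \<noteq> 0) \<Longrightarrow> smooth_fun_on A U (\<lambda>p. inverse (f p))"
  unfolding smooth_fun_on_iff
proof
  fix c assume "open U" "\<forall>c\<in>A. smooth_on (cmap c ` (U \<inter> cdom c)) (\<lambda>x. f (cinv c x))" "\<And>p. p \<in> U \<Longrightarrow> f p \<noteq> 0" "c \<in> A"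
  then show "smooth_on (cmap c ` (U \<inter> cdom c)) (\<lambda>x. inverse (f (cinv c x)))"
    using image_cmap[of c U] by (intro smooth_on_inverse open_cmap_image) auto
qed

lemma smooth_fun_on_local:
  assumes "\<And>p. p \<in> U \<Longrightarrow> \<exists>W. open W \<and> p \<in> W \<and> smooth_fun_on A (U \<inter> W) f"
  shows "smooth_fun_on A U f"
  unfolding smooth_fun_on_iff
proof
  fix c assume c: "c \<in> A"
  show "smooth_on (cmap c ` (U \<inter> cdom c)) (\<lambda>x. f (cinv c x))"
  proof (rule smooth_on_local)
    fix x assume "x \<in> cmap c ` (U \<inter> cdom c)"
    then have x: "x \<in> cmap c ` cdom c" "cinv c x \<in> U" using c by auto
    obtain W where W: "open W" "cinv c x \<in> W" "smooth_fun_on A (U \<inter> W) f" using assms[OF x(2)] by blast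
    show "\<exists>V. open V \<and> x \<in> V \<and> smooth_on (cmap c ` (U \<inter> cdom c) \<inter> V) (\<lambda>x. f (cinv c x))"
    proof (intro exI[of _ "cmap c ` (W \<inter> cdom c)"] conjI)
      show "open (cmap c ` (W \<inter> cdom c))" by (rule open_cmap_image[OF c W(1)])
      show "x \<in> cmap c ` (W \<inter> cdom c)" using x W(2) image_cmap[OF c] by blast
      have "cmap c ` (U \<inter> cdom c) \<inter> cmap c ` (W \<inter> cdom c) = cmap c ` ((U \<inter> W) \<inter> cdom c)"
        unfolding image_cmap[OF c] by auto
      then show "smooth_on (cmap c ` (U \<inter> cdom c) \<inter> cmap c ` (W \<inter> cdom c)) (\<lambda>x. f (cinv c x))"
        using smooth_fun_onD[OF W(3) c] by simp
    qed
  qed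
qed

text \<open>A single chart suffices on a subset of its domain, because the transition maps are smooth.\<close>

lemma smooth_fun_on_chartI:
  assumes c: "c \<in> A" and U: "open U" "U \<subseteq> cdom c" and f: "smooth_on (cmap c ` U) (\<lambda>x. f (cinv c x))"
  shows "smooth_fun_on A U f"
  unfolding smooth_fun_on_iff
proof
  fix c' assume c': "c' \<in> A"
  have op: "open (cmap c' ` (U \<inter> cdom c'))" by (rule open_cmap_image[OF c' U(1)])
  have U': "cmap c ` U = cmap c ` (U \<inter> cdom c)" using U(2) by (simp add: Int_absorb2)
  have "smooth_on (cmap c' ` (U \<inter> cdom c')) (\<lambda>x. f (cinv c (cmap c (cinv c' x))))"
  proof (rule smooth_on_compose[OF op _ _ f])
    show "open (cmap c ` U)" unfolding U' by (rule open_cmap_image[OF c U(1)])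
    show "smooth_on (cmap c' ` (U \<inter> cdom c')) (\<lambda>x. cmap c (cinv c' x))"
      by (rule smooth_on_subset[OF smooth_transition[OF c' c]]) (use U(2) in auto)
    show "(\<lambda>x. cmap c (cinv c' x)) ` cmap c' ` (U \<inter> cdom c') \<subseteq> cmap c ` U" using c' by auto
  qed
  then show "smooth_on (cmap c' ` (U \<inter> cdom c')) (\<lambda>x. f (cinv c' x))"
    by (rule smooth_on_cong[OF op, THEN iffD1, rotated]) (use c c' U(2) in auto)
qed

definition extend_zero :: "('a, 'm) chart \<Rightarrow> (real^'m \<Rightarrow> complex) \<Rightarrow> 'a \<Rightarrow> complex" where
  "extend_zero c g = (\<lambda>p. if p \<in> cdom c then g (cmap c p) else 0)"

text \<open>Smoothness is local, and the complement of \<open>L\<close> covers the points outside \<open>U\<close>.\<close>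

lemma smooth_fun_on_vanish_outside:
  assumes U: "open U" and L: "closed L" "L \<subseteq> U" and f: "smooth_fun_on A (U \<inter> W) f" "\<And>p. p \<in> W \<Longrightarrow> p \<notin> L \<Longrightarrow> f p = 0"
    and W: "open W"
  shows "smooth_fun_on A W f"
proof (rule smooth_fun_on_local)
  fix p assume p: "p \<in> W"
  show "\<exists>V. open V \<and> p \<in> V \<and> smooth_fun_on A (W \<inter> V) f"
  proof (cases "p \<in> U")
    case True
    then show ?thesis using U f(1) by (intro exI[of _ U]) (simp add: Int_commute)
  next
    case False
    have "smooth_fun_on A (W \<inter> - L) f"
      using smooth_fun_on_cong[of "W \<inter> - L" f "\<lambda>_. 0"] smooth_fun_on_const[of "W \<inter> - L" 0] f(2) W L(1) by (auto simp: open_Int)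
    then show ?thesis using False L by (intro exI[of _ "- L"]) auto
  qed
qed

lemma smooth_funs_vanish_outside:
  "open U \<Longrightarrow> closed L \<Longrightarrow> L \<subseteq> U \<Longrightarrow> smooth_fun_on A U f \<Longrightarrow> (\<And>p. p \<notin> L \<Longrightarrow> f p = 0) \<Longrightarrow> f \<in> smooth_funs A"
  using smooth_fun_on_vanish_outside[of U L UNIV f] by (simp add: smooth_funs_def)

lemma extend_zero_smooth:
  assumes c: "c \<in> A" and g: "g \<in> test_funs (cmap c ` cdom c)"
  shows "extend_zero c g \<in> smooth_funs A"
proof -
  from g obtain K where K: "compact K" "K \<subseteq> cmap c ` cdom c" "\<And>x. x \<notin> K \<Longrightarrow> g x = 0" by (rule test_funsE) blast
  note L = compact_cinv_image[OF c K(1,2)]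
  show ?thesis
  proof (rule smooth_funs_vanish_outside[OF open_cdom[OF c] _ L(2)])
    show "closed (cinv c ` K)" using L(1) by (rule compact_imp_closed)
    show "smooth_fun_on A (cdom c) (extend_zero c g)"
    proof (rule smooth_fun_on_chartI[OF c open_cdom[OF c] order_refl])
      have "smooth_on (cmap c ` cdom c) g" using test_funs_smooth[OF g] by (rule smooth_on_subset) simp
      then show "smooth_on (cmap c ` cdom c) (\<lambda>x. extend_zero c g (cinv c x))"
        by (rule smooth_on_cong[OF open_cimg[OF c], THEN iffD1, rotated]) (use c in \<open>auto simp: extend_zero_def\<close>)
    qed
    show "extend_zero c g p = 0" if "p \<notin> cinv c ` K" for p
      using that c K(3) by (force simp: extend_zero_def)
  qed
qed

lemma manifold_bump:
  assumes U: "open U" "p \<in> U" and c: "c \<in> A" "p \<in> cdom c"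
  obtains \<phi> W L where "\<phi> \<in> smooth_funs A" "open W" "p \<in> W" "\<And>q. q \<in> W \<Longrightarrow> \<phi> q = 1" "compact L" "L \<subseteq> U" "L \<subseteq> cdom c"
    "\<And>q. q \<notin> L \<Longrightarrow> \<phi> q = 0" "W \<subseteq> L"
proof -
  let ?S = "cmap c ` (U \<inter> cdom c)"
  have S: "open ?S" by (rule open_cmap_image[OF c(1) U(1)])
  have p: "cmap c p \<in> ?S" using U c by auto
  obtain \<beta> V where \<beta>: "\<beta> \<in> test_funs ?S" "open V" "{cmap c p} \<subseteq> V" "\<And>x. x \<in> V \<Longrightarrow> \<beta> x = 1"
    by (rule test_bump_point[OF S p]) blast
  obtain K where K: "compact K" "K \<subseteq> ?S" "\<And>x. x \<notin> K \<Longrightarrow> \<beta> x = 0" using \<beta>(1) by (rule test_funsE) blast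
  have K': "K \<subseteq> cmap c ` cdom c" using K(2) by blast
  have \<beta>': "\<beta> \<in> test_funs (cmap c ` cdom c)" by (rule test_funs_mono[OF \<beta>(1)]) auto
  show ?thesis
  proof (rule that[of "extend_zero c \<beta>" "{q \<in> cdom c. cmap c q \<in> V}" "cinv c ` K"])
    show "extend_zero c \<beta> \<in> smooth_funs A" by (rule extend_zero_smooth[OF c(1) \<beta>'])
    show "open {q \<in> cdom c. cmap c q \<in> V}" by (rule open_cinv_image[OF c(1) \<beta>(2)])
    show "compact (cinv c ` K)" "cinv c ` K \<subseteq> cdom c" using compact_cinv_image[OF c(1) K(1) K'] by auto
    show "cinv c ` K \<subseteq> U" using K(2) c(1) by (auto simp: subset_iff)
    show off: "extend_zero c \<beta> q = 0" if "q \<notin> cinv c ` K" for q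
      using that c K(3) by (force simp: extend_zero_def)
    show one: "extend_zero c \<beta> q = 1" if "q \<in> {q \<in> cdom c. cmap c q \<in> V}" for q
      using that \<beta>(4) by (auto simp: extend_zero_def)
    show "{q \<in> cdom c. cmap c q \<in> V} \<subseteq> cinv c ` K" using off one by force
  qed (use c \<beta>(3) in auto)
qed

lemma smooth_funs_intros:
  "(\<lambda>_. a) \<in> smooth_funs A"
  "f \<in> smooth_funs A \<Longrightarrow> g \<in> smooth_funs A \<Longrightarrow> (\<lambda>p. f p + g p) \<in> smooth_funs A"
  "f \<in> smooth_funs A \<Longrightarrow> g \<in> smooth_funs A \<Longrightarrow> (\<lambda>p. f p - g p) \<in> smooth_funs A"
  "f \<in> smooth_funs A \<Longrightarrow> g \<in> smooth_funs A \<Longrightarrow> (\<lambda>p. f p * g p) \<in> smooth_funs A"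
  "f \<in> smooth_funs A \<Longrightarrow> (\<lambda>p. cnj (f p)) \<in> smooth_funs A"
  unfolding smooth_funs_def
  by (simp_all add: smooth_fun_on_const smooth_fun_on_add smooth_fun_on_diff smooth_fun_on_mult smooth_fun_on_cnj)

lemma smooth_funs_sum: "(\<And>i. i \<in> I \<Longrightarrow> f i \<in> smooth_funs A) \<Longrightarrow> (\<lambda>p. \<Sum>i\<in>I. f i p) \<in> smooth_funs A"
  unfolding smooth_funs_def by (simp add: smooth_fun_on_sum)

lemma smooth_funs_cutoff:
  assumes "open U" "smooth_fun_on A U f" "\<phi> \<in> smooth_funs A" "closed L" "L \<subseteq> U" "\<And>q. q \<notin> L \<Longrightarrow> \<phi> q = 0"
  shows "(\<lambda>q. \<phi> q * f q) \<in> smooth_funs A"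
proof (rule smooth_funs_vanish_outside[OF assms(1,4,5)])
  show "smooth_fun_on A U (\<lambda>q. \<phi> q * f q)" by (rule smooth_fun_on_mult[OF assms(1) smooth_funs_on[OF assms(3)] assms(2)])
qed (simp add: assms(6))


section \<open>Tangent vectors as derivations\<close>

lemma ctangent_add: "v \<in> ctangent A p \<Longrightarrow> f \<in> smooth_funs A \<Longrightarrow> g \<in> smooth_funs A \<Longrightarrow> v (\<lambda>x. f x + g x) = v f + v g"
  and ctangent_cmult: "v \<in> ctangent A p \<Longrightarrow> f \<in> smooth_funs A \<Longrightarrow> v (\<lambda>x. a * f x) = a * v f"
  and ctangent_mult: "v \<in> ctangent A p \<Longrightarrow> f \<in> smooth_funs A \<Longrightarrow> g \<in> smooth_funs A \<Longrightarrow> v (\<lambda>x. f x * g x) = v f * g p + f p * v g"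
  and ctangent_nonsmooth: "v \<in> ctangent A p \<Longrightarrow> f \<notin> smooth_funs A \<Longrightarrow> v f = 0"
  unfolding ctangent_def by blast+

lemma ctangent_const [simp]: assumes "v \<in> ctangent A p" shows "v (\<lambda>_. a) = 0"
proof -
  have "v (\<lambda>_. 1) = 0"
    using ctangent_mult[OF assms smooth_funs_intros(1)[of 1] smooth_funs_intros(1)[of 1]] by simp
  then show ?thesis using ctangent_cmult[OF assms smooth_funs_intros(1)[of 1], of a] by simp
qed

lemma ctangent_diff:
  assumes "v \<in> ctangent A p" "f \<in> smooth_funs A" "g \<in> smooth_funs A" shows "v (\<lambda>x. f x - g x) = v f - v g"
  using ctangent_add[OF assms(1,2) smooth_funs_intros(4)[OF smooth_funs_intros(1)[of "-1"] assms(3)]] ctangent_cmult[OF assms(1,3), of "-1"]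
  by simp

lemma ctangent_sum:
  assumes "v \<in> ctangent A p" "\<And>i. i \<in> I \<Longrightarrow> f i \<in> smooth_funs A" shows "v (\<lambda>x. \<Sum>i\<in>I. f i x) = (\<Sum>i\<in>I. v (f i))"
  using assms(2)
  by (induction I rule: infinite_finite_induct) (auto simp: ctangent_const[OF assms(1)] ctangent_add[OF assms(1)] smooth_funs_sum)

text \<open>The difference \<open>h\<close> of the functions satisfies \<open>h = h (1 - \<phi>)\<close> for a bump function \<open>\<phi>\<close> at \<open>p\<close>, and both factors
  vanish at \<open>p\<close>.\<close>

lemma ctangent_local:
  assumes v: "v \<in> ctangent A p" and f: "f \<in> smooth_funs A" "g \<in> smooth_funs A"
    and W: "open W" "p \<in> W" "\<And>q. q \<in> W \<Longrightarrow> f q = g q"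
  shows "v f = v g"
proof -
  obtain c where c: "c \<in> A" "p \<in> cdom c" by (rule chart_cover)
  obtain \<phi> V L where \<phi>: "\<phi> \<in> smooth_funs A" "p \<in> V" "\<And>q. q \<in> V \<Longrightarrow> \<phi> q = 1" "L \<subseteq> W" "\<And>q. q \<notin> L \<Longrightarrow> \<phi> q = 0"
    using manifold_bump[OF W(1,2) c] by metis
  let ?h = "\<lambda>q. f q - g q" and ?k = "\<lambda>q. 1 - \<phi> q"
  have h: "?h \<in> smooth_funs A" and k: "?k \<in> smooth_funs A" by (intro smooth_funs_intros f \<phi>)+
  have "?h = (\<lambda>q. ?k q * ?h q)" using W(3) \<phi>(4,5) by (auto simp: fun_eq_iff)
  then have "v ?h = v (\<lambda>q. ?k q * ?h q)" by (rule arg_cong)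
  also have "\<dots> = v ?k * ?h p + ?k p * v ?h" by (rule ctangent_mult[OF v k h])
  also have "\<dots> = 0" using W \<phi>(2,3) by simp
  finally show ?thesis using ctangent_diff[OF v f] by simp
qed

lemma ctangent_zero [simp]: "(\<lambda>_. 0) \<in> ctangent A p"
  by (simp add: ctangent_def)

lemma ctangent_lincomb:
  assumes "v \<in> ctangent A p" "w \<in> ctangent A p" shows "(\<lambda>f. a * v f + b * w f) \<in> ctangent A p"
  using assms unfolding ctangent_def by (auto simp: algebra_simps)

lemma ctangent_plus: "v \<in> ctangent A p \<Longrightarrow> w \<in> ctangent A p \<Longrightarrow> (\<lambda>f. v f + w f) \<in> ctangent A p"
  and ctangent_scale: "v \<in> ctangent A p \<Longrightarrow> (\<lambda>f. a * v f) \<in> ctangent A p"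
  using ctangent_lincomb[of v p w 1 1] ctangent_lincomb[of v p v a 0] by simp_all

lemma ctangent_Sum: "(\<And>i. i \<in> I \<Longrightarrow> v i \<in> ctangent A p) \<Longrightarrow> (\<lambda>f. \<Sum>i\<in>I. a i * v i f) \<in> ctangent A p"
proof (induction I rule: infinite_finite_induct)
  case (insert i I)
  then show ?case using ctangent_plus[OF ctangent_scale, of "v i" p "\<lambda>f. \<Sum>i\<in>I. a i * v i f" "a i"] by simp
qed auto

lemma coord_vec_eq: "f \<in> smooth_funs A \<Longrightarrow> coord_vec A c i p f = frechet_derivative (\<lambda>x. f (cinv c x)) (at (cmap c p)) (axis i 1)"
  by (simp add: coord_vec_def comp_def)

lemma coord_vec_ctangent:
  assumes c: "c \<in> A" "p \<in> cdom c" shows "coord_vec A c i p \<in> ctangent A p"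
proof -
  have x: "cmap c p \<in> cmap c ` cdom c" using c by simp
  show ?thesis
    unfolding ctangent_def
  proof (intro CollectI conjI ballI allI impI)
    fix f g assume fg: "f \<in> smooth_funs A" "g \<in> smooth_funs A"
    note fg' = smooth_funsD[OF fg(1) c(1)] smooth_funsD[OF fg(2) c(1)]
    show "coord_vec A c i p (\<lambda>x. f x + g x) = coord_vec A c i p f + coord_vec A c i p g"
      using frechet_derivative_add_smooth[OF fg' x] by (simp add: coord_vec_eq fg smooth_funs_intros)
    show "coord_vec A c i p (\<lambda>x. f x * g x) = coord_vec A c i p f * g p + f p * coord_vec A c i p g"
      using frechet_derivative_mult_smooth[OF fg' x] c by (simp add: coord_vec_eq fg smooth_funs_intros)
  next
    fix f and a :: complex assume f: "f \<in> smooth_funs A"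
    show "coord_vec A c i p (\<lambda>x. a * f x) = a * coord_vec A c i p f"
      using frechet_derivative_cmult_smooth[OF smooth_funsD[OF f c(1)] x] by (simp add: coord_vec_eq f smooth_funs_intros)
  qed (simp add: coord_vec_def)
qed

lemma coord_vec_smooth:
  assumes c: "c \<in> A" and f: "f \<in> smooth_funs A" shows "smooth_fun_on A (cdom c) (\<lambda>q. coord_vec A c i q f)"
proof (rule smooth_fun_on_chartI[OF c open_cdom[OF c] order_refl])
  show "smooth_on (cmap c ` cdom c) (\<lambda>x. coord_vec A c i (cinv c x) f)"
    by (rule smooth_on_cong[OF open_cimg[OF c], THEN iffD1, OF _ smooth_on_frechet[OF smooth_funsD[OF f c], of "axis i 1"]])
       (use c f in \<open>auto simp: coord_vec_eq\<close>)
qed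

text \<open>Globally defined smooth functions that agree with the coordinates of a chart near a point.\<close>

lemma local_coordinates:
  assumes c: "c \<in> A" "p \<in> cdom c"
  obtains \<xi> W where "\<And>i. \<xi> i \<in> smooth_funs A" "open W" "p \<in> W" "W \<subseteq> cdom c" "\<And>q i. q \<in> W \<Longrightarrow> \<xi> i q = of_real (cmap c q $ i)"
    "\<And>q i j. q \<in> W \<Longrightarrow> coord_vec A c j q (\<xi> i) = (if i = j then 1 else 0)"
proof -
  let ?S = "cmap c ` cdom c"
  have S: "open ?S" by (rule open_cimg[OF c(1)])
  obtain \<beta> V where \<beta>: "\<beta> \<in> test_funs ?S" "open V" "{cmap c p} \<subseteq> V" "\<And>x. x \<in> V \<Longrightarrow> \<beta> x = 1"
    by (rule test_bump_point[OF S imageI[OF c(2)]]) blast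
  let ?x = "\<lambda>i x. complex_of_real (x $ i)"
  have xi: "smooth_on U (?x i)" if "open U" for U :: "(real^'m) set" and i
    using that by (intro smooth_on_of_real smooth_on_bounded_linear bounded_linear_vec_nth)
  let ?\<xi> = "\<lambda>i. extend_zero c (\<lambda>x. \<beta> x * ?x i x)"
  let ?W = "{q \<in> cdom c. cmap c q \<in> V}"
  have \<xi>: "?\<xi> i \<in> smooth_funs A" for i
    by (intro extend_zero_smooth c(1) test_funs_mult_UNIV(1)[OF \<beta>(1)] xi open_UNIV)
  show ?thesis
  proof (rule that[of ?\<xi> ?W])
    show "open ?W" by (rule open_cinv_image[OF c(1) \<beta>(2)])
    fix q i assume q: "q \<in> ?W"
    then show "?\<xi> i q = ?x i (cmap c q)" using \<beta>(4) by (simp add: extend_zero_def)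
    fix j
    have "coord_vec A c j q (?\<xi> i) = frechet_derivative (\<lambda>x. ?\<xi> i (cinv c x)) (at (cmap c q)) (axis j 1)" by (rule coord_vec_eq[OF \<xi>])
    also have "\<dots> = frechet_derivative (?x i) (at (cmap c q)) (axis j 1)"
    proof (subst frechet_derivative_cong_open[of "?S \<inter> V"])
      show "?\<xi> i (cinv c x) = ?x i x" if "x \<in> ?S \<inter> V" for x
        using that c(1) \<beta>(4)[of x] by (auto simp: extend_zero_def)
    qed (use S \<beta>(2) q in auto)
    also have "frechet_derivative (?x i) (at (cmap c q)) = (\<lambda>v. ?x i v)"
      by (intro frechet_derivative_eqI bounded_linear_imp_has_derivative bounded_linear_of_real[THEN bounded_linear_compose] bounded_linear_vec_nth)
    finally show "coord_vec A c j q (?\<xi> i) = (if i = j then 1 else 0)" by (simp add: axis_def)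
  qed (use \<xi> c \<beta>(3) in auto)
qed

text \<open>By Hadamard's lemma \<open>f - f p\<close> is near \<open>p\<close> a combination of the functions \<open>\<xi> i - \<xi> i p\<close>; a derivation applied
  to the products sees only the values of the coefficients at \<open>p\<close>.\<close>

lemma ctangent_expand:
  assumes c: "c \<in> A" "p \<in> cdom c" and v: "v \<in> ctangent A p" and f: "f \<in> smooth_funs A"
    and \<xi>: "\<And>i. \<xi> i \<in> smooth_funs A" "open W" "p \<in> W" "W \<subseteq> cdom c" "\<And>q i. q \<in> W \<Longrightarrow> \<xi> i q = of_real (cmap c q $ i)"
  shows "v f = (\<Sum>i\<in>UNIV. v (\<xi> i) * coord_vec A c i p f)"
proof -
  let ?x0 = "cmap c p"
  have S: "open (cmap c ` (W \<inter> cdom c))" by (rule open_cmap_image[OF c(1) \<xi>(2)])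
  have "?x0 \<in> cmap c ` (W \<inter> cdom c)" using c \<xi>(3) by auto
  then obtain r where r: "r > 0" "ball ?x0 r \<subseteq> cmap c ` (W \<inter> cdom c)" using S open_contains_ball by blast
  let ?B = "ball ?x0 r"
  have B: "?B \<subseteq> cmap c ` cdom c" using r(2) by blast
  have x0B: "?x0 \<in> ?B" "{?x0} \<subseteq> ?B" using r(1) by auto
  obtain g where g: "\<And>b. smooth_on ?B (g b)"
    "\<And>x. x \<in> ?B \<Longrightarrow> f (cinv c x) = f (cinv c ?x0) + (\<Sum>b\<in>Basis. ((x - ?x0) \<bullet> b) *\<^sub>R g b x)"
    using hadamard_lemma[OF open_ball convex_ball x0B(1) smooth_on_subset[OF smooth_funsD[OF f c(1)] B]] by blast
  obtain \<beta> V where \<beta>: "\<beta> \<in> test_funs ?B" "open V" "{?x0} \<subseteq> V" "\<And>x. x \<in> V \<Longrightarrow> \<beta> x = 1"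
    by (rule test_bump_point[OF open_ball x0B(1)]) blast
  let ?G = "\<lambda>i. extend_zero c (\<lambda>x. \<beta> x * g (axis i 1) x)"
  have G: "?G i \<in> smooth_funs A" for i
    by (intro extend_zero_smooth c(1) test_funs_mono[OF _ B] test_funs_mult \<beta>(1) g open_ball)
  have Gp: "?G i p = g (axis i 1) ?x0" for i using c \<beta>(3,4) by (auto simp: extend_zero_def)
  let ?\<eta> = "\<lambda>i q. \<xi> i q - \<xi> i p"
  have \<eta>: "?\<eta> i \<in> smooth_funs A" for i by (intro smooth_funs_intros \<xi>)
  let ?V = "{q \<in> cdom c. cmap c q \<in> V \<inter> ?B}"
  have expand: "v' f = (\<Sum>i\<in>UNIV. v' (\<xi> i) * g (axis i 1) ?x0)" if v': "v' \<in> ctangent A p" for v'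
  proof -
    have s: "(\<lambda>q. f p + (\<Sum>i\<in>UNIV. ?\<eta> i q * ?G i q)) \<in> smooth_funs A"
      by (intro smooth_funs_intros smooth_funs_sum \<xi> G)
    have "v' f = v' (\<lambda>q. f p + (\<Sum>i\<in>UNIV. ?\<eta> i q * ?G i q))"
    proof (rule ctangent_local[OF v' f s])
      show "open ?V" by (rule open_cinv_image[OF c(1)]) (use \<beta>(2) in auto)
      show "p \<in> ?V" using c \<beta>(3) r(1) by auto
      fix q assume q: "q \<in> ?V"
      then have qc: "q \<in> cdom c" and qB: "cmap c q \<in> ?B" and qV: "cmap c q \<in> V" by auto
      have "cmap c q \<in> cmap c ` (W \<inter> cdom c)" using qB r(2) by blast
      then have "cinv c (cmap c q) \<in> W" unfolding image_cmap[OF c(1)] by simp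
      then have qW: "q \<in> W" using cinv_cmap[OF c(1) qc] by simp
      have "f q = f p + (\<Sum>i\<in>UNIV. of_real ((cmap c q - ?x0) $ i) * g (axis i 1) (cmap c q))"
        using g(2)[OF qB] unfolding cinv_cmap[OF c(1) qc] cinv_cmap[OF c] sum_Basis_cart
        by (simp only: inner_axis scaleR_conv_of_real inner_real_def mult_1_right)
      then show "f q = f p + (\<Sum>i\<in>UNIV. ?\<eta> i q * ?G i q)"
        by (simp add: extend_zero_def qc \<beta>(4)[OF qV] \<xi>(5)[OF qW] \<xi>(5)[OF \<xi>(3)])
    qed
    also have "\<dots> = v' (\<lambda>_. f p) + v' (\<lambda>q. \<Sum>i\<in>UNIV. ?\<eta> i q * ?G i q)"
      by (rule ctangent_add[OF v']) (intro smooth_funs_intros smooth_funs_sum \<xi> G)+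
    also have "v' (\<lambda>q. \<Sum>i\<in>UNIV. ?\<eta> i q * ?G i q) = (\<Sum>i\<in>UNIV. v' (\<lambda>q. ?\<eta> i q * ?G i q))"
      by (rule ctangent_sum[OF v']) (intro smooth_funs_intros \<xi> G)
    also have "\<dots> = (\<Sum>i\<in>UNIV. v' (\<xi> i) * g (axis i 1) ?x0)"
    proof (intro sum.cong refl)
      fix i
      show "v' (\<lambda>q. ?\<eta> i q * ?G i q) = v' (\<xi> i) * g (axis i 1) ?x0"
      using ctangent_mult[OF v' \<eta> G, of i i] ctangent_diff[OF v' \<xi>(1) smooth_funs_intros(1), of i "\<xi> i p"] v' Gp by simp
    qed
    finally show ?thesis using v' by simp
  qed
  have delta: "coord_vec A c j p (\<xi> i) = (if i = j then 1 else 0)" for i j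
  proof -
    obtain \<xi>' W' where \<xi>': "\<And>i. \<xi>' i \<in> smooth_funs A" "open W'" "p \<in> W'" "W' \<subseteq> cdom c" "\<And>q i. q \<in> W' \<Longrightarrow> \<xi>' i q = of_real (cmap c q $ i)"
      "\<And>q i j. q \<in> W' \<Longrightarrow> coord_vec A c j q (\<xi>' i) = (if i = j then 1 else 0)"
      by (rule local_coordinates[OF c]) blast
    have "coord_vec A c j p (\<xi> i) = coord_vec A c j p (\<xi>' i)"
      by (rule ctangent_local[OF coord_vec_ctangent[OF c] \<xi>(1) \<xi>'(1), of "W \<inter> W'"]) (use \<xi> \<xi>' in auto)
    then show ?thesis using \<xi>'(6)[OF \<xi>'(3)] by simp
  qed
  have "coord_vec A c j p f = g (axis j 1) ?x0" for j
    using expand[OF coord_vec_ctangent[OF c], of j] by (simp add: delta if_distrib[of "\<lambda>c. c * _"] cong: if_cong)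
  then show ?thesis using expand[OF v] by simp
qed

lemma vec_coords_unique:
  assumes c: "c \<in> A" "p \<in> cdom c" and v: "v = (\<lambda>f. \<Sum>i\<in>UNIV. a $ i * coord_vec A c i p f)"
  shows "vec_coords A c p v = a"
  unfolding vec_coords_def
proof (rule the_equality)
  show "v = (\<lambda>f. \<Sum>i\<in>UNIV. a $ i * coord_vec A c i p f)" by fact
  fix b assume b: "v = (\<lambda>f. \<Sum>i\<in>UNIV. b $ i * coord_vec A c i p f)"
  obtain \<xi> W where \<xi>: "p \<in> W" "\<And>q i j. q \<in> W \<Longrightarrow> coord_vec A c j q (\<xi> i) = (if i = j then 1 else (0::complex))"
    by (rule local_coordinates[OF c]) blast
  have "v (\<xi> i) = a $ i" "v (\<xi> i) = b $ i" for i
    by (subst v, simp add: \<xi> if_distrib cong: if_cong) (subst b, simp add: \<xi> if_distrib cong: if_cong)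
  then show "b = a" by (simp add: vec_eq_iff)
qed

lemma vec_coords_expand:
  assumes c: "c \<in> A" "p \<in> cdom c" and v: "v \<in> ctangent A p"
  shows "v = (\<lambda>f. \<Sum>i\<in>UNIV. vec_coords A c p v $ i * coord_vec A c i p f)"
proof -
  obtain \<xi> W where \<xi>: "\<And>i. \<xi> i \<in> smooth_funs A" "open W" "p \<in> W" "W \<subseteq> cdom c" "\<And>q i. q \<in> W \<Longrightarrow> \<xi> i q = of_real (cmap c q $ i)"
    by (rule local_coordinates[OF c]) blast
  let ?a = "\<chi> i. v (\<xi> i)"
  have *: "v = (\<lambda>f. \<Sum>i\<in>UNIV. ?a $ i * coord_vec A c i p f)"
  proof
    fix f show "v f = (\<Sum>i\<in>UNIV. ?a $ i * coord_vec A c i p f)"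
      using ctangent_expand[OF c v _ \<xi>, of f] ctangent_nonsmooth[OF v, of f] by (cases "f \<in> smooth_funs A") (auto simp: coord_vec_def)
  qed
  show ?thesis using vec_coords_unique[OF c *] * by simp
qed

lemma vec_coords_local_coordinate:
  assumes c: "c \<in> A" "p \<in> cdom c" and v: "v \<in> ctangent A p"
    and \<xi>: "\<And>j. coord_vec A c j p \<xi> = (if i = j then 1 else 0)"
  shows "vec_coords A c p v $ i = v \<xi>"
  by (subst (2) vec_coords_expand[OF c v]) (simp add: \<xi> if_distrib cong: if_cong)

lemma vec_coords_linear:
  assumes c: "c \<in> A" "p \<in> cdom c" and v: "v \<in> ctangent A p" "w \<in> ctangent A p"
  shows "vec_coords A c p (\<lambda>f. v f + w f) = vec_coords A c p v + vec_coords A c p w"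
    and "vec_coords A c p (\<lambda>f. a * v f) $ i = a * vec_coords A c p v $ i"
proof -
  show "vec_coords A c p (\<lambda>f. v f + w f) = vec_coords A c p v + vec_coords A c p w"
    by (rule vec_coords_unique[OF c], subst vec_coords_expand[OF c v(1)], subst vec_coords_expand[OF c v(2)])
       (simp add: sum.distrib distrib_right)
  have "vec_coords A c p (\<lambda>f. a * v f) = (\<chi> i. a * vec_coords A c p v $ i)"
    by (rule vec_coords_unique[OF c], subst vec_coords_expand[OF c v(1)]) (simp add: sum_distrib_left mult.assoc)
  then show "vec_coords A c p (\<lambda>f. a * v f) $ i = a * vec_coords A c p v $ i" by simp
qed

lemma vec_coords_coord_vec:
  assumes c: "c \<in> A" "p \<in> cdom c" shows "vec_coords A c p (coord_vec A c i p) = axis i 1"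
  by (rule vec_coords_unique[OF c]) (simp add: axis_def if_distrib[of "\<lambda>x. x * _"] cong: if_cong)


section \<open>Vector fields and one-forms\<close>

lemma vector_fieldsD: "Y \<in> vector_fields A U \<Longrightarrow> p \<in> U \<Longrightarrow> Y p \<in> ctangent A p"
  "Y \<in> vector_fields A U \<Longrightarrow> f \<in> smooth_funs A \<Longrightarrow> smooth_fun_on A U (\<lambda>p. Y p f)"
  unfolding vector_fields_def by blast+

lemma vector_fields_smooth: "Y \<in> vector_fields A UNIV \<Longrightarrow> f \<in> smooth_funs A \<Longrightarrow> (\<lambda>p. Y p f) \<in> smooth_funs A"
  using vector_fieldsD(2)[of Y UNIV f] by (simp add: smooth_funs_def)

lemma vector_field_coords_smooth:
  assumes c: "c \<in> A" and Y: "Y \<in> vector_fields A U" and U: "open U"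
  shows "smooth_fun_on A (U \<inter> cdom c) (\<lambda>q. vec_coords A c q (Y q) $ i)"
proof (rule smooth_fun_on_local)
  fix p assume p: "p \<in> U \<inter> cdom c"
  obtain \<xi> W where \<xi>: "\<And>i. \<xi> i \<in> smooth_funs A" "open W" "p \<in> W" "W \<subseteq> cdom c"
    "\<And>q i j. q \<in> W \<Longrightarrow> coord_vec A c j q (\<xi> i) = (if i = j then 1 else 0)"
    using p by (rule_tac local_coordinates[OF c, of p]) auto
  have "smooth_fun_on A (U \<inter> W) (\<lambda>q. Y q (\<xi> i))"
    by (rule smooth_fun_on_subset[OF vector_fieldsD(2)[OF Y \<xi>(1)]]) auto
  then have "smooth_fun_on A (U \<inter> W) (\<lambda>q. vec_coords A c q (Y q) $ i)"
  proof (rule smooth_fun_on_cong[THEN iffD1, rotated 2])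
    fix q assume q: "q \<in> U \<inter> W"
    then show "Y q (\<xi> i) = vec_coords A c q (Y q) $ i"
      using vec_coords_local_coordinate[OF c _ vector_fieldsD(1)[OF Y], of q "\<xi> i" i] \<xi>(4,5) by auto
  qed (use U \<xi>(2) in auto)
  then show "\<exists>W. open W \<and> p \<in> W \<and> smooth_fun_on A (U \<inter> cdom c \<inter> W) (\<lambda>q. vec_coords A c q (Y q) $ i)"
    using \<xi>(2,3) by (intro exI[of _ W]) (auto elim: smooth_fun_on_subset)
qed

lemma vector_fields_cutoff:
  assumes U: "open U" and Y: "Y \<in> vector_fields A U" and \<phi>: "\<phi> \<in> smooth_funs A" "closed L" "L \<subseteq> U" "\<And>q. q \<notin> L \<Longrightarrow> \<phi> q = 0"
  shows "(\<lambda>q f. \<phi> q * Y q f) \<in> vector_fields A UNIV"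
  unfolding vector_fields_def
proof (intro CollectI conjI ballI)
  fix p :: 'a
  show "(\<lambda>f. \<phi> p * Y p f) \<in> ctangent A p"
  proof (cases "p \<in> U")
    case False
    then have "\<phi> p = 0" using \<phi>(3,4) by blast
    then show ?thesis by simp
  qed (use vector_fieldsD(1)[OF Y] in \<open>auto intro: ctangent_scale\<close>)
next
  fix f assume "f \<in> smooth_funs A"
  from smooth_funs_cutoff[OF U vector_fieldsD(2)[OF Y this] \<phi>]
  show "smooth_fun_on A UNIV (\<lambda>p. \<phi> p * Y p f)" by (simp add: smooth_funs_def)
qed

lemma coord_field: "c \<in> A \<Longrightarrow> coord_vec A c i \<in> vector_fields A (cdom c)"
  unfolding vector_fields_def using coord_vec_ctangent coord_vec_smooth by blast

lemma vector_fields_mult: "f \<in> smooth_funs A \<Longrightarrow> Y \<in> vector_fields A UNIV \<Longrightarrow> (\<lambda>p g. f p * Y p g) \<in> vector_fields A UNIV"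
  using vector_fields_cutoff[of UNIV Y f UNIV] by simp

lemma vector_fields_add: "open U \<Longrightarrow> Y \<in> vector_fields A U \<Longrightarrow> Z \<in> vector_fields A U \<Longrightarrow> (\<lambda>p f. Y p f + Z p f) \<in> vector_fields A U"
  unfolding vector_fields_def by (auto intro: ctangent_plus smooth_fun_on_add)

lemma vector_fields_zero: "open U \<Longrightarrow> (\<lambda>p f. 0) \<in> vector_fields A U"
  unfolding vector_fields_def by (auto intro: smooth_fun_on_const)

lemma vector_fields_cmult: "open U \<Longrightarrow> Y \<in> vector_fields A U \<Longrightarrow> (\<lambda>p f. a * Y p f) \<in> vector_fields A U"
  unfolding vector_fields_def by (auto intro: ctangent_scale smooth_fun_on_mult smooth_fun_on_const)

lemma vector_fields_sum: "open U \<Longrightarrow> (\<And>i. i \<in> I \<Longrightarrow> Y i \<in> vector_fields A U) \<Longrightarrow> (\<lambda>p f. \<Sum>i\<in>I. Y i p f) \<in> vector_fields A U"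
  by (induction I rule: infinite_finite_induct) (auto intro: vector_fields_add vector_fields_zero)

text \<open>Cut off a combination of the coordinate fields with constant coefficients.\<close>

lemma vector_field_extension:
  assumes "v \<in> ctangent A p" obtains Y where "Y \<in> vector_fields A UNIV" "Y p = v"
proof -
  obtain c where c: "c \<in> A" "p \<in> cdom c" by (rule chart_cover)
  obtain \<phi> W L where \<phi>: "\<phi> \<in> smooth_funs A" "open W" "p \<in> W" "\<And>q. q \<in> W \<Longrightarrow> \<phi> q = 1" "compact L" "L \<subseteq> cdom c"
    "\<And>q. q \<notin> L \<Longrightarrow> \<phi> q = 0" using manifold_bump[OF open_UNIV UNIV_I c] by metis
  let ?Y = "\<lambda>q f. \<Sum>i\<in>UNIV. vec_coords A c p v $ i * coord_vec A c i q f"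
  have "?Y \<in> vector_fields A (cdom c)"
    by (intro vector_fields_sum vector_fields_cmult coord_field open_cdom c)
  then have "(\<lambda>q f. \<phi> q * ?Y q f) \<in> vector_fields A UNIV"
    using \<phi> open_cdom[OF c(1)] by (intro vector_fields_cutoff[where L = L and U = "cdom c"]) (auto simp: compact_imp_closed)
  moreover have "(\<lambda>f. \<phi> p * ?Y p f) = v"
    by (subst (2) vec_coords_expand[OF c assms]) (simp add: \<phi>)
  ultimately show ?thesis by (rule that)
qed

lemma ccotangent_add: "\<xi> \<in> ccotangent A p \<Longrightarrow> v \<in> ctangent A p \<Longrightarrow> w \<in> ctangent A p \<Longrightarrow> \<xi> (\<lambda>f. v f + w f) = \<xi> v + \<xi> w"
  and ccotangent_cmult: "\<xi> \<in> ccotangent A p \<Longrightarrow> v \<in> ctangent A p \<Longrightarrow> \<xi> (\<lambda>f. a * v f) = a * \<xi> v"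
  and ccotangent_outside: "\<xi> \<in> ccotangent A p \<Longrightarrow> v \<notin> ctangent A p \<Longrightarrow> \<xi> v = 0"
  unfolding ccotangent_def by blast+

lemma ccotangent_zero: "\<xi> \<in> ccotangent A p \<Longrightarrow> \<xi> (\<lambda>_. 0) = 0"
  using ccotangent_cmult[of \<xi> p "\<lambda>_. 0" 0] by simp

lemma ccotangent_sum:
  assumes "\<xi> \<in> ccotangent A p" "\<And>i. i \<in> I \<Longrightarrow> v i \<in> ctangent A p"
  shows "\<xi> (\<lambda>f. \<Sum>i\<in>I. a i * v i f) = (\<Sum>i\<in>I. a i * \<xi> (v i))"
  using assms(2)
  by (induction I rule: infinite_finite_induct)
     (auto simp: ccotangent_zero[OF assms(1)] ccotangent_add[OF assms(1)] ccotangent_cmult[OF assms(1)] ctangent_scale ctangent_Sum)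

lemma ccotangent_coords:
  assumes c: "c \<in> A" "p \<in> cdom c" and \<xi>: "\<xi> \<in> ccotangent A p" and v: "v \<in> ctangent A p"
  shows "\<xi> v = (\<Sum>i\<in>UNIV. vec_coords A c p v $ i * \<xi> (coord_vec A c i p))"
proof -
  have "\<xi> v = \<xi> (\<lambda>f. \<Sum>i\<in>UNIV. vec_coords A c p v $ i * coord_vec A c i p f)"
    by (rule arg_cong[OF vec_coords_expand[OF c v]])
  also have "\<dots> = (\<Sum>i\<in>UNIV. vec_coords A c p v $ i * \<xi> (coord_vec A c i p))"
    by (rule ccotangent_sum[OF \<xi>]) (rule coord_vec_ctangent[OF c])
  finally show ?thesis .
qed

lemma ccotangent_eqI:
  assumes c: "c \<in> A" "p \<in> cdom c" and "\<xi> \<in> ccotangent A p" "\<eta> \<in> ccotangent A p"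
    and "\<And>i. \<xi> (coord_vec A c i p) = \<eta> (coord_vec A c i p)"
  shows "\<xi> = \<eta>"
proof
  fix v show "\<xi> v = \<eta> v"
    using ccotangent_coords[OF c assms(3), of v] ccotangent_coords[OF c assms(4), of v] assms(5)
      ccotangent_outside[OF assms(3), of v] ccotangent_outside[OF assms(4), of v]
    by (cases "v \<in> ctangent A p") auto
qed

lemma ccotangent_lincomb:
  assumes "\<xi> \<in> ccotangent A p" "\<eta> \<in> ccotangent A p" shows "(\<lambda>v. a * \<xi> v + b * \<eta> v) \<in> ccotangent A p"
  using assms unfolding ccotangent_def by (auto simp: algebra_simps)

lemma ccotangent_scale: "\<xi> \<in> ccotangent A p \<Longrightarrow> (\<lambda>v. a * \<xi> v) \<in> ccotangent A p"
  using ccotangent_lincomb[of \<xi> p \<xi> a 0] by simp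

lemma ccotangent_zero_form: "(\<lambda>_. 0) \<in> ccotangent A p"
  unfolding ccotangent_def by auto

lemma one_formsD: "\<alpha> \<in> one_forms A U \<Longrightarrow> p \<in> U \<Longrightarrow> \<alpha> p \<in> ccotangent A p"
  "\<alpha> \<in> one_forms A U \<Longrightarrow> Y \<in> vector_fields A UNIV \<Longrightarrow> smooth_fun_on A U (\<lambda>p. \<alpha> p (Y p))"
  unfolding one_forms_def by blast+

lemma one_forms_pairing_smooth: "\<alpha> \<in> one_forms A UNIV \<Longrightarrow> Y \<in> vector_fields A UNIV \<Longrightarrow> (\<lambda>p. \<alpha> p (Y p)) \<in> smooth_funs A"
  using one_formsD(2)[of \<alpha> UNIV Y] by (simp add: smooth_funs_def)

text \<open>Smoothness of a one-form is tested on global vector fields only. Near a point the coordinate field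
  agrees with its cutoff.\<close>

lemma one_form_coords_smooth:
  assumes c: "c \<in> A" and U: "open U" and \<alpha>: "\<alpha> \<in> one_forms A U"
  shows "smooth_fun_on A (U \<inter> cdom c) (\<lambda>q. \<alpha> q (coord_vec A c i q))"
proof (rule smooth_fun_on_local)
  fix p assume p: "p \<in> U \<inter> cdom c"
  then obtain \<phi> W L where \<phi>: "\<phi> \<in> smooth_funs A" "open W" "p \<in> W" "\<And>q. q \<in> W \<Longrightarrow> \<phi> q = 1" "compact L" "L \<subseteq> cdom c"
    "\<And>q. q \<notin> L \<Longrightarrow> \<phi> q = 0" using manifold_bump[OF open_UNIV UNIV_I c, of p] by (metis IntD2)
  let ?Y = "\<lambda>q f. \<phi> q * coord_vec A c i q f"
  have "?Y \<in> vector_fields A UNIV"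
    using \<phi> by (intro vector_fields_cutoff[OF open_cdom[OF c] coord_field[OF c] \<phi>(1)]) (auto simp: compact_imp_closed)
  from one_formsD(2)[OF \<alpha> this] have "smooth_fun_on A (U \<inter> cdom c \<inter> W) (\<lambda>q. \<alpha> q (?Y q))" by (rule smooth_fun_on_subset) auto
  then have "smooth_fun_on A (U \<inter> cdom c \<inter> W) (\<lambda>q. \<alpha> q (coord_vec A c i q))"
    by (rule smooth_fun_on_cong[THEN iffD1, rotated 2]) (use U \<phi> open_cdom[OF c] in auto)
  then show "\<exists>W. open W \<and> p \<in> W \<and> smooth_fun_on A (U \<inter> cdom c \<inter> W) (\<lambda>q. \<alpha> q (coord_vec A c i q))"
    using \<phi>(2,3) by blast
qed

lemma one_forms_mult:
  assumes "open U" "\<alpha> \<in> one_forms A U" "smooth_fun_on A U f" shows "(\<lambda>p v. f p * \<alpha> p v) \<in> one_forms A U"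
  using assms unfolding one_forms_def by (auto intro: ccotangent_scale smooth_fun_on_mult)

lemma one_forms_sum:
  assumes "open U" "\<And>i. i \<in> I \<Longrightarrow> \<alpha> i \<in> one_forms A U" shows "(\<lambda>p v. \<Sum>i\<in>I. \<alpha> i p v) \<in> one_forms A U"
  using assms(2)
proof (induction I rule: infinite_finite_induct)
  case (insert i I)
  have "(\<lambda>v. \<alpha> i p v + (\<Sum>i\<in>I. \<alpha> i p v)) \<in> ccotangent A p" if "p \<in> U" for p
    using ccotangent_lincomb[of "\<alpha> i p" p "\<lambda>v. \<Sum>i\<in>I. \<alpha> i p v" 1 1] insert one_formsD(1) that by fastforce
  with insert show ?case
    unfolding one_forms_def by (auto intro!: smooth_fun_on_add assms(1))
qed (auto simp: one_forms_def ccotangent_zero_form smooth_fun_on_const assms(1))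

end


section \<open>Change of variables\<close>

text \<open>The change of variables formula is stated for coordinates indexed by a well-ordered type. A copy of
  an arbitrary finite type carries such an order, and reindexing the coordinates preserves the Lebesgue
  measure and determinants.\<close>

typedef 'm ordered_copy = "UNIV :: 'm set" by simp

definition finite_enum :: "'m::finite \<Rightarrow> nat" where
  "finite_enum = (SOME f. inj f)"

lemma inj_finite_enum: "inj (finite_enum :: 'm::finite \<Rightarrow> nat)"
proof -
  have "\<exists>f :: 'm \<Rightarrow> nat. inj f" using finite_imp_inj_to_nat_seg[of "UNIV :: 'm set"] by auto
  then show ?thesis unfolding finite_enum_def by (rule someI_ex)
qed

instantiation ordered_copy :: (finite) wellorder
begin

definition less_eq_ordered_copy :: "'a ordered_copy \<Rightarrow> 'a ordered_copy \<Rightarrow> bool" where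
  "x \<le> y \<longleftrightarrow> finite_enum (Rep_ordered_copy x) \<le> finite_enum (Rep_ordered_copy y)"

definition less_ordered_copy :: "'a ordered_copy \<Rightarrow> 'a ordered_copy \<Rightarrow> bool" where
  "x < y \<longleftrightarrow> finite_enum (Rep_ordered_copy x) < finite_enum (Rep_ordered_copy y)"

instance
proof
  fix x y :: "'a ordered_copy"
  assume "x \<le> y" "y \<le> x"
  then have "finite_enum (Rep_ordered_copy x) = finite_enum (Rep_ordered_copy y)" by (simp add: less_eq_ordered_copy_def)
  then show "x = y" by (simp add: inj_eq[OF inj_finite_enum] Rep_ordered_copy_inject)
next
  fix P :: "'a ordered_copy \<Rightarrow> bool" and a :: "'a ordered_copy"
  assume "\<And>x. (\<And>y. y < x \<Longrightarrow> P y) \<Longrightarrow> P x"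
  then show "P a"
    unfolding less_ordered_copy_def by (rule measure_induct[of "\<lambda>x. finite_enum (Rep_ordered_copy x)"]) blast
qed (auto simp: less_eq_ordered_copy_def less_ordered_copy_def)

end

instance ordered_copy :: (finite) finite
proof
  have "(UNIV :: 'a ordered_copy set) = Abs_ordered_copy ` UNIV" by (metis Abs_ordered_copy_cases surjI surj_def)
  then show "finite (UNIV :: 'a ordered_copy set)" by (metis finite finite_imageI)
qed

lemma bij_Rep_ordered_copy: "bij Rep_ordered_copy"
  by (metis Abs_ordered_copy_inverse Rep_ordered_copy_inverse UNIV_I bij_betw_def inj_def surj_def)

definition reindex :: "real^'m::finite \<Rightarrow> real^'m ordered_copy" where
  "reindex x = (\<chi> j. x $ Rep_ordered_copy j)"

definition unindex :: "real^'m ordered_copy \<Rightarrow> real^'m::finite" where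
  "unindex y = (\<chi> i. y $ Abs_ordered_copy i)"

lemma unindex_reindex [simp]: "unindex (reindex x) = x" "reindex (unindex y) = y"
  by (simp_all add: reindex_def unindex_def vec_eq_iff Abs_ordered_copy_inverse Rep_ordered_copy_inverse)

lemma bounded_linear_reindex: "bounded_linear reindex" and bounded_linear_unindex: "bounded_linear unindex"
proof -
  have "linear reindex" "linear unindex" by (auto intro!: linearI simp: reindex_def unindex_def vec_eq_iff)
  then show "bounded_linear reindex" "bounded_linear unindex" by (simp_all add: linear_conv_bounded_linear)
qed

lemma lborel_reindex: "distr lborel borel (reindex :: real^'m::finite \<Rightarrow> _) = lborel"
proof (rule lborel_eqI[symmetric])
  fix l u :: "real^'m ordered_copy"
  assume le: "\<And>b. b \<in> Basis \<Longrightarrow> l \<bullet> b \<le> u \<bullet> b"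
  have meas: "reindex \<in> measurable lborel (borel :: (real^'m ordered_copy) measure)"
    using borel_measurable_continuous_onI[OF linear_continuous_on[OF bounded_linear_reindex]] by simp
  have le': "l $ j \<le> u $ j" for j using le[of "axis j 1"] by (auto simp: Basis_vec_def inner_axis)
  have vi: "reindex -` box l u = box (unindex l) (unindex u)"
  proof (rule set_eqI)
    fix x :: "real^'m"
    have "reindex x \<in> box l u \<longleftrightarrow> (\<forall>j. l $ j < x $ Rep_ordered_copy j \<and> x $ Rep_ordered_copy j < u $ j)"
      by (simp add: mem_box_cart reindex_def)
    also have "\<dots> \<longleftrightarrow> (\<forall>i. l $ Abs_ordered_copy i < x $ i \<and> x $ i < u $ Abs_ordered_copy i)"
      by (metis Abs_ordered_copy_inverse Rep_ordered_copy_inverse UNIV_I)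
    also have "\<dots> \<longleftrightarrow> x \<in> box (unindex l) (unindex u)" by (simp add: mem_box_cart unindex_def)
    finally show "x \<in> reindex -` box l u \<longleftrightarrow> x \<in> box (unindex l) (unindex u)" by simp
  qed
  have "emeasure (distr lborel borel reindex) (box l u) = emeasure lborel (box (unindex l) (unindex u))"
    using emeasure_distr[OF meas, of "box l u"] vi by simp
  also have "\<dots> = (\<Prod>b\<in>Basis. (unindex u - unindex l) \<bullet> b)"
  proof (rule emeasure_lborel_box)
    fix b :: "real^'m" assume "b \<in> Basis"
    then obtain i where "b = axis i 1" by (auto simp: Basis_vec_def)
    then show "unindex l \<bullet> b \<le> unindex u \<bullet> b" using le' by (simp add: inner_axis unindex_def)
  qed
  also have "(\<Prod>b\<in>Basis. (unindex u - unindex l) \<bullet> b) = (\<Prod>b\<in>Basis. (u - l) \<bullet> b)"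
  proof -
    have prod_Basis: "(\<Prod>b\<in>(Basis :: (real^'n::finite) set). f b) = (\<Prod>i\<in>UNIV. f (axis i 1))" for f :: "real^'n::finite \<Rightarrow> real"
    proof -
      have B: "(Basis :: (real^'n) set) = (\<lambda>i. axis i 1) ` UNIV" by (auto simp: Basis_vec_def)
      have "inj (\<lambda>i::'n. axis i (1::real))" by (auto simp: inj_on_def axis_eq_axis)
      then show ?thesis unfolding B by (subst prod.reindex) auto
    qed
    have "(\<Prod>b\<in>Basis. (u - l) \<bullet> b) = (\<Prod>j\<in>UNIV. u $ j - l $ j)" by (simp add: prod_Basis inner_axis)
    also have "\<dots> = (\<Prod>j\<in>UNIV. (unindex u - unindex l) $ Rep_ordered_copy j)" by (simp add: unindex_def Rep_ordered_copy_inverse)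
    also have "\<dots> = (\<Prod>i\<in>UNIV. (unindex u - unindex l) $ i)"
      by (rule prod.reindex_bij_betw[OF bij_Rep_ordered_copy])
    finally show ?thesis by (simp add: prod_Basis inner_axis)
  qed
  finally show "emeasure (distr lborel borel reindex) (box l u) = (\<Prod>b\<in>Basis. (u - l) \<bullet> b)" .
qed simp

lemma sign_conjugate:
  fixes h :: "'a::finite \<Rightarrow> 'b::finite"
  assumes "bij h" "p permutes UNIV"
  shows "sign (h \<circ> p \<circ> inv h) = sign p" "h \<circ> p \<circ> inv h permutes UNIV"
proof -
  have inv: "inv h (h x) = x" "h (inv h y) = y" for x y
    using assms(1) by (simp_all add: bij_is_inj bij_is_surj surj_f_inv_f)
  have perm: "h \<circ> p \<circ> inv h permutes UNIV" if "p permutes UNIV" for p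
    using bij_comp[OF bij_imp_bij_inv[OF assms(1)] bij_comp[OF permutes_bij[OF that] assms(1)]]
    by (intro bij_imp_permutes) (simp_all add: comp_assoc)
  show "h \<circ> p \<circ> inv h permutes UNIV" by (rule perm[OF assms(2)])
  show "sign (h \<circ> p \<circ> inv h) = sign p"
    using assms(2) finite[of UNIV]
  proof (induction p rule: permutes_induct)
    case id
    have "h \<circ> id \<circ> inv h = id" by (auto simp: inv)
    then show ?case by simp
  next
    case (swap a b p)
    have eq: "h \<circ> (Transposition.transpose a b \<circ> p) \<circ> inv h = Transposition.transpose (h a) (h b) \<circ> (h \<circ> p \<circ> inv h)"
      using assms(1) by (auto simp: fun_eq_iff Transposition.transpose_def inv bij_is_inj inj_eq)
    have pp: "permutation p" "permutation (h \<circ> p \<circ> inv h)"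
      using swap.hyps(4) perm[OF swap.hyps(4)] permutes_imp_permutation[OF finite] by blast+
    have hab: "h a = h b \<longleftrightarrow> a = b" using assms(1) by (simp add: bij_is_inj inj_eq)
    then show ?case
      unfolding eq
      by (simp only: sign_compose[OF permutation_swap_id pp(1)] sign_compose[OF permutation_swap_id pp(2)] sign_swap_id hab swap.IH)
  qed
qed

text \<open>Conjugation by the bijection between the index types is a bijection between the permutations in the
  Leibniz formula that preserves signs.\<close>

lemma det_reindex:
  fixes M :: "real^'m::finite^'m"
  shows "det (\<chi> i j. M $ Rep_ordered_copy i $ Rep_ordered_copy j) = det M"
proof -
  let ?h = "Abs_ordered_copy :: 'm \<Rightarrow> 'm ordered_copy"
  have bh: "bij ?h" by (metis Abs_ordered_copy_inverse Rep_ordered_copy_inverse UNIV_I bij_betw_def inj_def surj_def)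
  have ih: "inv ?h = Rep_ordered_copy"
    by (rule inv_equality) (simp_all add: Abs_ordered_copy_inverse Rep_ordered_copy_inverse)
  let ?c = "\<lambda>p. ?h \<circ> p \<circ> inv ?h"
  have "det (\<chi> i j. M $ Rep_ordered_copy i $ Rep_ordered_copy j)
    = (\<Sum>q | q permutes UNIV. of_int (sign q) * (\<Prod>i\<in>UNIV. M $ Rep_ordered_copy i $ Rep_ordered_copy (q i)))"
    by (simp add: det_def)
  also have "\<dots> = (\<Sum>p | p permutes UNIV. of_int (sign p) * (\<Prod>i\<in>UNIV. M $ i $ p i))"
  proof (rule sum.reindex_bij_witness[where i = ?c and j = "\<lambda>q. Rep_ordered_copy \<circ> q \<circ> ?h"])
    fix q :: "'m ordered_copy \<Rightarrow> 'm ordered_copy" assume q: "q \<in> {q. q permutes UNIV}"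
    have hh: "inv (Rep_ordered_copy :: 'm ordered_copy \<Rightarrow> 'm) = ?h"
      by (rule inv_equality) (simp_all add: Abs_ordered_copy_inverse Rep_ordered_copy_inverse)
    show "Rep_ordered_copy \<circ> q \<circ> ?h \<in> {p. p permutes UNIV}"
      using sign_conjugate(2)[OF bij_Rep_ordered_copy, of q] q by (simp add: hh)
    show "?c (Rep_ordered_copy \<circ> q \<circ> ?h) = q"
      by (simp add: ih fun_eq_iff Rep_ordered_copy_inverse)
    have "sign (Rep_ordered_copy \<circ> q \<circ> ?h) = sign q" using sign_conjugate(1)[OF bij_Rep_ordered_copy, of q] q by (simp add: hh)
    moreover have "(\<Prod>i\<in>UNIV. M $ i $ (Rep_ordered_copy \<circ> q \<circ> ?h) i) = (\<Prod>i\<in>UNIV. M $ Rep_ordered_copy i $ Rep_ordered_copy (q i))"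
      by (subst prod.reindex_bij_betw[OF bij_Rep_ordered_copy, symmetric]) (simp add: Rep_ordered_copy_inverse)
    ultimately show "of_int (sign (Rep_ordered_copy \<circ> q \<circ> ?h)) * (\<Prod>i\<in>UNIV. M $ i $ (Rep_ordered_copy \<circ> q \<circ> ?h) i)
      = of_int (sign q) * (\<Prod>i\<in>UNIV. M $ Rep_ordered_copy i $ Rep_ordered_copy (q i))" by simp
  next
    fix p :: "'m \<Rightarrow> 'm" assume p: "p \<in> {p. p permutes UNIV}"
    show "?c p \<in> {q. q permutes UNIV}" using sign_conjugate(2)[OF bh, of p] p by simp
    show "Rep_ordered_copy \<circ> ?c p \<circ> ?h = p" by (simp add: ih fun_eq_iff Abs_ordered_copy_inverse)
  qed
  finally show ?thesis by (simp add: det_def)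
qed

lemma integral_vanish_outside:
  fixes f :: "'a::euclidean_space \<Rightarrow> real"
  assumes "integrable lborel f" "\<And>x. x \<notin> T \<Longrightarrow> f x = 0"
  shows "f absolutely_integrable_on T" "integral T f = (LINT x|lborel. f x)"
proof -
  have eq: "(\<lambda>x. if x \<in> T then f x else 0) = f" using assms(2) by auto
  have "f absolutely_integrable_on UNIV"
    using assms(1) by (simp add: set_integrable_def integrable_completion)
  then show "f absolutely_integrable_on T" using absolutely_integrable_restrict_UNIV[of T f] eq by simp
  show "integral T f = (LINT x|lborel. f x)"
    using integral_restrict_UNIV[of T f] eq integral_lborel[OF assms(1)] by simp
qed

lemma change_of_variables_real:
  fixes F :: "real^'m::finite \<Rightarrow> real^'m" and f g :: "real^'m \<Rightarrow> real"
  assumes W: "open W" and F: "\<And>x. x \<in> W \<Longrightarrow> (F has_derivative F' x) (at x)" and inj: "inj_on F W"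
    and f: "integrable lborel f" "\<And>y. y \<notin> F ` W \<Longrightarrow> f y = 0"
    and g: "integrable lborel g" "\<And>x. x \<notin> W \<Longrightarrow> g x = 0"
    and eq: "\<And>x. x \<in> W \<Longrightarrow> g x = \<bar>det (matrix (F' x))\<bar> * f (F x)"
  shows "(LINT x|lborel. g x) = (LINT y|lborel. f y)"
proof -
  have meas: "reindex \<in> measurable lborel (borel :: (real^'m ordered_copy) measure)"
    using borel_measurable_continuous_onI[OF linear_continuous_on[OF bounded_linear_reindex]] by simp
  have unm: "unindex \<in> measurable borel (borel :: (real^'m) measure)"
    using borel_measurable_continuous_onI[OF linear_continuous_on[OF bounded_linear_unindex]] by simp
  have transfer: "integrable lborel (\<lambda>y. h (unindex y))" "(LINT y|lborel. h (unindex y)) = (LINT x|lborel. h x)"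
    if h: "integrable lborel h" for h :: "real^'m \<Rightarrow> real"
  proof -
    have hm: "(\<lambda>y. h (unindex y)) \<in> borel_measurable borel"
      using measurable_compose[OF unm, of h] borel_measurable_integrable[OF h] by simp
    show "integrable lborel (\<lambda>y. h (unindex y))"
      unfolding lborel_reindex[symmetric] by (subst integrable_distr_eq[OF meas hm]) (simp add: h)
    show "(LINT y|lborel. h (unindex y)) = (LINT x|lborel. h x)"
      by (subst lborel_reindex[symmetric], subst integral_distr[OF meas hm]) simp
  qed
  let ?G = "\<lambda>y. reindex (F (unindex y))" and ?S = "reindex ` W"
  let ?f = "\<lambda>y. vec (f (unindex y)) :: real^1"
  have GS: "?G ` ?S = reindex ` (F ` W)" by (simp add: image_image)
  have S: "?S \<in> sets lebesgue"
  proof -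
    have "?S = unindex -` W" by (force simp: image_iff)
    moreover have "open (unindex -` W)"
      by (rule open_vimage[OF W linear_continuous_on[OF bounded_linear_unindex]])
    ultimately show ?thesis by simp
  qed
  have G: "(?G has_derivative (\<lambda>v. reindex (F' (unindex y) (unindex v)))) (at y within ?S)" if "y \<in> ?S" for y
  proof -
    have "unindex y \<in> W" using that by auto
    have "(unindex has_derivative unindex) (at y within ?S)"
      using bounded_linear_imp_has_derivative[OF bounded_linear_unindex] by (rule has_derivative_at_withinI)
    from has_derivative_compose[OF this F[OF \<open>unindex y \<in> W\<close>]]
    show ?thesis by (rule bounded_linear.has_derivative[OF bounded_linear_reindex])
  qed
  have injG: "inj_on ?G ?S"
    using inj by (auto simp: inj_on_def) (metis unindex_reindex(1))
  have detG: "det (matrix (\<lambda>v. reindex (F' (unindex y) (unindex v)))) = det (matrix (F' (unindex y)))" for y :: "real^'m ordered_copy"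
  proof -
    have ax: "unindex (axis j 1) = axis (Rep_ordered_copy j) 1" for j
      by (auto simp: unindex_def axis_def vec_eq_iff Abs_ordered_copy_inverse Rep_ordered_copy_inverse)
    have "matrix (\<lambda>v. reindex (F' (unindex y) (unindex v))) = (\<chi> i j. matrix (F' (unindex y)) $ Rep_ordered_copy i $ Rep_ordered_copy j)"
      by (simp add: matrix_def reindex_def ax)
    then show ?thesis by (simp add: det_reindex)
  qed
  have 1: "?f absolutely_integrable_on (?G ` ?S)" "integral (?G ` ?S) ?f = vec (LINT y|lborel. f y)"
  proof -
    have off: "f (unindex y) = 0" if "y \<notin> ?G ` ?S" for y
      using that f(2)[of "unindex y"] unfolding GS by (metis image_eqI unindex_reindex(2))
    note * = integral_vanish_outside[OF transfer(1)[OF f(1)] off]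
    show "?f absolutely_integrable_on (?G ` ?S)" using *(1) by (simp add: absolutely_integrable_on_1_iff)
    show "integral (?G ` ?S) ?f = vec (LINT y|lborel. f y)"
      using *(2) transfer(2)[OF f(1)] by (simp add: integral_on_1_eq)
  qed
  have "integral ?S (\<lambda>y. \<bar>det (matrix (\<lambda>v. reindex (F' (unindex y) (unindex v))))\<bar> *\<^sub>R ?f (?G y)) = vec (LINT y|lborel. f y)"
    using has_absolute_integral_change_of_variables[OF S G injG, of ?f "vec (LINT y|lborel. f y)"] 1 by blast
  moreover have "integral ?S (\<lambda>y. \<bar>det (matrix (\<lambda>v. reindex (F' (unindex y) (unindex v))))\<bar> *\<^sub>R ?f (?G y)) = integral ?S (\<lambda>y. vec (g (unindex y)) :: real^1)"
  proof (rule integral_cong)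
    fix y assume "y \<in> ?S"
    then have "unindex y \<in> W" by auto
    from eq[OF this] show "\<bar>det (matrix (\<lambda>v. reindex (F' (unindex y) (unindex v))))\<bar> *\<^sub>R ?f (?G y) = (vec (g (unindex y)) :: real^1)"
      unfolding detG by (simp add: vec_eq_iff)
  qed
  moreover have "integral ?S (\<lambda>y. vec (g (unindex y)) :: real^1) = vec (LINT x|lborel. g x)"
  proof -
    have off: "g (unindex y) = 0" if "y \<notin> ?S" for y
      using that g(2)[of "unindex y"] by (metis image_eqI unindex_reindex(2))
    show ?thesis
      using integral_vanish_outside(2)[OF transfer(1)[OF g(1)] off] transfer(2)[OF g(1)] by (simp add: integral_on_1_eq)
  qed
  ultimately have "(vec (LINT x|lborel. g x) :: real^1) = vec (LINT y|lborel. f y)" by simp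
  then show ?thesis by (simp add: vec_eq_iff)
qed

lemma change_of_variables_test_funs:
  fixes F :: "real^'m::finite \<Rightarrow> real^'m"
  assumes W: "open W" and F: "smooth_on W F" and inj: "inj_on F W"
    and f: "f \<in> test_funs (F ` W)" and g: "g \<in> test_funs W"
    and eq: "\<And>x. x \<in> W \<Longrightarrow> g x = of_real \<bar>det (matrix (frechet_derivative F (at x)))\<bar> * f (F x)"
  shows "(LINT x|lborel. g x) = (LINT y|lborel. f y)"
proof -
  have "(LINT x|lborel. Re (g x)) = (LINT y|lborel. Re (f y))"
    by (rule change_of_variables_real[OF W smooth_on_has_derivative[OF F] inj])
       (auto simp: eq test_funs_outside[OF f] test_funs_outside[OF g] test_funs_integrable[OF f] test_funs_integrable[OF g])
  moreover have "(LINT x|lborel. Im (g x)) = (LINT y|lborel. Im (f y))"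
    by (rule change_of_variables_real[OF W smooth_on_has_derivative[OF F] inj])
       (auto simp: eq test_funs_outside[OF f] test_funs_outside[OF g] test_funs_integrable[OF f] test_funs_integrable[OF g])
  ultimately show ?thesis
    using test_funs_integrable[OF f] test_funs_integrable[OF g] by (simp add: complex_eq_iff integral_Re integral_Im)
qed


section \<open>Densities and distributions on the manifold\<close>

lemma smooth_on_abs:
  fixes f :: "'a::real_normed_vector \<Rightarrow> real"
  assumes S: "open S" and f: "smooth_on S f" and nz: "\<And>x. x \<in> S \<Longrightarrow> f x \<noteq> 0"
  shows "smooth_on S (\<lambda>x. \<bar>f x\<bar>)"
proof (rule smooth_on_local)
  fix x assume x: "x \<in> S"
  let ?U = "{y \<in> S. f x * f y > 0}"
  have "continuous_on S (\<lambda>y. f x * f y)" by (intro continuous_intros smooth_on_continuous f)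
  then have U: "open ?U" using S continuous_open_preimage[of S "\<lambda>y. f x * f y" "{0<..}"] by (simp add: vimage_def Int_def)
  have "smooth_on ?U (\<lambda>y. sgn (f x) * f y)"
    by (rule smooth_on_mult[OF U smooth_on_const[OF U] smooth_on_subset[OF f]]) auto
  then have "smooth_on ?U (\<lambda>y. \<bar>f y\<bar>)"
    by (rule smooth_on_cong[OF U, THEN iffD1, rotated]) (auto simp: zero_less_mult_iff sgn_if)
  moreover have "x \<in> ?U" using x nz[OF x] by (auto simp: zero_less_mult_iff linorder_neq_iff)
  moreover have "S \<inter> ?U = ?U" by auto
  ultimately show "\<exists>U. open U \<and> x \<in> U \<and> smooth_on (S \<inter> U) (\<lambda>x. \<bar>f x\<bar>)" using U by metis
qed

context smooth_manifold
begin

lemma cinv_notin: "c \<in> A \<Longrightarrow> x \<in> cmap c ` cdom c \<Longrightarrow> x \<notin> cmap c ` K \<Longrightarrow> cinv c x \<notin> K"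
  by (metis cmap_cinv image_eqI)

definition dens_coeff :: "('a, 'm) chart \<Rightarrow> ('a, 'm) dens \<Rightarrow> real^'m \<Rightarrow> complex" where
  "dens_coeff c \<mu> x = (if x \<in> cmap c ` cdom c then \<mu> c (cinv c x) else 0)"

lemma open_cdom_Int: "c \<in> A \<Longrightarrow> c' \<in> A \<Longrightarrow> open (cdom c \<inter> cdom c')"
  by (intro open_Int open_cdom)

lemma jacobian_eq: "jacobian c c' p = \<bar>det (matrix (frechet_derivative (\<lambda>x. cmap c (cinv c' x)) (at (cmap c' p))))\<bar>"
  by (simp add: jacobian_def comp_def)

lemma jacobian_cocycle:
  assumes c: "c \<in> A" "c1 \<in> A" "c2 \<in> A" and p: "p \<in> cdom c" "p \<in> cdom c1" "p \<in> cdom c2"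
  shows "jacobian c c2 p = jacobian c c1 p * jacobian c1 c2 p"
proof -
  let ?F = "\<lambda>x. cmap c (cinv c1 x)" and ?G = "\<lambda>x. cmap c1 (cinv c2 x)" and ?x = "cmap c2 p"
  let ?W = "cmap c2 ` ((cdom c \<inter> cdom c1) \<inter> cdom c2)"
  have W: "open ?W" by (rule open_cmap_image[OF c(3) open_cdom_Int[OF c(1,2)]])
  have x: "?x \<in> ?W" using p by auto
  have Gx: "?G ?x = cmap c1 p" using c p by simp
  have F: "(?F has_derivative frechet_derivative ?F (at (cmap c1 p))) (at (cmap c1 p))"
    by (rule smooth_on_has_derivative[OF smooth_transition[OF c(2,1)]]) (use p in auto)
  have G: "(?G has_derivative frechet_derivative ?G (at ?x)) (at ?x)"
    by (rule smooth_on_has_derivative[OF smooth_transition[OF c(3,2)]]) (use p in auto)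
  have "((\<lambda>x. ?F (?G x)) has_derivative (\<lambda>v. frechet_derivative ?F (at (cmap c1 p)) (frechet_derivative ?G (at ?x) v))) (at ?x)"
    using has_derivative_compose[OF G, of ?F] F by (simp add: Gx)
  then have "((\<lambda>x. cmap c (cinv c2 x)) has_derivative (\<lambda>v. frechet_derivative ?F (at (cmap c1 p)) (frechet_derivative ?G (at ?x) v))) (at ?x)"
    by (rule has_derivative_transform_within_open[OF _ W x]) (use c in auto)
  then have "frechet_derivative (\<lambda>x. cmap c (cinv c2 x)) (at ?x) = frechet_derivative ?F (at (cmap c1 p)) \<circ> frechet_derivative ?G (at ?x)"
    by (simp add: frechet_derivative_eqI comp_def)
  then show ?thesis
    unfolding jacobian_eq
    using matrix_compose[OF has_derivative_linear[OF G] has_derivative_linear[OF F]] by (simp add: det_mul abs_mult)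
qed

lemma jacobian_self: assumes c: "c \<in> A" "p \<in> cdom c" shows "jacobian c c p = 1"
proof -
  have "((\<lambda>x. x) has_derivative (\<lambda>x. x)) (at (cmap c p))" by simp
  then have "((\<lambda>x. cmap c (cinv c x)) has_derivative (\<lambda>x. x)) (at (cmap c p))"
    by (rule has_derivative_transform_within_open[OF _ open_cimg[OF c(1)]]) (use c in auto)
  then have "frechet_derivative (\<lambda>x. cmap c (cinv c x)) (at (cmap c p)) = (\<lambda>x. x)" by (rule frechet_derivative_eqI)
  then show ?thesis by (simp add: jacobian_eq matrix_id_mat_1[unfolded id_def])
qed

lemma jacobian_nonzero: assumes "c \<in> A" "c' \<in> A" "p \<in> cdom c" "p \<in> cdom c'" shows "jacobian c c' p \<noteq> 0"
  using jacobian_cocycle[of c c' c p] jacobian_self[of c p] assms by auto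

lemma jacobian_smooth:
  assumes c: "c \<in> A" "c' \<in> A"
  shows "smooth_fun_on A (cdom c \<inter> cdom c') (\<lambda>p. of_real (jacobian c c' p))"
proof (rule smooth_fun_on_chartI[OF c(2)])
  let ?O = "cdom c \<inter> cdom c'"
  show O: "open ?O" by (rule open_cdom_Int[OF c])
  have W: "open (cmap c' ` ?O)" using open_cmap_image[OF c(2) O] by (simp add: Int_assoc)
  let ?F = "\<lambda>x. cmap c (cinv c' x)"
  have F: "smooth_on (cmap c' ` ?O) ?F" using smooth_transition[OF c(2,1)] by (simp add: Int_commute)
  have entry: "smooth_on (cmap c' ` ?O) (\<lambda>x. matrix (frechet_derivative ?F (at x)) $ i $ j)" for i j
    unfolding matrix_def using smooth_on_bounded_linear_compose[OF W bounded_linear_vec_nth smooth_on_frechet[OF F]] by simp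
  have det: "smooth_on (cmap c' ` ?O) (\<lambda>x. det (matrix (frechet_derivative ?F (at x))))"
    unfolding det_def by (intro smooth_on_sum smooth_on_mult smooth_on_prod smooth_on_const W entry)
  have "smooth_on (cmap c' ` ?O) (\<lambda>x. \<bar>det (matrix (frechet_derivative ?F (at x)))\<bar>)"
  proof (rule smooth_on_abs[OF W det])
    fix x assume "x \<in> cmap c' ` ?O"
    then show "det (matrix (frechet_derivative ?F (at x))) \<noteq> 0" using jacobian_nonzero[OF c] c by (auto simp: jacobian_eq)
  qed
  then have "smooth_on (cmap c' ` ?O) (\<lambda>x. complex_of_real \<bar>det (matrix (frechet_derivative ?F (at x)))\<bar>)"
    by (rule smooth_on_of_real[OF W])
  then show "smooth_on (cmap c' ` ?O) (\<lambda>x. complex_of_real (jacobian c c' (cinv c' x)))"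
    by (rule smooth_on_cong[OF W, THEN iffD1, rotated]) (use c in \<open>auto simp: jacobian_eq\<close>)
qed auto

lemma test_densE:
  assumes "\<mu> \<in> test_dens A U"
  obtains K where "compact K" "K \<subseteq> U" "\<And>c p. p \<notin> K \<Longrightarrow> \<mu> c p = 0"
  using assms unfolding test_dens_def by blast

lemma test_densD:
  assumes "\<mu> \<in> test_dens A U"
  shows "c \<notin> A \<or> p \<notin> cdom c \<Longrightarrow> \<mu> c p = 0" "c \<in> A \<Longrightarrow> smooth_fun_on A (cdom c) (\<mu> c)"
    "c \<in> A \<Longrightarrow> c' \<in> A \<Longrightarrow> p \<in> cdom c \<Longrightarrow> p \<in> cdom c' \<Longrightarrow> \<mu> c' p = of_real (jacobian c c' p) * \<mu> c p"
    "p \<notin> U \<Longrightarrow> \<mu> c p = 0"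
  using assms unfolding test_dens_def by blast+

lemma test_densI:
  assumes "\<And>c p. c \<notin> A \<or> p \<notin> cdom c \<Longrightarrow> \<mu> c p = 0" "\<And>c. c \<in> A \<Longrightarrow> smooth_fun_on A (cdom c) (\<mu> c)"
    "\<And>c c' p. c \<in> A \<Longrightarrow> c' \<in> A \<Longrightarrow> p \<in> cdom c \<Longrightarrow> p \<in> cdom c' \<Longrightarrow> \<mu> c' p = of_real (jacobian c c' p) * \<mu> c p"
    "compact K" "K \<subseteq> U" "\<And>c p. p \<notin> K \<Longrightarrow> \<mu> c p = 0"
  shows "\<mu> \<in> test_dens A U"
  unfolding test_dens_def
proof (intro CollectI conjI allI impI ballI)
  show "\<exists>K. compact K \<and> K \<subseteq> U \<and> (\<forall>c p. p \<notin> K \<longrightarrow> \<mu> c p = 0)"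
    using assms(4-6) by (intro exI[of _ K]) blast
next
  fix c c' p assume "c \<in> A" "c' \<in> A" "p \<in> cdom c \<inter> cdom c'"
  then show "\<mu> c' p = of_real (jacobian c c' p) * \<mu> c p" by (intro assms(3)) auto
qed (fact assms(1) assms(2))+

lemma test_dens_mono: "\<mu> \<in> test_dens A U \<Longrightarrow> U \<subseteq> V \<Longrightarrow> \<mu> \<in> test_dens A V"
  unfolding test_dens_def by blast

lemma test_dens_mult:
  assumes f: "f \<in> smooth_funs A" and \<mu>: "\<mu> \<in> test_dens A U"
  shows "(\<lambda>c p. f p * \<mu> c p) \<in> test_dens A U"
proof -
  obtain K where K: "compact K" "K \<subseteq> U" "\<And>c p. p \<notin> K \<Longrightarrow> \<mu> c p = 0" using \<mu> by (rule test_densE) blast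
  show ?thesis
  proof (rule test_densI[OF _ _ _ K(1,2)])
    fix c c' p assume "c \<in> A" "c' \<in> A" "p \<in> cdom c" "p \<in> cdom c'"
    from test_densD(3)[OF \<mu> this] show "f p * \<mu> c' p = of_real (jacobian c c' p) * (f p * \<mu> c p)" by simp
  qed (simp_all add: test_densD(1)[OF \<mu>] K(3) smooth_fun_on_mult[OF open_cdom smooth_funs_on[OF f] test_densD(2)[OF \<mu>]])
qed

lemma test_dens_mult_supp:
  assumes f: "f \<in> smooth_funs A" "compact L" "L \<subseteq> V" "\<And>p. p \<notin> L \<Longrightarrow> f p = 0" and \<mu>: "\<mu> \<in> test_dens A U"
  shows "(\<lambda>c p. f p * \<mu> c p) \<in> test_dens A V"
proof -
  show ?thesis
    by (rule test_densI[OF test_densD(1-3)[OF test_dens_mult[OF f(1) \<mu>]] f(2,3)]) (use f(4) in simp_all)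
qed

lemma dens_coeff_test_fun:
  assumes c: "c \<in> A" and U: "open U" "U \<subseteq> cdom c" and \<mu>: "\<mu> \<in> test_dens A U"
  shows "dens_coeff c \<mu> \<in> test_funs (cmap c ` U)"
proof -
  obtain K where K: "compact K" "K \<subseteq> U" "\<And>c p. p \<notin> K \<Longrightarrow> \<mu> c p = 0" using \<mu> by (rule test_densE) blast
  have U': "cmap c ` U = cmap c ` (U \<inter> cdom c)" using U(2) by (simp add: Int_absorb2)
  have W: "open (cmap c ` U)" unfolding U' by (rule open_cmap_image[OF c U(1)])
  show ?thesis
  proof (rule test_funsI[OF W])
    have "smooth_on (cmap c ` U) (\<lambda>x. \<mu> c (cinv c x))"
      using smooth_on_subset[OF smooth_fun_onD[OF test_densD(2)[OF \<mu> c] c]] U(2) by (auto simp: image_mono)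
    then show "smooth_on (cmap c ` U) (dens_coeff c \<mu>)"
      by (rule smooth_on_cong[OF W, THEN iffD1, rotated]) (use U(2) in \<open>auto simp: dens_coeff_def\<close>)
    show "compact (cmap c ` K)" using compact_cmap_image[OF c K(1)] K(2) U(2) by blast
    show "cmap c ` K \<subseteq> cmap c ` U" using K(2) by blast
    show "dens_coeff c \<mu> x = 0" if "x \<notin> cmap c ` K" for x
      using K(3)[OF cinv_notin[OF c _ that]] by (simp add: dens_coeff_def)
  qed
qed

lemma chart_dens_test_dens:
  assumes c: "c \<in> A" and U: "open U" "U \<subseteq> cdom c" and g: "g \<in> test_funs (cmap c ` U)"
  shows "chart_dens A c g \<in> test_dens A U"
proof -
  obtain K where K: "compact K" "K \<subseteq> cmap c ` U" "\<And>x. x \<notin> K \<Longrightarrow> g x = 0" using g by (rule test_funsE) blast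
  have K': "K \<subseteq> cmap c ` cdom c" using K(2) U(2) by blast
  note L = compact_cinv_image[OF c K(1) K']
  have LU: "cinv c ` K \<subseteq> U" using K(2) U(2) c by (auto simp: subset_iff)
  have off: "chart_dens A c g c' p = 0" if "p \<notin> cinv c ` K" for c' p
    using that K(3)[of "cmap c p"] c by (force simp: chart_dens_def)
  have g': "g \<in> test_funs (cmap c ` cdom c)" using test_funs_mono[OF g] U(2) by blast
  show ?thesis
    unfolding test_dens_def
  proof (intro CollectI conjI allI impI ballI)
    fix c' p assume "c' \<notin> A \<or> p \<notin> cdom c'"
    then show "chart_dens A c g c' p = 0" by (auto simp: chart_dens_def)
  next
    fix c' assume c': "c' \<in> A"
    show "smooth_fun_on A (cdom c') (chart_dens A c g c')"
    proof (rule smooth_fun_on_vanish_outside[OF open_cdom[OF c] compact_imp_closed[OF L(1)] L(2)])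
      have O: "open (cdom c \<inter> cdom c')" by (rule open_cdom_Int[OF c c'])
      have "smooth_fun_on A (cdom c \<inter> cdom c') (\<lambda>p. of_real (jacobian c c' p) * extend_zero c g p)"
        by (intro smooth_fun_on_mult O jacobian_smooth c c' smooth_funs_on extend_zero_smooth g')
      then show "smooth_fun_on A (cdom c \<inter> cdom c') (chart_dens A c g c')"
        by (rule smooth_fun_on_cong[OF O, THEN iffD1, rotated]) (use c' in \<open>auto simp: chart_dens_def extend_zero_def\<close>)
    qed (use off open_cdom[OF c'] in auto)
  next
    fix c1 c2 p assume c12: "c1 \<in> A" "c2 \<in> A" "p \<in> cdom c1 \<inter> cdom c2"
    show "chart_dens A c g c2 p = of_real (jacobian c1 c2 p) * chart_dens A c g c1 p"
      using jacobian_cocycle[OF c c12(1,2), of p] c12 by (auto simp: chart_dens_def)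
  next
    show "\<exists>K. compact K \<and> K \<subseteq> U \<and> (\<forall>c' p. p \<notin> K \<longrightarrow> chart_dens A c g c' p = 0)"
      using L(1) LU off by blast
  qed
qed

lemma chart_dens_dens_coeff:
  assumes c: "c \<in> A" and \<mu>: "\<mu> \<in> test_dens A (cdom c)"
  shows "chart_dens A c (dens_coeff c \<mu>) = \<mu>"
proof (intro ext)
  fix c' p
  show "chart_dens A c (dens_coeff c \<mu>) c' p = \<mu> c' p"
    using test_densD(1)[OF \<mu>, of c' p] test_densD(3)[OF \<mu> c, of c' p] test_densD(4)[OF \<mu>, of p c'] c
    by (auto simp: chart_dens_def dens_coeff_def)
qed

lemma dens_coeff_chart_dens:
  assumes c: "c \<in> A" and x: "x \<in> cmap c ` cdom c"
  shows "dens_coeff c (chart_dens A c g) x = g x"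
  using x cinv_in[OF c x] cmap_cinv[OF c x] jacobian_self[OF c cinv_in[OF c x]] c by (simp add: dens_coeff_def chart_dens_def)

lemma smooth_cdom_pull: "c \<in> A \<Longrightarrow> smooth_fun_on A (cdom c) h \<Longrightarrow> smooth_on (cmap c ` cdom c) (\<lambda>x. h (cinv c x))"
  using smooth_fun_onD[of "cdom c" h c] by simp

text \<open>The Jacobian in the transformation law of densities is that of the change of variables formula.\<close>

lemma dens_integral_chart_change:
  assumes c: "c \<in> A" "c' \<in> A" and \<mu>: "\<mu> \<in> test_dens A (cdom c \<inter> cdom c')" and h: "smooth_fun_on A (cdom c \<inter> cdom c') h"
  shows "(LINT x|lborel. dens_coeff c' \<mu> x * h (cinv c' x)) = (LINT x|lborel. dens_coeff c \<mu> x * h (cinv c x))"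
proof -
  let ?O = "cdom c \<inter> cdom c'" and ?F = "\<lambda>x. cmap c (cinv c' x)"
  have O: "open ?O" by (rule open_cdom_Int[OF c])
  have W: "open (cmap c' ` ?O)" "open (cmap c ` ?O)"
    using open_cmap_image[OF c(2) open_cdom[OF c(1)]] open_cmap_image[OF c(1) open_cdom[OF c(2)]] by (simp_all add: Int_commute)
  have F: "smooth_on (cmap c' ` ?O) ?F" using smooth_transition[OF c(2,1)] by (simp add: Int_commute)
  have FW: "?F ` (cmap c' ` ?O) = cmap c ` ?O" using c by (auto simp: image_iff)
  have hc: "smooth_on (cmap c' ` ?O) (\<lambda>x. h (cinv c' x))" "smooth_on (cmap c ` ?O) (\<lambda>x. h (cinv c x))"
    using smooth_fun_onD[OF h c(2)] smooth_fun_onD[OF h c(1)] by (simp_all add: Int_assoc Int_commute Int_left_commute)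
  have inj: "inj_on ?F (cmap c' ` ?O)"
  proof (rule inj_on_inverseI[where g = "\<lambda>x. cmap c' (cinv c x)"])
    fix x assume "x \<in> cmap c' ` ?O" then show "cmap c' (cinv c (?F x)) = x" using c by auto
  qed
  show ?thesis
  proof (rule change_of_variables_test_funs[OF W(1) F inj])
    show "(\<lambda>x. dens_coeff c \<mu> x * h (cinv c x)) \<in> test_funs (?F ` cmap c' ` ?O)"
      unfolding FW by (rule test_funs_mult[OF W(2) dens_coeff_test_fun[OF c(1) O _ \<mu>] hc(2)]) auto
    show "(\<lambda>x. dens_coeff c' \<mu> x * h (cinv c' x)) \<in> test_funs (cmap c' ` ?O)"
      by (rule test_funs_mult[OF W(1) dens_coeff_test_fun[OF c(2) O _ \<mu>] hc(1)]) auto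
    fix x assume "x \<in> cmap c' ` ?O"
    then obtain p where p: "x = cmap c' p" "p \<in> cdom c" "p \<in> cdom c'" by auto
    then show "dens_coeff c' \<mu> x * h (cinv c' x) = of_real \<bar>det (matrix (frechet_derivative ?F (at x)))\<bar> * (dens_coeff c \<mu> (?F x) * h (cinv c (?F x)))"
      using test_densD(3)[OF \<mu> c p(2,3)] c by (simp add: dens_coeff_def jacobian_eq)
  qed
qed

text \<open>Only densities supported in one chart are tested; by a partition of unity they determine a linear
  functional.\<close>

definition represents :: "(('a, 'm) dens \<Rightarrow> complex) \<Rightarrow> ('a \<Rightarrow> complex) \<Rightarrow> bool" where
  "represents u h \<longleftrightarrow> (\<forall>c\<in>A. \<forall>\<mu>\<in>test_dens A (cdom c). u \<mu> = (LINT x|lborel. dens_coeff c \<mu> x * h (cinv c x)))"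


section \<open>Lie derivatives of densities\<close>

lemma field_in_chart:
  assumes c: "c \<in> A" "q \<in> cdom c" and L: "L \<in> vector_fields A UNIV" and f: "f \<in> smooth_funs A"
  shows "L q f = (\<Sum>i\<in>UNIV. vec_coords A c q (L q) $ i * frechet_derivative (\<lambda>x. f (cinv c x)) (at (cmap c q)) (axis i 1))"
  by (subst vec_coords_expand[OF c vector_fieldsD(1)[OF L UNIV_I]]) (simp add: coord_vec_eq[OF f])

lemma lie_dens_in_chart:
  assumes c: "c \<in> A" and x: "x \<in> cmap c ` cdom c"
  shows "dens_coeff c (lie_dens A L \<mu>) x
    = (\<Sum>i\<in>UNIV. frechet_derivative (\<lambda>y. vec_coords A c (cinv c y) (L (cinv c y)) $ i * \<mu> c (cinv c y)) (at x) (axis i 1))"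
  using cinv_in[OF c x] cmap_cinv[OF c x] x c by (simp add: dens_coeff_def lie_dens_def comp_def)

lemma lie_dens_smooth:
  assumes c: "c \<in> A" and L: "L \<in> vector_fields A UNIV" and \<mu>: "smooth_fun_on A (cdom c) (\<mu> c)"
  shows "smooth_on (cmap c ` cdom c) (\<lambda>y. vec_coords A c (cinv c y) (L (cinv c y)) $ i * \<mu> c (cinv c y))"
    and "smooth_fun_on A (cdom c) (lie_dens A L \<mu> c)"
proof -
  have a: "smooth_on (cmap c ` cdom c) (\<lambda>y. vec_coords A c (cinv c y) (L (cinv c y)) $ i)" for i
    using smooth_fun_onD[OF vector_field_coords_smooth[OF c L open_UNIV] c] by simp
  show b: "smooth_on (cmap c ` cdom c) (\<lambda>y. vec_coords A c (cinv c y) (L (cinv c y)) $ i * \<mu> c (cinv c y))" for i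
    by (rule smooth_on_mult[OF open_cimg[OF c] a smooth_cdom_pull[OF c \<mu>]])
  show "smooth_fun_on A (cdom c) (lie_dens A L \<mu> c)"
  proof (rule smooth_fun_on_chartI[OF c open_cdom[OF c] order_refl])
    have "smooth_on (cmap c ` cdom c) (\<lambda>x. \<Sum>i\<in>UNIV. frechet_derivative (\<lambda>y. vec_coords A c (cinv c y) (L (cinv c y)) $ i * \<mu> c (cinv c y)) (at x) (axis i 1))"
      by (intro smooth_on_sum open_cimg[OF c] smooth_on_frechet b)
    then show "smooth_on (cmap c ` cdom c) (\<lambda>x. lie_dens A L \<mu> c (cinv c x))"
      by (rule smooth_on_cong[OF open_cimg[OF c], THEN iffD1, rotated])
         (use lie_dens_in_chart[OF c] in \<open>simp add: dens_coeff_def\<close>)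
  qed
qed

text \<open>In a chart the Lie derivative of a density is a divergence, which is integrated by parts.\<close>

lemma lie_dens_integral_compact_fun:
  assumes c: "c \<in> A" and L: "L \<in> vector_fields A UNIV" and \<mu>: "smooth_fun_on A (cdom c) (\<mu> c)"
    and \<phi>: "\<phi> \<in> smooth_funs A" "compact K" "K \<subseteq> cdom c" "\<And>p. p \<notin> K \<Longrightarrow> \<phi> p = 0"
  shows "(LINT x|lborel. (if x \<in> cmap c ` cdom c then \<phi> (cinv c x) else 0) * dens_coeff c (lie_dens A L \<mu>) x)
    = - (LINT x|lborel. (if x \<in> cmap c ` cdom c then L (cinv c x) \<phi> * \<mu> c (cinv c x) else 0))"
proof -
  let ?S = "cmap c ` cdom c" and ?\<phi> = "\<lambda>x. if x \<in> cmap c ` cdom c then \<phi> (cinv c x) else 0"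
  let ?b = "\<lambda>i y. vec_coords A c (cinv c y) (L (cinv c y)) $ i * \<mu> c (cinv c y)"
  have S: "open ?S" by (rule open_cimg[OF c])
  have t: "?\<phi> \<in> test_funs ?S"
  proof (rule test_funsI[OF S])
    show "smooth_on ?S ?\<phi>"
      by (rule smooth_on_cong[OF S, THEN iffD1, OF _ smooth_funsD[OF \<phi>(1) c]]) auto
    show "compact (cmap c ` K)" "cmap c ` K \<subseteq> ?S" using compact_cmap_image[OF c \<phi>(2,3)] \<phi>(3) by auto
    show "?\<phi> x = 0" if "x \<notin> cmap c ` K" for x
      using \<phi>(4)[OF cinv_notin[OF c _ that]] by simp
  qed
  note b = lie_dens_smooth(1)[where \<mu> = \<mu>, OF c L \<mu>]
  have i1: "integrable lborel (\<lambda>x. ?\<phi> x * frechet_derivative (?b i) (at x) (axis i 1))" for i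
    by (rule test_funs_integrable[OF test_funs_mult[OF S t smooth_on_frechet[OF b]]])
  have i2: "integrable lborel (\<lambda>x. frechet_derivative ?\<phi> (at x) (axis i 1) * ?b i x)" for i
    by (rule test_funs_integrable[OF test_funs_mult[OF S test_funs_frechet[OF t] b]])
  have "(LINT x|lborel. ?\<phi> x * dens_coeff c (lie_dens A L \<mu>) x) = (LINT x|lborel. (\<Sum>i\<in>UNIV. ?\<phi> x * frechet_derivative (?b i) (at x) (axis i 1)))"
    by (intro Bochner_Integration.integral_cong refl) (simp add: lie_dens_in_chart[OF c] sum_distrib_left)
  also have "\<dots> = (\<Sum>i\<in>UNIV. LINT x|lborel. ?\<phi> x * frechet_derivative (?b i) (at x) (axis i 1))"
    by (rule Bochner_Integration.integral_sum) (rule i1)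
  also have "\<dots> = (\<Sum>i\<in>UNIV. - (LINT x|lborel. frechet_derivative ?\<phi> (at x) (axis i 1) * ?b i x))"
    using integration_by_parts[OF S t b] by simp
  also have "\<dots> = - (LINT x|lborel. (\<Sum>i\<in>UNIV. frechet_derivative ?\<phi> (at x) (axis i 1) * ?b i x))"
    by (subst Bochner_Integration.integral_sum) (auto simp: i2 sum_negf)
  also have "(\<lambda>x. \<Sum>i\<in>UNIV. frechet_derivative ?\<phi> (at x) (axis i 1) * ?b i x) = (\<lambda>x. if x \<in> ?S then L (cinv c x) \<phi> * \<mu> c (cinv c x) else 0)"
  proof
    fix x
    show "(\<Sum>i\<in>UNIV. frechet_derivative ?\<phi> (at x) (axis i 1) * ?b i x) = (if x \<in> ?S then L (cinv c x) \<phi> * \<mu> c (cinv c x) else 0)"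
    proof (cases "x \<in> ?S")
      case True
      have "frechet_derivative ?\<phi> (at x) = frechet_derivative (\<lambda>x. \<phi> (cinv c x)) (at x)"
        by (rule frechet_derivative_cong_open[OF S True]) auto
      then show ?thesis using True field_in_chart[OF c cinv_in[OF c True] L \<phi>(1)] cmap_cinv[OF c True]
        by (simp add: sum_distrib_left sum_distrib_right mult_ac)
    next
      case False
      then show ?thesis using test_funs_outside[OF test_funs_frechet[OF t] False] by simp
    qed
  qed
  finally show ?thesis .
qed

text \<open>The same integration by parts, where now the density and not the function has compact support.\<close>

lemma lie_dens_integral_compact_dens:
  assumes c: "c \<in> A" and L: "L \<in> vector_fields A UNIV" and \<mu>: "\<mu> \<in> test_dens A (cdom c)" and h: "h \<in> smooth_funs A"
  shows "(LINT x|lborel. dens_coeff c (lie_dens A L \<mu>) x * h (cinv c x)) = - (LINT x|lborel. dens_coeff c \<mu> x * L (cinv c x) h)"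
proof -
  let ?S = "cmap c ` cdom c" and ?a = "\<lambda>i y. vec_coords A c (cinv c y) (L (cinv c y)) $ i" and ?h = "\<lambda>x. h (cinv c x)"
  let ?b = "\<lambda>i x. dens_coeff c \<mu> x * ?a i x"
  have S: "open ?S" by (rule open_cimg[OF c])
  have a: "smooth_on ?S (?a i)" for i
    using smooth_fun_onD[OF vector_field_coords_smooth[OF c L open_UNIV] c] by simp
  have b: "?b i \<in> test_funs ?S" for i
    by (rule test_funs_mult[OF S dens_coeff_test_fun[OF c open_cdom[OF c] order_refl \<mu>] a])
  have hs: "smooth_on ?S ?h" by (rule smooth_funsD[OF h c])
  have i1: "integrable lborel (\<lambda>x. frechet_derivative (?b i) (at x) (axis i 1) * ?h x)" for i
    by (rule test_funs_integrable[OF test_funs_mult[OF S test_funs_frechet[OF b] hs]])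
  have i2: "integrable lborel (\<lambda>x. ?b i x * frechet_derivative ?h (at x) (axis i 1))" for i
    by (rule test_funs_integrable[OF test_funs_mult[OF S b smooth_on_frechet[OF hs]]])
  have "dens_coeff c (lie_dens A L \<mu>) x = (\<Sum>i\<in>UNIV. frechet_derivative (?b i) (at x) (axis i 1))" for x
  proof (cases "x \<in> ?S")
    case True
    have "frechet_derivative (?b i) (at x) = frechet_derivative (\<lambda>y. ?a i y * \<mu> c (cinv c y)) (at x)" for i
      by (rule frechet_derivative_cong_open[OF S True]) (simp add: dens_coeff_def mult.commute)
    then show ?thesis using lie_dens_in_chart[OF c True, of L \<mu>] by simp
  next
    case False
    then show ?thesis using test_funs_outside[OF test_funs_frechet[OF b] False] by (simp add: dens_coeff_def)
  qed
  then have "(LINT x|lborel. dens_coeff c (lie_dens A L \<mu>) x * ?h x) = (LINT x|lborel. (\<Sum>i\<in>UNIV. frechet_derivative (?b i) (at x) (axis i 1) * ?h x))"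
    by (simp add: sum_distrib_right)
  also have "\<dots> = (\<Sum>i\<in>UNIV. LINT x|lborel. frechet_derivative (?b i) (at x) (axis i 1) * ?h x)"
    by (rule Bochner_Integration.integral_sum) (rule i1)
  also have "\<dots> = (\<Sum>i\<in>UNIV. - (LINT x|lborel. ?b i x * frechet_derivative ?h (at x) (axis i 1)))"
    using integration_by_parts[OF S b hs] by simp
  also have "\<dots> = - (LINT x|lborel. (\<Sum>i\<in>UNIV. ?b i x * frechet_derivative ?h (at x) (axis i 1)))"
    by (subst Bochner_Integration.integral_sum) (auto simp: i2 sum_negf)
  also have "(\<lambda>x. \<Sum>i\<in>UNIV. ?b i x * frechet_derivative ?h (at x) (axis i 1)) = (\<lambda>x. dens_coeff c \<mu> x * L (cinv c x) h)"
  proof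
    fix x
    show "(\<Sum>i\<in>UNIV. ?b i x * frechet_derivative ?h (at x) (axis i 1)) = dens_coeff c \<mu> x * L (cinv c x) h"
      using field_in_chart[OF c cinv_in[OF c] L h, of x] cmap_cinv[OF c, of x]
      by (cases "x \<in> ?S") (auto simp: dens_coeff_def sum_distrib_left mult.assoc)
  qed
  finally show ?thesis .
qed

text \<open>The transformation law of the Lie derivative of a density follows by duality: tested against a
  function, it is the derivative of the function integrated against the density, which is independent
  of the chart.\<close>

lemma lie_dens_test_dens:
  assumes L: "L \<in> vector_fields A UNIV" and \<mu>: "\<mu> \<in> test_dens A U"
  shows "lie_dens A L \<mu> \<in> test_dens A U"
proof -
  obtain K where K: "compact K" "K \<subseteq> U" "\<And>c p. p \<notin> K \<Longrightarrow> \<mu> c p = 0" using \<mu> by (rule test_densE) blast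
  have off: "lie_dens A L \<mu> c p = 0" if p: "p \<notin> K" for c p
  proof (cases "c \<in> A \<and> p \<in> cdom c")
    case True
    then have c: "c \<in> A" "p \<in> cdom c" by auto
    have O: "open (cmap c ` (- K \<inter> cdom c))" by (rule open_cmap_image[OF c(1)]) (simp add: K(1) compact_imp_closed open_Compl)
    have "frechet_derivative (\<lambda>y. vec_coords A c (cinv c y) (L (cinv c y)) $ i * \<mu> c (cinv c y)) (at (cmap c p))
      = frechet_derivative (\<lambda>_. 0) (at (cmap c p))" for i
      by (rule frechet_derivative_cong_open[OF O]) (use p c K(3)[of _ c] in auto)
    then have "dens_coeff c (lie_dens A L \<mu>) (cmap c p) = 0"
      using lie_dens_in_chart[OF c(1), of "cmap c p" L \<mu>] c by (simp add: frechet_derivative_const)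
    then show ?thesis using c by (simp add: dens_coeff_def)
  qed (auto simp: lie_dens_def)
  show ?thesis
    unfolding test_dens_def
  proof (intro CollectI conjI allI impI ballI)
    fix c p assume "c \<notin> A \<or> p \<notin> cdom c" then show "lie_dens A L \<mu> c p = 0" by (auto simp: lie_dens_def)
  next
    fix c assume c: "c \<in> A"
    show "smooth_fun_on A (cdom c) (lie_dens A L \<mu> c)" by (rule lie_dens_smooth(2)[where \<mu> = \<mu>, OF c L test_densD(2)[OF \<mu> c]])
  next
    fix c c' p assume c: "c \<in> A" "c' \<in> A" and p: "p \<in> cdom c \<inter> cdom c'"
    let ?O = "cdom c \<inter> cdom c'"
    let ?D = "\<lambda>c. lie_dens A L \<mu> c"
    have O: "open ?O" by (rule open_cdom_Int[OF c])
    have W: "open (cmap c' ` ?O)" using open_cmap_image[OF c(2) open_cdom[OF c(1)]] by simp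
    have Ds: "smooth_fun_on A ?O (?D c)" "smooth_fun_on A ?O (?D c')"
      using smooth_fun_on_subset[OF lie_dens_smooth(2)[where \<mu> = \<mu>, OF c(1) L test_densD(2)[OF \<mu> c(1)]]]
        smooth_fun_on_subset[OF lie_dens_smooth(2)[where \<mu> = \<mu>, OF c(2) L test_densD(2)[OF \<mu> c(2)]]] by auto
    let ?h = "\<lambda>q. ?D c' q - of_real (jacobian c c' q) * ?D c q"
    have hs: "smooth_fun_on A ?O ?h"
      by (intro smooth_fun_on_diff smooth_fun_on_mult O Ds jacobian_smooth c)
    have hs': "smooth_on (cmap c' ` ?O) (\<lambda>x. ?h (cinv c' x))"
      using smooth_fun_onD[OF hs c(2)] by (simp add: Int_assoc)
    have "?h (cinv c' (cmap c' p)) = 0"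
    proof (rule fundamental_lemma[OF W hs'])
      fix f assume f: "f \<in> test_funs (cmap c' ` ?O)"
      let ?\<phi> = "extend_zero c' f"
      obtain C where C: "compact C" "C \<subseteq> cmap c' ` ?O" "\<And>x. x \<notin> C \<Longrightarrow> f x = 0" using f by (rule test_funsE) blast
      have f': "f \<in> test_funs (cmap c' ` cdom c')" by (rule test_funs_mono[OF f]) auto
      have \<phi>: "?\<phi> \<in> smooth_funs A" by (rule extend_zero_smooth[OF c(2) f'])
      let ?K = "cinv c' ` C"
      have CC: "C \<subseteq> cmap c' ` cdom c'" using C(2) by blast
      have K': "compact ?K" by (rule compact_cinv_image(1)[OF c(2) C(1) CC])
      have KO: "?K \<subseteq> ?O" using C(2) c by (auto simp: subset_iff)
      have \<phi>0: "?\<phi> q = 0" if "q \<notin> ?K" for q using that C(3)[of "cmap c' q"] c by (force simp: extend_zero_def)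
      have L\<phi>: "(\<lambda>q. L q ?\<phi>) \<in> smooth_funs A" by (rule vector_fields_smooth[OF L \<phi>])
      have L\<phi>0: "L q ?\<phi> = 0" if "q \<notin> ?K" for q
      proof -
        have "L q ?\<phi> = L q (\<lambda>_. 0)"
          by (rule ctangent_local[OF vector_fieldsD(1)[OF L UNIV_I] \<phi> smooth_funs_intros(1), of "- ?K"])
             (use that \<phi>0 K' in \<open>auto simp: compact_imp_closed open_Compl\<close>)
        then show ?thesis using ctangent_const[OF vector_fieldsD(1)[OF L UNIV_I]] by simp
      qed
      let ?\<nu> = "\<lambda>c q. L q ?\<phi> * \<mu> c q"
      have \<nu>: "?\<nu> \<in> test_dens A ?O" by (rule test_dens_mult_supp[OF L\<phi> K' KO L\<phi>0 \<mu>])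
      have ibp: "(LINT x|lborel. (if x \<in> cmap e ` cdom e then ?\<phi> (cinv e x) else 0) * dens_coeff e (lie_dens A L \<mu>) x)
        = - (LINT x|lborel. dens_coeff e ?\<nu> x)" if e: "e \<in> A" "?K \<subseteq> cdom e" for e
        using lie_dens_integral_compact_fun[where \<mu> = \<mu>, OF e(1) L test_densD(2)[OF \<mu> e(1)] \<phi> K' e(2) \<phi>0]
        by (simp add: dens_coeff_def[of e ?\<nu>] cong: if_cong)
      have \<nu>eq: "(LINT x|lborel. dens_coeff c' ?\<nu> x) = (LINT x|lborel. dens_coeff c ?\<nu> x)"
        using dens_integral_chart_change[OF c \<nu> smooth_fun_on_const[OF O, of 1]] by simp
      \<comment> \<open>the density with coefficient \<open>\<phi> * D c\<close> in the chart \<open>c\<close>\<close>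
      let ?g = "\<lambda>x. if x \<in> cmap c ` cdom c then ?\<phi> (cinv c x) * ?D c (cinv c x) else 0"
      have Wc: "open (cmap c ` ?O)" using open_cmap_image[OF c(1) open_cdom[OF c(2)]] by (simp add: Int_commute)
      have g: "?g \<in> test_funs (cmap c ` ?O)"
      proof (rule test_funsI[OF Wc, where K = "cmap c ` ?K"])
        have "smooth_fun_on A ?O (\<lambda>q. ?\<phi> q * ?D c q)" by (intro smooth_fun_on_mult O smooth_funs_on[OF \<phi>] Ds)
        from smooth_fun_onD[OF this c(1)] have "smooth_on (cmap c ` ?O) (\<lambda>x. ?\<phi> (cinv c x) * ?D c (cinv c x))"
          by (simp add: Int_assoc Int_commute Int_left_commute)
        then show "smooth_on (cmap c ` ?O) ?g" by (rule smooth_on_cong[OF Wc, THEN iffD1, rotated]) auto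
        show "compact (cmap c ` ?K)" using compact_cmap_image[OF c(1) K'] KO by blast
        show "cmap c ` ?K \<subseteq> cmap c ` ?O" using KO by blast
        show "?g x = 0" if "x \<notin> cmap c ` ?K" for x
        proof (cases "x \<in> cmap c ` cdom c")
          case True
          then have "cinv c x \<notin> ?K" using that cmap_cinv[OF c(1) True] by (metis image_eqI)
          then show ?thesis using \<phi>0 by simp
        qed simp
      qed
      let ?\<sigma> = "chart_dens A c ?g"
      have \<sigma>: "?\<sigma> \<in> test_dens A ?O" by (rule chart_dens_test_dens[OF c(1) O _ g]) auto
      have "(LINT x|lborel. dens_coeff c' ?\<sigma> x) = (LINT x|lborel. dens_coeff c ?\<sigma> x)"
        using dens_integral_chart_change[OF c \<sigma> smooth_fun_on_const[OF O, of 1]] by simp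
      also have "\<dots> = (LINT x|lborel. (if x \<in> cmap c ` cdom c then ?\<phi> (cinv c x) else 0) * dens_coeff c (lie_dens A L \<mu>) x)"
      proof (intro Bochner_Integration.integral_cong refl)
        fix x show "dens_coeff c ?\<sigma> x = (if x \<in> cmap c ` cdom c then ?\<phi> (cinv c x) else 0) * dens_coeff c (lie_dens A L \<mu>) x"
          using dens_coeff_chart_dens[OF c(1), of x ?g] by (cases "x \<in> cmap c ` cdom c") (auto simp: dens_coeff_def)
      qed
      also have "\<dots> = - (LINT x|lborel. dens_coeff c ?\<nu> x)" by (rule ibp[OF c(1)]) (use KO in auto)
      also have "\<dots> = - (LINT x|lborel. dens_coeff c' ?\<nu> x)" using \<nu>eq by simp
      also have "\<dots> = (LINT x|lborel. (if x \<in> cmap c' ` cdom c' then ?\<phi> (cinv c' x) else 0) * dens_coeff c' (lie_dens A L \<mu>) x)"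
        by (rule ibp[OF c(2), symmetric]) (use KO in auto)
      finally have eq: "(LINT x|lborel. dens_coeff c' ?\<sigma> x) = (LINT x|lborel. (if x \<in> cmap c' ` cdom c' then ?\<phi> (cinv c' x) else 0) * dens_coeff c' (lie_dens A L \<mu>) x)" .
      have fx: "(if x \<in> cmap c' ` cdom c' then ?\<phi> (cinv c' x) else 0) = f x" for x
        using test_funs_outside[OF f', of x] cinv_in[OF c(2), of x] cmap_cinv[OF c(2), of x] by (auto simp: extend_zero_def)
      have s1: "f x * ?D c' (cinv c' x) = f x * dens_coeff c' (lie_dens A L \<mu>) x" for x
        using test_funs_outside[OF f', of x] by (simp add: dens_coeff_def)
      have s2: "f x * (of_real (jacobian c c' (cinv c' x)) * ?D c (cinv c' x)) = dens_coeff c' ?\<sigma> x" for x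
      proof (cases "x \<in> cmap c' ` ?O")
        case True
        then obtain q where q: "x = cmap c' q" "q \<in> cdom c" "q \<in> cdom c'" by auto
        then show ?thesis using c by (simp add: dens_coeff_def chart_dens_def extend_zero_def)
      next
        case False
        then have "dens_coeff c' ?\<sigma> x = 0" using c(2) by (auto simp: dens_coeff_def chart_dens_def)
        then show ?thesis using test_funs_outside[OF f False] by simp
      qed
      have i1: "integrable lborel (\<lambda>x. f x * ?D c' (cinv c' x))"
        by (rule test_funs_integrable[OF test_funs_mult[OF W f]]) (use smooth_fun_onD[OF Ds(2) c(2)] in \<open>simp add: Int_assoc\<close>)
      have i2: "integrable lborel (\<lambda>x. f x * (of_real (jacobian c c' (cinv c' x)) * ?D c (cinv c' x)))"
        unfolding s2 by (rule test_funs_integrable[OF dens_coeff_test_fun[OF c(2) O _ \<sigma>]]) auto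
      have "(LINT x|lborel. f x * ?h (cinv c' x)) = (LINT x|lborel. f x * ?D c' (cinv c' x)) - (LINT x|lborel. f x * (of_real (jacobian c c' (cinv c' x)) * ?D c (cinv c' x)))"
        unfolding right_diff_distrib by (rule Bochner_Integration.integral_diff[OF i1 i2])
      also have "\<dots> = 0" unfolding s1 s2 using eq by (simp add: fx)
      finally show "(LINT x|lborel. f x * ?h (cinv c' x)) = 0" .
    qed (use p in auto)
    then show "lie_dens A L \<mu> c' p = of_real (jacobian c c' p) * lie_dens A L \<mu> c p" using c p by simp
  next
    show "\<exists>K. compact K \<and> K \<subseteq> U \<and> (\<forall>c p. p \<notin> K \<longrightarrow> lie_dens A L \<mu> c p = 0)" using K off by blast
  qed
qed

lemma represents_field_distr:
  assumes L: "L \<in> vector_fields A UNIV" and h: "h \<in> smooth_funs A" and u: "represents u h"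
  shows "represents (field_distr A L u) (\<lambda>p. L p h)"
  unfolding represents_def
proof (intro ballI)
  fix c \<mu> assume c: "c \<in> A" and \<mu>: "\<mu> \<in> test_dens A (cdom c)"
  have "u (lie_dens A L \<mu>) = (LINT x|lborel. dens_coeff c (lie_dens A L \<mu>) x * h (cinv c x))"
    using u c lie_dens_test_dens[OF L \<mu>] unfolding represents_def by blast
  then show "field_distr A L u \<mu> = (LINT x|lborel. dens_coeff c \<mu> x * L (cinv c x) h)"
    using lie_dens_integral_compact_dens[OF c L \<mu> h] by (simp add: field_distr_def)
qed

end


section \<open>Smooth representation of distributions with empty wavefront set\<close>

text \<open>Since \<open>v\<close> is real, a cutoff function that gives decay near \<open>- \<xi>\<close> has a conjugate that gives decay near \<open>\<xi>\<close>:
  conjugating the test function \<open>\<rho> exp (- i \<eta> y)\<close> reflects the frequency \<open>\<eta>\<close>.\<close>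

lemma wavefront_euclidean_symmetric:
  fixes S :: "(real^'m::finite) set"
  assumes v: "\<And>g. g \<in> test_funs S \<Longrightarrow> v g = cnj (v (\<lambda>y. cnj (g y)))"
    and wf: "(x, \<xi>) \<in> wavefront_euclidean S v"
  shows "(x, - \<xi>) \<in> wavefront_euclidean S v"
proof (rule ccontr)
  assume n: "(x, - \<xi>) \<notin> wavefront_euclidean S v"
  from wf have x: "x \<in> S" "- \<xi> \<noteq> 0" unfolding wavefront_euclidean_def by auto
  obtain \<rho> C where \<rho>: "\<rho> \<in> test_funs S" "\<rho> x \<noteq> 0" "open C" "- \<xi> \<in> C" "\<And>\<eta> t. \<eta> \<in> C \<Longrightarrow> t > 0 \<Longrightarrow> t *\<^sub>R \<eta> \<in> C"
    "rapid_decay_on C (\<lambda>\<eta>. v (\<lambda>x. \<rho> x * wave (- \<eta>) x))"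
    using wavefront_euclideanD[OF n x] by blast
  have \<rho>': "(\<lambda>y. cnj (\<rho> y)) \<in> test_funs S" by (rule test_funs_cnj[OF \<rho>(1)])
  have eq: "cmod (v (\<lambda>y. cnj (\<rho> y) * exp (- (\<i> * of_real (\<eta> \<bullet> y))))) = cmod (v (\<lambda>x. \<rho> x * wave (- (- \<eta>)) x))" for \<eta>
  proof -
    have t: "(\<lambda>y. \<rho> y * wave (- (- \<eta>)) y) \<in> test_funs S"
      by (rule test_funs_mult_UNIV(1)[OF \<rho>(1)]) (rule smooth_on_wave[OF open_UNIV])
    have "(\<lambda>y. cnj (\<rho> y * wave (- (- \<eta>)) y)) = (\<lambda>y. cnj (\<rho> y) * exp (- (\<i> * of_real (\<eta> \<bullet> y))))"
      by (simp add: wave_def exp_cnj)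
    then show ?thesis using v[OF t] by simp
  qed
  obtain K where K: "compact K" "K \<subseteq> S" "\<And>x. x \<notin> K \<Longrightarrow> cnj (\<rho> x) = 0" using \<rho>' by (rule test_funsE) blast
  have op: "open (uminus ` C)" using \<rho>(3) open_negations by blast
  have dir: "\<xi> \<in> uminus ` C" using \<rho>(4) by force
  have cone: "\<forall>\<eta>\<in>uminus ` C. \<forall>t>0. t *\<^sub>R \<eta> \<in> uminus ` C" using \<rho>(5) by force
  have decay: "\<exists>B. \<forall>\<eta>\<in>uminus ` C. (1 + norm \<eta>) ^ k * cmod (v (\<lambda>y. cnj (\<rho> y) * exp (- (\<i> * of_real (\<eta> \<bullet> y))))) \<le> B" for k
    using \<rho>(6) unfolding rapid_decay_on_def eq by simp
  have "\<exists>\<rho>::real^'m \<Rightarrow> complex. smooth_on UNIV \<rho> \<and> (\<exists>K. compact K \<and> K \<subseteq> S \<and> (\<forall>y. y \<notin> K \<longrightarrow> \<rho> y = 0)) \<and> \<rho> x \<noteq> 0 \<and>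
    (\<exists>C. open C \<and> \<xi> \<in> C \<and> (\<forall>\<eta>\<in>C. \<forall>t>0. t *\<^sub>R \<eta> \<in> C) \<and>
      (\<forall>k::nat. \<exists>B. \<forall>\<eta>\<in>C. (1 + norm \<eta>) ^ k * cmod (v (\<lambda>y. \<rho> y * exp (- (\<i> * of_real (\<eta> \<bullet> y))))) \<le> B))"
    by (rule exI[of _ "\<lambda>y. cnj (\<rho> y)"], intro conjI exI[of _ K] exI[of _ "uminus ` C"])
       (use test_funs_smooth[OF \<rho>'] K \<rho>(2) op dir cone decay in simp_all)
  then show False using wf unfolding wavefront_euclidean_def by blast
qed

context smooth_manifold
begin

text \<open>The coordinate fields are real.\<close>

lemma coord_vec_cnj:
  assumes c: "c \<in> A" "p \<in> cdom c"
  shows "coord_vec A c i p (\<lambda>q. cnj (f q)) = cnj (coord_vec A c i p f)"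
proof (cases "f \<in> smooth_funs A")
  case True
  have "((\<lambda>x. f (cinv c x)) has_derivative frechet_derivative (\<lambda>x. f (cinv c x)) (at (cmap c p))) (at (cmap c p))"
    by (rule smooth_on_has_derivative[OF smooth_funsD[OF True c(1)]]) (use c in auto)
  from bounded_linear.has_derivative[OF bounded_linear_cnj this]
  have "frechet_derivative (\<lambda>x. cnj (f (cinv c x))) (at (cmap c p)) = (\<lambda>v. cnj (frechet_derivative (\<lambda>x. f (cinv c x)) (at (cmap c p)) v))"
    by (rule frechet_derivative_eqI)
  then show ?thesis using True smooth_funs_intros(5)[OF True] by (simp add: coord_vec_eq)
next
  case False
  then have "(\<lambda>q. cnj (f q)) \<notin> smooth_funs A" using smooth_funs_intros(5)[of "\<lambda>q. cnj (f q)"] by auto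
  then show ?thesis using False by (simp add: coord_vec_def)
qed

lemma conj_vec_expand:
  assumes c: "c \<in> A" "p \<in> cdom c" and v: "v \<in> ctangent A p"
  shows "conj_vec v = (\<lambda>f. \<Sum>i\<in>UNIV. (\<chi> i. cnj (vec_coords A c p v $ i)) $ i * coord_vec A c i p f)"
proof
  fix f
  have "v (\<lambda>q. cnj (f q)) = (\<Sum>i\<in>UNIV. vec_coords A c p v $ i * cnj (coord_vec A c i p f))"
    by (subst vec_coords_expand[OF c v]) (simp add: coord_vec_cnj[OF c])
  then show "conj_vec v f = (\<Sum>i\<in>UNIV. (\<chi> i. cnj (vec_coords A c p v $ i)) $ i * coord_vec A c i p f)"
    by (simp add: conj_vec_def)
qed

lemma vec_coords_conj:
  assumes c: "c \<in> A" "p \<in> cdom c" and v: "v \<in> ctangent A p"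
  shows "vec_coords A c p (conj_vec v) $ i = cnj (vec_coords A c p v $ i)"
  using vec_coords_unique[OF c conj_vec_expand[OF c v]] by simp

lemma covector_with_coords:
  fixes a :: "'m \<Rightarrow> complex"
  assumes c: "c \<in> A" "p \<in> cdom c"
  defines "\<xi> \<equiv> \<lambda>v. if v \<in> ctangent A p then \<Sum>i\<in>UNIV. a i * vec_coords A c p v $ i else 0"
  shows "\<xi> \<in> ccotangent A p" "\<xi> (coord_vec A c i p) = a i"
proof -
  show "\<xi> \<in> ccotangent A p"
    unfolding ccotangent_def \<xi>_def
    by (auto simp: vec_coords_linear[OF c] ctangent_plus ctangent_scale distrib_left sum.distrib sum_distrib_left mult.left_commute)
  show "\<xi> (coord_vec A c i p) = a i"
    by (simp add: \<xi>_def coord_vec_ctangent[OF c] vec_coords_coord_vec[OF c] axis_def if_distrib[of "\<lambda>x. _ * x"] cong: if_cong)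
qed

text \<open>The wavefront set on the manifold consists of covectors, that in a chart of coordinate vectors. As every
  coordinate vector comes from a covector, emptiness of the former implies emptiness of the latter.\<close>

lemma real_covector_with_coords:
  assumes c: "c \<in> A" "p \<in> cdom c"
  obtains \<xi> where "\<xi> \<in> real_cotangent A p" "covec_coords A c p \<xi> = \<xi>0"
proof -
  let ?\<xi> = "\<lambda>v. if v \<in> ctangent A p then \<Sum>i\<in>UNIV. complex_of_real (\<xi>0 $ i) * vec_coords A c p v $ i else 0"
  have "?\<xi> v \<in> \<real>" if v: "v \<in> ctangent A p" "conj_vec v = v" for v
  proof -
    have "vec_coords A c p v $ i \<in> \<real>" for i
      using vec_coords_conj[OF c v(1), of i] v(2) by (simp add: Reals_cnj_iff)
    then show ?thesis using v(1) by (auto intro!: sum_in_Reals Reals_mult)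
  qed
  then have "?\<xi> \<in> real_cotangent A p"
    using covector_with_coords(1)[OF c, where a = "\<lambda>i. complex_of_real (\<xi>0 $ i)"] unfolding real_cotangent_def by (intro CollectI conjI ballI impI)
  moreover have "covec_coords A c p ?\<xi> = \<xi>0"
    unfolding covec_coords_def using covector_with_coords(2)[OF c, where a = "\<lambda>i. complex_of_real (\<xi>0 $ i)"] by (simp add: vec_eq_iff)
  ultimately show ?thesis by (rule that)
qed

lemma wavefront_empty_in_chart:
  assumes wf: "wavefront A u = {}" and c: "c \<in> A" and x: "x \<in> cmap c ` cdom c"
  shows "(x, \<xi>0) \<notin> wavefront_euclidean (cmap c ` cdom c) (\<lambda>g. u (chart_dens A c g))"
proof
  assume n: "(x, \<xi>0) \<in> wavefront_euclidean (cmap c ` cdom c) (\<lambda>g. u (chart_dens A c g))"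
  obtain p where p: "p \<in> cdom c" "x = cmap c p" using x by blast
  obtain \<xi> where \<xi>: "\<xi> \<in> real_cotangent A p" "covec_coords A c p \<xi> = \<xi>0" by (rule real_covector_with_coords[OF c p(1)])
  have "(cmap c p, covec_coords A c p \<xi>) \<in> wavefront_euclidean (cmap c ` cdom c) (\<lambda>g. u (chart_dens A c g))"
    using n \<xi>(2) p(2) by simp
  with \<xi>(1) p(1) c have "(p, \<xi>) \<in> wavefront A u" unfolding wavefront_def by blast
  then show False using wf by simp
qed

lemma wavefront_symmetric:
  assumes u: "\<And>\<mu>. \<mu> \<in> test_dens A UNIV \<Longrightarrow> u \<mu> = conj_distr u \<mu>" and wf: "(p, \<xi>) \<in> wavefront A u"
  shows "(p, \<lambda>v. - \<xi> v) \<in> wavefront A u"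
proof -
  from wf obtain c where \<xi>: "\<xi> \<in> real_cotangent A p" and c: "c \<in> A" "p \<in> cdom c"
    and n: "(cmap c p, covec_coords A c p \<xi>) \<in> wavefront_euclidean (cmap c ` cdom c) (\<lambda>g. u (chart_dens A c g))"
    unfolding wavefront_def by (simp del: split_paired_Ex split_paired_All) blast
  have "(cmap c p, - covec_coords A c p \<xi>) \<in> wavefront_euclidean (cmap c ` cdom c) (\<lambda>g. u (chart_dens A c g))"
  proof (rule wavefront_euclidean_symmetric[OF _ n])
    fix g assume g: "g \<in> test_funs (cmap c ` cdom c)"
    have "chart_dens A c g \<in> test_dens A UNIV"
      by (rule test_dens_mono[OF chart_dens_test_dens[OF c(1) open_cdom[OF c(1)] order_refl g]]) simp
    moreover have "(\<lambda>c' p. cnj (chart_dens A c g c' p)) = chart_dens A c (\<lambda>y. cnj (g y))"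
      unfolding chart_dens_def by (intro ext) simp
    ultimately show "u (chart_dens A c g) = cnj (u (chart_dens A c (\<lambda>y. cnj (g y))))"
      using u by (simp add: conj_distr_def)
  qed
  moreover have "- covec_coords A c p \<xi> = covec_coords A c p (\<lambda>v. - \<xi> v)" by (simp add: covec_coords_def vec_eq_iff)
  moreover have "(\<lambda>v. - \<xi> v) \<in> real_cotangent A p"
    using \<xi> ccotangent_scale[of \<xi> p "-1"] by (simp add: real_cotangent_def)
  ultimately show ?thesis using c unfolding wavefront_def by (simp del: split_paired_Ex split_paired_All) metis
qed

text \<open>Each chart yields a smooth function. Two of them agree on the overlap of their charts, because
  integrals of densities supported there do not depend on the chart.\<close>

lemma represents_of_wavefront_empty:
  assumes u: "\<And>c. c \<in> A \<Longrightarrow> distribution_on (cmap c ` cdom c) (\<lambda>g. u (chart_dens A c g))"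
    and wf: "wavefront A u = {}"
  obtains h where "h \<in> smooth_funs A" "represents u h"
proof -
  have "\<forall>c\<in>A. \<exists>H. smooth_on (cmap c ` cdom c) H \<and> (\<forall>f\<in>test_funs (cmap c ` cdom c). u (chart_dens A c f) = (LINT y|lborel. f y * H y))"
  proof
    fix c assume c: "c \<in> A"
    obtain H where "smooth_on (cmap c ` cdom c) H" "\<And>f. f \<in> test_funs (cmap c ` cdom c) \<Longrightarrow> u (chart_dens A c f) = (LINT y|lborel. f y * H y)"
      using distribution_smooth_glue[OF open_cimg[OF c] u[OF c] locally_smooth_of_wavefront[OF open_cimg[OF c] u[OF c] _ wavefront_empty_in_chart[OF wf c]]]
      by blast
    then show "\<exists>H. smooth_on (cmap c ` cdom c) H \<and> (\<forall>f\<in>test_funs (cmap c ` cdom c). u (chart_dens A c f) = (LINT y|lborel. f y * H y))" by blast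
  qed
  from bchoice[OF this] obtain H where H': "\<forall>c\<in>A. smooth_on (cmap c ` cdom c) (H c) \<and> (\<forall>f\<in>test_funs (cmap c ` cdom c). u (chart_dens A c f) = (LINT y|lborel. f y * H c y))" ..
  then have Hs: "\<And>c. c \<in> A \<Longrightarrow> smooth_on (cmap c ` cdom c) (H c)"
    and H: "\<And>c f. c \<in> A \<Longrightarrow> f \<in> test_funs (cmap c ` cdom c) \<Longrightarrow> u (chart_dens A c f) = (LINT y|lborel. f y * H c y)" by blast+
  let ?h = "\<lambda>c p. H c (cmap c p)"
  have hs: "smooth_fun_on A (cdom c) (?h c)" if c: "c \<in> A" for c
  proof (rule smooth_fun_on_chartI[OF c open_cdom[OF c] order_refl])
    show "smooth_on (cmap c ` cdom c) (\<lambda>x. ?h c (cinv c x))"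
      by (rule smooth_on_cong[OF open_cimg[OF c], THEN iffD1, OF _ Hs[OF c]]) (simp add: cmap_cinv[OF c])
  qed
  have consistent: "?h c p = ?h c' p" if c: "c \<in> A" "c' \<in> A" and p: "p \<in> cdom c" "p \<in> cdom c'" for c c' p
  proof -
    let ?O = "cdom c \<inter> cdom c'"
    have O: "open ?O" by (rule open_cdom_Int[OF c])
    have W: "open (cmap c' ` ?O)" using open_cmap_image[OF c(2) open_cdom[OF c(1)]] .
    have hs1: "smooth_fun_on A ?O (?h c)" "smooth_fun_on A ?O (?h c')"
      using smooth_fun_on_subset[OF hs[OF c(1)]] smooth_fun_on_subset[OF hs[OF c(2)]] by auto
    have s: "smooth_on (cmap c' ` ?O) (\<lambda>x. ?h c (cinv c' x))" "smooth_on (cmap c' ` ?O) (\<lambda>x. ?h c' (cinv c' x))"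
      using smooth_fun_onD[OF hs1(1) c(2)] smooth_fun_onD[OF hs1(2) c(2)] by (simp_all add: Int_assoc)
    have "?h c (cinv c' (cmap c' p)) - ?h c' (cinv c' (cmap c' p)) = 0"
    proof (rule fundamental_lemma[OF W smooth_on_diff[OF W s]])
      fix f assume f: "f \<in> test_funs (cmap c' ` ?O)"
      have f': "f \<in> test_funs (cmap c' ` cdom c')" by (rule test_funs_mono[OF f]) auto
      let ?\<mu> = "chart_dens A c' f"
      have \<mu>: "?\<mu> \<in> test_dens A ?O" by (rule chart_dens_test_dens[OF c(2) O _ f]) simp
      have \<mu>c: "?\<mu> \<in> test_dens A (cdom c)" by (rule test_dens_mono[OF \<mu>]) simp
      have pt: "dens_coeff e \<nu> x * ?h e (cinv e x) = dens_coeff e \<nu> x * H e x" if "e \<in> A" for e \<nu> x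
        by (cases "x \<in> cmap e ` cdom e") (auto simp: dens_coeff_def cmap_cinv[OF that])
      have f1: "dens_coeff c' ?\<mu> x = f x" for x
        using dens_coeff_chart_dens[OF c(2), of x f] test_funs_outside[OF f', of x]
        by (cases "x \<in> cmap c' ` cdom c'") (auto simp: dens_coeff_def)
      have "u ?\<mu> = u (chart_dens A c (dens_coeff c ?\<mu>))" by (simp only: chart_dens_dens_coeff[OF c(1) \<mu>c])
      also have "\<dots> = (LINT y|lborel. dens_coeff c ?\<mu> y * H c y)"
        by (rule H[OF c(1) dens_coeff_test_fun[OF c(1) open_cdom[OF c(1)] order_refl \<mu>c]])
      also have "\<dots> = (LINT x|lborel. dens_coeff c' ?\<mu> x * ?h c (cinv c' x))"
        using dens_integral_chart_change[OF c \<mu> hs1(1)] by (simp only: pt[OF c(1)])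
      finally have 1: "u ?\<mu> = (LINT x|lborel. f x * ?h c (cinv c' x))" by (simp only: f1)
      have 2: "u ?\<mu> = (LINT x|lborel. f x * ?h c' (cinv c' x))"
        using H[OF c(2) f'] pt[OF c(2), of ?\<mu>] by (simp only: f1)
      have "(LINT x|lborel. f x * (?h c (cinv c' x) - ?h c' (cinv c' x))) = (LINT x|lborel. f x * ?h c (cinv c' x)) - (LINT x|lborel. f x * ?h c' (cinv c' x))"
        unfolding right_diff_distrib
        by (rule Bochner_Integration.integral_diff) (rule test_funs_integrable[OF test_funs_mult[OF W f]], rule s)+
      then show "(LINT x|lborel. f x * (?h c (cinv c' x) - ?h c' (cinv c' x))) = 0" using 1 2 by simp
    qed (use p in auto)
    then show ?thesis using c p by simp
  qed
  have "\<forall>p. \<exists>c. c \<in> A \<and> p \<in> cdom c" using chart_cover by metis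
  from choice[OF this] obtain e where e: "\<And>p. e p \<in> A" "\<And>p. p \<in> cdom (e p)" by blast
  let ?g = "\<lambda>p. ?h (e p) p"
  have g: "?g p = ?h c p" if "c \<in> A" "p \<in> cdom c" for c p
    using consistent[OF e(1) that(1) e(2) that(2)] .
  show ?thesis
  proof (rule that[of ?g])
    have "smooth_fun_on A UNIV ?g"
    proof (rule smooth_fun_on_local)
      fix p :: 'a
      have "smooth_fun_on A (cdom (e p)) ?g"
        by (rule smooth_fun_on_cong[OF open_cdom[OF e(1)], THEN iffD1, OF _ hs[OF e(1)]]) (simp add: g[OF e(1)])
      then show "\<exists>W. open W \<and> p \<in> W \<and> smooth_fun_on A (UNIV \<inter> W) ?g"
        using open_cdom[OF e(1)] e(2) by (intro exI[of _ "cdom (e p)"]) simp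
    qed
    then show "?g \<in> smooth_funs A" by (simp add: smooth_funs_def)
    show "represents u ?g"
      unfolding represents_def
    proof (intro ballI)
      fix c \<mu> assume c: "c \<in> A" and \<mu>: "\<mu> \<in> test_dens A (cdom c)"
      have "u \<mu> = u (chart_dens A c (dens_coeff c \<mu>))" by (simp only: chart_dens_dens_coeff[OF c \<mu>])
      also have "\<dots> = (LINT y|lborel. dens_coeff c \<mu> y * H c y)"
        by (rule H[OF c dens_coeff_test_fun[OF c open_cdom[OF c] order_refl \<mu>]])
      also have "\<dots> = (LINT x|lborel. dens_coeff c \<mu> x * ?g (cinv c x))"
      proof (intro Bochner_Integration.integral_cong refl)
        fix x show "dens_coeff c \<mu> x * H c x = dens_coeff c \<mu> x * ?g (cinv c x)"
          using g[OF c cinv_in[OF c], of x] cmap_cinv[OF c, of x]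
          by (cases "x \<in> cmap c ` cdom c") (auto simp: dens_coeff_def)
      qed
      finally show "u \<mu> = (LINT x|lborel. dens_coeff c \<mu> x * ?g (cinv c x))" .
    qed
  qed
qed


section \<open>Holomorphic forms applied to distributional sections\<close>

lemma hol_cotangent_lincomb:
  "\<xi> \<in> hol_cotangent A V p \<Longrightarrow> \<eta> \<in> hol_cotangent A V p \<Longrightarrow> (\<lambda>v. a * \<xi> v + b * \<eta> v) \<in> hol_cotangent A V p"
  unfolding hol_cotangent_def by (simp add: ccotangent_lincomb)

lemma hol_cotangent_scale: "\<xi> \<in> hol_cotangent A V p \<Longrightarrow> (\<lambda>v. a * \<xi> v) \<in> hol_cotangent A V p"
  using hol_cotangent_lincomb[of \<xi> V p \<xi> a 0] by simp

lemma hol_cotangent_add: "\<xi> \<in> hol_cotangent A V p \<Longrightarrow> \<eta> \<in> hol_cotangent A V p \<Longrightarrow> (\<lambda>v. \<xi> v + \<eta> v) \<in> hol_cotangent A V p"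
  using hol_cotangent_lincomb[of \<xi> V p \<eta> 1 1] by simp

lemma hol_cotangent_zero: "(\<lambda>_. 0) \<in> hol_cotangent A V p"
  unfolding hol_cotangent_def by (simp add: ccotangent_zero_form)

lemma hol_cotangent_sum:
  "(\<And>i. i \<in> I \<Longrightarrow> \<xi> i \<in> hol_cotangent A V p) \<Longrightarrow> (\<lambda>v. \<Sum>i\<in>I. a i * \<xi> i v) \<in> hol_cotangent A V p"
proof (induction I rule: infinite_finite_induct)
  case (insert i I)
  then have "(\<lambda>v. \<Sum>i\<in>I. a i * \<xi> i v) \<in> hol_cotangent A V p" "\<xi> i \<in> hol_cotangent A V p" by simp_all
  from hol_cotangent_lincomb[OF this(2,1), of "a i" 1] show ?case using insert.hyps by simp
qed (simp_all add: hol_cotangent_zero)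

lemma hol_formsD:
  "\<alpha> \<in> hol_forms A V U \<Longrightarrow> p \<in> U \<Longrightarrow> \<alpha> p \<in> hol_cotangent A V p" "\<alpha> \<in> hol_forms A V U \<Longrightarrow> \<alpha> \<in> one_forms A U"
  unfolding hol_forms_def by blast+

lemma one_forms_subset: "\<alpha> \<in> one_forms A U \<Longrightarrow> W \<subseteq> U \<Longrightarrow> \<alpha> \<in> one_forms A W"
  unfolding one_forms_def using smooth_fun_on_subset by blast

lemma hol_forms_subset: "\<alpha> \<in> hol_forms A V U \<Longrightarrow> W \<subseteq> U \<Longrightarrow> \<alpha> \<in> hol_forms A V W"
  unfolding hol_forms_def using one_forms_subset by blast

lemma hol_forms_mult:
  assumes "open U" "\<alpha> \<in> hol_forms A V U" "smooth_fun_on A U f" shows "(\<lambda>p v. f p * \<alpha> p v) \<in> hol_forms A V U"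
  using assms one_forms_mult[OF assms(1) _ assms(3)] unfolding hol_forms_def by (auto intro: hol_cotangent_scale)

lemma hol_forms_sum:
  assumes "open U" "\<And>i. i \<in> I \<Longrightarrow> \<alpha> i \<in> hol_forms A V U" shows "(\<lambda>p v. \<Sum>i\<in>I. \<alpha> i p v) \<in> hol_forms A V U"
proof -
  have "(\<lambda>v. \<Sum>i\<in>I. \<alpha> i p v) \<in> hol_cotangent A V p" if "p \<in> U" for p
    using hol_cotangent_sum[of I "\<lambda>i. \<alpha> i p" V p "\<lambda>_. 1"] hol_formsD(1)[OF assms(2) that] by simp
  then show ?thesis using one_forms_sum[OF assms(1), of I \<alpha>] hol_formsD(2)[OF assms(2)] unfolding hol_forms_def by blast
qed

lemma tensor_dens_test_form_dens:
  assumes \<omega>: "\<omega> \<in> hol_forms A V UNIV" and \<mu>: "\<mu> \<in> test_dens A U"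
  shows "tensor_dens \<omega> \<mu> \<in> test_form_dens A V U"
proof -
  obtain K where K: "compact K" "K \<subseteq> U" "\<And>c p. p \<notin> K \<Longrightarrow> \<mu> c p = 0" using \<mu> by (rule test_densE) blast
  show ?thesis
    unfolding test_form_dens_def tensor_dens_def
  proof (intro CollectI conjI allI impI ballI)
    fix c p assume "c \<notin> A \<or> p \<notin> cdom c"
    then show "(\<lambda>v. \<mu> c p * \<omega> p v) = (\<lambda>_. 0)" using test_densD(1)[OF \<mu>, of c p] by simp
  next
    fix c assume c: "c \<in> A"
    show "(\<lambda>p v. \<mu> c p * \<omega> p v) \<in> hol_forms A V (cdom c)"
      by (rule hol_forms_mult[OF open_cdom[OF c] hol_forms_subset[OF \<omega>] test_densD(2)[OF \<mu> c]]) simp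
  next
    fix c c' p assume c: "c \<in> A" "c' \<in> A" "p \<in> cdom c \<inter> cdom c'"
    show "(\<lambda>v. \<mu> c' p * \<omega> p v) = (\<lambda>v. of_real (jacobian c c' p) * (\<mu> c p * \<omega> p v))"
      using test_densD(3)[OF \<mu> c(1,2), of p] c(3) by (simp add: mult.assoc)
  next
    show "\<exists>K. compact K \<and> K \<subseteq> U \<and> (\<forall>c p. p \<notin> K \<longrightarrow> (\<lambda>v. \<mu> c p * \<omega> p v) = (\<lambda>_. 0))"
      using K by (intro exI[of _ K]) simp
  qed
qed

text \<open>For continuity, null sequences in one chart must be null sequences in all others. The supports lie in
  a fixed compact set \<open>L\<close>; on \<open>L\<close> the derivatives are controlled by the chain rule, and off \<open>L\<close> everything
  vanishes.\<close>

lemma apply_form_distribution: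
  assumes X: "X \<in> distr_sections A V" and \<omega>: "\<omega> \<in> hol_forms A V UNIV" and c: "c \<in> A"
  shows "distribution_on (cmap c ` cdom c) (\<lambda>g. apply_form \<omega> X (chart_dens A c g))"
  unfolding distribution_on_def
proof (intro conjI ballI allI impI)
  let ?S = "cmap c ` cdom c" and ?T = "\<lambda>g. tensor_dens \<omega> (chart_dens A c g)"
  have T: "?T g \<in> test_form_dens A V UNIV" if "g \<in> test_funs ?S" for g
    by (rule tensor_dens_test_form_dens[OF \<omega> test_dens_mono[OF chart_dens_test_dens[OF c open_cdom[OF c] order_refl that]]]) simp
  {
    fix f g assume f: "f \<in> test_funs ?S" "g \<in> test_funs ?S"
    have "?T (\<lambda>x. f x + g x) = (\<lambda>c p v. ?T f c p v + ?T g c p v)"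
      unfolding tensor_dens_def chart_dens_def by (intro ext) (simp add: algebra_simps)
    then show "apply_form \<omega> X (chart_dens A c (\<lambda>x. f x + g x)) = apply_form \<omega> X (chart_dens A c f) + apply_form \<omega> X (chart_dens A c g)"
      using X T[OF f(1)] T[OF f(2)] unfolding distr_sections_def apply_form_def by simp
  next
    fix f and a :: complex assume f: "f \<in> test_funs ?S"
    have "?T (\<lambda>x. a * f x) = (\<lambda>c p v. a * ?T f c p v)"
      unfolding tensor_dens_def chart_dens_def by (intro ext) (simp add: algebra_simps)
    then show "apply_form \<omega> X (chart_dens A c (\<lambda>x. a * f x)) = a * apply_form \<omega> X (chart_dens A c f)"
      using X T[OF f(1)] unfolding distr_sections_def apply_form_def by simp
  next
    fix f K assume "(\<forall>j. f j \<in> test_funs ?S) \<and> compact K \<and> K \<subseteq> ?S \<and> (\<forall>j x. x \<notin> K \<longrightarrow> f j x = 0) \<and> Cinf_null UNIV f"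
    then have f: "\<And>j. f j \<in> test_funs ?S" and K: "compact K" "K \<subseteq> ?S" "\<And>j x. x \<notin> K \<Longrightarrow> f j x = 0" and null: "Cinf_null UNIV f"
      by (auto simp del: split_paired_All)
    let ?L = "cinv c ` K"
    note L = compact_cinv_image[OF c K(1,2)]
    have off: "?T (f j) c' p = (\<lambda>_. 0)" if "p \<notin> ?L" for j c' p
    proof -
      have "chart_dens A c (f j) c' p = 0" using that K(3)[of "cmap c p"] c by (force simp: chart_dens_def)
      then show ?thesis by (simp add: tensor_dens_def)
    qed
    have "test_null A (\<lambda>j. ?T (f j))"
      unfolding test_null_def
    proof (intro conjI ballI allI impI)
      show "\<exists>K. compact K \<and> (\<forall>j c' p. p \<notin> K \<longrightarrow> ?T (f j) c' p = (\<lambda>_. 0))"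
        using L(1) off by (intro exI[of _ ?L]) simp
    next
      fix c' C i and vs :: "(real^'m) list" assume c': "c' \<in> A" and C': "compact C \<and> C \<subseteq> cmap c' ` cdom c'"
      then have C: "compact C" "C \<subseteq> cmap c' ` cdom c'" by auto
      let ?G = "\<lambda>j x. ?T (f j) c' (cinv c' x) (coord_vec A c' i (cinv c' x))"
      let ?O = "cdom c \<inter> cdom c'" and ?F = "\<lambda>x. cmap c (cinv c' x)"
      let ?a = "\<lambda>q. of_real (jacobian c c' q) * \<omega> q (coord_vec A c' i q)"
      let ?C = "cmap c' ` (cinv c' ` C \<inter> ?L)"
      have O: "open ?O" by (rule open_cdom_Int[OF c c'])
      have W: "open (cmap c' ` ?O)" using open_cmap_image[OF c' open_cdom[OF c]] .
      note D = compact_cinv_image[OF c' C]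
      have C1: "compact ?C" by (rule compact_cmap_image[OF c' compact_Int[OF D(1) L(1)]]) (use D(2) in blast)
      have C1W: "?C \<subseteq> cmap c' ` ?O" using D(2) L(2) by blast
      have "smooth_fun_on A ?O ?a"
      proof (rule smooth_fun_on_mult[OF O jacobian_smooth[OF c c']])
        have "smooth_fun_on A (UNIV \<inter> cdom c') (\<lambda>q. \<omega> q (coord_vec A c' i q))"
          by (rule one_form_coords_smooth[OF c' open_UNIV hol_formsD(2)[OF \<omega>]])
        then show "smooth_fun_on A ?O (\<lambda>q. \<omega> q (coord_vec A c' i q))" by (rule smooth_fun_on_subset) auto
      qed
      from smooth_fun_onD[OF this c'] have a: "smooth_on (cmap c' ` ?O) (\<lambda>x. ?a (cinv c' x))" by (simp add: Int_assoc)
      have F: "smooth_on (cmap c' ` ?O) ?F" using smooth_transition[OF c' c] by (simp add: Int_commute)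
      have "Cinf_null ?C (\<lambda>j x. ?a (cinv c' x) * f j (?F x))"
      proof (rule Cinf_null_mult_compose[OF W open_cimg[OF c] F _ C1 C1W _ _ a])
        show "?F ` cmap c' ` ?O \<subseteq> cmap c ` cdom c" using c' by auto
        show "smooth_on (cmap c ` cdom c) (f j)" for j by (rule smooth_on_subset[OF test_funs_smooth[OF f]]) simp
        show "Cinf_null (?F ` ?C) f" using null unfolding Cinf_null_def by (meson subset_UNIV uniform_limit_on_subset)
      qed
      then have lim: "uniform_limit ?C (\<lambda>j. iter_deriv vs (\<lambda>x. ?a (cinv c' x) * f j (?F x))) (\<lambda>_. 0) sequentially"
        unfolding Cinf_null_def by blast
      have inside: "iter_deriv vs (?G j) x = iter_deriv vs (\<lambda>x. ?a (cinv c' x) * f j (?F x)) x" if "x \<in> ?C" for j x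
      proof (rule iter_deriv_cong[OF W])
        fix y assume "y \<in> cmap c' ` ?O"
        then show "?G j y = ?a (cinv c' y) * f j (?F y)"
          using c c' by (auto simp: tensor_dens_def chart_dens_def)
      qed (use that C1W in blast)
      have outside: "iter_deriv vs (?G j) x = 0" if x: "x \<in> C" "x \<notin> ?C" for j x
      proof -
        have V: "open (cmap c' ` (- ?L \<inter> cdom c'))"
          by (rule open_cmap_image[OF c']) (simp add: L(1) compact_imp_closed open_Compl)
        obtain q where q: "q \<in> cdom c'" "x = cmap c' q" using x(1) C(2) by blast
        have "q \<in> cinv c' ` C" using q c' x(1) by force
        then have qL: "q \<notin> ?L" using x(2) q(2) by blast
        have "iter_deriv vs (?G j) x = iter_deriv vs (\<lambda>_. 0) x"
        proof (rule iter_deriv_cong[OF V])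
          fix y assume "y \<in> cmap c' ` (- ?L \<inter> cdom c')"
          then obtain r where r: "r \<notin> ?L" "r \<in> cdom c'" "y = cmap c' r" by blast
          then show "?G j y = 0" by (simp only: cinv_cmap[OF c' r(2)] off[OF r(1)])
        qed (use q qL in blast)
        then show ?thesis by simp
      qed
      show "uniform_limit C (\<lambda>j. iter_deriv vs (?G j)) (\<lambda>_. 0) sequentially"
        unfolding uniform_limit_iff
      proof (intro allI impI)
        fix \<epsilon> :: real assume \<epsilon>: "\<epsilon> > 0"
        from lim \<epsilon> have "\<forall>\<^sub>F j in sequentially. \<forall>x\<in>?C. dist (iter_deriv vs (\<lambda>x. ?a (cinv c' x) * f j (?F x)) x) 0 < \<epsilon>"
          unfolding uniform_limit_iff by blast
        then show "\<forall>\<^sub>F j in sequentially. \<forall>x\<in>C. dist (iter_deriv vs (?G j) x) 0 < \<epsilon>"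
        proof (rule eventually_mono, intro ballI)
          fix j x assume j: "\<forall>x\<in>?C. dist (iter_deriv vs (\<lambda>x. ?a (cinv c' x) * f j (?F x)) x) 0 < \<epsilon>" and x: "x \<in> C"
          show "dist (iter_deriv vs (?G j) x) 0 < \<epsilon>"
          proof (cases "x \<in> ?C")
            case True
            then show ?thesis using bspec[OF j True] by (simp only: inside[OF True])
          next
            case False
            then show ?thesis using outside[OF x False] \<epsilon> by simp
          qed
        qed
      qed
    qed
    then show "(\<lambda>j. apply_form \<omega> X (chart_dens A c (f j))) \<longlonglongrightarrow> 0"
      using X T[OF f] by (simp add: distr_sections_def apply_form_def)
  }
qed

end


section \<open>The exterior derivative and Lie derivatives of holomorphic forms\<close>

context smooth_manifold
begin

lemma bracket_vector_fields:
  assumes Y: "Y \<in> vector_fields A UNIV" and Z: "Z \<in> vector_fields A UNIV"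
  shows "bracket Y Z \<in> vector_fields A UNIV"
proof -
  have sm: "(\<lambda>q. Y q f) \<in> smooth_funs A" "(\<lambda>q. Z q f) \<in> smooth_funs A" if "f \<in> smooth_funs A" for f
    using vector_fields_smooth[OF Y that] vector_fields_smooth[OF Z that] by auto
  note Yt = vector_fieldsD(1)[OF Y UNIV_I] and Zt = vector_fieldsD(1)[OF Z UNIV_I]
  have "bracket Y Z p \<in> ctangent A p" for p
    unfolding ctangent_def
  proof (intro CollectI conjI ballI allI impI)
    fix f g assume f: "f \<in> smooth_funs A" and g: "g \<in> smooth_funs A"
    show "bracket Y Z p (\<lambda>x. f x + g x) = bracket Y Z p f + bracket Y Z p g"
      by (simp add: bracket_def ctangent_add[OF Yt] ctangent_add[OF Zt] f g sm)
    show "bracket Y Z p (\<lambda>x. f x * g x) = bracket Y Z p f * g p + f p * bracket Y Z p g"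
      by (simp add: bracket_def ctangent_add[OF Yt] ctangent_add[OF Zt] ctangent_mult[OF Yt] ctangent_mult[OF Zt] f g sm smooth_funs_intros(4) algebra_simps)
  next
    fix f and a :: complex assume f: "f \<in> smooth_funs A"
    show "bracket Y Z p (\<lambda>x. a * f x) = a * bracket Y Z p f"
      by (simp add: bracket_def ctangent_cmult[OF Yt] ctangent_cmult[OF Zt] f sm algebra_simps)
  next
    fix f assume "f \<notin> smooth_funs A"
    then show "bracket Y Z p f = 0"
      by (simp add: bracket_def ctangent_nonsmooth[OF Yt] ctangent_nonsmooth[OF Zt] ctangent_const[OF Yt] ctangent_const[OF Zt])
  qed
  moreover have "(\<lambda>p. bracket Y Z p f) \<in> smooth_funs A" if "f \<in> smooth_funs A" for f
    unfolding bracket_def by (rule smooth_funs_intros(3)[OF sm(1)[OF sm(2)[OF that]] sm(2)[OF sm(1)[OF that]]])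
  ultimately show ?thesis unfolding vector_fields_def smooth_funs_def by simp
qed

text \<open>The right side is the invariant formula for \<open>d\<alpha>(Y, Z)\<close>, before it is known to depend on the values of the
  fields at \<open>p\<close> only.\<close>

definition d_form :: "('a \<Rightarrow> 'a covec) \<Rightarrow> ('a \<Rightarrow> 'a tvec) \<Rightarrow> ('a \<Rightarrow> 'a tvec) \<Rightarrow> 'a \<Rightarrow> complex" where
  "d_form \<alpha> Y Z p = Y p (\<lambda>q. \<alpha> q (Z q)) - Z p (\<lambda>q. \<alpha> q (Y q)) - \<alpha> p (bracket Y Z p)"

lemma d_form_smooth:
  assumes "\<alpha> \<in> one_forms A UNIV" "Y \<in> vector_fields A UNIV" "Z \<in> vector_fields A UNIV"
  shows "d_form \<alpha> Y Z \<in> smooth_funs A"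
  unfolding d_form_def[abs_def]
  by (rule smooth_funs_intros(3)[OF smooth_funs_intros(3)[OF
        vector_fields_smooth[OF assms(2) one_forms_pairing_smooth[OF assms(1,3)]]
        vector_fields_smooth[OF assms(3) one_forms_pairing_smooth[OF assms(1,2)]]]
        one_forms_pairing_smooth[OF assms(1) bracket_vector_fields[OF assms(2,3)]]])

lemma d_form_antisym:
  assumes \<alpha>: "\<alpha> \<in> one_forms A UNIV" and Y: "Y \<in> vector_fields A UNIV" and Z: "Z \<in> vector_fields A UNIV"
  shows "d_form \<alpha> Z Y p = - d_form \<alpha> Y Z p"
proof -
  have "bracket Z Y p = (\<lambda>f. (-1) * bracket Y Z p f)" by (simp add: bracket_def)
  then have "\<alpha> p (bracket Z Y p) = (-1) * \<alpha> p (bracket Y Z p)"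
    using ccotangent_cmult[OF one_formsD(1)[OF \<alpha> UNIV_I] vector_fieldsD(1)[OF bracket_vector_fields[OF Y Z] UNIV_I], where a = "-1"] by simp
  then show ?thesis by (simp add: d_form_def)
qed

text \<open>The derivative of \<open>f\<close> along \<open>Z\<close> occurs in the second term and in the bracket, and cancels.\<close>

lemma d_form_mult:
  assumes \<alpha>: "\<alpha> \<in> one_forms A UNIV" and Y: "Y \<in> vector_fields A UNIV" and Z: "Z \<in> vector_fields A UNIV"
    and f: "f \<in> smooth_funs A"
  shows "d_form \<alpha> (\<lambda>q g. f q * Y q g) Z p = f p * d_form \<alpha> Y Z p"
proof -
  note \<alpha>c = one_formsD(1)[OF \<alpha> UNIV_I]
  note Yt = vector_fieldsD(1)[OF Y UNIV_I] and Zt = vector_fieldsD(1)[OF Z UNIV_I]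
  note Bt = vector_fieldsD(1)[OF bracket_vector_fields[OF Y Z] UNIV_I]
  have "bracket (\<lambda>q g. f q * Y q g) Z p = (\<lambda>g. f p * bracket Y Z p g + (- Z p f) * Y p g)"
  proof
    fix g
    show "bracket (\<lambda>q g. f q * Y q g) Z p g = f p * bracket Y Z p g + (- Z p f) * Y p g"
    proof (cases "g \<in> smooth_funs A")
      case True
      then show ?thesis
        by (simp add: bracket_def ctangent_mult[OF Zt f vector_fields_smooth[OF Y True]] algebra_simps)
    next
      case False
      then show ?thesis
        by (simp add: bracket_def ctangent_nonsmooth[OF Yt] ctangent_nonsmooth[OF Zt] ctangent_const[OF Yt] ctangent_const[OF Zt])
    qed
  qed
  then have "\<alpha> p (bracket (\<lambda>q g. f q * Y q g) Z p)
    = \<alpha> p (\<lambda>g. f p * bracket Y Z p g) + \<alpha> p (\<lambda>g. (- Z p f) * Y p g)"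
    by (simp only: ccotangent_add[OF \<alpha>c ctangent_scale[OF Bt] ctangent_scale[OF Yt]])
  also have "\<dots> = f p * \<alpha> p (bracket Y Z p) + (- Z p f) * \<alpha> p (Y p)"
    by (simp only: ccotangent_cmult[OF \<alpha>c Bt] ccotangent_cmult[OF \<alpha>c Yt])
  finally have "\<alpha> p (bracket (\<lambda>q g. f q * Y q g) Z p) = f p * \<alpha> p (bracket Y Z p) - Z p f * \<alpha> p (Y p)" by simp
  moreover have "Z p (\<lambda>q. f q * \<alpha> q (Y q)) = Z p f * \<alpha> p (Y p) + f p * Z p (\<lambda>q. \<alpha> q (Y q))"
    by (rule ctangent_mult[OF Zt f one_forms_pairing_smooth[OF \<alpha> Y]])
  ultimately show ?thesis
    by (simp add: d_form_def ccotangent_cmult[OF \<alpha>c Yt] algebra_simps)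
qed

lemma d_form_add:
  assumes \<alpha>: "\<alpha> \<in> one_forms A UNIV" and Y: "Y \<in> vector_fields A UNIV" "Y' \<in> vector_fields A UNIV" and Z: "Z \<in> vector_fields A UNIV"
  shows "d_form \<alpha> (\<lambda>q g. Y q g + Y' q g) Z p = d_form \<alpha> Y Z p + d_form \<alpha> Y' Z p"
proof -
  note \<alpha>c = one_formsD(1)[OF \<alpha> UNIV_I]
  note Yt = vector_fieldsD(1)[OF Y(1) UNIV_I] and Yt' = vector_fieldsD(1)[OF Y(2) UNIV_I] and Zt = vector_fieldsD(1)[OF Z UNIV_I]
  have "bracket (\<lambda>q g. Y q g + Y' q g) Z p = (\<lambda>g. bracket Y Z p g + bracket Y' Z p g)"
  proof
    fix g
    show "bracket (\<lambda>q g. Y q g + Y' q g) Z p g = bracket Y Z p g + bracket Y' Z p g"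
    proof (cases "g \<in> smooth_funs A")
      case True
      then show ?thesis
        by (simp add: bracket_def ctangent_add[OF Zt vector_fields_smooth[OF Y(1) True] vector_fields_smooth[OF Y(2) True]])
    next
      case False
      then show ?thesis
        by (simp add: bracket_def ctangent_nonsmooth[OF Yt] ctangent_nonsmooth[OF Yt'] ctangent_nonsmooth[OF Zt]
            ctangent_const[OF Yt] ctangent_const[OF Yt'] ctangent_const[OF Zt])
    qed
  qed
  then have "\<alpha> p (bracket (\<lambda>q g. Y q g + Y' q g) Z p) = \<alpha> p (bracket Y Z p) + \<alpha> p (bracket Y' Z p)"
    by (simp add: ccotangent_add[OF \<alpha>c vector_fieldsD(1)[OF bracket_vector_fields[OF Y(1) Z] UNIV_I] vector_fieldsD(1)[OF bracket_vector_fields[OF Y(2) Z] UNIV_I]])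
  then show ?thesis
    by (simp add: d_form_def ccotangent_add[OF \<alpha>c Yt Yt'] ctangent_add[OF Zt one_forms_pairing_smooth[OF \<alpha> Y(1)] one_forms_pairing_smooth[OF \<alpha> Y(2)]])
qed

lemma d_form_lincomb:
  assumes \<alpha>: "\<alpha> \<in> one_forms A UNIV" and Z: "Z \<in> vector_fields A UNIV"
    and I: "finite I" and Y: "\<And>i. i \<in> I \<Longrightarrow> Y i \<in> vector_fields A UNIV" and f: "\<And>i. i \<in> I \<Longrightarrow> f i \<in> smooth_funs A"
  shows "d_form \<alpha> (\<lambda>q g. \<Sum>i\<in>I. f i q * Y i q g) Z p = (\<Sum>i\<in>I. f i p * d_form \<alpha> (Y i) Z p)"
  using I Y f
proof (induction I rule: finite_induct)
  case empty
  show ?case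
    using d_form_mult[OF \<alpha> vector_fields_zero[OF open_UNIV] Z smooth_funs_intros(1)[of 0], of p] by simp
next
  case (insert i I)
  have 1: "(\<lambda>q g. f i q * Y i q g) \<in> vector_fields A UNIV" by (intro vector_fields_mult) (simp_all add: insert.prems)
  have 2: "(\<lambda>q g. \<Sum>i\<in>I. f i q * Y i q g) \<in> vector_fields A UNIV"
    by (intro vector_fields_sum vector_fields_mult open_UNIV) (simp_all add: insert.prems)
  have "d_form \<alpha> (\<lambda>q g. \<Sum>i\<in>insert i I. f i q * Y i q g) Z p
    = d_form \<alpha> (\<lambda>q g. f i q * Y i q g + (\<Sum>i\<in>I. f i q * Y i q g)) Z p"
    using insert.hyps by simp
  also have "\<dots> = d_form \<alpha> (\<lambda>q g. f i q * Y i q g) Z p + d_form \<alpha> (\<lambda>q g. \<Sum>i\<in>I. f i q * Y i q g) Z p"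
    by (rule d_form_add[OF \<alpha> 1 2 Z])
  also have "\<dots> = (\<Sum>i\<in>insert i I. f i p * d_form \<alpha> (Y i) Z p)"
    using insert d_form_mult[OF \<alpha> _ Z, of "Y i" "f i" p] by simp
  finally show ?case .
qed

text \<open>A field vanishing at \<open>p\<close> is, up to a cutoff, a combination of the coordinate fields
  with coefficients vanishing at \<open>p\<close>. The cutoff is squared to make both the coefficients and the fields
  global.\<close>

lemma d_form_vanishing_field:
  assumes \<alpha>: "\<alpha> \<in> one_forms A UNIV" and Y: "Y \<in> vector_fields A UNIV" and Z: "Z \<in> vector_fields A UNIV"
    and Yp: "Y p = (\<lambda>_. 0)"
  shows "d_form \<alpha> Y Z p = 0"
proof -
  obtain c where c: "c \<in> A" "p \<in> cdom c" by (rule chart_cover)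
  obtain \<phi> W L where \<phi>: "\<phi> \<in> smooth_funs A" "p \<in> W" "\<And>q. q \<in> W \<Longrightarrow> \<phi> q = 1" "compact L" "L \<subseteq> cdom c" "\<And>q. q \<notin> L \<Longrightarrow> \<phi> q = 0"
    by (rule manifold_bump[OF open_UNIV UNIV_I c]) blast
  note cut = \<phi>(1) compact_imp_closed[OF \<phi>(4)] \<phi>(5,6)
  let ?y = "\<lambda>i q. \<phi> q * vec_coords A c q (Y q) $ i" and ?e = "\<lambda>i q f. \<phi> q * coord_vec A c i q f"
  have y: "?y i \<in> smooth_funs A" for i
    by (rule smooth_funs_cutoff[OF open_cdom[OF c(1)] _ cut]) (use vector_field_coords_smooth[OF c(1) Y open_UNIV] in simp)
  have e: "?e i \<in> vector_fields A UNIV" for i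
    by (rule vector_fields_cutoff[OF open_cdom[OF c(1)] coord_field[OF c(1)] cut])
  have "(\<lambda>q f. (\<phi> q * \<phi> q) * Y q f) = (\<lambda>q f. \<Sum>i\<in>UNIV. ?y i q * ?e i q f)"
  proof (intro ext)
    fix q f
    show "(\<phi> q * \<phi> q) * Y q f = (\<Sum>i\<in>UNIV. ?y i q * ?e i q f)"
    proof (cases "q \<in> cdom c")
      case True
      show ?thesis
        by (subst vec_coords_expand[OF c(1) True vector_fieldsD(1)[OF Y UNIV_I]]) (simp add: sum_distrib_left mult_ac)
    next
      case False
      then have "\<phi> q = 0" using \<phi>(5,6) by blast
      then show ?thesis by simp
    qed
  qed
  then have "d_form \<alpha> (\<lambda>q f. (\<phi> q * \<phi> q) * Y q f) Z p = (\<Sum>i\<in>UNIV. ?y i p * d_form \<alpha> (?e i) Z p)"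
    using d_form_lincomb[OF \<alpha> Z finite[of UNIV], of ?e ?y p] y e by simp
  moreover have "d_form \<alpha> (\<lambda>q f. (\<phi> q * \<phi> q) * Y q f) Z p = (\<phi> p * \<phi> p) * d_form \<alpha> Y Z p"
    by (rule d_form_mult[OF \<alpha> Y Z]) (intro smooth_funs_intros(4) \<phi>(1))
  moreover have "vec_coords A c p (Y p) = 0"
    by (rule vec_coords_unique[OF c]) (simp add: Yp)
  ultimately show ?thesis using \<phi>(3)[OF \<phi>(2)] by simp
qed

lemma d_form_cong:
  assumes \<alpha>: "\<alpha> \<in> one_forms A UNIV" and Y: "Y \<in> vector_fields A UNIV" "Y' \<in> vector_fields A UNIV" and Z: "Z \<in> vector_fields A UNIV"
    and eq: "Y p = Y' p"
  shows "d_form \<alpha> Y Z p = d_form \<alpha> Y' Z p"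
proof -
  let ?N = "\<lambda>q g. (-1) * Y' q g"
  have N: "?N \<in> vector_fields A UNIV" by (rule vector_fields_cmult[OF open_UNIV Y(2)])
  have "d_form \<alpha> (\<lambda>q g. Y q g + ?N q g) Z p = 0"
    by (rule d_form_vanishing_field[OF \<alpha> vector_fields_add[OF open_UNIV Y(1) N] Z]) (simp add: eq)
  moreover have "d_form \<alpha> (\<lambda>q g. Y q g + ?N q g) Z p = d_form \<alpha> Y Z p + d_form \<alpha> ?N Z p"
    by (rule d_form_add[OF \<alpha> Y(1) N Z])
  moreover have "d_form \<alpha> ?N Z p = (-1) * d_form \<alpha> Y' Z p"
    by (rule d_form_mult[OF \<alpha> Y(2) Z smooth_funs_intros(1)])
  ultimately show ?thesis by simp
qed

text \<open>The exterior derivative uses arbitrary extensions of the two vectors; the values of \<open>d_form\<close> at \<open>p\<close> are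
  independent of them, in the second argument by antisymmetry.\<close>

lemma ext_deriv_eq:
  assumes \<alpha>: "\<alpha> \<in> one_forms A UNIV" and Y: "Y \<in> vector_fields A UNIV" and Z: "Z \<in> vector_fields A UNIV"
  shows "ext_deriv A \<alpha> p (Y p) (Z p) = d_form \<alpha> Y Z p"
proof -
  let ?Y = "SOME Y'. Y' \<in> vector_fields A UNIV \<and> Y' p = Y p" and ?Z = "SOME Z'. Z' \<in> vector_fields A UNIV \<and> Z' p = Z p"
  have Y': "?Y \<in> vector_fields A UNIV \<and> ?Y p = Y p" by (rule someI[of _ Y]) (simp add: Y)
  have Z': "?Z \<in> vector_fields A UNIV \<and> ?Z p = Z p" by (rule someI[of _ Z]) (simp add: Z)
  have "ext_deriv A \<alpha> p (Y p) (Z p) = d_form \<alpha> ?Y ?Z p" by (simp only: ext_deriv_def Let_def d_form_def)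
  also have "\<dots> = d_form \<alpha> Y ?Z p" using d_form_cong[OF \<alpha> _ Y, of ?Y ?Z p] Y' Z' by blast
  also have "\<dots> = - d_form \<alpha> ?Z Y p" using d_form_antisym[OF \<alpha> _ Y, of ?Z p] Z' by blast
  also have "\<dots> = - d_form \<alpha> Z Y p" using d_form_cong[OF \<alpha> _ Z Y, of ?Z p] Z' by simp
  also have "\<dots> = d_form \<alpha> Y Z p" using d_form_antisym[OF \<alpha> Y Z, of p] by simp
  finally show ?thesis .
qed

lemma lie_form_eq:
  assumes \<alpha>: "\<alpha> \<in> one_forms A UNIV" and L: "L \<in> vector_fields A UNIV" and Z: "Z \<in> vector_fields A UNIV"
  shows "lie_form A L \<alpha> p (Z p) = d_form \<alpha> L Z p"
  using ext_deriv_eq[OF \<alpha> L Z, of p] vector_fieldsD(1)[OF Z UNIV_I, of p] by (simp add: lie_form_def)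

lemma lie_form_one_form:
  assumes \<alpha>: "\<alpha> \<in> one_forms A UNIV" and L: "L \<in> vector_fields A UNIV"
  shows "lie_form A L \<alpha> \<in> one_forms A UNIV"
proof -
  have eq: "lie_form A L \<alpha> p (Z p) = - d_form \<alpha> Z L p" if Z: "Z \<in> vector_fields A UNIV" for Z p
    using lie_form_eq[OF \<alpha> L Z] d_form_antisym[OF \<alpha> Z L] by simp
  have "lie_form A L \<alpha> p \<in> ccotangent A p" for p
    unfolding ccotangent_def
  proof (intro CollectI conjI ballI allI impI)
    fix v w assume v: "v \<in> ctangent A p" and w: "w \<in> ctangent A p"
    obtain Y where Y: "Y \<in> vector_fields A UNIV" "Y p = v" by (rule vector_field_extension[OF v])
    obtain Z where Z: "Z \<in> vector_fields A UNIV" "Z p = w" by (rule vector_field_extension[OF w])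
    show "lie_form A L \<alpha> p (\<lambda>f. v f + w f) = lie_form A L \<alpha> p v + lie_form A L \<alpha> p w"
      using eq[OF vector_fields_add[OF open_UNIV Y(1) Z(1)], of p] eq[OF Y(1), of p] eq[OF Z(1), of p] d_form_add[OF \<alpha> Y(1) Z(1) L, of p] Y(2) Z(2)
      by simp
  next
    fix v and a :: complex assume v: "v \<in> ctangent A p"
    obtain Y where Y: "Y \<in> vector_fields A UNIV" "Y p = v" by (rule vector_field_extension[OF v])
    show "lie_form A L \<alpha> p (\<lambda>f. a * v f) = a * lie_form A L \<alpha> p v"
      using eq[OF vector_fields_cmult[OF open_UNIV Y(1)], of p a] eq[OF Y(1), of p] d_form_mult[OF \<alpha> Y(1) L smooth_funs_intros(1), of a p] Y(2)
      by simp
  qed (simp add: lie_form_def)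
  moreover have "smooth_fun_on A UNIV (\<lambda>p. lie_form A L \<alpha> p (Z p))" if Z: "Z \<in> vector_fields A UNIV" for Z
    using d_form_smooth[OF \<alpha> L Z] lie_form_eq[OF \<alpha> L Z] by (simp add: smooth_funs_def)
  ultimately show ?thesis unfolding one_forms_def by blast
qed

end


section \<open>Involutive structures\<close>

locale involutive_structure = smooth_manifold A
  for A :: "('a::{t2_space, second_countable_topology}, 'm::finite) chart set" +
  fixes V :: "'a \<Rightarrow> 'a tvec set" and n :: nat
  assumes subbundle: "smooth_subbundle A V n"
    and involutive: "L \<in> CR_fields A V \<Longrightarrow> K \<in> CR_fields A V \<Longrightarrow> bracket L K \<in> CR_fields A V"
begin

lemma local_frame:
  obtains U Ls where "open U" "p \<in> U" "\<And>j. j < n \<Longrightarrow> Ls j \<in> vector_fields A U" "\<And>q. q \<in> U \<Longrightarrow> complex_basis n (\<lambda>j. Ls j q) (V q)"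
proof -
  from subbundle obtain U Ls where "open U" "p \<in> U" "\<forall>j<n. Ls j \<in> vector_fields A U" "\<forall>q\<in>U. complex_basis n (\<lambda>j. Ls j q) (V q)"
    unfolding smooth_subbundle_def by (elim allE[of _ p] exE conjE) (rule that)
  then show ?thesis by (intro that[of U Ls]) simp_all
qed

lemma complex_basisD:
  assumes "complex_basis k b S"
  shows "(\<lambda>x. \<Sum>j<k. a j * b j x) \<in> S" "v \<in> S \<Longrightarrow> \<exists>a. v = (\<lambda>x. \<Sum>j<k. a j * b j x)"
    "(\<And>x. (\<Sum>j<k. a j * b j x) = 0) \<Longrightarrow> j < k \<Longrightarrow> a j = 0"
proof -
  have S: "S = range (\<lambda>a. (\<lambda>x. \<Sum>j<k. a j * b j x))" using assms unfolding complex_basis_def by (rule conjunct1)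
  show "(\<lambda>x. \<Sum>j<k. a j * b j x) \<in> S" unfolding S by (rule rangeI)
  show "v \<in> S \<Longrightarrow> \<exists>a. v = (\<lambda>x. \<Sum>j<k. a j * b j x)" unfolding S by blast
  show "(\<And>x. (\<Sum>j<k. a j * b j x) = 0) \<Longrightarrow> j < k \<Longrightarrow> a j = 0" using assms unfolding complex_basis_def by blast
qed

lemma zero_in_V: "(\<lambda>_. 0) \<in> V p"
proof -
  obtain U Ls where U: "p \<in> U" "\<And>q. q \<in> U \<Longrightarrow> complex_basis n (\<lambda>j. Ls j q) (V q)" by (rule local_frame) blast
  show ?thesis using complex_basisD(1)[OF U(2)[OF U(1)], of "\<lambda>_. 0"] by simp
qed

lemma CR_fieldsD: "L \<in> CR_fields A V \<Longrightarrow> L \<in> vector_fields A UNIV" "L \<in> CR_fields A V \<Longrightarrow> L p \<in> V p"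
  unfolding CR_fields_def by blast+

text \<open>Cut off a combination of a local frame with constant coefficients. Membership in \<open>V\<close> is preserved, as
  the fibres are vector spaces.\<close>

lemma CR_field_extension:
  assumes v: "v \<in> V p" obtains K where "K \<in> CR_fields A V" "K p = v"
proof -
  obtain U Ls where U: "open U" "p \<in> U" "\<And>j. j < n \<Longrightarrow> Ls j \<in> vector_fields A U" "\<And>q. q \<in> U \<Longrightarrow> complex_basis n (\<lambda>j. Ls j q) (V q)"
    by (rule local_frame) blast
  obtain a where a: "v = (\<lambda>f. \<Sum>j<n. a j * Ls j p f)" using complex_basisD(2)[OF U(4)[OF U(2)] v] by blast
  obtain c where c: "c \<in> A" "p \<in> cdom c" by (rule chart_cover)
  obtain \<phi> W L where \<phi>: "\<phi> \<in> smooth_funs A" "p \<in> W" "\<And>q. q \<in> W \<Longrightarrow> \<phi> q = 1" "compact L" "L \<subseteq> U" "\<And>q. q \<notin> L \<Longrightarrow> \<phi> q = 0"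
    by (rule manifold_bump[OF U(1,2) c]) blast
  let ?Y = "\<lambda>q f. \<Sum>j<n. a j * Ls j q f" and ?K = "\<lambda>q f. \<phi> q * (\<Sum>j<n. a j * Ls j q f)"
  have "?Y \<in> vector_fields A U" by (intro vector_fields_sum vector_fields_cmult U(1)) (simp add: U(3))
  then have "?K \<in> vector_fields A UNIV" by (rule vector_fields_cutoff[OF U(1) _ \<phi>(1) compact_imp_closed[OF \<phi>(4)] \<phi>(5,6)])
  moreover have "?K q \<in> V q" for q
  proof (cases "q \<in> U")
    case True
    have "?K q = (\<lambda>f. \<Sum>j<n. (\<phi> q * a j) * Ls j q f)" by (simp add: sum_distrib_left mult.assoc)
    then show ?thesis using complex_basisD(1)[OF U(4)[OF True]] by simp
  next
    case False
    then have "\<phi> q = 0" using \<phi>(5,6) by blast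
    then show ?thesis using zero_in_V by simp
  qed
  ultimately have "?K \<in> CR_fields A V" unfolding CR_fields_def by blast
  moreover have "?K p = v" using \<phi>(3)[OF \<phi>(2)] a by simp
  ultimately show ?thesis by (rule that)
qed

lemma V_subset_ctangent: "v \<in> V p \<Longrightarrow> v \<in> ctangent A p"
  by (metis CR_field_extension CR_fieldsD(1) vector_fieldsD(1) UNIV_I)

lemma hol_forms_UNIV_vanish: "\<alpha> \<in> hol_forms A V UNIV \<Longrightarrow> L \<in> CR_fields A V \<Longrightarrow> \<alpha> p (L p) = 0"
  unfolding hol_forms_def hol_cotangent_def CR_fields_def by blast

text \<open>All three terms of \<open>d\<alpha>(L, K)\<close> vanish for CR fields, the last one by involutivity.\<close>

lemma lie_form_hol_form:
  assumes \<alpha>: "\<alpha> \<in> hol_forms A V UNIV" and L: "L \<in> CR_fields A V"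
  shows "lie_form A L \<alpha> \<in> hol_forms A V UNIV"
proof -
  note \<alpha>1 = hol_formsD(2)[OF \<alpha>] and L1 = CR_fieldsD(1)[OF L]
  note Lf = lie_form_one_form[OF \<alpha>1 L1]
  have "lie_form A L \<alpha> p v = 0" if v: "v \<in> V p" for p v
  proof -
    obtain K where K: "K \<in> CR_fields A V" "K p = v" by (rule CR_field_extension[OF v])
    note K1 = CR_fieldsD(1)[OF K(1)]
    have "d_form \<alpha> L K p = 0"
      unfolding d_form_def hol_forms_UNIV_vanish[OF \<alpha> L] hol_forms_UNIV_vanish[OF \<alpha> K(1)] hol_forms_UNIV_vanish[OF \<alpha> involutive[OF L K(1)]]
      by (simp add: ctangent_const[OF vector_fieldsD(1)[OF L1 UNIV_I]] ctangent_const[OF vector_fieldsD(1)[OF K1 UNIV_I]])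
    then show ?thesis using lie_form_eq[OF \<alpha>1 L1 K1, of p] K(2) by simp
  qed
  then show ?thesis using Lf one_formsD(1)[OF Lf UNIV_I] unfolding hol_forms_def hol_cotangent_def by blast
qed

lemma char_forms_hol_forms: "\<tau> \<in> char_forms A V \<Longrightarrow> \<tau> \<in> hol_forms A V UNIV"
  unfolding char_forms_def hol_forms_def char_cotangent_def real_cotangent_def hol_cotangent_def by blast

end


section \<open>Regularity of the values of the forms in \<open>E\<close>\<close>

context smooth_manifold
begin

lemma hol_forms_add:
  assumes "open U" "\<alpha> \<in> hol_forms A V U" "\<beta> \<in> hol_forms A V U" shows "(\<lambda>p v. \<alpha> p v + \<beta> p v) \<in> hol_forms A V U"
  using hol_forms_sum[OF assms(1), of "UNIV :: bool set" "\<lambda>b. if b then \<alpha> else \<beta>" V] assms by (simp add: UNIV_bool add.commute)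

lemma test_form_dens_add:
  assumes m: "m \<in> test_form_dens A V U" "m' \<in> test_form_dens A V U"
  shows "(\<lambda>c p v. m c p v + m' c p v) \<in> test_form_dens A V U"
proof -
  obtain K where K: "compact K" "K \<subseteq> U" "\<And>c p. p \<notin> K \<Longrightarrow> m c p = (\<lambda>_. 0)" using m(1) unfolding test_form_dens_def by blast
  obtain K' where K': "compact K'" "K' \<subseteq> U" "\<And>c p. p \<notin> K' \<Longrightarrow> m' c p = (\<lambda>_. 0)" using m(2) unfolding test_form_dens_def by blast
  show ?thesis
    unfolding test_form_dens_def
  proof (intro CollectI conjI allI impI ballI)
    fix c p assume "c \<notin> A \<or> p \<notin> cdom c"
    then have "m c p = (\<lambda>_. 0)" "m' c p = (\<lambda>_. 0)" using m unfolding test_form_dens_def by blast+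
    then show "(\<lambda>v. m c p v + m' c p v) = (\<lambda>_. 0)" by simp
  next
    fix c assume c: "c \<in> A"
    then have "m c \<in> hol_forms A V (cdom c)" "m' c \<in> hol_forms A V (cdom c)" using m unfolding test_form_dens_def by blast+
    then show "(\<lambda>p v. m c p v + m' c p v) \<in> hol_forms A V (cdom c)" by (rule hol_forms_add[OF open_cdom[OF c]])
  next
    fix c c' p assume "c \<in> A" "c' \<in> A" "p \<in> cdom c \<inter> cdom c'"
    then have "m c' p = (\<lambda>v. of_real (jacobian c c' p) * m c p v)" "m' c' p = (\<lambda>v. of_real (jacobian c c' p) * m' c p v)"
      using m unfolding test_form_dens_def by blast+
    then show "(\<lambda>v. m c' p v + m' c' p v) = (\<lambda>v. of_real (jacobian c c' p) * (m c p v + m' c p v))" by (simp add: distrib_left)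
  next
    show "\<exists>K. compact K \<and> K \<subseteq> U \<and> (\<forall>c p. p \<notin> K \<longrightarrow> (\<lambda>v. m c p v + m' c p v) = (\<lambda>_. 0))"
      using K K' by (intro exI[of _ "K \<union> K'"]) (simp add: compact_Un)
  qed
qed

lemma test_form_dens_zero: "(\<lambda>c p v. 0) \<in> test_form_dens A V U"
proof -
  have "(\<lambda>p v. 0) \<in> hol_forms A V (cdom c)" if "c \<in> A" for c
    using hol_forms_sum[OF open_cdom[OF that], of "{}"] by simp
  then show ?thesis unfolding test_form_dens_def by (auto intro!: exI[of _ "{}"])
qed

lemma test_form_dens_sum:
  "finite I \<Longrightarrow> (\<And>i. i \<in> I \<Longrightarrow> m i \<in> test_form_dens A V U) \<Longrightarrow> (\<lambda>c p v. \<Sum>i\<in>I. m i c p v) \<in> test_form_dens A V U"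
proof (induction I rule: finite_induct)
  case (insert i I)
  then have "m i \<in> test_form_dens A V U" "(\<lambda>c p v. \<Sum>i\<in>I. m i c p v) \<in> test_form_dens A V U" by simp_all
  from test_form_dens_add[OF this] show ?case using insert.hyps by simp
qed (simp add: test_form_dens_zero)

lemma distr_sections_add: "X \<in> distr_sections A V \<Longrightarrow> m \<in> test_form_dens A V UNIV \<Longrightarrow> m' \<in> test_form_dens A V UNIV
    \<Longrightarrow> X (\<lambda>c p v. m c p v + m' c p v) = X m + X m'"
  and distr_sections_cmult: "X \<in> distr_sections A V \<Longrightarrow> m \<in> test_form_dens A V UNIV \<Longrightarrow> X (\<lambda>c p v. a * m c p v) = a * X m"
  by (simp_all add: distr_sections_def)

lemma distr_sections_sum:
  assumes X: "X \<in> distr_sections A V" and I: "finite I" and m: "\<And>i. i \<in> I \<Longrightarrow> m i \<in> test_form_dens A V UNIV"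
  shows "X (\<lambda>c p v. \<Sum>i\<in>I. m i c p v) = (\<Sum>i\<in>I. X (m i))"
  using I m
proof (induction I rule: finite_induct)
  case empty
  show ?case using distr_sections_cmult[OF X test_form_dens_zero, of 0] by simp
next
  case (insert i I)
  have "X (\<lambda>c p v. m i c p v + (\<Sum>i\<in>I. m i c p v)) = X (m i) + X (\<lambda>c p v. \<Sum>i\<in>I. m i c p v)"
    by (intro distr_sections_add[OF X] test_form_dens_sum insert.hyps insert.prems) simp_all
  then show ?case using insert by simp
qed

lemma represents_cong:
  assumes "\<And>\<mu>. \<mu> \<in> test_dens A UNIV \<Longrightarrow> u \<mu> = u' \<mu>" "represents u h" shows "represents u' h"
  unfolding represents_def
proof (intro ballI)
  fix c \<mu> assume c: "c \<in> A" and \<mu>: "\<mu> \<in> test_dens A (cdom c)"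
  have "u \<mu> = u' \<mu>" by (rule assms(1)[OF test_dens_mono[OF \<mu>]]) simp
  then show "u' \<mu> = (LINT x|lborel. dens_coeff c \<mu> x * h (cinv c x))"
    using assms(2) c \<mu> unfolding represents_def by metis
qed

lemma represents_lincomb:
  assumes X: "X \<in> distr_sections A V" and I: "finite I" and \<beta>: "\<And>i. i \<in> I \<Longrightarrow> \<beta> i \<in> hol_forms A V UNIV"
    and g: "\<And>i. i \<in> I \<Longrightarrow> g i \<in> smooth_funs A" and h: "\<And>i. i \<in> I \<Longrightarrow> h i \<in> smooth_funs A"
    and rep: "\<And>i. i \<in> I \<Longrightarrow> represents (apply_form (\<beta> i) X) (h i)"
  shows "represents (apply_form (\<lambda>p v. \<Sum>i\<in>I. g i p * \<beta> i p v) X) (\<lambda>p. \<Sum>i\<in>I. g i p * h i p)"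
  unfolding represents_def
proof (intro ballI)
  fix c \<mu> assume c: "c \<in> A" and \<mu>: "\<mu> \<in> test_dens A (cdom c)"
  let ?\<mu> = "\<lambda>i c p. g i p * \<mu> c p" and ?S = "cmap c ` cdom c"
  have S: "open ?S" by (rule open_cimg[OF c])
  have \<mu>i: "?\<mu> i \<in> test_dens A (cdom c)" if "i \<in> I" for i by (rule test_dens_mult[OF g[OF that] \<mu>])
  have \<mu>i': "?\<mu> i \<in> test_dens A UNIV" if "i \<in> I" for i by (rule test_dens_mono[OF \<mu>i[OF that]]) simp
  have int: "integrable lborel (\<lambda>x. dens_coeff c (?\<mu> i) x * h i (cinv c x))" if "i \<in> I" for i
    by (rule test_funs_integrable[OF test_funs_mult[OF S dens_coeff_test_fun[OF c open_cdom[OF c] order_refl \<mu>i[OF that]] smooth_funsD[OF h[OF that] c]]])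
  have "tensor_dens (\<lambda>p v. \<Sum>i\<in>I. g i p * \<beta> i p v) \<mu> = (\<lambda>c p v. \<Sum>i\<in>I. tensor_dens (\<beta> i) (?\<mu> i) c p v)"
    unfolding tensor_dens_def by (intro ext) (simp add: sum_distrib_left mult_ac)
  then have "apply_form (\<lambda>p v. \<Sum>i\<in>I. g i p * \<beta> i p v) X \<mu> = (\<Sum>i\<in>I. apply_form (\<beta> i) X (?\<mu> i))"
    unfolding apply_form_def
    using distr_sections_sum[OF X I tensor_dens_test_form_dens[OF \<beta> \<mu>i']] by simp
  also have "\<dots> = (\<Sum>i\<in>I. LINT x|lborel. dens_coeff c (?\<mu> i) x * h i (cinv c x))"
    by (rule sum.cong[OF refl]) (use rep \<mu>i c in \<open>simp add: represents_def\<close>)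
  also have "\<dots> = (LINT x|lborel. (\<Sum>i\<in>I. dens_coeff c (?\<mu> i) x * h i (cinv c x)))"
    by (rule Bochner_Integration.integral_sum[symmetric]) (rule int)
  also have "\<dots> = (LINT x|lborel. dens_coeff c \<mu> x * (\<Sum>i\<in>I. g i (cinv c x) * h i (cinv c x)))"
    by (intro Bochner_Integration.integral_cong refl) (simp add: dens_coeff_def sum_distrib_left mult_ac)
  finally show "apply_form (\<lambda>p v. \<Sum>i\<in>I. g i p * \<beta> i p v) X \<mu> = (LINT x|lborel. dens_coeff c \<mu> x * (\<Sum>i\<in>I. g i (cinv c x) * h i (cinv c x)))" .
qed

end

context involutive_structure
begin

text \<open>The wavefront set of a real distribution is symmetric, and a convex cone without \<open>0\<close> contains no
  pair of opposite covectors.\<close>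

lemma char_form_wavefront_empty:
  assumes X: "infinitesimal_CR_diffeo A V X" and wedge: "extends_to_wedge A V X" and \<tau>: "\<tau> \<in> char_forms A V"
  shows "wavefront A (apply_form \<tau> X) = {}"
proof (rule ccontr)
  assume "wavefront A (apply_form \<tau> X) \<noteq> {}"
  then obtain p \<xi> where wf: "(p, \<xi>) \<in> wavefront A (apply_form \<tau> X)" by (metis ex_in_conv surj_pair)
  have "(p, \<lambda>v. - \<xi> v) \<in> wavefront A (apply_form \<tau> X)"
    by (rule wavefront_symmetric[OF _ wf]) (use X \<tau> in \<open>simp add: infinitesimal_CR_diffeo_def\<close>)
  moreover from wedge obtain \<Gamma> where \<Gamma>: "\<forall>p. \<Gamma> p \<subseteq> char_cotangent A V p - {\<lambda>_. 0} \<and>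
             closedin (top_of_set (char_cotangent A V p - {\<lambda>_. 0})) (\<Gamma> p) \<and>
             (\<forall>\<xi>\<in>\<Gamma> p. \<forall>t>0. (\<lambda>v. of_real t * \<xi> v) \<in> \<Gamma> p) \<and>
             (\<forall>\<xi>\<in>\<Gamma> p. \<forall>\<eta>\<in>\<Gamma> p. \<forall>t\<in>{0..1::real}. (\<lambda>v. of_real (1 - t) * \<xi> v + of_real t * \<eta> v) \<in> \<Gamma> p)"
      "\<forall>\<omega>\<in>hol_forms A V UNIV. wavefront A (apply_form \<omega> X) \<subseteq> (SIGMA p:UNIV. \<Gamma> p)"
    unfolding extends_to_wedge_def by (elim exE conjE) (rule that)
  have zero: "\<Gamma> p \<subseteq> char_cotangent A V p - {\<lambda>_. 0}" using spec[OF \<Gamma>(1), of p] by (elim conjE)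
  have cone: "\<forall>\<xi>\<in>\<Gamma> p. \<forall>\<eta>\<in>\<Gamma> p. \<forall>t\<in>{0..1::real}. (\<lambda>v. of_real (1 - t) * \<xi> v + of_real t * \<eta> v) \<in> \<Gamma> p"
    using spec[OF \<Gamma>(1), of p] by (elim conjE)
  ultimately have "\<xi> \<in> \<Gamma> p" "(\<lambda>v. - \<xi> v) \<in> \<Gamma> p"
    using wf bspec[OF \<Gamma>(2) char_forms_hol_forms[OF \<tau>]] by (auto simp: subset_iff)
  from bspec[OF bspec[OF bspec[OF cone this(1)] this(2)], of "1/2"] have "(\<lambda>v. of_real (1 - 1/2) * \<xi> v + of_real (1/2) * (- \<xi> v)) \<in> \<Gamma> p" by simp
  moreover have "(\<lambda>v. of_real (1 - 1/2) * \<xi> v + of_real (1/2) * (- \<xi> v)) = (\<lambda>_. 0)" by simp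
  ultimately show False using zero by auto
qed

text \<open>Holomorphic forms on which \<open>X\<close> takes a smooth value. The aim is to show that all elements of \<open>E\<close> are of
  this kind.\<close>

definition smooth_value :: "(('a, 'm) form_dens \<Rightarrow> complex) \<Rightarrow> ('a \<Rightarrow> 'a covec) \<Rightarrow> bool" where
  "smooth_value X \<omega> \<longleftrightarrow> \<omega> \<in> hol_forms A V UNIV \<and> (\<exists>h\<in>smooth_funs A. represents (apply_form \<omega> X) h)"

lemma char_form_smooth_value:
  assumes X: "infinitesimal_CR_diffeo A V X" and wedge: "extends_to_wedge A V X" and \<tau>: "\<tau> \<in> char_forms A V"
  shows "smooth_value X \<tau>"
proof -
  have X1: "X \<in> distr_sections A V" using X unfolding infinitesimal_CR_diffeo_def by blast
  note \<tau>1 = char_forms_hol_forms[OF \<tau>]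
  obtain h where "h \<in> smooth_funs A" "represents (apply_form \<tau> X) h"
    by (rule represents_of_wavefront_empty[OF apply_form_distribution[OF X1 \<tau>1] char_form_wavefront_empty[OF X wedge \<tau>]])
  then show ?thesis using \<tau>1 unfolding smooth_value_def by blast
qed

text \<open>By the equation for infinitesimal CR diffeomorphisms, the value on the Lie derivative is the derivative
  along \<open>L\<close> of the value on \<open>\<omega>\<close>.\<close>

lemma lie_form_smooth_value:
  assumes X: "infinitesimal_CR_diffeo A V X" and L: "L \<in> CR_fields A V" and \<omega>: "smooth_value X \<omega>"
  shows "smooth_value X (lie_form A L \<omega>)"
proof -
  from \<omega> obtain h where \<omega>1: "\<omega> \<in> hol_forms A V UNIV" and h: "h \<in> smooth_funs A" "represents (apply_form \<omega> X) h"
    unfolding smooth_value_def by blast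
  note L1 = CR_fieldsD(1)[OF L]
  have "represents (apply_form (lie_form A L \<omega>) X) (\<lambda>p. L p h)"
    by (rule represents_cong[OF _ represents_field_distr[OF L1 h]])
       (use X L \<omega>1 in \<open>simp add: infinitesimal_CR_diffeo_def\<close>)
  then show ?thesis using vector_fields_smooth[OF L1 h(1)] lie_form_hol_form[OF \<omega>1 L] unfolding smooth_value_def by blast
qed

lemma E_module_smooth_value:
  assumes X: "infinitesimal_CR_diffeo A V X" and wedge: "extends_to_wedge A V X" and W: "W \<in> E_module A V k"
  shows "smooth_value X W"
proof -
  have X1: "X \<in> distr_sections A V" using X unfolding infinitesimal_CR_diffeo_def by blast
  have gen: "smooth_value X (foldr (lie_form A) Ks \<theta>)" if "set Ks \<subseteq> CR_fields A V" "\<theta> \<in> char_forms A V" for Ks \<theta>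
    using that(1)
    by (induction Ks) (simp_all add: char_form_smooth_value[OF X wedge that(2)] lie_form_smooth_value[OF X])
  from W have "\<exists>(r::nat) g \<beta>. W = (\<lambda>p v. \<Sum>l<r. g l p * \<beta> l p v) \<and> (\<forall>l<r. g l \<in> smooth_funs A \<and> \<beta> l \<in> E_generators A V k)"
    by (simp only: E_module_def mem_Collect_eq)
  then obtain r :: nat and g \<beta> where W: "W = (\<lambda>p v. \<Sum>l<r. g l p * \<beta> l p v)"
    and g\<beta>: "\<forall>l<r. g l \<in> smooth_funs A \<and> \<beta> l \<in> E_generators A V k"
    by (elim exE conjE) (rule that)
  then have g: "\<And>l. l < r \<Longrightarrow> g l \<in> smooth_funs A" and \<beta>: "\<And>l. l < r \<Longrightarrow> \<beta> l \<in> E_generators A V k" by simp_all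
  have sv: "smooth_value X (\<beta> l)" if l: "l < r" for l
  proof -
    obtain Ks \<theta> where "\<beta> l = foldr (lie_form A) Ks \<theta>" "set Ks \<subseteq> CR_fields A V" "\<theta> \<in> char_forms A V"
      using \<beta>[OF l] unfolding E_generators_def by blast
    then show ?thesis using gen by simp
  qed
  then have hol: "\<And>l. l < r \<Longrightarrow> \<beta> l \<in> hol_forms A V UNIV" unfolding smooth_value_def by blast
  have "\<forall>l\<in>{..<r}. \<exists>h. h \<in> smooth_funs A \<and> represents (apply_form (\<beta> l) X) h"
    using sv unfolding smooth_value_def by (simp add: Bex_def)
  from bchoice[OF this] obtain h where h: "\<forall>l\<in>{..<r}. h l \<in> smooth_funs A \<and> represents (apply_form (\<beta> l) X) (h l)" ..
  have "represents (apply_form W X) (\<lambda>p. \<Sum>l<r. g l p * h l p)"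
    unfolding W by (rule represents_lincomb[OF X1]) (use hol g h in simp_all)
  moreover have "(\<lambda>p. \<Sum>l<r. g l p * h l p) \<in> smooth_funs A"
    by (rule smooth_funs_sum, rule smooth_funs_intros(4)) (use g h in simp_all)
  moreover have "W \<in> hol_forms A V UNIV"
    unfolding W by (rule hol_forms_sum[OF open_UNIV], rule hol_forms_mult[OF open_UNIV]) (use hol g smooth_funs_on in simp_all)
  ultimately show ?thesis unfolding smooth_value_def by blast
qed

end


section \<open>Cramer's rule\<close>

lemma leibniz_det_replace_row:
  assumes i: "i < N"
  shows "leibniz_det N (a(i := (\<lambda>j. \<Sum>k\<in>I. f k * b k j))) = (\<Sum>k\<in>I. f k * leibniz_det N (a(i := b k)))"
proof -
  have split: "(\<Prod>l<N. (a(i := b)) l (\<pi> l)) = b (\<pi> i) * (\<Prod>l\<in>{..<N} - {i}. a l (\<pi> l))" for b \<pi>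
  proof -
    have "(\<Prod>l\<in>{..<N} - {i}. (a(i := b)) l (\<pi> l)) = (\<Prod>l\<in>{..<N} - {i}. a l (\<pi> l))" by (rule prod.cong) auto
    then show ?thesis using prod.remove[of "{..<N}" i "\<lambda>l. (a(i := b)) l (\<pi> l)"] i by simp
  qed
  have "leibniz_det N (a(i := (\<lambda>j. \<Sum>k\<in>I. f k * b k j)))
    = (\<Sum>\<pi> | \<pi> permutes {..<N}. \<Sum>k\<in>I. f k * (of_int (sign \<pi>) * (b k (\<pi> i) * (\<Prod>l\<in>{..<N} - {i}. a l (\<pi> l)))))"
    unfolding leibniz_det_def split by (simp add: sum_distrib_left sum_distrib_right mult_ac)
  also have "\<dots> = (\<Sum>k\<in>I. f k * leibniz_det N (a(i := b k)))"
    unfolding leibniz_det_def split by (subst sum.swap) (simp add: sum_distrib_left)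
  finally show ?thesis .
qed

text \<open>Composition with the transposition of the two rows changes the sign of a permutation but not the
  product of the entries, so the determinant equals its negative.\<close>

lemma leibniz_det_equal_rows:
  assumes i: "i < N" "k < N" "i \<noteq> k" and eq: "a i = a k"
  shows "leibniz_det N a = 0"
proof -
  let ?t = "Transposition.transpose i k" and ?F = "\<lambda>\<pi>. of_int (sign \<pi>) * (\<Prod>l<N. a l (\<pi> l))"
  have t: "?t permutes {..<N}" using i by (intro permutes_swap_id) auto
  have at: "a (?t l) = a l" for l using eq by (auto simp: Transposition.transpose_def)
  have "?F (\<pi> \<circ> ?t) = - ?F \<pi>" if \<pi>: "\<pi> permutes {..<N}" for \<pi>
  proof -
    have "sign (\<pi> \<circ> ?t) = - sign \<pi>"
      using sign_compose[OF permutes_imp_permutation[OF finite_lessThan \<pi>] permutation_swap_id] i(3) by (simp add: sign_swap_id)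
    moreover have "(\<Prod>l<N. a l ((\<pi> \<circ> ?t) l)) = (\<Prod>l<N. a l (\<pi> l))"
    proof -
      have "(\<Prod>l<N. a l (\<pi> l)) = (\<Prod>l<N. a (?t l) (\<pi> (?t l)))"
        by (rule prod.permute[OF t, unfolded comp_def])
      then show ?thesis by (simp add: at)
    qed
    ultimately show ?thesis by simp
  qed
  then have "(\<Sum>\<pi> | \<pi> permutes {..<N}. ?F (\<pi> \<circ> ?t)) = - leibniz_det N a"
    by (simp add: leibniz_det_def sum_negf)
  then have "leibniz_det N a = - leibniz_det N a"
    using sum_permutations_compose_right[OF t, of ?F] by (simp add: leibniz_det_def)
  then show ?thesis by simp
qed

text \<open>Replacing row \<open>i\<close> by another row \<open>k\<close> gives two equal rows; only the term \<open>k = i\<close> of the combination survives.\<close>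

lemma leibniz_det_replace_lincomb:
  assumes i: "i < N"
  shows "leibniz_det N (a(i := (\<lambda>j. \<Sum>k<N. f k * a k j))) = f i * leibniz_det N a"
proof -
  have "leibniz_det N (a(i := a k)) = (if k = i then leibniz_det N a else 0)" if "k < N" for k
    using leibniz_det_equal_rows[of i N k "a(i := a k)"] i that by simp
  then have "(\<Sum>k<N. f k * leibniz_det N (a(i := a k))) = (\<Sum>k<N. if k = i then f i * leibniz_det N a else 0)"
    by (intro sum.cong) auto
  then show ?thesis using i by (simp add: leibniz_det_replace_row[OF i])
qed

text \<open>Replacing row \<open>i\<close> by the vanishing combination gives \<open>f i\<close> times the determinant, and also \<open>0\<close>.\<close>

lemma leibniz_det_independent_rows:
  assumes "leibniz_det N a \<noteq> 0" "\<And>j. (\<Sum>k<N. f k * a k j) = 0" "i < N"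
  shows "f i = 0"
proof -
  have "leibniz_det N (a(i := (\<lambda>j. 0))) = 0"
    using leibniz_det_replace_row[OF assms(3), of a "\<lambda>_. 0" "\<lambda>_ _. 0" "{}"] by simp
  then show ?thesis using leibniz_det_replace_lincomb[OF assms(3), of a f] assms(1,2) by simp
qed


section \<open>The rank of the holomorphic cotangent bundle\<close>

lemma independent_family_span:
  fixes b :: "nat \<Rightarrow> complex^'m"
  assumes ind: "\<forall>a. (\<Sum>i<N. a i *s b i) = 0 \<longrightarrow> (\<forall>i<N. a i = 0)"
  shows "vec.dim (vec.span (b ` {..<N})) = N" and "x \<in> vec.span (b ` {..<N}) \<Longrightarrow> \<exists>a. x = (\<Sum>i<N. a i *s b i)"
proof -
  have inj: "inj_on b {..<N}"
  proof (rule inj_onI, rule ccontr)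
    fix i k assume ik: "i \<in> {..<N}" "k \<in> {..<N}" "b i = b k" "i \<noteq> k"
    let ?a = "\<lambda>l. (if l = i then 1 else 0) - (if l = k then 1 else (0::complex))"
    have "(\<Sum>l<N. ?a l *s b l) = (\<Sum>l<N. if l = i then b i else 0) - (\<Sum>l<N. if l = k then b k else 0)"
      unfolding sum_subtractf[symmetric] by (rule sum.cong) (auto simp: vector_sub_rdistrib)
    also have "\<dots> = 0" using ik by simp
    finally have "\<forall>l<N. ?a l = 0" by (rule mp[OF spec[OF ind]])
    then have "?a i = 0" using ik by blast
    then show False using ik(4) by simp
  qed
  have "vec.independent (b ` {..<N})"
  proof (rule vec.independent_if_scalars_zero)
    fix f x assume "(\<Sum>x\<in>b ` {..<N}. f x *s x) = 0" "x \<in> b ` {..<N}"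
    then show "f x = 0" using spec[OF ind, of "\<lambda>i. f (b i)"] by (auto simp: sum.reindex[OF inj])
  qed simp
  from vec.dim_eq_card_independent[OF this] card_image[OF inj]
  show "vec.dim (vec.span (b ` {..<N})) = N" by simp
  assume "x \<in> vec.span (b ` {..<N})"
  then obtain f where "x = (\<Sum>v\<in>b ` {..<N}. f v *s v)" by (auto simp: vec.span_finite)
  then show "\<exists>a. x = (\<Sum>i<N. a i *s b i)"
    by (intro exI[of _ "\<lambda>i. f (b i)"]) (simp add: sum.reindex[OF inj])
qed

text \<open>With respect to the standard Hermitian product, the annihilator of \<open>e\<close> is orthogonal to the conjugates
  of \<open>e\<close>. So the span of \<open>b\<close> and that of the conjugates meet in \<open>0\<close>, and by the dimension formula they
  generate the whole space. A vector annihilating \<open>e\<close> has no component in the second span.\<close>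

lemma annihilator_spanned:
  fixes b e :: "nat \<Rightarrow> complex^'m" and x :: "complex^'m"
  assumes b: "\<forall>a. (\<Sum>i<N. a i *s b i) = 0 \<longrightarrow> (\<forall>i<N. a i = 0)"
    and e: "\<forall>a. (\<Sum>j<n. a j *s e j) = 0 \<longrightarrow> (\<forall>j<n. a j = 0)"
    and be: "\<And>i j. i < N \<Longrightarrow> j < n \<Longrightarrow> (\<Sum>k\<in>UNIV. b i $ k * e j $ k) = 0"
    and xe: "\<And>j. j < n \<Longrightarrow> (\<Sum>k\<in>UNIV. x $ k * e j $ k) = 0"
    and card: "CARD('m) = N + n"
  obtains f where "x = (\<Sum>i<N. f i *s b i)"
proof -
  define c where "c j = (\<chi> k. cnj (e j $ k))" for j
  have c: "\<forall>a. (\<Sum>j<n. a j *s c j) = 0 \<longrightarrow> (\<forall>j<n. a j = 0)"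
  proof (intro allI impI)
    fix a j assume that: "(\<Sum>j<n. a j *s c j) = 0" "j < n"
    have "(\<Sum>j<n. cnj (a j) * e j $ k) = 0" for k
    proof -
      have "(\<Sum>j<n. a j * cnj (e j $ k)) = 0" using that(1) by (simp add: vec_eq_iff c_def)
      then have "cnj (\<Sum>j<n. a j * cnj (e j $ k)) = 0" by simp
      then show ?thesis by simp
    qed
    then have "(\<Sum>j<n. cnj (a j) *s e j) = 0" by (simp add: vec_eq_iff)
    from mp[OF spec[OF e] this] that(2) show "a j = 0" by simp
  qed
  let ?S = "vec.span (b ` {..<N})" and ?T = "vec.span (c ` {..<n})"
  note S = independent_family_span[where b = b and N = N, OF b] and T = independent_family_span[where b = c and N = n, OF c]
  have orth: "t = 0" if t: "t \<in> ?T" and ann: "\<And>j. j < n \<Longrightarrow> (\<Sum>k\<in>UNIV. t $ k * e j $ k) = 0" for t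
  proof -
    obtain a where a: "t = (\<Sum>j<n. a j *s c j)" using T(2)[OF t] by blast
    have "(\<Sum>k\<in>UNIV. t $ k * cnj (t $ k)) = (\<Sum>k\<in>UNIV. \<Sum>j<n. cnj (a j) * (t $ k * e j $ k))"
      by (subst (2) a) (simp add: c_def sum_distrib_left mult_ac)
    also have "\<dots> = (\<Sum>j<n. cnj (a j) * (\<Sum>k\<in>UNIV. t $ k * e j $ k))"
      by (subst sum.swap) (simp add: sum_distrib_left)
    also have "\<dots> = 0" using ann by simp
    finally have "complex_of_real (\<Sum>k\<in>UNIV. (cmod (t $ k))\<^sup>2) = 0" by (simp only: of_real_sum complex_norm_square)
    then have "(\<Sum>k\<in>UNIV. (cmod (t $ k))\<^sup>2) = 0" by (simp only: of_real_eq_0_iff)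
    then show "t = 0" by (simp add: sum_nonneg_eq_0_iff vec_eq_iff)
  qed
  have annS: "(\<Sum>k\<in>UNIV. s $ k * e j $ k) = 0" if s: "s \<in> ?S" and j: "j < n" for s j
  proof -
    obtain a where a: "s = (\<Sum>i<N. a i *s b i)" using S(2)[OF s] by blast
    have "(\<Sum>k\<in>UNIV. s $ k * e j $ k) = (\<Sum>i<N. a i * (\<Sum>k\<in>UNIV. b i $ k * e j $ k))"
      unfolding a by (simp add: sum_distrib_left sum_distrib_right mult_ac sum.swap[of _ "{..<N}"])
    then show ?thesis using be j by simp
  qed
  have "?S \<inter> ?T = {0}" using orth annS vec.span_zero by blast
  then have "vec.dim (?S \<inter> ?T) = 0" by simp
  with vec.dim_sums_Int[OF vec.subspace_span vec.subspace_span, of "b ` {..<N}" "c ` {..<n}"]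
  have "vec.dim {s + t |s t. s \<in> ?S \<and> t \<in> ?T} = N + n"
    unfolding S(1) T(1) by (simp only: add_0_right)
  also have "N + n = vec.dimension TYPE(complex) TYPE('m)" using card by (simp add: vec.dimension_def card_cart_basis)
  finally have "vec.span {s + t |s t. s \<in> ?S \<and> t \<in> ?T} = UNIV" by (simp only: vec.dim_eq_full)
  moreover have "vec.span {s + t |s t. s \<in> ?S \<and> t \<in> ?T} = {s + t |s t. s \<in> ?S \<and> t \<in> ?T}"
    by (rule vec.span_eq_iff[THEN iffD2, OF vec.subspace_sums[OF vec.subspace_span vec.subspace_span]])
  ultimately have "x \<in> {s + t |s t. s \<in> ?S \<and> t \<in> ?T}" by simp
  then obtain s t where st: "x = s + t" "s \<in> ?S" "t \<in> ?T" by blast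
  have "(\<Sum>k\<in>UNIV. t $ k * e j $ k) = 0" if j: "j < n" for j
    using xe[OF j] annS[OF st(2) j] by (simp add: st(1) distrib_right sum.distrib)
  then have "t = 0" by (rule orth[OF st(3)])
  then show ?thesis using S(2)[OF st(2)] st(1) that by auto
qed

context involutive_structure
begin

text \<open>The rank of the holomorphic cotangent bundle is \<open>N\<close>, so \<open>N\<close> independent elements of a fibre span it. In
  coordinates the fibre is the annihilator of the \<open>n\<close> independent vectors of a frame of \<open>V\<close>.\<close>

lemma hol_cotangent_spanned:
  assumes card: "CARD('m) = N + n" and b: "\<And>i. i < N \<Longrightarrow> b i \<in> hol_cotangent A V p"
    and ind: "\<forall>a. (\<forall>v. (\<Sum>i<N. a i * b i v) = 0) \<longrightarrow> (\<forall>i<N. a i = 0)"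
    and \<xi>: "\<xi> \<in> hol_cotangent A V p"
  obtains f where "\<xi> = (\<lambda>v. \<Sum>i<N. f i * b i v)"
proof -
  obtain c where c: "c \<in> A" "p \<in> cdom c" by (rule chart_cover)
  obtain U Ls where U: "p \<in> U" "\<And>q. q \<in> U \<Longrightarrow> complex_basis n (\<lambda>j. Ls j q) (V q)" by (rule local_frame) blast
  note basis = U(2)[OF U(1)]
  have LV: "Ls j p \<in> V p" if "j < n" for j
    using complex_basisD(1)[OF basis, of "\<lambda>k. if k = j then 1 else 0"] that by (simp add: if_distrib[of "\<lambda>x. x * _"] cong: if_cong)
  note Lt = V_subset_ctangent[OF LV]
  let ?c = "\<lambda>\<xi>. \<chi> k. \<xi> (coord_vec A c k p)" and ?e = "\<lambda>j. vec_coords A c p (Ls j p)"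
  have pair: "(\<Sum>k\<in>UNIV. ?c \<eta> $ k * ?e j $ k) = 0" if "\<eta> \<in> hol_cotangent A V p" "j < n" for \<eta> j
    using that LV[OF that(2)] ccotangent_coords[OF c, of \<eta> "Ls j p"] Lt[OF that(2)]
    by (simp add: hol_cotangent_def mult.commute)
  have hc: "\<eta> \<in> ccotangent A p" if "\<eta> \<in> hol_cotangent A V p" for \<eta> using that by (simp add: hol_cotangent_def)
  have comb: "(\<lambda>v. \<Sum>i<N. a i * b i v) \<in> ccotangent A p" for a
    by (rule hc[OF hol_cotangent_sum]) (use b in simp)
  obtain f where f: "?c \<xi> = (\<Sum>i<N. f i *s ?c (b i))"
  proof (rule annihilator_spanned[where b = "\<lambda>i. ?c (b i)" and e = ?e and N = N and n = n and x = "?c \<xi>"], intro allI impI)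
    fix a i assume "(\<Sum>i<N. a i *s ?c (b i)) = 0" "i < N"
    then have "(\<lambda>v. \<Sum>i<N. a i * b i v) = (\<lambda>_. 0)"
      by (intro ccotangent_eqI[OF c comb ccotangent_zero_form]) (simp add: vec_eq_iff)
    then show "a i = 0" using spec[OF ind, of a] \<open>i < N\<close> by (simp add: fun_eq_iff)
  next
    show "\<forall>a. (\<Sum>j<n. a j *s ?e j) = 0 \<longrightarrow> (\<forall>j<n. a j = 0)"
    proof (intro allI impI)
      fix a j assume a: "(\<Sum>j<n. a j *s ?e j) = 0" and j: "j < n"
      have "(\<Sum>j<n. a j * Ls j p g) = 0" for g
      proof -
        have "(\<Sum>j<n. a j * Ls j p g) = (\<Sum>j<n. \<Sum>k\<in>UNIV. a j * ?e j $ k * coord_vec A c k p g)"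
        proof (rule sum.cong[OF refl])
          fix j assume "j \<in> {..<n}"
          then show "a j * Ls j p g = (\<Sum>k\<in>UNIV. a j * ?e j $ k * coord_vec A c k p g)"
            by (subst vec_coords_expand[OF c Lt, of j]) (simp_all add: sum_distrib_left mult.assoc)
        qed
        also have "\<dots> = (\<Sum>k\<in>UNIV. (\<Sum>j<n. a j * ?e j $ k) * coord_vec A c k p g)"
          by (subst sum.swap) (simp add: sum_distrib_right)
        also have "\<dots> = 0" using a by (simp add: vec_eq_iff)
        finally show ?thesis .
      qed
      then show "a j = 0" by (rule complex_basisD(3)[OF basis _ j])
    qed
  qed (use pair b \<xi> card in auto)
  have "\<xi> = (\<lambda>v. \<Sum>i<N. f i * b i v)"
  proof (rule ccotangent_eqI[OF c hc[OF \<xi>] comb])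
    fix k show "\<xi> (coord_vec A c k p) = (\<Sum>i<N. f i * b i (coord_vec A c k p))"
      using arg_cong[OF f, of "\<lambda>x. x $ k"] by simp
  qed
  then show ?thesis by (rule that)
qed

lemma hol_dual_add: "s \<in> hol_dual A V p \<Longrightarrow> \<xi> \<in> hol_cotangent A V p \<Longrightarrow> \<eta> \<in> hol_cotangent A V p \<Longrightarrow> s (\<lambda>v. \<xi> v + \<eta> v) = s \<xi> + s \<eta>"
  and hol_dual_cmult: "s \<in> hol_dual A V p \<Longrightarrow> \<xi> \<in> hol_cotangent A V p \<Longrightarrow> s (\<lambda>v. a * \<xi> v) = a * s \<xi>"
  by (simp_all add: hol_dual_def)

lemma hol_dual_sum:
  assumes s: "s \<in> hol_dual A V p"
  shows "finite I \<Longrightarrow> (\<And>i. i \<in> I \<Longrightarrow> \<xi> i \<in> hol_cotangent A V p) \<Longrightarrow> s (\<lambda>v. \<Sum>i\<in>I. a i * \<xi> i v) = (\<Sum>i\<in>I. a i * s (\<xi> i))"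
proof (induction I rule: finite_induct)
  case empty
  show ?case using hol_dual_cmult[OF s hol_cotangent_zero, of 0] by simp
next
  case (insert i I)
  then have "s (\<lambda>v. a i * \<xi> i v + (\<Sum>i\<in>I. a i * \<xi> i v)) = s (\<lambda>v. a i * \<xi> i v) + s (\<lambda>v. \<Sum>i\<in>I. a i * \<xi> i v)"
    by (intro hol_dual_add[OF s] hol_cotangent_scale hol_cotangent_sum) simp_all
  with insert show ?case by (simp add: hol_dual_cmult[OF s])
qed

text \<open>The determinant in which \<open>\<xi>\<close> replaces the \<open>i\<close>-th row: the numerator in Cramer's rule.\<close>

definition cofactor :: "nat \<Rightarrow> (nat \<Rightarrow> 'a covec \<Rightarrow> complex) \<Rightarrow> (nat \<Rightarrow> 'a covec) \<Rightarrow> nat \<Rightarrow> 'a covec \<Rightarrow> complex" where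
  "cofactor N s b i \<xi> = leibniz_det N ((\<lambda>k j. s j (b k))(i := (\<lambda>j. s j \<xi>)))"

lemma cofactor_lincomb:
  assumes s: "\<And>j. j < N \<Longrightarrow> s j \<in> hol_dual A V p" and i: "i < N" and I: "finite I" and \<xi>: "\<And>k. k \<in> I \<Longrightarrow> \<xi> k \<in> hol_cotangent A V p"
  shows "cofactor N s b i (\<lambda>v. \<Sum>k\<in>I. f k * \<xi> k v) = (\<Sum>k\<in>I. f k * cofactor N s b i (\<xi> k))"
proof -
  have cong: "leibniz_det N a = leibniz_det N a'" if "\<And>l j. l < N \<Longrightarrow> j < N \<Longrightarrow> a l j = a' l j" for a a'
    unfolding leibniz_det_def
  proof (intro sum.cong refl arg_cong2[where f = "(*)"] prod.cong)
    fix \<pi> l assume "\<pi> \<in> {\<pi>. \<pi> permutes {..<N}}" "l \<in> {..<N}"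
    then show "a l (\<pi> l) = a' l (\<pi> l)" using that permutes_in_image[of \<pi> "{..<N}" l] by simp
  qed
  show ?thesis
    unfolding cofactor_def leibniz_det_replace_row[OF i, symmetric]
    by (rule cong) (use hol_dual_sum[OF s I \<xi>] in auto)
qed

text \<open>A nonzero determinant makes the rows independent, hence a basis of the fibre. In the expansion of \<open>\<xi>\<close> in
  this basis the \<open>i\<close>-th coefficient times the determinant is the \<open>i\<close>-th cofactor.\<close>

lemma cofactor_expansion:
  assumes card: "CARD('m) = N + n" and b: "\<And>i. i < N \<Longrightarrow> b i \<in> hol_cotangent A V p" and s: "\<And>j. j < N \<Longrightarrow> s j \<in> hol_dual A V p"
    and det: "leibniz_det N (\<lambda>k j. s j (b k)) \<noteq> 0" and \<xi>: "\<xi> \<in> hol_cotangent A V p"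
  shows "(\<Sum>i<N. cofactor N s b i \<xi> * b i v) = leibniz_det N (\<lambda>k j. s j (b k)) * \<xi> v"
proof -
  let ?s = "\<lambda>j. if j < N then s j else (\<lambda>_. 0)"
  have ind: "\<forall>a. (\<forall>v. (\<Sum>i<N. a i * b i v) = 0) \<longrightarrow> (\<forall>i<N. a i = 0)"
  proof (intro allI impI)
    fix a i assume a: "\<forall>v. (\<Sum>i<N. a i * b i v) = 0" and i: "i < N"
    have dc: "leibniz_det N (\<lambda>k j. ?s j (b k)) = leibniz_det N (\<lambda>k j. s j (b k))"
      unfolding leibniz_det_def
    proof (intro sum.cong refl arg_cong2[where f = "(*)"] prod.cong)
      fix \<pi> l assume "\<pi> \<in> {\<pi>. \<pi> permutes {..<N}}" "l \<in> {..<N}"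
      then show "?s (\<pi> l) (b l) = s (\<pi> l) (b l)" using permutes_in_image[of \<pi> "{..<N}" l] by simp
    qed
    have "(\<Sum>k<N. a k * ?s j (b k)) = 0" for j
    proof (cases "j < N")
      case True
      have "(\<Sum>k<N. a k * s j (b k)) = s j (\<lambda>v. \<Sum>k<N. a k * b k v)"
        by (rule hol_dual_sum[OF s[OF True], symmetric]) (use b in simp_all)
      also have "\<dots> = s j (\<lambda>v. 0 * 0)" using a by simp
      also have "\<dots> = 0" using hol_dual_cmult[OF s[OF True] hol_cotangent_zero, of 0] by simp
      finally show ?thesis using True by simp
    qed simp
    with leibniz_det_independent_rows[of N "\<lambda>k j. ?s j (b k)" a i] det dc i show "a i = 0" by simp
  qed
  obtain f where f: "\<xi> = (\<lambda>v. \<Sum>i<N. f i * b i v)" by (rule hol_cotangent_spanned[OF card b ind \<xi>])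
  have "cofactor N s b i \<xi> = f i * leibniz_det N (\<lambda>k j. s j (b k))" if i: "i < N" for i
  proof -
    have "cofactor N s b i \<xi> = (\<Sum>k<N. f k * cofactor N s b i (b k))"
      unfolding f by (rule cofactor_lincomb[OF s i]) (use b in simp_all)
    also have "\<dots> = leibniz_det N ((\<lambda>k j. s j (b k))(i := (\<lambda>j. \<Sum>k<N. f k * s j (b k))))"
      unfolding cofactor_def leibniz_det_replace_row[OF i] ..
    also have "\<dots> = f i * leibniz_det N (\<lambda>k j. s j (b k))"
      by (rule leibniz_det_replace_lincomb[OF i])
    finally show ?thesis .
  qed
  then show ?thesis by (simp add: f sum_distrib_left mult_ac)
qed


section \<open>Sections of the dual bundle\<close>

lemma dual_sectionsD: "s \<in> dual_sections A V \<Longrightarrow> s p \<in> hol_dual A V p"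
  "s \<in> dual_sections A V \<Longrightarrow> \<alpha> \<in> hol_forms A V UNIV \<Longrightarrow> (\<lambda>p. s p (\<alpha> p)) \<in> smooth_funs A"
  by (simp_all add: dual_sections_def smooth_funs_def)

text \<open>Smoothness of a section of the dual bundle is tested on global holomorphic forms only; near a point a
  local form agrees with its cutoff.\<close>

lemma dual_sections_smooth_on:
  assumes s: "s \<in> dual_sections A V" and U: "open U" and \<alpha>: "\<alpha> \<in> hol_forms A V U"
  shows "smooth_fun_on A U (\<lambda>p. s p (\<alpha> p))"
proof (rule smooth_fun_on_local)
  fix p assume p: "p \<in> U"
  obtain c where c: "c \<in> A" "p \<in> cdom c" by (rule chart_cover)
  obtain \<phi> W L where \<phi>: "\<phi> \<in> smooth_funs A" "open W" "p \<in> W" "\<And>q. q \<in> W \<Longrightarrow> \<phi> q = 1" "compact L" "L \<subseteq> U" "\<And>q. q \<notin> L \<Longrightarrow> \<phi> q = 0"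
    by (rule manifold_bump[OF U p c]) blast
  let ?\<alpha> = "\<lambda>q v. \<phi> q * \<alpha> q v"
  have \<alpha>1: "?\<alpha> q \<in> hol_cotangent A V q" for q
  proof (cases "q \<in> U")
    case True
    then show ?thesis using hol_cotangent_scale[OF hol_formsD(1)[OF \<alpha> True]] by simp
  next
    case False
    then have "\<phi> q = 0" using \<phi>(6,7) by blast
    then show ?thesis by (simp add: hol_cotangent_zero)
  qed
  have "smooth_fun_on A UNIV (\<lambda>q. ?\<alpha> q (Y q))" if Y: "Y \<in> vector_fields A UNIV" for Y
    using smooth_funs_cutoff[OF U one_formsD(2)[OF hol_formsD(2)[OF \<alpha>] Y] \<phi>(1) compact_imp_closed[OF \<phi>(5)] \<phi>(6,7)]
    by (simp add: smooth_funs_def)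
  then have "?\<alpha> \<in> one_forms A UNIV" using \<alpha>1 unfolding one_forms_def hol_cotangent_def by blast
  then have "?\<alpha> \<in> hol_forms A V UNIV" using \<alpha>1 unfolding hol_forms_def by blast
  from smooth_funs_on[OF dual_sectionsD(2)[OF s this], of "U \<inter> W"]
  have "smooth_fun_on A (U \<inter> W) (\<lambda>q. s q (\<alpha> q))"
    by (rule smooth_fun_on_cong[THEN iffD1, rotated 2]) (use U \<phi>(2,4) in auto)
  then show "\<exists>W. open W \<and> p \<in> W \<and> smooth_fun_on A (U \<inter> W) (\<lambda>q. s q (\<alpha> q))" using \<phi>(2,3) by blast
qed

lemma leibniz_det_smooth:
  assumes U: "open U" and a: "\<And>i j. i < N \<Longrightarrow> j < N \<Longrightarrow> smooth_fun_on A U (\<lambda>p. a p i j)"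
  shows "smooth_fun_on A U (\<lambda>p. leibniz_det N (a p))"
  unfolding leibniz_det_def
proof (intro smooth_fun_on_sum smooth_fun_on_mult smooth_fun_on_const smooth_fun_on_prod U)
  fix \<pi> i assume "\<pi> \<in> {\<pi>. \<pi> permutes {..<N}}" "i \<in> {..<N}"
  then show "smooth_fun_on A U (\<lambda>p. a p i (\<pi> i))" using a permutes_in_image[of \<pi> "{..<N}" i] by simp
qed

lemma cofactor_smooth:
  assumes U: "open U" and s: "\<And>j. j < N \<Longrightarrow> s j \<in> dual_sections A V" and b: "\<And>k. k < N \<Longrightarrow> b k \<in> hol_forms A V UNIV"
    and \<alpha>: "\<alpha> \<in> hol_forms A V U"
  shows "smooth_fun_on A U (\<lambda>p. cofactor N (\<lambda>j. s j p) (\<lambda>k. b k p) i (\<alpha> p))"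
  unfolding cofactor_def
proof (rule leibniz_det_smooth[OF U])
  fix k j assume k: "k < N" and j: "j < N"
  show "smooth_fun_on A U (\<lambda>p. ((\<lambda>k j. s j p (b k p))(i := (\<lambda>j. s j p (\<alpha> p)))) k j)"
    using dual_sections_smooth_on[OF s[OF j] U \<alpha>] smooth_funs_on[OF dual_sectionsD(2)[OF s[OF j] b[OF k]]]
    by (cases "k = i") auto
qed

end


section \<open>Smoothness of the distributional section\<close>

context involutive_structure
begin

lemma represents_test_form_dens:
  assumes X: "X \<in> distr_sections A V" and I: "finite I"
    and b: "\<And>i. i \<in> I \<Longrightarrow> b i \<in> hol_forms A V UNIV" and h: "\<And>i. i \<in> I \<Longrightarrow> h i \<in> smooth_funs A"
    and rep: "\<And>i. i \<in> I \<Longrightarrow> represents (apply_form (b i) X) (h i)"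
    and c: "c \<in> A" and \<mu>: "\<And>i. i \<in> I \<Longrightarrow> \<mu> i \<in> test_dens A (cdom c)"
    and m: "\<And>c' p v. m c' p v = (\<Sum>i\<in>I. \<mu> i c' p * b i p v)"
  shows "X m = (LINT x|lborel. (\<Sum>i\<in>I. dens_coeff c (\<mu> i) x * h i (cinv c x)))"
proof -
  have int: "integrable lborel (\<lambda>x. dens_coeff c (\<mu> i) x * h i (cinv c x))" if "i \<in> I" for i
    by (rule test_funs_integrable[OF test_funs_mult[OF open_cimg[OF c]
          dens_coeff_test_fun[OF c open_cdom[OF c] order_refl \<mu>[OF that]] smooth_funsD[OF h[OF that] c]]])
  have "m = (\<lambda>c' p v. \<Sum>i\<in>I. tensor_dens (b i) (\<mu> i) c' p v)"
    by (intro ext) (simp add: m tensor_dens_def)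
  then have "X m = (\<Sum>i\<in>I. X (tensor_dens (b i) (\<mu> i)))"
    using distr_sections_sum[OF X I, of "\<lambda>i. tensor_dens (b i) (\<mu> i)"] tensor_dens_test_form_dens[OF b test_dens_mono[OF \<mu> subset_UNIV]] by simp
  also have "\<dots> = (\<Sum>i\<in>I. LINT x|lborel. dens_coeff c (\<mu> i) x * h i (cinv c x))"
    by (rule sum.cong[OF refl]) (use rep \<mu> c in \<open>simp add: represents_def apply_form_def\<close>)
  also have "\<dots> = (LINT x|lborel. (\<Sum>i\<in>I. dens_coeff c (\<mu> i) x * h i (cinv c x)))"
    by (rule Bochner_Integration.integral_sum[symmetric]) (rule int)
  finally show ?thesis .
qed

lemma det_idealE:
  assumes "f \<in> det_ideal A V N"
  obtains r :: nat and g W Y where "\<And>l i. l < r \<Longrightarrow> i < N \<Longrightarrow> \<exists>k. W l i \<in> E_module A V k"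
    "\<And>l j. l < r \<Longrightarrow> j < N \<Longrightarrow> Y l j \<in> dual_sections A V"
    "\<And>p. f p = (\<Sum>l<r. g l p * leibniz_det N (\<lambda>i j. Y l j p (W l i p)))"
proof -
  from assms have "\<exists>(r::nat) g W Y. f = (\<lambda>p. \<Sum>l<r. g l p * leibniz_det N (\<lambda>i j. Y l j p (W l i p))) \<and>
      (\<forall>l<r. g l \<in> smooth_funs A \<and> (\<forall>i<N. W l i \<in> (\<Union>k. E_module A V k)) \<and> (\<forall>j<N. Y l j \<in> dual_sections A V))"
    by (simp only: det_ideal_def mem_Collect_eq)
  then obtain r :: nat and g W Y where
    gWY: "\<forall>l<r. g l \<in> smooth_funs A \<and> (\<forall>i<N. W l i \<in> (\<Union>k. E_module A V k)) \<and> (\<forall>j<N. Y l j \<in> dual_sections A V)"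
    and f: "f = (\<lambda>p. \<Sum>l<r. g l p * leibniz_det N (\<lambda>i j. Y l j p (W l i p)))"
    by (elim exE conjE) (rule that)
  show ?thesis by (rule that[of r W Y g]) (use gWY f in simp_all)
qed

lemma test_form_densD:
  assumes "m \<in> test_form_dens A V U"
  shows "c \<notin> A \<or> p \<notin> cdom c \<Longrightarrow> m c p = (\<lambda>_. 0)" "c \<in> A \<Longrightarrow> m c \<in> hol_forms A V (cdom c)"
    "c \<in> A \<Longrightarrow> c' \<in> A \<Longrightarrow> p \<in> cdom c \<Longrightarrow> p \<in> cdom c' \<Longrightarrow> m c' p = (\<lambda>v. of_real (jacobian c c' p) * m c p v)"
    "\<exists>K. compact K \<and> K \<subseteq> U \<and> (\<forall>c p. p \<notin> K \<longrightarrow> m c p = (\<lambda>_. 0))"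
  using assms unfolding test_form_dens_def by blast+

lemma test_form_dens_hol_cotangent: "m \<in> test_form_dens A V U \<Longrightarrow> m c p \<in> hol_cotangent A V p"
  using test_form_densD(1)[of m U c p] hol_formsD(1)[OF test_form_densD(2)[of m U c], of p] hol_cotangent_zero[of V p]
  by (cases "c \<in> A \<and> p \<in> cdom c") auto

text \<open>A fibrewise linear functional of a form-valued density is a density: it commutes with the Jacobian
  factors of the transformation law.\<close>

lemma test_form_dens_pairing:
  assumes m: "m \<in> test_form_dens A V U"
    and lin: "\<And>p \<xi> a. \<xi> \<in> hol_cotangent A V p \<Longrightarrow> F p (\<lambda>v. a * \<xi> v) = a * F p \<xi>"
    and smooth: "\<And>W \<alpha>. open W \<Longrightarrow> \<alpha> \<in> hol_forms A V W \<Longrightarrow> smooth_fun_on A W (\<lambda>p. F p (\<alpha> p))"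
  shows "(\<lambda>c p. F p (m c p)) \<in> test_dens A U"
proof -
  have zero: "F p (\<lambda>_. 0) = 0" for p using lin[OF hol_cotangent_zero, of p 0] by simp
  obtain K where K: "compact K" "K \<subseteq> U" "\<forall>c p. p \<notin> K \<longrightarrow> m c p = (\<lambda>_. 0)"
    using test_form_densD(4)[OF m] by (elim exE conjE) (rule that)
  show ?thesis
  proof (rule test_densI[OF _ _ _ K(1,2)])
    fix c p assume "c \<notin> A \<or> p \<notin> cdom c"
    then show "F p (m c p) = 0" by (simp only: test_form_densD(1)[OF m] zero)
  next
    fix c assume c: "c \<in> A"
    show "smooth_fun_on A (cdom c) (\<lambda>p. F p (m c p))" by (rule smooth[OF open_cdom[OF c] test_form_densD(2)[OF m c]])
  next
    fix c c' p assume "c \<in> A" "c' \<in> A" "p \<in> cdom c" "p \<in> cdom c'"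
    from test_form_densD(3)[OF m this] show "F p (m c' p) = of_real (jacobian c c' p) * F p (m c p)"
      by (simp only: lin[OF test_form_dens_hol_cotangent[OF m]])
  next
    fix c p assume "p \<notin> K"
    then have "m c p = (\<lambda>_. 0)" using spec[OF spec[OF K(3), of c], of p] by simp
    then show "F p (m c p) = 0" by (simp only: zero)
  qed
qed

lemma lborel_integral_cimg:
  fixes F :: "real^'m \<Rightarrow> complex"
  assumes c: "c \<in> A" and F: "F \<in> test_funs (cmap c ` cdom c)" and eq: "\<And>x. x \<in> cmap c ` cdom c \<Longrightarrow> F x = G x"
  shows "(LINT x|lborel. F x) = (LINT x : cmap c ` cdom c | lebesgue. G x)"
proof -
  have "(LINT x : cmap c ` cdom c | lebesgue. G x) = (LINT x|lebesgue. F x)"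
    unfolding set_lebesgue_integral_def
  proof (intro Bochner_Integration.integral_cong refl)
    fix x show "indicator (cmap c ` cdom c) x *\<^sub>R G x = F x"
      using eq[of x] test_funs_outside[OF F, of x] by (cases "x \<in> cmap c ` cdom c") auto
  qed
  also have "\<dots> = (LINT x|lborel. F x)"
    by (rule integral_completion) (use test_funs_integrable[OF F] in simp)
  finally show ?thesis by simp
qed

text \<open>Let \<open>D l\<close> be the determinants in a representation of \<open>1\<close>. They have no common zero, so the weights
  \<open>w l = cnj (D l) / (\<Sum>k. \<bar>D k\<bar>\<^sup>2)\<close> are smooth and \<open>\<Sum>l. w l * D l = 1\<close>. Multiplying the Cramer expansions with
  respect to the forms \<open>W l i\<close> by the weights and adding them expresses every holomorphic form \<open>\<xi>\<close> as
  \<open>\<Sum>l i. C (l, i) \<xi> * W l i\<close>. Terms with \<open>D l = 0\<close>, for which there is no expansion, have weight \<open>0\<close>. As \<open>X\<close>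
  takes a smooth value \<open>h (l, i)\<close> on \<open>W l i\<close>, it is the section \<open>\<xi> \<mapsto> \<Sum>l i. C (l, i) \<xi> * h (l, i)\<close>.\<close>

theorem smooth_distr_section_of_nondegenerate:
  assumes card: "CARD('m) = N + n" and nondeg: "finitely_nondegenerate A V N"
    and X: "infinitesimal_CR_diffeo A V X" and wedge: "extends_to_wedge A V X"
  shows "smooth_distr_section A V X"
proof -
  have X1: "X \<in> distr_sections A V" using X unfolding infinitesimal_CR_diffeo_def by blast
  have mem: "(\<lambda>_. 1) \<in> det_ideal A V N" using nondeg smooth_funs_intros(1)[of 1] by (simp add: finitely_nondegenerate_def)
  show ?thesis
  proof (rule det_idealE[OF mem])
    fix r :: nat and g W Y
    assume W: "\<And>l i. l < r \<Longrightarrow> i < N \<Longrightarrow> \<exists>k. W l i \<in> E_module A V k"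
      and Y: "\<And>l j. l < r \<Longrightarrow> j < N \<Longrightarrow> Y l j \<in> dual_sections A V"
      and one: "\<And>p. 1 = (\<Sum>l<r. g l p * leibniz_det N (\<lambda>i j. Y l j p (W l i p)))"
    have sv: "smooth_value X (W l i)" if "l < r" "i < N" for l i
      using W[OF that] E_module_smooth_value[OF X wedge] by blast
    then have Wh: "\<And>l i. l < r \<Longrightarrow> i < N \<Longrightarrow> W l i \<in> hol_forms A V UNIV" unfolding smooth_value_def by blast
    have "\<forall>x\<in>{..<r} \<times> {..<N}. \<exists>h. h \<in> smooth_funs A \<and> represents (apply_form (W (fst x) (snd x)) X) h"
      using sv unfolding smooth_value_def by (auto simp: Bex_def)
    from bchoice[OF this] obtain h where h: "\<forall>x\<in>{..<r} \<times> {..<N}. h x \<in> smooth_funs A \<and> represents (apply_form (W (fst x) (snd x)) X) (h x)" ..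
    let ?D = "\<lambda>l p. leibniz_det N (\<lambda>i j. Y l j p (W l i p))"
    let ?I = "{..<r} \<times> {..<N}"
    let ?n = "\<lambda>p. \<Sum>l<r. ?D l p * cnj (?D l p)"
    define w where "w l p = inverse (?n p) * cnj (?D l p)" for l p
    define C where "C x p \<xi> = w (fst x) p * cofactor N (\<lambda>j. Y (fst x) j p) (\<lambda>k. W (fst x) k p) (snd x) \<xi>" for x p \<xi>
    have D: "?D l \<in> smooth_funs A" if "l < r" for l
      unfolding smooth_funs_def mem_Collect_eq
      by (rule leibniz_det_smooth[OF open_UNIV]) (use dual_sectionsD(2)[OF Y Wh] that in \<open>simp add: smooth_funs_def\<close>)
    have npos: "?n p \<noteq> 0" for p
    proof
      assume "?n p = 0"
      then have "complex_of_real (\<Sum>l<r. (cmod (?D l p))\<^sup>2) = 0"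
        by (simp only: of_real_sum complex_norm_square)
      then have "(\<Sum>l<r. (cmod (?D l p))\<^sup>2) = 0" by (simp only: of_real_eq_0_iff)
      then have "\<forall>l<r. ?D l p = 0" by (simp add: sum_nonneg_eq_0_iff)
      then show False using one[of p] by simp
    qed
    have w: "w l \<in> smooth_funs A" if "l < r" for l
    proof -
      have "?n \<in> smooth_funs A"
        by (rule smooth_funs_sum, rule smooth_funs_intros(4)) (use D smooth_funs_intros(5) in simp_all)
      then have "(\<lambda>p. inverse (?n p)) \<in> smooth_funs A"
        using smooth_fun_on_inverse[OF open_UNIV _ npos] by (simp add: smooth_funs_def)
      from smooth_funs_intros(4)[OF this smooth_funs_intros(5)[OF D[OF that]]] show ?thesis
        by (simp add: w_def[abs_def])
    qed
    have w1: "(\<Sum>l<r. w l p * ?D l p) = 1" for p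
    proof -
      have "(\<Sum>l<r. w l p * ?D l p) = inverse (?n p) * ?n p"
        unfolding w_def sum_distrib_left by (rule sum.cong) (simp_all add: mult_ac)
      then show ?thesis using npos[of p] by simp
    qed
    have Wc: "W l i p \<in> hol_cotangent A V p" if "l < r" "i < N" for l i p by (rule hol_formsD(1)[OF Wh[OF that] UNIV_I])
    have Yc: "Y l j p \<in> hol_dual A V p" if "l < r" "j < N" for l j p by (rule dual_sectionsD(1)[OF Y[OF that]])
    have C_expand: "(\<Sum>x\<in>?I. C x p \<xi> * W (fst x) (snd x) p v) = \<xi> v" if \<xi>: "\<xi> \<in> hol_cotangent A V p" for p \<xi> v
    proof -
      have "(\<Sum>x\<in>?I. C x p \<xi> * W (fst x) (snd x) p v)
        = (\<Sum>l<r. w l p * (\<Sum>i<N. cofactor N (\<lambda>j. Y l j p) (\<lambda>k. W l k p) i \<xi> * W l i p v))"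
        by (simp add: C_def sum.cartesian_product case_prod_unfold sum_distrib_left mult.assoc)
      also have "\<dots> = (\<Sum>l<r. w l p * (?D l p * \<xi> v))"
      proof (rule sum.cong[OF refl])
        fix l assume l: "l \<in> {..<r}"
        show "w l p * (\<Sum>i<N. cofactor N (\<lambda>j. Y l j p) (\<lambda>k. W l k p) i \<xi> * W l i p v) = w l p * (?D l p * \<xi> v)"
        proof (cases "?D l p = 0")
          case True
          then show ?thesis by (simp add: w_def)
        next
          case False
          have "(\<Sum>i<N. cofactor N (\<lambda>j. Y l j p) (\<lambda>k. W l k p) i \<xi> * W l i p v) = ?D l p * \<xi> v"
            by (rule cofactor_expansion[where s = "\<lambda>j. Y l j p" and b = "\<lambda>k. W l k p", OF card _ _ False \<xi>]) (use Wc Yc l in simp_all)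
          then show ?thesis by simp
        qed
      qed
      also have "\<dots> = \<xi> v" using w1[of p] by (simp add: mult.assoc[symmetric] sum_distrib_right[symmetric])
      finally show ?thesis .
    qed
    \<comment> \<open>linear combinations of at most two terms, indexed by Booleans\<close>
    have C_lin: "C x p (\<lambda>v. \<Sum>k\<in>K. f k * \<xi> k v) = (\<Sum>k\<in>K. f k * C x p (\<xi> k))"
      if x: "x \<in> ?I" and K: "finite K" and \<xi>: "\<And>k. k \<in> K \<Longrightarrow> \<xi> k \<in> hol_cotangent A V p" for x p f \<xi> and K :: "bool set"
      using cofactor_lincomb[of N "\<lambda>j. Y (fst x) j p" p "snd x" K \<xi> "\<lambda>k. W (fst x) k p" f] Yc x K \<xi>
      by (simp add: C_def mem_Times_iff sum_distrib_left mult.left_commute)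
    have C_cmult: "C x p (\<lambda>v. a * \<xi> v) = a * C x p \<xi>" if "x \<in> ?I" "\<xi> \<in> hol_cotangent A V p" for x p a \<xi>
      using C_lin[OF that(1), of "{True}" "\<lambda>_. \<xi>" p "\<lambda>_. a"] that(2) by simp
    have C_add: "C x p (\<lambda>v. \<xi> v + \<eta> v) = C x p \<xi> + C x p \<eta>"
      if "x \<in> ?I" "\<xi> \<in> hol_cotangent A V p" "\<eta> \<in> hol_cotangent A V p" for x p \<xi> \<eta>
      using C_lin[OF that(1), of UNIV "\<lambda>b. if b then \<xi> else \<eta>" p "\<lambda>_. 1"] that(2,3) by (simp add: UNIV_bool add.commute)
    have C_smooth: "smooth_fun_on A U (\<lambda>p. C x p (\<alpha> p))" if x: "x \<in> ?I" and U: "open U" "\<alpha> \<in> hol_forms A V U" for x U \<alpha>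
      unfolding C_def
      by (rule smooth_fun_on_mult[OF U(1) smooth_funs_on[OF w] cofactor_smooth[OF U(1) _ _ U(2)]])
         (use x Y Wh in auto)
    define s where "s p \<xi> = (if \<xi> \<in> hol_cotangent A V p then \<Sum>x\<in>?I. C x p \<xi> * h x p else 0)" for p \<xi>
    have s: "s \<in> dual_sections A V"
      unfolding dual_sections_def
    proof (intro CollectI conjI allI ballI)
      fix p show "s p \<in> hol_dual A V p"
        unfolding hol_dual_def s_def
        by (auto simp: C_add C_cmult hol_cotangent_add hol_cotangent_scale distrib_right sum.distrib sum_distrib_left mult.assoc intro!: sum.cong)
    next
      fix \<alpha> assume \<alpha>: "\<alpha> \<in> hol_forms A V UNIV"
      have "smooth_fun_on A UNIV (\<lambda>p. \<Sum>x\<in>?I. C x p (\<alpha> p) * h x p)"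
        by (rule smooth_fun_on_sum[OF open_UNIV], rule smooth_fun_on_mult[OF open_UNIV C_smooth[OF _ open_UNIV \<alpha>] smooth_funs_on])
           (use h in blast)+
      then show "smooth_fun_on A UNIV (\<lambda>p. s p (\<alpha> p))" using hol_formsD(1)[OF \<alpha> UNIV_I] by (simp add: s_def)
    qed
    have "X m = (LINT x : cmap c ` cdom c | lebesgue. s (cinv c x) (m c (cinv c x)))"
      if c: "c \<in> A" and m: "m \<in> test_form_dens A V (cdom c)" for c m
    proof -
      let ?\<mu> = "\<lambda>x c p. C x p (m c p)"
      have \<mu>: "?\<mu> x \<in> test_dens A (cdom c)" if x: "x \<in> ?I" for x
        by (rule test_form_dens_pairing[OF m C_cmult[OF x] C_smooth[OF x]])
      have mh: "m c' p \<in> hol_cotangent A V p" for c' p by (rule test_form_dens_hol_cotangent[OF m])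
      let ?F = "\<lambda>y. \<Sum>x\<in>?I. dens_coeff c (?\<mu> x) y * h x (cinv c y)"
      have "X m = (LINT y|lborel. ?F y)"
      proof (rule represents_test_form_dens[where b = "\<lambda>x. W (fst x) (snd x)", OF X1 _ _ _ _ c \<mu>])
        show "m c' p v = (\<Sum>x\<in>?I. ?\<mu> x c' p * W (fst x) (snd x) p v)" for c' p v by (rule C_expand[OF mh, symmetric])
      qed (use Wh h in auto)
      also have "\<dots> = (LINT y : cmap c ` cdom c | lebesgue. s (cinv c y) (m c (cinv c y)))"
      proof (rule lborel_integral_cimg[OF c])
        show "?F \<in> test_funs (cmap c ` cdom c)"
          by (rule test_funs_sum, rule test_funs_mult[OF open_cimg[OF c] dens_coeff_test_fun[OF c open_cdom[OF c] order_refl \<mu>] smooth_funsD[OF _ c]])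
             (use h in auto)
        show "?F y = s (cinv c y) (m c (cinv c y))" if "y \<in> cmap c ` cdom c" for y
          using that mh by (simp add: s_def dens_coeff_def)
      qed
      finally show ?thesis .
    qed
    then show ?thesis using s unfolding smooth_distr_section_def by blast
  qed
qed

end

theorem corollary1:
  fixes A :: "('a::{t2_space, second_countable_topology}, 'm::finite) chart set"
    and V :: "'a \<Rightarrow> 'a tvec set"
    and n d :: nat
    and X :: "('a, 'm) form_dens \<Rightarrow> complex"
  assumes "CR_structure A V n"
    and "CARD('m) = 2 * n + d"
    and "finitely_nondegenerate A V (n + d)"
    and "infinitesimal_CR_diffeo A V X"
    and "loc_integrable_section A V (n + d) X"
    and "extends_to_wedge A V X"
  shows "smooth_distr_section A V X"
proof -
  interpret involutive_structure A V n
    using assms(1) by unfold_locales (simp_all add: CR_structure_def)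
  show ?thesis
    by (rule smooth_distr_section_of_nondegenerate[OF _ assms(3,4,6)]) (simp add: assms(2))
qed


end
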